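(* The bigraded $A_\infty$ algebras $\mathcal{A}^*[U,U^{-1}]$ and $\mathcal{B}^*[U,U^{-1}]$ are quasi-isomorphic. Moreover, the quasi-isomorphism can be given by two $A_\infty$ homomorphisms $F^U:\mathcal{A}^*[U,U^{-1}]\to\mathcal{B}^*[U,U^{-1}]$ and $G^U:\mathcal{B}^*[U,U^{-1}]\to\mathcal{A}^*[U,U^{-1}]$ that are positive on $\mathcal{A}=\mathcal{A}\otimes1\subset\mathcal{A}^*[U,U^{-1}]$, where a map is called positive if it does not pick up a negative power of $U$.
   Context: $\mathbb{F}=\mathbb{F}_2$, $\widetilde{R}^\partial=\mathbb{F}[x,y,z]$ with $x,y,z$ of quantum grading $-2$ and homological grading $0$. $\widetilde{M}(\mathcal{D}_0)$ is the matrix factorization $q^1h^0\widetilde{R}^\partial\rightleftarrows\widetilde{R}^\partial$ with maps $x$ (from the shifted copy) and $yz$ (back); $\widetilde{M}(\mathcal{D}_1)$ the same with $y$ and $xz$; the total differential $d_0$ satisfies $d_0^2=xyz\cdot\mathrm{id}$. $\mathcal{A}=\mathrm{End}_{\widetilde{R}^\partial}(\widetilde{M}(\mathcal{D}_0)\oplus\widetilde{M}(\mathcal{D}_1))$ is the dg algebra of all $\widetilde{R}^\partial$-linear maps of the underlying modules, product composition, differential $f\mapsto f\circ d_0+d_0\circ f$, bigraded by $\mathrm{gr}(u\xrightarrow{a}v)=\mathrm{gr}(v)+\mathrm{gr}(a)-\mathrm{gr}(u)$. $\mathcal{A}^*[U,U^{-1}]=\mathcal{A}\otimes\mathbb{F}[U,U^{-1}]$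 with $\mathrm{gr}(U)=q^{-3}h^{-1}$, product $(aU^i)(bU^j)=abU^{i+j}$, and differential $d(aU^k)=d^{\mathcal{A}}(a)U^{k-1}$; it is a bigraded dg algebra (differential of bidegree $q^0h^1$). $\mathcal{B}$: path algebra over $\mathbb{F}$ of the quiver with vertices $\circ,\bullet$, loops $D_\circ,D_\bullet$, arrows ${}_\circ S_\bullet,{}_\bullet S_\circ$, modulo all products of a $D$-arrow with an $S$-arrow being $0$ (${}_a x_b\cdot{}_b y_c$ is concatenation); basis: idempotents, $D^n$, alternating $S$-words $S^n$ ($n\ge1$); $\mathrm{gr}(S)=q^{-1}h^0$, $\mathrm{gr}(D)=q^{-2}h^0$. $\mathcal{B}^\infty$: same space, $\mu_1=0$, $\mu_2$ from $\mathcal{B}$, higher products from disk sequences: $E_4$ = cyclic permutations of $({}_\circ S_\bullet,{}_\bullet D_\bullet,{}_\bullet S_\circ,{}_\circ D_\circ)$; $E_{2m+2}$ obtained from $E_{2m}$ by one replacement of consecutive entries $(D^k_\bullet,{}_\bullet S^\ell)\mapsto(D^{k+1}_\bullet,{}_\bullet S_\circ,{}_\circ D_\circ,{}_\circ S^{\ell+1})$, $(D^k_\circ,{}_\circ S^\ell)\mapsto(D^{k+1}_\circ,{}_\circ S_\bullet,{}_\bullet D_\bullet,{}_\bullet S^{\ell+1})$, $(S^k_\bullet,{}_\bullet D^\ell)\mapsto(S^{k+1}_\circ,{}_\circ D_\circ,{}_\circ S_\bullet,{}_\bullet D^{\ell+1})$, $(S^k_\circ,{}_\circ D^\ell)\mapsto(S^{k+1}_\bullet,{}_\bullet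 D_\bullet,{}_\bullet S_\circ,{}_\circ D^{\ell+1})$; for $(a_1,\dots,a_{2m})\in E_{2m}$ and $b\in\{\text{idempotents},S^n,D^n:n\ge1\}$, $\mu_{2m}(a_1,\dots,a_{2m}b)=b$ if $a_{2m}b\ne0$ and $\mu_{2m}(ba_1,\dots,a_{2m})=b$ if $ba_1\ne0$; other higher products of basis elements vanish. $\mathcal{B}^*[U,U^{-1}]=\mathcal{B}^\infty\otimes\mathbb{F}[U,U^{-1}]$ with $\mu_k(a_1U^{i_1},\dots,a_kU^{i_k})=\mu_k^{\mathcal{B}^\infty}(a_1,\dots,a_k)U^{k-2+i_1+\dots+i_k}$, $\mathrm{gr}(U)=q^{-3}h^{-1}$; it is bigraded with $\mathrm{gr}(\mu_k)=q^0h^{2-k}$. A bigraded quasi-isomorphism preserves these bigradings. *)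

theory Defs
  imports Main
begin

text \<open>A vector of the F_2-vector space with basis (the elements of) type 'b is a finite set
of basis elements; addition is symmetric difference.  A (multi)linear map is determined by its
values on basis elements (basis tuples).\<close>

definition vsum :: "('a \<Rightarrow> 'b set) \<Rightarrow> 'a set \<Rightarrow> 'b set" where
  "vsum f A = {b. odd (card {a \<in> A. b \<in> f a})}"

definition mext :: "('a list \<Rightarrow> 'b set) \<Rightarrow> 'a set list \<Rightarrow> 'b set" where
  "mext g Vs = {b. odd (card {as. list_all2 (\<lambda>a V. a \<in> V) as Vs \<and> b \<in> g as})}"

definition vadd :: "'b set \<Rightarrow> 'b set \<Rightarrow> 'b set" where
  "vadd V W = (V - W) \<union> (W - V)"

text \<open>An A-infinity structure is given by mu :: 'a list => 'a set, mu applied to a basis tuple of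
length k being mu_k of it.  An A-infinity homomorphism f is given by f_k on basis tuples of
length k (k >= 1).\<close>

fun blocks :: "nat list \<Rightarrow> 'a list \<Rightarrow> 'a list list" where
  "blocks [] xs = []"
| "blocks (c # cs) xs = take c xs # blocks cs (drop c xs)"

definition compositions :: "nat \<Rightarrow> nat list set" where
  "compositions n = {cs. (\<forall>c \<in> set cs. 0 < c) \<and> sum_list cs = n}"

definition hom_lhs :: "('a list \<Rightarrow> 'a set) \<Rightarrow> ('a list \<Rightarrow> 'b set) \<Rightarrow> 'a list \<Rightarrow> 'b set" where
  "hom_lhs muA f as =
     vsum (\<lambda>(i, j). mext f (map (\<lambda>a. {a}) (take i as) @ [muA (take j (drop i as))]
                             @ map (\<lambda>a. {a}) (drop (i + j) as)))
          {(i, j). 1 \<le> j \<and> i + j \<le> length as}"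

definition hom_rhs :: "('b list \<Rightarrow> 'b set) \<Rightarrow> ('a list \<Rightarrow> 'b set) \<Rightarrow> 'a list \<Rightarrow> 'b set" where
  "hom_rhs muB f as =
     vsum (\<lambda>cs. mext muB (map f (blocks cs as))) (compositions (length as))"

definition ainf_hom :: "('a list \<Rightarrow> 'a set) \<Rightarrow> ('b list \<Rightarrow> 'b set) \<Rightarrow> ('a list \<Rightarrow> 'b set) \<Rightarrow> bool" where
  "ainf_hom muA muB f \<longleftrightarrow>
     f [] = {} \<and> (\<forall>as. finite (f as)) \<and>
     (\<forall>as. as \<noteq> [] \<longrightarrow> hom_lhs muA f as = hom_rhs muB f as)"

text \<open>Bigradings: deg gives (q-grading, h-grading) of a basis element.  f_k must have bidegree
q^0 h^(1-k).\<close>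

definition gsum :: "(int \<times> int) list \<Rightarrow> int \<times> int" where
  "gsum ds = (sum_list (map fst ds), sum_list (map snd ds))"

definition bigraded_hom :: "('a \<Rightarrow> int \<times> int) \<Rightarrow> ('b \<Rightarrow> int \<times> int) \<Rightarrow> ('a list \<Rightarrow> 'b set) \<Rightarrow> bool" where
  "bigraded_hom degA degB f \<longleftrightarrow>
     (\<forall>as. as \<noteq> [] \<longrightarrow> (\<forall>c \<in> f as.
        degB c = (fst (gsum (map degA as)), snd (gsum (map degA as)) + 1 - int (length as))))"

definition dlin :: "('a list \<Rightarrow> 'a set) \<Rightarrow> 'a set \<Rightarrow> 'a set" where
  "dlin mu V = vsum (\<lambda>a. mu [a]) V"

definition cycles :: "('a list \<Rightarrow> 'a set) \<Rightarrow> 'a set set" where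
  "cycles mu = {Z. finite Z \<and> dlin mu Z = {}}"

definition boundaries :: "('a list \<Rightarrow> 'a set) \<Rightarrow> 'a set set" where
  "boundaries mu = {dlin mu W | W. finite W}"

definition quasi_iso :: "('a list \<Rightarrow> 'a set) \<Rightarrow> ('b list \<Rightarrow> 'b set) \<Rightarrow> ('a list \<Rightarrow> 'b set) \<Rightarrow> bool" where
  "quasi_iso muA muB f \<longleftrightarrow>
     (\<forall>Z \<in> cycles muA. vsum (\<lambda>a. f [a]) Z \<in> boundaries muB \<longrightarrow> Z \<in> boundaries muA) \<and>
     (\<forall>W \<in> cycles muB. \<exists>Z \<in> cycles muA. vadd (vsum (\<lambda>a. f [a]) Z) W \<in> boundaries muB)"

definition positive_hom :: "(('a \<times> int) list \<Rightarrow> ('b \<times> int) set) \<Rightarrow> bool" where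
  "positive_hom f \<longleftrightarrow>
     (\<forall>as. as \<noteq> [] \<longrightarrow> (\<forall>a \<in> set as. snd a = 0) \<longrightarrow> (\<forall>c \<in> f as. 0 \<le> snd c))"

text \<open>Generators of the free R-module underlying M(D_0) + M(D_1), R = F[x,y,z]:
G0s, G0u: the shifted (q^1) and unshifted copy in M(D_0); G1s, G1u likewise for M(D_1).\<close>

datatype gen = G0s | G0u | G1s | G1u

type_synonym mono = "nat \<times> nat \<times> nat"  \<comment> \<open>exponents of x, y, z\<close>

text \<open>F-basis of A: (i, j, m) is the R-linear map sending generator j to m times generator i and
the other generators to 0.\<close>
type_synonym abasis = "gen \<times> gen \<times> mono"

fun mmul :: "mono \<Rightarrow> mono \<Rightarrow> mono" where
  "mmul (a, b, c) (a', b', c') = (a + a', b + b', c + c')"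

fun gdeg :: "gen \<Rightarrow> int \<times> int" where
  "gdeg G0s = (1, 0)" | "gdeg G0u = (0, 0)" | "gdeg G1s = (1, 0)" | "gdeg G1u = (0, 0)"

fun mdeg :: "mono \<Rightarrow> int \<times> int" where
  "mdeg (a, b, c) = (- 2 * int (a + b + c), 0)"

fun degA :: "abasis \<Rightarrow> int \<times> int" where
  "degA (i, j, m) = (fst (gdeg i) + fst (mdeg m) - fst (gdeg j),
                     snd (gdeg i) + snd (mdeg m) - snd (gdeg j))"

fun compA :: "abasis \<Rightarrow> abasis \<Rightarrow> abasis set" where
  "compA (i, j, m) (i', j', m') = (if j = i' then {(i, j', mmul m m')} else {})"

definition d0 :: "abasis set" where
  "d0 = {(G0u, G0s, (1, 0, 0)), (G0s, G0u, (0, 1, 1)), (G1u, G1s, (0, 1, 0)), (G1s, G1u, (1, 0, 1))}"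

definition dA :: "abasis \<Rightarrow> abasis set" where
  "dA a = vadd (vsum (\<lambda>e. compA a e) d0) (vsum (\<lambda>e. compA e a) d0)"

type_synonym aubasis = "abasis \<times> int"   \<comment> \<open>a U^k\<close>

fun muAU :: "aubasis list \<Rightarrow> aubasis set" where
  "muAU [(a, k)] = (\<lambda>b. (b, k - 1)) ` dA a"
| "muAU [(a, k), (a', k')] = (\<lambda>b. (b, k + k')) ` compA a a'"
| "muAU _ = {}"

definition degAU :: "aubasis \<Rightarrow> int \<times> int" where
  "degAU x = (fst (degA (fst x)) - 3 * snd x, snd (degA (fst x)) - snd x)"

datatype vtx = Wh | Bl   \<comment> \<open>Wh = the vertex circ, Bl = the vertex bullet\<close>

fun oth :: "vtx \<Rightarrow> vtx" where "oth Wh = Bl" | "oth Bl = Wh"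

text \<open>F-basis of B: Idem v; Dp v n = D_v^(n+1); Sw v n = the alternating S-word of length n+1
starting at vertex v.\<close>
datatype bbasis = Idem vtx | Dp vtx nat | Sw vtx nat

fun bsrc :: "bbasis \<Rightarrow> vtx" where
  "bsrc (Idem v) = v" | "bsrc (Dp v n) = v" | "bsrc (Sw v n) = v"

fun btgt :: "bbasis \<Rightarrow> vtx" where
  "btgt (Idem v) = v" | "btgt (Dp v n) = v"
| "btgt (Sw v n) = (if even n then oth v else v)"

fun mulB :: "bbasis \<Rightarrow> bbasis \<Rightarrow> bbasis set" where
  "mulB (Idem v) b = (if bsrc b = v then {b} else {})"
| "mulB a (Idem v) = (if btgt a = v then {a} else {})"
| "mulB (Dp v n) (Dp w m) = (if v = w then {Dp v (n + m + 1)} else {})"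
| "mulB (Sw v n) (Sw w m) = (if btgt (Sw v n) = w then {Sw v (n + m + 1)} else {})"
| "mulB _ _ = {}"

fun degB :: "bbasis \<Rightarrow> int \<times> int" where
  "degB (Idem v) = (0, 0)"
| "degB (Dp v n) = (- 2 * int (Suc n), 0)"
| "degB (Sw v n) = (- int (Suc n), 0)"

inductive disk :: "bbasis list \<Rightarrow> bool" where
  base: "n < 4 \<Longrightarrow> disk (rotate n [Sw Wh 0, Dp Bl 0, Sw Bl 0, Dp Wh 0])"
| r1: "disk (p @ [Dp Bl k, Sw Bl l] @ s) \<Longrightarrow>
       disk (p @ [Dp Bl (Suc k), Sw Bl 0, Dp Wh 0, Sw Wh (Suc l)] @ s)"
| r2: "disk (p @ [Dp Wh k, Sw Wh l] @ s) \<Longrightarrow>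
       disk (p @ [Dp Wh (Suc k), Sw Wh 0, Dp Bl 0, Sw Bl (Suc l)] @ s)"
| r3: "btgt (Sw v k) = Bl \<Longrightarrow> disk (p @ [Sw v k, Dp Bl l] @ s) \<Longrightarrow>
       disk (p @ [Sw v (Suc k), Dp Wh 0, Sw Wh 0, Dp Bl (Suc l)] @ s)"
| r4: "btgt (Sw v k) = Wh \<Longrightarrow> disk (p @ [Sw v k, Dp Wh l] @ s) \<Longrightarrow>
       disk (p @ [Sw v (Suc k), Dp Bl 0, Sw Bl 0, Dp Wh (Suc l)] @ s)"

definition muBinf :: "bbasis list \<Rightarrow> bbasis set" where
  "muBinf xs =
     (if length xs = 2 then mulB (xs ! 0) (xs ! 1)
      else if 4 \<le> length xs \<and> even (length xs) then
        {b. (\<exists>a. disk (butlast xs @ [a]) \<and> mulB a b = {last xs}) \<or>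
            (\<exists>a. disk (a # tl xs) \<and> mulB b a = {hd xs})}
      else {})"

type_synonym bubasis = "bbasis \<times> int"   \<comment> \<open>b U^k\<close>

definition muBU :: "bubasis list \<Rightarrow> bubasis set" where
  "muBU xs = (\<lambda>c. (c, int (length xs) - 2 + sum_list (map snd xs))) ` muBinf (map fst xs)"

definition degBU :: "bubasis \<Rightarrow> int \<times> int" where
  "degBU x = (fst (degB (fst x)) - 3 * snd x, snd (degB (fst x)) - snd x)"

end

theory Submission
  imports Defs "HOL-Library.Product_Plus"
begin

text \<open>The exponent of \<open>U\<close> in every term is forced by the homological grading, so positivity is
automatic and one may compute with \<open>U = 1\<close>. The homomorphism \<open>G\<close> is given in closed form:
spelling a list of basis elements of the quiver algebra as a word in the letters \<open>D\<close> and \<open>S\<close>, disk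
sequences become words of an unambiguous context-free language of ternary trees, and the values of
\<open>G\<close> are the coefficients of the noncommutative geometric series \<open>(1 + K)\<inverse>\<close> of a two by two
matrix series \<open>K\<close>. The homomorphism equations reduce to the single identity
\<open>dK = TJ + K (J + TJ) K\<close> and a splitting identity inside runs of equal letters. The linear part of
\<open>G\<close> extends to an explicit contraction of the matrix factorization algebra, and obstruction theory for
bar constructions over this contraction produces \<open>F\<close> with linear part the projection.\<close>

text \<open>In the ring of endomorphisms the loops \<open>D\<close> and the arrows \<open>S\<close>
  are represented by cycles \<open>y\<close> and \<open>sg\<close>. The products D S and S D vanish
  in the quiver algebra, and \<open>a\<close> and \<open>b\<close> bound their representatives;
  \<open>c\<close> bounds the triple product of (D, S, D), while that of (S, D, S) is already zero.
  The fourfold products \<open>c * sg + a * a\<close> and \<open>sg * c + b * b\<close> are 1, which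
  is the shortest disk product. Every replacement rule inserts one more shortest disk word between
  two neighbouring unequal letters. Hence \<open>K\<close> is built from these five elements with an
  arbitrary disk word allowed at each letter change, and all higher products are accounted for at
  once. The A-infinity relations of the disk products are never verified by combinatorics: they are
  inherited through \<open>G\<close>, whose linear part is split injective. Minimality of the quiver
  side means that an obstruction to extending \<open>F\<close> has no room to be corrected by the
  differential there. It is made exact by keeping the composite of \<open>G\<close> and
  \<open>F\<close> equal to the identity in all arities already treated.\<close>

section \<open>Algebra in characteristic two\<close>

class char2 = ab_group_add +
  assumes add_self [simp]: "x + x = 0"
begin

lemma add_self_left [simp]: "x + (x + y) = y"
  by (simp flip: add.assoc)

lemma uminus_char2 [simp]: "- x = x"
  by (rule minus_unique) simp

lemma minus_char2 [simp]: "x - y = x + y"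
  by (simp add: diff_conv_add_uminus del: add_uminus_conv_diff)

lemma add_self_right [simp]: "x + y + y = x"
  by (simp add: add.assoc)

lemma add_move_char2: "x = y + z \<Longrightarrow> x + z = y"
  by simp

lemma add_eq_0_char2: "x + y = 0 \<longleftrightarrow> x = y"
  using eq_neg_iff_add_eq_0[of x y] by simp

end

text \<open>The axiom \<open>0 \<noteq> 1\<close> is left out, so monoid algebras, series and
  matrices form instances without a nontriviality argument.\<close>

class f2ring = ring + monoid_mult + char2

lemma sum_char2_symdiff:
  fixes f :: "'a \<Rightarrow> 'm::char2"
  assumes "finite A" "finite B"
  shows "sum f ((A - B) \<union> (B - A)) = sum f A + sum f B"
proof -
  have A: "sum f A = sum f (A - B) + sum f (A \<inter> B)"
    using assms by (metis sum.Int_Diff add.commute)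
  have B: "sum f B = sum f (B - A) + sum f (A \<inter> B)"
    using assms by (metis sum.Int_Diff add.commute Int_commute)
  have "sum f ((A - B) \<union> (B - A)) = sum f (A - B) + sum f (B - A)"
    using assms by (intro sum.union_disjoint) auto
  then show ?thesis
    by (simp add: A B ac_simps)
qed

subsection \<open>Finite sets as vectors over the two-element field\<close>

text \<open>The finite-set vectors of the problem as a type. Addition becomes a class operation, so
  finite sums and ring arithmetic apply to them.\<close>

typedef 'a vec = "{A :: 'a set. finite A}"
  morphisms supp Vec by auto

lemma finite_supp [simp]: "finite (supp v)"
  using supp by auto

lemma supp_Vec [simp]: "finite A \<Longrightarrow> supp (Vec A) = A"
  by (simp add: Vec_inverse)

lemma vec_eqI: "(\<And>a. a \<in> supp v \<longleftrightarrow> a \<in> supp w) \<Longrightarrow> v = w"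
  by (metis subsetI subset_antisym supp_inject)

instantiation vec :: (type) char2
begin

definition "0 = Vec {}"
definition "v + w = Vec ((supp v - supp w) \<union> (supp w - supp v))"
definition "- v = (v :: 'a vec)"
definition "v - w = (v :: 'a vec) + w"

lemma supp_zero [simp]: "supp 0 = {}"
  by (simp add: zero_vec_def)

lemma supp_add: "supp (v + w) = (supp v - supp w) \<union> (supp w - supp v)"
  by (simp add: plus_vec_def)

instance
  by standard (auto intro!: vec_eqI simp: supp_add uminus_vec_def minus_vec_def)

end

lemma supp_eq_empty_iff [simp]: "supp v = {} \<longleftrightarrow> v = 0"
  by (metis supp_inject supp_zero)

definition bas :: "'a \<Rightarrow> 'a vec" where "bas a = Vec {a}"

lemma supp_bas [simp]: "supp (bas a) = {a}"
  by (simp add: bas_def)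

lemma bas_neq_0 [simp]: "bas a \<noteq> 0"
  by (metis insert_not_empty supp_bas supp_zero)

lemma bas_eq_iff [simp]: "bas a = bas b \<longleftrightarrow> a = b"
  by (metis singleton_iff supp_bas)

text \<open>Linear extension from the basis. It is additive only for values in characteristic two,
  where common basis elements of two vectors cancel in pairs.\<close>

definition lin :: "('a \<Rightarrow> 'm::comm_monoid_add) \<Rightarrow> 'a vec \<Rightarrow> 'm" where
  "lin f v = sum f (supp v)"

lemma lin_0 [simp]: "lin f 0 = 0"
  and lin_bas [simp]: "lin f (bas a) = f a"
  by (simp_all add: lin_def)

lemma lin_add [simp]: "lin f (v + w) = lin f v + lin (f :: 'a \<Rightarrow> 'm::char2) w"
  by (simp add: lin_def supp_add sum_char2_symdiff)

lemma lin_fun_add: "lin (\<lambda>a. f a + g a) v = lin f v + lin g v"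
  by (simp add: lin_def sum.distrib)

lemma lin_fun_zero [simp]: "lin (\<lambda>a. 0) v = 0"
  by (simp add: lin_def)

lemma lin_cong: "(\<And>a. a \<in> supp v \<Longrightarrow> f a = g a) \<Longrightarrow> lin f v = lin g v"
  by (simp add: lin_def)

lemma lin_sum: "lin f (\<Sum>i\<in>I. g i) = (\<Sum>i\<in>I. lin (f :: 'a \<Rightarrow> 'm::char2) (g i))"
  by (induction I rule: infinite_finite_induct) auto

lemma lin_fun_sum: "lin (\<lambda>a. \<Sum>i\<in>I. f i a) v = (\<Sum>i\<in>I. lin (f i) v)"
  unfolding lin_def by (rule sum.swap)

lemma vec_induct [case_names zero add]:
  assumes "P 0" "\<And>a v. P v \<Longrightarrow> P (bas a + v)"
  shows "P v"
proof -
  have "P (Vec A)" if "finite A" for A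
    using that
  proof (induction A rule: finite_induct)
    case empty
    then show ?case using assms(1) by (simp add: zero_vec_def)
  next
    case (insert a A)
    have "Vec (insert a A) = bas a + Vec A"
      using insert by (intro vec_eqI) (auto simp: supp_add)
    then show ?case using assms(2) insert by simp
  qed
  from this[of "supp v"] show ?thesis by (simp add: supp_inverse)
qed

text \<open>Over the two-element field an additive map is linear, so it is determined by its values
  on the basis.\<close>

lemma lin_eqI:
  fixes h :: "'a vec \<Rightarrow> 'm::char2"
  assumes "\<And>v w. h (v + w) = h v + h w" "\<And>a. h (bas a) = f a"
  shows "h v = lin f v"
proof -
  have "h 0 = 0" using assms(1)[of 0 0] by simp
  then show ?thesis
    by (induction v rule: vec_induct) (auto simp: assms)
qed

lemma lin_bas_id [simp]: "lin bas v = v"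
  by (rule lin_eqI[symmetric]) auto

lemma lin_lin: "lin f (lin g v) = lin (\<lambda>a. lin f (g a)) (v :: 'a vec)"
  for f :: "'b \<Rightarrow> 'm::char2"
  by (rule lin_eqI) auto

text \<open>Bridge to the parity counts in \<open>vsum\<close> and \<open>mext\<close>: counting
  modulo two is summation of vectors.\<close>

lemma Vec_odd:
  assumes "finite A" "\<And>a. a \<in> A \<Longrightarrow> finite (f a)"
  shows "(\<Sum>a\<in>A. Vec (f a)) = Vec {b. odd (card {a \<in> A. b \<in> f a})}"
    and "finite {b. odd (card {a \<in> A. b \<in> f a})}"
proof -
  have "b \<in> supp (\<Sum>a\<in>A. Vec (f a)) \<longleftrightarrow> odd (card {a \<in> A. b \<in> f a})" for b
    using assms
  proof (induction A rule: finite_induct)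
    case (insert x A)
    have "{a \<in> insert x A. b \<in> f a} =
        (if b \<in> f x then insert x {a \<in> A. b \<in> f a} else {a \<in> A. b \<in> f a})"
      by auto
    then show ?case using insert by (auto simp: supp_add)
  qed auto
  then have *: "supp (\<Sum>a\<in>A. Vec (f a)) = {b. odd (card {a \<in> A. b \<in> f a})}"
    by auto
  show "finite {b. odd (card {a \<in> A. b \<in> f a})}"
    using finite_supp * by metis
  then show "(\<Sum>a\<in>A. Vec (f a)) = Vec {b. odd (card {a \<in> A. b \<in> f a})}"
    using * by (metis supp_inverse)
qed

subsection \<open>Monoid algebras\<close>

text \<open>Concatenation is written additively so that one monoid algebra construction serves
  twice: \<open>'a list vec\<close> is the tensor algebra, and vectors over exponent tuples are
  polynomials.\<close>

instantiation list :: (type) monoid_add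
begin
definition "0 = ([] :: 'a list)"
definition "xs + ys = xs @ (ys :: 'a list)"
instance by standard (auto simp: zero_list_def plus_list_def)
end

instantiation vec :: (monoid_add) f2ring
begin

definition "1 = bas 0"
definition "v * w = lin (\<lambda>a. lin (\<lambda>b. bas (a + b)) w) v"

lemma mult_bas_bas [simp]: "bas a * bas b = bas (a + b)"
  by (simp add: times_vec_def)

instance
proof
  fix a b c :: "'a vec"
  have l: "(a + b) * c = a * c + b * c" for a b c :: "'a vec"
    by (simp add: times_vec_def)
  have r: "a * (b + c) = a * b + a * c" for a b c :: "'a vec"
    by (simp add: times_vec_def lin_fun_add)
  show "(a + b) * c = a * c + b * c" "a * (b + c) = a * b + a * c" by (fact l r)+
  have z: "0 * a = 0" "a * 0 = 0" for a :: "'a vec" by (simp_all add: times_vec_def)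
  have "bas x * bas y * c = bas x * (bas y * c)" for x y
    by (induction c rule: vec_induct) (simp_all add: z r add.assoc)
  then have "bas x * b * c = bas x * (b * c)" for x
    by (induction b rule: vec_induct) (simp_all add: z r l)
  then show "a * b * c = a * (b * c)"
    by (induction a rule: vec_induct) (simp_all add: z l)
  show "1 * a = a"
    by (induction a rule: vec_induct) (simp_all add: z r one_vec_def)
  show "a * 1 = a"
    by (induction a rule: vec_induct) (simp_all add: z l one_vec_def)
qed

end

lemma bas_Nil: "bas [] = 1"
  by (simp add: one_vec_def zero_list_def)

lemma bas_Cons: "bas (x # xs) = bas [x] * bas xs"
  by (simp add: plus_list_def)

lemma bas_append: "bas (xs @ ys) = bas xs * bas ys"
  by (simp add: plus_list_def)

lemma lin_mult_left: "lin f v * r = lin (\<lambda>a. f a * (r :: 'm::f2ring)) v"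
  by (simp add: lin_def sum_distrib_right)

lemma lin_mult_right: "r * lin f v = lin (\<lambda>a. (r :: 'm::f2ring) * f a) v"
  by (simp add: lin_def sum_distrib_left)

definition emb :: "'a vec \<Rightarrow> 'a list vec" where
  "emb = lin (\<lambda>a. bas [a])"

lemma emb_add [simp]: "emb (v + w) = emb v + emb w"
  and emb_0 [simp]: "emb 0 = 0"
  and emb_bas [simp]: "emb (bas a) = bas [a]"
  by (simp_all add: emb_def)

lemma lin_emb: "lin f (emb v) = lin (\<lambda>a. f [a]) v" for f :: "_ \<Rightarrow> 'm::char2"
  by (simp add: emb_def lin_lin)

subsection \<open>Noncommutative power series\<close>

text \<open>A family of multilinear maps, one for each arity, is stored as the function of its
  values on basis words. The product defined below is convolution over all ways of cutting a word in
  two.\<close>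

typedef ('a, 'r) ser = "UNIV :: ('a list \<Rightarrow> 'r) set"
  morphisms cf Ser by auto

lemma cf_Ser [simp]: "cf (Ser f) = f"
  by (simp add: Ser_inverse)

lemma ser_eqI: "(\<And>xs. cf f xs = cf g xs) \<Longrightarrow> f = g"
  by (metis cf_inject ext)

instantiation ser :: (type, char2) char2
begin

definition "0 = Ser (\<lambda>_. 0)"
definition "f + g = Ser (\<lambda>xs. cf f xs + cf g xs)"
definition "- f = (f :: ('a, 'b) ser)"
definition "f - g = (f :: ('a, 'b) ser) + g"

lemma cf_0 [simp]: "cf 0 = (\<lambda>xs. 0)"
  and cf_add [simp]: "cf (f + g) = (\<lambda>xs. cf f xs + cf g xs)"
  by (simp_all add: zero_ser_def plus_ser_def)

instance
  by standard (auto intro!: ser_eqI simp: uminus_ser_def minus_ser_def ac_simps)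

end

text \<open>Both sides run over the cuts of a word into three pieces, fixing the second cut first or
  the first cut first; associativity of convolution rests on this.\<close>

lemma sum_split3:
  fixes h :: "'a list \<Rightarrow> 'a list \<Rightarrow> 'a list \<Rightarrow> 'm::comm_monoid_add"
  shows "(\<Sum>i\<le>length xs. \<Sum>j\<le>i. h (take j xs) (drop j (take i xs)) (drop i xs)) =
         (\<Sum>j\<le>length xs. \<Sum>i\<le>length xs - j. h (take j xs) (take i (drop j xs)) (drop i (drop j xs)))"
proof -
  have "(\<Sum>i\<le>length xs. \<Sum>j\<le>i. h (take j xs) (drop j (take i xs)) (drop i xs)) =
     (\<Sum>(i, j)\<in>(SIGMA i:{..length xs}. {..i}). h (take j xs) (drop j (take i xs)) (drop i xs))"
    by (simp add: sum.Sigma)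
  also have "\<dots> = (\<Sum>(j, i)\<in>(SIGMA j:{..length xs}. {..length xs - j}).
      h (take j xs) (take i (drop j xs)) (drop i (drop j xs)))"
    by (rule sum.reindex_bij_witness[of _ "\<lambda>(j, i). (i + j, j)" "\<lambda>(i, j). (j, i - j)"])
       (auto simp: take_drop)
  finally show ?thesis by (simp add: sum.Sigma)
qed

instantiation ser :: (type, f2ring) f2ring
begin

definition "1 = Ser (\<lambda>xs. if xs = [] then 1 else 0)"
definition "f * g = Ser (\<lambda>xs. \<Sum>i\<le>length xs. cf f (take i xs) * cf g (drop i xs))"

lemma cf_1: "cf 1 xs = (if xs = [] then 1 else 0)"
  and cf_mult: "cf (f * g) xs = (\<Sum>i\<le>length xs. cf f (take i xs) * cf g (drop i xs))"
  by (simp_all add: one_ser_def times_ser_def)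

instance
proof
  fix f g h :: "('a, 'b) ser"
  show "(f + g) * h = f * h + g * h" "f * (g + h) = f * g + f * h"
    by (auto intro!: ser_eqI simp: cf_mult algebra_simps sum.distrib)
  show "f * g * h = f * (g * h)"
  proof (rule ser_eqI)
    fix xs
    have "cf (f * g * h) xs = (\<Sum>i\<le>length xs. \<Sum>j\<le>i.
        cf f (take j xs) * cf g (drop j (take i xs)) * cf h (drop i xs))"
      unfolding cf_mult sum_distrib_right by (intro sum.cong) (auto simp: min_def)
    also have "\<dots> = cf (f * (g * h)) xs"
      by (subst sum_split3[of "\<lambda>u v w. cf f u * cf g v * cf h w"])
         (simp add: cf_mult sum_distrib_left mult.assoc)
    finally show "cf (f * g * h) xs = cf (f * (g * h)) xs" .
  qed
  show "1 * f = f"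
  proof (rule ser_eqI)
    fix xs
    have "cf (1 * f) xs = (\<Sum>i\<le>length xs. if i = 0 then cf f xs else 0)"
      unfolding cf_mult by (intro sum.cong) (auto simp: cf_1)
    then show "cf (1 * f) xs = cf f xs" by simp
  qed
  show "f * 1 = f"
  proof (rule ser_eqI)
    fix xs
    have "cf (f * 1) xs = (\<Sum>i\<le>length xs. if i = length xs then cf f xs else 0)"
      unfolding cf_mult by (intro sum.cong) (auto simp: cf_1)
    then show "cf (f * 1) xs = cf f xs" by simp
  qed
qed

end

lemma cf_mult_Nil [simp]: "cf (f * g) [] = cf f [] * cf g []"
  by (simp add: cf_mult)

lemma cf_1_Nil [simp]: "cf 1 [] = 1"
  and cf_1_Cons [simp]: "cf 1 (x # xs) = 0"
  by (simp_all add: cf_1)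

lemma cf_mult_Cons:
  "cf (f * g) (x # xs) = cf f [] * cf g (x # xs) + cf (Ser (\<lambda>u. cf f (x # u)) * g) xs"
  by (simp add: cf_mult sum.atMost_Suc_shift del: sum.atMost_Suc)

lemma cf_sum: "cf (\<Sum>i\<in>I. f i) xs = (\<Sum>i\<in>I. cf (f i) xs)"
  by (induction I rule: infinite_finite_induct) auto

subsection \<open>The bar construction\<close>

definition smap :: "('r \<Rightarrow> 's) \<Rightarrow> ('a, 'r) ser \<Rightarrow> ('a, 's) ser" where
  "smap h f = Ser (\<lambda>xs. h (cf f xs))"

lemma cf_smap [simp]: "cf (smap h f) = (\<lambda>xs. h (cf f xs))"
  by (simp add: smap_def)

text \<open>The identity map of the tensor coalgebra, viewed as a series with words as
  coefficients.\<close>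

definition sid :: "('a, 'a list vec) ser" where
  "sid = Ser bas"

lemma cf_sid [simp]: "cf sid = bas"
  by (simp add: sid_def)

text \<open>Precomposition with the linear map of tensor coalgebras whose values on basis words are
  the coefficients of \<open>X\<close>.\<close>

definition pull :: "('a, 'b list vec) ser \<Rightarrow> ('b, 'm) ser \<Rightarrow> ('a, 'm::comm_monoid_add) ser" where
  "pull X f = Ser (\<lambda>xs. lin (cf f) (cf X xs))"

lemma cf_pull [simp]: "cf (pull X f) = (\<lambda>xs. lin (cf f) (cf X xs))"
  by (simp add: pull_def)

lemma pull_add: "pull X (f + g) = pull X f + pull X g"
  by (rule ser_eqI) (simp add: lin_fun_add)

lemma pull_add_left: "pull (X + Y) f = pull X f + pull Y (f :: (_, 'm::char2) ser)"
  by (rule ser_eqI) simp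

lemma pull_0 [simp]: "pull X 0 = (0 :: (_, 'm::char2) ser)"
  by (rule ser_eqI) simp

lemma pull_pull: "pull X (pull Y f) = pull (pull X Y) (f :: (_, 'm::char2) ser)"
  by (rule ser_eqI) (simp add: lin_lin)

lemma pull_sid [simp]: "pull X sid = X"
  by (rule ser_eqI) (simp cong: lin_cong)

lemma sid_pull [simp]: "pull sid f = f"
  by (rule ser_eqI) simp

lemma smap_pull:
  fixes X :: "('a, 'b list vec) ser"
  assumes "\<And>x y. h (x + y) = h x + h y" "h 0 = 0"
  shows "smap h (pull X f) = pull X (smap h f)"
proof (rule ser_eqI)
  fix xs
  have "h (sum g A) = (\<Sum>a\<in>A. h (g a))" for A :: "'b list set" and g
    by (induction A rule: infinite_finite_induct) (auto simp: assms)
  then show "cf (smap h (pull X f)) xs = cf (pull X (smap h f)) xs"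
    by (simp add: lin_def)
qed

abbreviation ems :: "('a, 'b vec) ser \<Rightarrow> ('a, 'b list vec) ser" where
  "ems \<equiv> smap emb"

lemma ems_add: "ems (f + g) = ems f + ems g"
  by (rule ser_eqI) simp

lemma ems_pull: "ems (pull X f) = pull X (ems f)"
  by (rule smap_pull) auto

definition shift :: "'a \<Rightarrow> ('a, 'r) ser \<Rightarrow> ('a, 'r) ser" where
  "shift a f = Ser (\<lambda>xs. cf f (a # xs))"

lemma cf_shift [simp]: "cf (shift a f) = (\<lambda>xs. cf f (a # xs))"
  by (simp add: shift_def)

lemma lin_front: "lin f (emb v * t) = lin (\<lambda>b. lin (\<lambda>w. f (b # w)) t) v"
  for f :: "'b list \<Rightarrow> 'm::char2"
proof (induction v rule: vec_induct)
  case (add b v)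
  have "lin f (bas [b] * t) = lin (\<lambda>w. f (b # w)) t"
    by (induction t rule: vec_induct) (simp_all add: distrib_left plus_list_def)
  then show ?case using add by (simp add: distrib_right)
qed simp

lemma cf_mult_shift: "cf (f * g) (x # xs) = cf f [] * cf g (x # xs) + cf (shift x f * g) xs"
  by (simp add: cf_mult_Cons shift_def)

lemma lin_shift_mult:
  "lin (\<lambda>w. cf (f * g) (b # w)) t = cf f [] * lin (\<lambda>w. cf g (b # w)) t + lin (cf (shift b f * g)) t"
  by (simp add: cf_mult_shift lin_fun_add lin_mult_right)

text \<open>First-letter recursion shared by coalgebra maps (\<open>X = hat F\<close>) and
  coderivations (\<open>X = sid\<close>). The first output letter is produced by \<open>F\<close>
  from a nonempty prefix. A cut of the output word lies before this letter or after it, and in the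
  second case the hypothesis on proper suffixes applies.\<close>

lemma pull_front:
  fixes f g :: "('b, 'm::f2ring) ser"
  assumes F: "cf F [] = 0"
    and X: "\<And>f i. 0 < i \<Longrightarrow> i \<le> length xs \<Longrightarrow>
      cf (pull X (f * g)) (drop i xs) = cf (pull X f * g') (drop i xs)"
  shows "cf (pull (ems F * X) (f * g)) xs =
         cf f [] * cf (pull (ems F * X) g) xs + cf (pull (ems F * X) f * g') xs"
proof -
  have *: "cf (pull (ems F * X) f) ys =
      (\<Sum>i\<le>length ys. lin (\<lambda>b. cf (pull X (shift b f)) (drop i ys)) (cf F (take i ys)))" for f :: "('b, 'm) ser" and ys
    by (simp add: cf_mult lin_sum lin_front)
  have "cf (pull (ems F * X) (f * g)) xs = (\<Sum>i\<le>length xs.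
     cf f [] * lin (\<lambda>b. cf (pull X (shift b g)) (drop i xs)) (cf F (take i xs)) +
     lin (\<lambda>b. cf (pull X (shift b f * g)) (drop i xs)) (cf F (take i xs)))"
    unfolding * by (simp add: lin_shift_mult lin_fun_add lin_mult_right)
  also have "\<dots> = cf f [] * cf (pull (ems F * X) g) xs +
      (\<Sum>i\<le>length xs. lin (\<lambda>b. cf (pull X (shift b f * g)) (drop i xs)) (cf F (take i xs)))"
    unfolding * by (simp add: sum.distrib sum_distrib_left)
  also have "(\<Sum>i\<le>length xs. lin (\<lambda>b. cf (pull X (shift b f * g)) (drop i xs)) (cf F (take i xs))) =
      (\<Sum>i\<le>length xs. lin (\<lambda>b. cf (pull X (shift b f) * g') (drop i xs)) (cf F (take i xs)))"
  proof (rule sum.cong[OF refl])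
    fix i assume "i \<in> {..length xs}"
    then show "lin (\<lambda>b. cf (pull X (shift b f * g)) (drop i xs)) (cf F (take i xs)) =
      lin (\<lambda>b. cf (pull X (shift b f) * g') (drop i xs)) (cf F (take i xs))"
      using X[of i] F by (cases "i = 0") (auto intro!: lin_cong simp del: cf_pull)
  qed
  also have "\<dots> = (\<Sum>i\<le>length xs. \<Sum>j\<le>length xs - i.
      lin (\<lambda>b. cf (pull X (shift b f)) (take j (drop i xs))) (cf F (take i xs)) *
      cf g' (drop j (drop i xs)))"
    by (simp add: cf_mult lin_fun_sum lin_mult_left)
  also have "\<dots> = (\<Sum>j\<le>length xs. \<Sum>i\<le>j.
      lin (\<lambda>b. cf (pull X (shift b f)) (drop i (take j xs))) (cf F (take i xs)) * cf g' (drop j xs))"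
    by (rule sum_split3[symmetric, of "\<lambda>u v w. lin (\<lambda>b. cf (pull X (shift b f)) v) (cf F u) * cf g' w"])
  also have "\<dots> = cf (pull (ems F * X) f * g') xs"
    unfolding cf_mult[of "pull _ _"] * sum_distrib_right
    by (intro sum.cong) (auto simp: min_def split: if_splits)
  finally show ?thesis .
qed

text \<open>As \<open>f\<close> has no constant term, each coefficient of \<open>g\<close> is
  expressed through coefficients at shorter words.\<close>

lemma ser_fix_0:
  assumes "cf f [] = 0" "g = f * (g :: ('a, 'r::f2ring) ser)"
  shows "g = 0"
proof (rule ser_eqI)
  fix xs
  show "cf g xs = cf 0 xs"
  proof (induction xs rule: length_induct)
    case (1 xs)
    have "cf g xs = (\<Sum>i\<le>length xs. cf f (take i xs) * cf g (drop i xs))"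
      by (subst assms(2)) (simp add: cf_mult)
    also have "\<dots> = (\<Sum>i\<le>length xs. 0)"
    proof (rule sum.cong[OF refl])
      fix i assume "i \<in> {..length xs}"
      then show "cf f (take i xs) * cf g (drop i xs) = 0"
        using 1[rule_format, of "drop i xs"] assms(1) by (cases "i = 0") auto
    qed
    finally show ?case by simp
  qed
qed

text \<open>Coefficients of 1 + f + f^2 + ..., which inverts 1 + f in characteristic two when
  \<open>f\<close> has no constant term. The recursion strips the first block; \<open>Suc i\<close>
  keeps that block nonempty and gives termination.\<close>

function geo :: "('a, 'r::f2ring) ser \<Rightarrow> 'a list \<Rightarrow> 'r" where
  "geo f xs = (if xs = [] then 1 else \<Sum>i<length xs. cf f (take (Suc i) xs) * geo f (drop (Suc i) xs))"
  by pat_completeness auto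
termination by (relation "measure (length \<circ> snd)") auto

declare geo.simps [simp del]

definition ginv :: "('a, 'r::f2ring) ser \<Rightarrow> ('a, 'r) ser" where
  "ginv f = Ser (geo f)"

lemma ginv_eq: "cf f [] = 0 \<Longrightarrow> ginv f = 1 + f * ginv f"
proof (rule ser_eqI)
  fix xs
  assume f: "cf f [] = 0"
  show "cf (ginv f) xs = cf (1 + f * ginv f) xs"
  proof (cases "xs = []")
    case False
    then obtain n where n: "length xs = Suc n" by (cases xs) auto
    have "geo f xs = (\<Sum>i<length xs. cf f (take (Suc i) xs) * geo f (drop (Suc i) xs))"
      using False by (subst geo.simps) simp
    also have "\<dots> = (\<Sum>i\<le>length xs. cf f (take i xs) * geo f (drop i xs))"
      by (simp add: n sum.atMost_Suc_shift f lessThan_Suc_atMost del: sum.atMost_Suc)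
    finally show ?thesis using False by (simp add: ginv_def cf_mult cf_1)
  qed (simp add: ginv_def geo.simps f)
qed

lemma ginv_unique:
  assumes "cf f [] = 0" "g = 1 + f * g"
  shows "g = ginv f"
proof -
  have "g + ginv f = (1 + f * g) + (1 + f * ginv f)"
    by (rule arg_cong2[of _ _ _ _ "(+)", OF assms(2) ginv_eq[OF assms(1)]])
  also have "\<dots> = f * (g + ginv f)"
    by (simp add: distrib_left ac_simps)
  finally have "g + ginv f = f * (g + ginv f)" .
  then have "g + ginv f = 0" by (rule ser_fix_0[OF assms(1)])
  then show ?thesis by (simp add: add_eq_0_char2)
qed

lemma ginv_left: "cf f [] = 0 \<Longrightarrow> (1 + f) * ginv f = 1"
  using add_move_char2[OF ginv_eq[of f]] by (simp only: distrib_right mult_1_left)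

lemma ginv_right:
  assumes f: "cf f [] = 0"
  shows "ginv f * (1 + f) = 1"
proof -
  let ?z = "ginv f * (1 + f) + 1"
  have "(1 + f) * ?z = 0"
    using ginv_left[OF f] by (simp add: distrib_left mult.assoc[symmetric])
  then have "?z + f * ?z = 0" by (simp only: distrib_right mult_1_left)
  then have "?z = f * ?z" by (simp only: add_eq_0_char2)
  then have "?z = 0" by (rule ser_fix_0[OF f])
  then show ?thesis by (simp add: add_eq_0_char2)
qed

text \<open>The coalgebra map with corestriction \<open>F\<close>: the geometric series sums over
  all ways to cut a word into blocks and to apply \<open>F\<close> to every block.\<close>

definition hat :: "('a, 'b vec) ser \<Rightarrow> ('a, 'b list vec) ser" where
  "hat F = ginv (ems F)"

lemma hat_eq: "cf F [] = 0 \<Longrightarrow> hat F = 1 + ems F * hat F"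
  unfolding hat_def by (rule ginv_eq) simp

lemma cf_pull_1: "cf (pull 1 f) xs = (if xs = [] then cf f [] else 0)" for f :: "('b, 'm::char2) ser"
  by (auto simp: cf_1 simp flip: bas_Nil)

lemma pull_1_mult: "cf (pull 1 f * g) xs = cf f [] * cf g xs" for f :: "('b, 'm::f2ring) ser"
proof -
  have "cf (pull 1 f * g) xs = (\<Sum>i\<le>length xs. if i = 0 then cf f [] * cf g xs else 0)"
    unfolding cf_mult by (intro sum.cong) (auto simp: cf_pull_1 simp del: cf_pull)
  then show ?thesis by simp
qed

text \<open>Every block yields one output letter, so a cut of the output separates blocks and
  therefore comes from a cut of the input. This is compatibility of \<open>hat F\<close> with
  deconcatenation.\<close>

lemma pull_hat_mult:
  fixes f g :: "('b, 'm::f2ring) ser"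
  assumes F: "cf F [] = 0"
  shows "pull (hat F) (f * g) = pull (hat F) f * pull (hat F) g"
proof (rule ser_eqI)
  fix xs
  show "cf (pull (hat F) (f * g)) xs = cf (pull (hat F) f * pull (hat F) g) xs"
  proof (induction "length xs" arbitrary: xs f rule: less_induct)
    case less
    have H: "pull (hat F) f = pull 1 f + pull (ems F * hat F) f" for f :: "('b, 'm) ser"
      by (subst hat_eq[OF F]) (simp add: pull_add_left)
    have "cf (pull (ems F * hat F) (f * g)) xs = cf f [] * cf (pull (ems F * hat F) g) xs +
       cf (pull (ems F * hat F) f * pull (hat F) g) xs"
      by (rule pull_front[OF F]) (use less in auto)
    moreover have "cf (pull (hat F) f * pull (hat F) g) xs =
        cf f [] * cf (pull (hat F) g) xs + cf (pull (ems F * hat F) f * pull (hat F) g) xs"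
      by (subst H[of f]) (simp only: distrib_right cf_add pull_1_mult)
    moreover have "cf (pull (hat F) h) xs = cf (pull 1 h) xs + cf (pull (ems F * hat F) h) xs" for h :: "('b, 'm) ser"
      by (subst H) simp
    moreover have "cf (pull 1 (f * g)) xs = cf f [] * cf (pull 1 g) xs"
      by (simp add: cf_pull_1 del: cf_pull)
    ultimately show ?case
      by (simp only: distrib_left add.assoc)
  qed
qed

lemma pull_hat_1:
  fixes F :: "('a, 'b vec) ser"
  assumes F: "cf F [] = 0"
  shows "pull (hat F) 1 = (1 :: ('a, 'm::f2ring) ser)"
proof -
  have "\<And>xs. cf (pull (ems F * hat F) (1 :: ('b, 'm) ser)) xs = 0"
    by (simp add: cf_mult lin_sum lin_front)
  moreover have "pull (hat F) (1 :: ('b, 'm) ser) = pull 1 (1 :: ('b, 'm) ser) + pull (ems F * hat F) (1 :: ('b, 'm) ser)"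
    by (subst hat_eq[OF F]) (simp add: pull_add_left)
  ultimately show ?thesis
    by (intro ser_eqI) (simp add: cf_pull_1 cf_1 del: cf_pull)
qed

text \<open>The coderivation with corestriction \<open>M\<close>: one block is replaced and the
  letters on both sides of it are kept. Characteristic two removes all signs.\<close>

definition cod :: "('a, 'a vec) ser \<Rightarrow> ('a, 'a list vec) ser" where
  "cod M = sid * ems M * sid"

lemma shift_mult: "shift x (f * g) = Ser (\<lambda>w. cf f [] * cf (shift x g) w) + shift x f * g"
  by (rule ser_eqI) (simp add: cf_mult_shift)

lemma pull_cod_Cons:
  fixes f :: "('a, 'm::char2) ser"
  shows "cf (pull (cod M) f) (x # xs) = cf (pull (ems M * sid) f) (x # xs) + cf (pull (cod M) (shift x f)) xs"
proof -
  have sx: "cf (shift x sid) u = bas [x] * bas u" for u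
    by (simp add: plus_list_def)
  have "cf (cod M) (x # xs) = cf (ems M * sid) (x # xs) + cf (shift x sid * (ems M * sid)) xs"
    by (simp add: cod_def mult.assoc cf_mult_shift bas_Nil)
  also have "shift x sid * (ems M * sid) = Ser (\<lambda>u. bas [x] * cf (cod M) u)"
    by (rule ser_eqI)
       (simp add: cod_def mult.assoc cf_mult[of "shift x sid"] cf_mult[of sid] sx sum_distrib_left
             del: cf_shift mult_bas_bas)
  finally have "cf (cod M) (x # xs) = cf (ems M * sid) (x # xs) + emb (bas x) * cf (cod M) xs"
    by simp
  then show ?thesis by (simp add: lin_front del: emb_bas)
qed

text \<open>Leibniz rule: the letter produced by \<open>M\<close> lies on one side of any given cut,
  and the other side is left unchanged.\<close>

lemma pull_cod_mult:
  fixes f g :: "('a, 'm::f2ring) ser"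
  assumes M: "cf M [] = 0"
  shows "pull (cod M) (f * g) = pull (cod M) f * g + f * pull (cod M) g"
proof (rule ser_eqI)
  fix xs
  have N: "cf (pull (cod M) f) [] = 0" "cf (pull (ems M * sid) f) [] = 0" for f :: "('a, 'm) ser"
    by (simp_all add: cod_def M)
  show "cf (pull (cod M) (f * g)) xs = cf (pull (cod M) f * g + f * pull (cod M) g) xs"
  proof (induction xs arbitrary: f)
    case Nil
    then show ?case by (simp add: N del: cf_pull)
  next
    case (Cons x xs)
    have R: "cf (pull (ems M * sid) (f * g)) (x # xs) = cf f [] * cf (pull (ems M * sid) g) (x # xs) +
       cf (pull (ems M * sid) f * g) (x # xs)"
      by (rule pull_front[OF M]) simp
    have S: "shift x (pull (cod M) f) = shift x (pull (ems M * sid) f) + pull (cod M) (shift x f)"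
      by (rule ser_eqI) (simp add: pull_cod_Cons del: cf_pull)
    have "cf (pull (cod M) (shift x (f * g))) xs = cf f [] * cf (pull (cod M) (shift x g)) xs +
        cf (pull (cod M) (shift x f) * g + shift x f * pull (cod M) g) xs"
      unfolding shift_mult pull_add cf_add[of "pull _ _"] Cons by (simp add: lin_mult_right)
    then show ?case
      unfolding pull_cod_Cons R cf_add[of "_ * _" "_ * _"] cf_mult_shift S
      by (simp add: N algebra_simps pull_cod_Cons del: cf_pull)
  qed
qed

lemma pull_cod_1: 
  assumes M: "cf M [] = 0"
  shows "pull (cod M) 1 = (0 :: ('a, 'm::f2ring) ser)"
proof -
  have "pull (cod M) (1 * 1) = pull (cod M) 1 + pull (cod M) (1 :: ('a, 'm) ser)"
    unfolding pull_cod_mult[OF M] by simp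
  then show ?thesis by simp
qed

text \<open>The derivative of an inverse: differentiate \<open>hat F = 1 + ems F * hat F\<close> and
  cancel the invertible factor \<open>1 + ems F\<close>.\<close>

lemma pull_cod_hat:
  assumes M: "cf M [] = 0" and F: "cf F [] = 0"
  shows "pull (cod M) (hat F) = hat F * ems (pull (cod M) F) * hat F"
proof -
  let ?d = "pull (cod M)"
  have "?d (hat F) = ?d (1 + ems F * hat F)" by (subst hat_eq[OF F]) simp
  also have "\<dots> = ?d (ems F) * hat F + ems F * ?d (hat F)"
    by (simp add: pull_add pull_cod_1[OF M] pull_cod_mult[OF M])
  finally have "?d (hat F) + ems F * ?d (hat F) = ?d (ems F) * hat F"
    by (rule add_move_char2)
  then have "(1 + ems F) * ?d (hat F) = ?d (ems F) * hat F"
    by (simp only: distrib_right mult_1_left)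
  then have "hat F * (1 + ems F) * ?d (hat F) = hat F * ?d (ems F) * hat F"
    by (simp only: mult.assoc)
  moreover have "hat F * (1 + ems F) = 1"
    unfolding hat_def by (rule ginv_right) (simp add: F)
  ultimately show ?thesis by (simp add: ems_pull)
qed

lemma pull_hat_cod:
  assumes F: "cf F [] = 0"
  shows "pull (hat F) (cod M) = hat F * ems (pull (hat F) M) * hat F"
  by (simp add: cod_def pull_hat_mult[OF F] ems_pull)

text \<open>Composition of morphisms in bar form. The pulled back fixed point equation has only one
  solution, namely the \<open>hat\<close> of the composite.\<close>

lemma pull_hat_hat:
  assumes F: "cf F [] = 0" and G: "cf G [] = 0"
  shows "pull (hat G) (hat F) = hat (pull (hat G) F)"
  unfolding hat_def[of "pull _ _"]
proof (rule ginv_unique)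
  show "cf (ems (pull (hat G) F)) [] = 0"
    by (simp add: hat_def ginv_def geo.simps F flip: bas_Nil)
  have "pull (hat G) (hat F) = pull (hat G) (1 + ems F * hat F)" by (subst hat_eq[OF F]) simp
  then show "pull (hat G) (hat F) = 1 + ems (pull (hat G) F) * pull (hat G) (hat F)"
    by (simp add: pull_add pull_hat_1[OF G] pull_hat_mult[OF G] ems_pull)
qed

subsection \<open>Homogeneous vectors\<close>

definition hg :: "('a \<Rightarrow> 'g) \<Rightarrow> 'g \<Rightarrow> 'a vec \<Rightarrow> bool" where
  "hg w e v \<longleftrightarrow> (\<forall>a \<in> supp v. w a = e)"

abbreviation lw :: "('a \<Rightarrow> 'g::ab_group_add) \<Rightarrow> 'a list \<Rightarrow> 'g" where
  "lw w xs \<equiv> sum_list (map w xs)"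

lemma hg_0 [simp]: "hg w e 0"
  and hg_bas [simp]: "hg w e (bas a) \<longleftrightarrow> w a = e"
  by (simp_all add: hg_def)

lemma hg_add: "hg w e u \<Longrightarrow> hg w e v \<Longrightarrow> hg w e (u + v)"
  by (auto simp: hg_def supp_add)

lemma hg_sum: "(\<And>i. i \<in> I \<Longrightarrow> hg w e (f i)) \<Longrightarrow> hg w e (\<Sum>i\<in>I. f i)"
  by (induction I rule: infinite_finite_induct) (auto intro: hg_add)

lemma hg_lin: "hg w e v \<Longrightarrow> (\<And>a. w a = e \<Longrightarrow> hg w' e' (f a)) \<Longrightarrow> hg w' e' (lin f v)"
  unfolding lin_def by (rule hg_sum) (auto simp: hg_def)

lemma hg_emb: "hg w e v \<Longrightarrow> hg (lw w) e (emb v)"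
  unfolding emb_def by (erule hg_lin) simp

lemma hg_mult: "hg (lw w) e u \<Longrightarrow> hg (lw w) e' v \<Longrightarrow> hg (lw w) (e + e') (u * v)"
  unfolding times_vec_def by (erule hg_lin, erule hg_lin) (simp add: plus_list_def)

lemma hg_hat:
  assumes F: "cf F [] = 0" "\<And>xs. hg w' (lw w xs) (cf F xs)"
  shows "hg (lw w') (lw w xs) (cf (hat F) xs)"
proof (induction xs rule: length_induct)
  case (1 xs)
  have "hg (lw w') (lw w xs) (emb (cf F (take i xs)) * cf (hat F) (drop i xs))" if "i \<le> length xs" for i
  proof (cases "i = 0")
    case False
    have "lw w xs = lw w (take i xs) + lw w (drop i xs)"
      by (metis append_take_drop_id map_append sum_list_append)
    then show ?thesis
      using hg_mult[OF hg_emb[OF F(2)[of "take i xs"]], of "lw w (drop i xs)" "cf (hat F) (drop i xs)"] 1 False that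
      by (cases xs) (auto simp: not_le)
  qed (simp add: F)
  then have "hg (lw w') (lw w xs) (\<Sum>i\<le>length xs. emb (cf F (take i xs)) * cf (hat F) (drop i xs))"
    by (intro hg_sum) auto
  moreover have "hg (lw w') (lw w xs) (cf 1 xs)"
    by (auto simp: cf_1 simp flip: bas_Nil)
  ultimately show ?case
    by (subst hat_eq[OF F(1)]) (auto simp: cf_mult intro: hg_add)
qed

lemma hg_cod:
  assumes "\<And>xs. hg w (lw w xs + s) (cf M xs)"
  shows "hg (lw w) (lw w xs + s) (cf (cod M) xs)"
proof -
  have "hg (lw w) (lw w xs + s) (cf sid (take i xs) *
     (emb (cf M (take j (drop i xs))) * cf sid (drop j (drop i xs))))" for i j
  proof -
    have "lw w xs = lw w (take i xs) + (lw w (take j (drop i xs)) + lw w (drop j (drop i xs)))"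
      by (metis append_take_drop_id map_append sum_list_append)
    then have "lw w xs + s = lw w (take i xs) + ((lw w (take j (drop i xs)) + s) + lw w (drop j (drop i xs)))"
      by (simp add: algebra_simps)
    then show ?thesis by (simp only:) (intro hg_mult hg_emb assms, simp_all)
  qed
  then show ?thesis
    unfolding cod_def mult.assoc cf_mult sum_distrib_left by (auto intro!: hg_sum simp: cf_mult)
qed

subsection \<open>Leading terms\<close>

text \<open>A block other than the whole word is shorter than \<open>xs\<close> and contributes
  nothing. This isolates the lowest-arity term of a bar expression.\<close>

lemma sandwich:
  fixes X Y :: "('a, 'b list vec) ser"
  assumes "\<And>ys. length ys < length xs \<Longrightarrow> cf E ys = 0"
  shows "cf (X * ems E * Y) xs = cf X [] * emb (cf E xs) * cf Y []"
proof -
  have 1: "cf (ems E * Y) ys = (if length ys = length xs then emb (cf E ys) * cf Y [] else 0)"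
    if "length ys \<le> length xs" for ys
  proof -
    have "cf (ems E * Y) ys = (\<Sum>i\<le>length ys. if i = length xs then emb (cf E ys) * cf Y [] else 0)"
      unfolding cf_mult using that assms by (intro sum.cong) auto
    then show ?thesis using that by auto
  qed
  have "cf (X * (ems E * Y)) xs = (\<Sum>i\<le>length xs. if i = 0 then cf X [] * emb (cf E xs) * cf Y [] else 0)"
    unfolding cf_mult[of X] by (intro sum.cong) (auto simp: 1 mult.assoc)
  then show ?thesis by (simp add: mult.assoc)
qed

lemma cf_hat_Nil: "cf F [] = 0 \<Longrightarrow> cf (hat F) [] = 1"
  by (simp add: hat_def ginv_def geo.simps)

lemma hat_cong:
  assumes F: "cf F [] = 0" and F': "cf F' [] = 0"
    and "\<And>ys. length ys \<le> length xs \<Longrightarrow> cf F ys = cf F' ys"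
  shows "cf (hat F) xs = cf (hat F') xs"
  using assms(3)
proof (induction xs rule: length_induct)
  case (1 xs)
  have "emb (cf F (take i xs)) * cf (hat F) (drop i xs) = emb (cf F' (take i xs)) * cf (hat F') (drop i xs)"
    if "i \<le> length xs" for i
    using 1 that F F' by (cases "i = 0") auto
  then show ?case
    by (subst hat_eq[OF F], subst hat_eq[OF F']) (simp add: cf_mult)
qed

text \<open>When a word is cut into two or more blocks, all blocks are shorter than it, so the two
  maps can differ only in the uncut term.\<close>

lemma hat_perturb:
  fixes F F' :: "('a, 'b vec) ser"
  assumes F: "cf F [] = 0" and F': "cf F' [] = 0"
    and agree: "\<And>ys. length ys < length xs \<Longrightarrow> cf F ys = cf F' ys"
  shows "cf (hat F') xs = cf (hat F) xs + emb (cf F xs + cf F' xs)"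
proof (cases "xs = []")
  case False
  have *: "cf (hat F) xs = (\<Sum>i<length xs. emb (cf F (take i xs)) * cf (hat F) (drop i xs)) + emb (cf F xs)"
    if F: "cf F [] = 0" for F :: "('a, 'b vec) ser"
    using False by (subst hat_eq[OF F]) (simp add: cf_mult cf_1 cf_hat_Nil F flip: lessThan_Suc_atMost)
  have "(\<Sum>i<length xs. emb (cf F (take i xs)) * cf (hat F) (drop i xs)) =
        (\<Sum>i<length xs. emb (cf F' (take i xs)) * cf (hat F') (drop i xs))"
  proof (rule sum.cong[OF refl])
    fix i assume "i \<in> {..<length xs}"
    then show "emb (cf F (take i xs)) * cf (hat F) (drop i xs) = emb (cf F' (take i xs)) * cf (hat F') (drop i xs)"
      using agree F hat_cong[OF F F', of "drop i xs"] F' by (cases "i = 0") auto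
  qed
  then show ?thesis
    unfolding *[OF F] *[OF F'] by simp
qed (simp add: F F' cf_hat_Nil)

text \<open>Projection to words of length one: the identity A-infinity morphism, since its
  \<open>hat\<close> is \<open>sid\<close>.\<close>

definition letter :: "('a, 'a vec) ser" where
  "letter = Ser (\<lambda>xs. if length xs = 1 then bas (hd xs) else 0)"

lemma cf_letter: "cf letter xs = (if length xs = 1 then bas (hd xs) else 0)"
  by (simp add: letter_def)

lemma hat_letter: "hat letter = (sid :: ('a, 'a list vec) ser)"
  unfolding hat_def
proof (rule ginv_unique[symmetric])
  show "cf (ems letter) [] = (0 :: 'a list vec)" by (simp add: cf_letter)
  show "(sid :: ('a, 'a list vec) ser) = 1 + ems letter * sid"
  proof (rule ser_eqI)
    fix xs :: "'a list"
    show "cf sid xs = cf (1 + ems letter * sid) xs"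
    proof (cases xs)
      case (Cons x ys)
      have "cf (ems letter * sid) xs = (\<Sum>i\<le>length xs. if i = 1 then bas xs else 0)"
        unfolding cf_mult by (intro sum.cong) (auto simp: cf_letter Cons plus_list_def)
      then show ?thesis by (auto simp: Cons Suc_le_eq)
    next
      case Nil
      show ?thesis unfolding Nil by (simp add: bas_Nil cf_letter)
    qed
  qed
qed

lemma emb_eq_iff [simp]: "emb v = emb w \<longleftrightarrow> v = w"
proof
  assume "emb v = emb w"
  then have "lin (cf letter) (emb v) = lin (cf letter) (emb w)" by simp
  then show "v = w" by (simp add: lin_emb cf_letter)
qed auto

text \<open>A coderivation determines its corestriction. Applying \<open>pull_cod_hat\<close> to
  \<open>letter\<close> gives a second expression for \<open>cod M\<close>, and the factors
  \<open>sid\<close> on both sides are cancelled by their inverse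
  \<open>1 + ems letter\<close>.\<close>

lemma pull_cod_letter:
  assumes M: "cf M [] = 0"
  shows "pull (cod M) letter = M"
proof -
  let ?N = "pull (cod M) letter" and ?j = "1 + ems letter :: ('a, 'a list vec) ser"
  have l: "cf letter [] = 0" by (simp add: cf_letter)
  have "sid * ems M * sid = sid * ems ?N * sid"
    using pull_cod_hat[OF M l] by (simp add: hat_letter cod_def)
  then have "?j * (sid * ems M * sid) * ?j = ?j * (sid * ems ?N * sid) * ?j" by simp
  then have "(?j * sid) * ems M * (sid * ?j) = (?j * sid) * ems ?N * (sid * ?j)"
    by (simp only: mult.assoc)
  moreover have "?j * sid = 1" "sid * ?j = 1"
    using ginv_left[of "ems letter :: ('a, 'a list vec) ser"] ginv_right[of "ems letter :: ('a, 'a list vec) ser"]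
    by (simp_all add: l flip: hat_letter) (simp_all add: hat_def)
  ultimately have "ems M = ems ?N" by simp
  then have "emb (cf M xs) = emb (cf ?N xs)" for xs by (metis cf_smap)
  then show ?thesis by (intro ser_eqI) (simp del: cf_pull)
qed

text \<open>The terms with two disjoint blocks occur once in each order and cancel modulo two; only
  \<open>M\<close> nested in \<open>M\<close> is left.\<close>

lemma pull_cod_cod:
  assumes M: "cf M [] = 0"
  shows "pull (cod M) (cod M) = cod (pull (cod M) M)"
proof -
  have "pull (cod M) (cod M) = cod M * ems M * sid + sid * ems (pull (cod M) M) * sid + sid * ems M * cod M"
    unfolding cod_def[of M, THEN arg_cong[of _ _ "pull (cod M)"]]
    by (simp add: pull_cod_mult[OF M] ems_pull distrib_right)
  moreover have "cod M * ems M * sid = sid * ems M * cod M"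
    by (simp add: cod_def mult.assoc)
  ultimately show ?thesis
    by (simp add: cod_def[of "pull _ _"] ac_simps)
qed

text \<open>The A-infinity morphism equations in bar form, compared after projection to single
  letters. The identity of full coalgebra maps follows in \<open>hom_cod_hat\<close>.\<close>

definition hom :: "('a, 'a vec) ser \<Rightarrow> ('b, 'b vec) ser \<Rightarrow> ('a, 'b vec) ser \<Rightarrow> bool" where
  "hom M N F \<longleftrightarrow> cf F [] = 0 \<and> pull (cod M) F = pull (hat F) N"

lemma hom_cod_hat:
  assumes "hom M N F" "cf M [] = 0"
  shows "pull (cod M) (hat F) = pull (hat F) (cod N)"
  using assms by (simp add: hom_def pull_cod_hat pull_hat_cod)

fun tens :: "('a \<Rightarrow> 'b vec) \<Rightarrow> 'a list \<Rightarrow> 'b list vec" where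
  "tens f [] = 1"
| "tens f (x # xs) = emb (f x) * tens f xs"

fun der :: "('a \<Rightarrow> 'a vec) \<Rightarrow> 'a list \<Rightarrow> 'a list vec" where
  "der d [] = 0"
| "der d (x # xs) = emb (d x) * bas xs + bas [x] * der d xs"

text \<open>The tensor trick: the homotopy \<open>h\<close> acts at one place, \<open>e\<close> at
  all places to its left, the identity at all places to its right. It is used with \<open>e\<close>
  the composite of projection and inclusion.\<close>

fun hty :: "('a \<Rightarrow> 'a vec) \<Rightarrow> ('a \<Rightarrow> 'a vec) \<Rightarrow> 'a list \<Rightarrow> 'a list vec" where
  "hty h e [] = 0"
| "hty h e (x # xs) = emb (h x) * bas xs + emb (e x) * hty h e xs"

lemma lin_tens_mult: "lin (tens f) (u * v) = lin (tens f) u * lin (tens f) v"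
proof -
  have *: "tens f (xs @ ys) = tens f xs * tens f ys" for xs ys
    by (induction xs) (simp_all add: mult.assoc)
  have "lin (tens f) (bas xs * v) = tens f xs * lin (tens f) v" for xs
    by (induction v rule: vec_induct) (simp_all add: distrib_left * plus_list_def)
  then show ?thesis
    by (induction u rule: vec_induct) (simp_all add: distrib_right)
qed

lemma lin_tens_emb: "lin (tens f) (emb v) = emb (lin f v)"
  by (induction v rule: vec_induct) simp_all

lemma lin_der_mult: "lin (der d) (u * v) = lin (der d) u * v + u * lin (der d) v"
proof -
  have *: "der d (xs @ ys) = der d xs * bas ys + bas xs * der d ys" for xs ys
  proof (induction xs)
    case (Cons x xs)
    then show ?case
      by (simp add: bas_append bas_Cons[of x xs] distrib_left distrib_right mult.assoc add.assoc del: mult_bas_bas)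
  qed (simp add: bas_Nil)
  have "lin (der d) (bas xs * v) = der d xs * v + bas xs * lin (der d) v" for xs
    by (induction v rule: vec_induct) (simp_all add: distrib_left * plus_list_def ac_simps)
  then show ?thesis
    by (induction u rule: vec_induct) (simp_all add: distrib_right ac_simps)
qed

lemma lin_der_emb: "lin (der d) (emb v) = emb (lin d v)"
  by (induction v rule: vec_induct) (simp_all add: bas_Nil)

lemma lin_hty_front: "lin (hty h e) (emb v * t) = emb (lin h v) * t + emb (lin e v) * lin (hty h e) t"
proof (induction v rule: vec_induct)
  case (add b v)
  have "lin (hty h e) (bas [b] * t) = emb (h b) * t + emb (e b) * lin (hty h e) t"
    by (induction t rule: vec_induct) (simp_all add: distrib_left plus_list_def ac_simps)
  then show ?case using add by (simp add: distrib_right ac_simps)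
qed simp

lemma hg_tens:
  assumes "\<And>a. hg w' (w a) (f a)"
  shows "hg (lw w') (lw w xs) (tens f xs)"
proof (induction xs)
  case (Cons x xs)
  then show ?case using hg_mult[OF hg_emb[OF assms] Cons] by simp
qed (simp add: one_vec_def zero_list_def)

lemma pull_0_left [simp]: "pull 0 f = 0"
  by (rule ser_eqI) simp

lemma cod_0 [simp]: "cod 0 = 0"
  by (rule ser_eqI) (simp add: cod_def cf_mult)

lemma hg_der:
  assumes "\<And>a. hg w (w a + s) (f a)"
  shows "hg (lw w) (lw w xs + s) (der f xs)"
proof (induction xs)
  case (Cons x xs)
  have "hg (lw w) ((w x + s) + lw w xs) (emb (f x) * bas xs)"
    by (intro hg_mult hg_emb assms) simp
  moreover have "hg (lw w) (w x + (lw w xs + s)) (bas [x] * der f xs)"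
    by (intro hg_mult Cons) simp
  ultimately show ?case by (auto intro!: hg_add simp: ac_simps)
qed simp

lemma hg_hty:
  assumes "\<And>a. hg w (w a + s) (h a)" "\<And>a. hg w (w a) (e a)"
  shows "hg (lw w) (lw w xs + s) (hty h e xs)"
proof (induction xs)
  case (Cons x xs)
  have "hg (lw w) ((w x + s) + lw w xs) (emb (h x) * bas xs)"
    by (intro hg_mult hg_emb assms) simp
  moreover have "hg (lw w) (w x + (lw w xs + s)) (emb (e x) * hty h e xs)"
    by (intro hg_mult hg_emb assms Cons)
  ultimately show ?case by (auto intro!: hg_add simp: ac_simps)
qed simp

lemma lw_one: "lw (\<lambda>_. 1 :: int) xs = int (length xs)"
  by (induction xs) auto

text \<open>Length is the total weight when every letter weighs 1, so preservation of length is a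
  case of homogeneity.\<close>

lemma length_tens: "ys \<in> supp (tens f xs) \<Longrightarrow> length ys = length xs"
  using hg_tens[of "\<lambda>_. 1 :: int" "\<lambda>_. 1" f xs] unfolding hg_def lw_one by auto

lemma length_der: "ys \<in> supp (der f xs) \<Longrightarrow> length ys = length xs"
  using hg_der[of "\<lambda>_. 1 :: int" 0 f xs] unfolding hg_def lw_one by auto

lemma length_hty: "ys \<in> supp (hty h e xs) \<Longrightarrow> length ys = length xs"
  using hg_hty[of "\<lambda>_. 1 :: int" 0 h e xs] unfolding hg_def lw_one by auto

lemma lin_eq_0: "(\<And>a. a \<in> supp v \<Longrightarrow> f a = 0) \<Longrightarrow> lin f v = 0"
  by (simp add: lin_def)

text \<open>A block of two or more letters shortens the word, and \<open>f\<close> vanishes on the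
  result. Only the unary part of \<open>M\<close> survives, acting as the differential of a tensor
  power.\<close>

lemma cod_lead:
  fixes f :: "('a, 'm::char2) ser"
  assumes M: "cf M [] = 0" and f: "\<And>ys. length ys < length xs \<Longrightarrow> cf f ys = 0"
  shows "lin (cf f) (cf (cod M) xs) = lin (cf f) (der (\<lambda>a. cf M [a]) xs)"
  using f
proof (induction xs arbitrary: f)
  case Nil
  then show ?case by (simp add: cod_def M)
next
  case (Cons x xs)
  have IH: "cf (pull (cod M) (shift x f)) xs = lin (cf (shift x f)) (der (\<lambda>a. cf M [a]) xs)"
    using Cons.IH[of "shift x f"] Cons.prems by simp
  have 0: "lin (cf f) (emb v * bas ys) = 0" if "length ys < length xs" for v ys
    using that Cons.prems by (simp add: lin_front)
  have "lin (cf f) (cf (ems M * sid) (x # xs)) =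
      (\<Sum>i\<le>length (x # xs). if i = 1 then lin (cf f) (emb (cf M [x]) * bas xs) else 0)"
    unfolding cf_mult lin_sum
  proof (rule sum.cong[OF refl])
    fix i assume "i \<in> {..length (x # xs)}"
    then show "lin (cf f) (cf (ems M) (take i (x # xs)) * cf sid (drop i (x # xs))) =
      (if i = 1 then lin (cf f) (emb (cf M [x]) * bas xs) else 0)"
      using 0[of "drop i (x # xs)"] by (cases "i = 0"; cases "i = 1") (auto simp: M)
  qed
  then have "lin (cf f) (cf (ems M * sid) (x # xs)) = lin (cf f) (emb (cf M [x]) * bas xs)"
    by (simp add: Suc_le_eq)
  moreover have "lin (cf (shift x f)) t = lin (cf f) (bas [x] * t)" for t
    using lin_front[of "cf f" "bas x" t] by simp
  ultimately show ?case
    using pull_cod_Cons[of M f x xs] IH by simp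
qed

text \<open>If some block has two or more letters, the output is shorter than \<open>xs\<close> and
  is killed by \<open>f\<close>; what remains is the tensor power of the linear part.\<close>

lemma hat_lead:
  fixes f :: "('a, 'm::char2) ser"
  assumes F: "cf F [] = 0" and f: "\<And>ys. length ys < length xs \<Longrightarrow> cf f ys = 0"
  shows "lin (cf f) (cf (hat F) xs) = lin (cf f) (tens (\<lambda>a. cf F [a]) xs)"
  using f
proof (induction xs arbitrary: f rule: length_induct)
  case (1 xs)
  show ?case
  proof (cases xs)
    case (Cons x zs)
    have 0: "lin (cf f) (emb v * cf (hat F) ys) = 0" if "length ys < length zs" for v ys
    proof -
      have "lin (cf (shift b f)) (cf (hat F) ys) = 0" for b
      proof -
        have "lin (cf (shift b f)) (cf (hat F) ys) = lin (cf (shift b f)) (tens (\<lambda>a. cf F [a]) ys)"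
          using that 1(2) by (intro 1(1)[rule_format]) (auto simp: Cons)
        also have "\<dots> = 0"
          using that 1(2) by (intro lin_eq_0) (auto dest!: length_tens simp: Cons)
        finally show ?thesis .
      qed
      then show ?thesis by (simp add: lin_front)
    qed
    have "lin (cf f) (cf (ems F * hat F) xs) =
        (\<Sum>i\<le>length xs. if i = 1 then lin (cf f) (emb (cf F [x]) * cf (hat F) zs) else 0)"
      unfolding cf_mult lin_sum
    proof (rule sum.cong[OF refl])
      fix i assume i: "i \<in> {..length xs}"
      consider "i = 0" | "i = 1" | "i > 1" by linarith
      then show "lin (cf f) (cf (ems F) (take i xs) * cf (hat F) (drop i xs)) =
        (if i = 1 then lin (cf f) (emb (cf F [x]) * cf (hat F) zs) else 0)"
        using 0[of "drop i xs"] i by cases (auto simp: F Cons)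
    qed
    then have "lin (cf f) (cf (hat F) xs) = lin (cf f) (emb (cf F [x]) * cf (hat F) zs)"
      by (subst hat_eq[OF F]) (simp add: Cons Suc_le_eq)
    also have "\<dots> = lin (cf f) (emb (cf F [x]) * tens (\<lambda>a. cf F [a]) zs)"
    proof -
      have "lin (cf (shift b f)) (cf (hat F) zs) = lin (cf (shift b f)) (tens (\<lambda>a. cf F [a]) zs)" for b
        using 1(2) by (intro 1(1)[rule_format]) (auto simp: Cons)
      then show ?thesis by (simp add: lin_front)
    qed
    finally show ?thesis by (simp add: Cons)
  qed (simp add: cf_hat_Nil F)
qed

section \<open>Obstruction theory along a contraction\<close>

text \<open>\<open>N\<close> is minimal, and the linear part \<open>i\<close> of \<open>G\<close> is
  a homotopy equivalence with inverse \<open>p\<close> and homotopy \<open>h\<close>. The A-infinity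
  relations are demanded of \<open>M\<close> alone; \<open>NN\<close> derives those of
  \<open>N\<close>. Weights are suspended degrees, for which morphisms have weight 0 and structure
  maps have weight \<open>s\<close>.\<close>

locale contraction =
  fixes M :: "('a, 'a vec) ser" and N :: "('b, 'b vec) ser" and G :: "('b, 'a vec) ser"
    and p :: "'a \<Rightarrow> 'b vec" and h :: "'a \<Rightarrow> 'a vec"
    and wa :: "'a \<Rightarrow> 'g::ab_group_add" and wb :: "'b \<Rightarrow> 'g" and s :: 'g
  assumes M0: "cf M [] = 0" and N0: "cf N [] = 0" and G: "hom N M G"
    and MM: "pull (cod M) M = 0" and N1: "\<And>b. cf N [b] = 0"
    and pi: "\<And>b. lin p (cf G [b]) = bas b" and pd: "\<And>a. lin p (cf M [a]) = 0"
    and htpy: "\<And>a. lin h (cf M [a]) + lin (\<lambda>c. cf M [c]) (h a) = bas a + lin (\<lambda>b. cf G [b]) (p a)"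
    and wM: "\<And>xs. hg wa (lw wa xs + s) (cf M xs)" and wN: "\<And>xs. hg wb (lw wb xs + s) (cf N xs)"
    and wG: "\<And>xs. hg wa (lw wb xs) (cf G xs)"
    and wp: "\<And>a. hg wb (wa a) (p a)" and wh: "\<And>a. hg wa (wa a - s) (h a)"
begin

lemma G0: "cf G [] = 0"
  using G by (simp add: hom_def)

abbreviation "i \<equiv> \<lambda>b. cf G [b]"
abbreviation "d \<equiv> \<lambda>a. cf M [a]"
abbreviation "e \<equiv> \<lambda>a. lin i (p a)"

text \<open>The morphism equation for \<open>G\<close> in arity one, where the minimal
  \<open>N\<close> contributes nothing.\<close>

lemma di: "lin d (i b) = 0"
proof -
  have "cf (cod N) [b] = emb (cf N [b])"
    unfolding cod_def by (subst sandwich) (auto simp: N0 bas_Nil)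
  moreover have "cf (hat G) [b] = emb (cf G [b])"
    by (subst hat_eq[OF G0]) (simp add: cf_mult G0 cf_hat_Nil)
  moreover have "cf (pull (cod N) G) [b] = cf (pull (hat G) M) [b]"
    using G by (simp add: hom_def)
  ultimately show ?thesis by (simp add: N1 lin_emb)
qed

text \<open>Induction on the first letter. Terms with \<open>h\<close> on it and the differential on
  the rest occur twice; terms pairing \<open>e\<close> with \<open>d\<close> vanish because both
  composites are zero. The one-letter formula \<open>htpy\<close> and the induction hypothesis give
  the rest.\<close>

lemma hty_eq: "lin (hty h e) (der d xs) + lin (der d) (hty h e xs) = bas xs + lin (tens i) (tens p xs)"
proof (induction xs)
  case Nil
  show ?case by (simp add: one_vec_def zero_list_def)
next
  case (Cons x xs)
  have e0: "lin e (d x) = 0" "lin d (e x) = 0"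
    using pd[of x] by (simp_all add: lin_lin di flip: lin_lin[of i p])
  have "lin (hty h e) (der d (x # xs)) + lin (der d) (hty h e (x # xs)) =
      emb (lin h (d x) + lin d (h x)) * bas xs +
      emb (e x) * (lin (hty h e) (der d xs) + lin (der d) (hty h e xs))"
    using lin_hty_front[of h e "bas x" "der d xs"]
    by (simp add: lin_hty_front lin_der_mult lin_der_emb e0 distrib_left distrib_right ac_simps)
  also have "\<dots> = bas [x] * bas xs + emb (e x) * lin (tens i) (tens p xs)"
    unfolding htpy Cons by (simp add: distrib_left distrib_right ac_simps)
  finally show ?case by (simp add: lin_tens_mult lin_tens_emb plus_list_def)
qed

lemma tens_der: "lin (tens p) (der d xs) = 0"
  by (induction xs) (simp_all add: lin_tens_mult lin_tens_emb pd)

lemma tens_tens: "lin (tens p) (tens i bs) = bas bs"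
  by (induction bs) (simp_all add: lin_tens_mult lin_tens_emb pi plus_list_def one_vec_def zero_list_def)

text \<open>Moving the square of \<open>cod N\<close> through \<open>G\<close> turns it into the
  square of \<open>cod M\<close>, which is zero. In the lowest arity where the defect of
  \<open>N\<close> could survive, this says that \<open>i\<close> annihilates it, and
  \<open>p\<close> is a left inverse of \<open>i\<close>.\<close>

lemma NN: "pull (cod N) N = 0"
proof (rule ser_eqI)
  let ?E = "pull (cod N) N"
  have DG: "pull (cod N) (hat G) = pull (hat G) (cod M)"
    by (rule hom_cod_hat[OF G N0])
  have "pull (cod N) (pull (cod N) G) = pull (pull (cod N) (hat G)) M"
    using G by (simp add: hom_def pull_pull)
  also have "\<dots> = pull (hat G) (pull (cod M) M)"
    by (simp add: DG pull_pull)
  finally have EG: "pull (cod ?E) G = 0"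
    by (simp add: MM pull_pull pull_cod_cod[OF N0])
  fix bs
  show "cf ?E bs = cf 0 bs"
  proof (induction bs rule: length_induct)
    case (1 bs)
    have "cf (cod ?E) bs = emb (cf ?E bs)"
      unfolding cod_def[of ?E] by (subst sandwich) (use 1 in \<open>auto simp: bas_Nil simp del: cf_pull\<close>)
    then have "lin i (cf ?E bs) = cf (pull (cod ?E) G) bs"
      unfolding fun_cong[OF cf_pull[of "cod ?E" G]] by (simp add: lin_emb del: cf_pull)
    then have "lin i (cf ?E bs) = 0" unfolding EG by simp
    then have "lin p (lin i (cf ?E bs)) = 0" by simp
    then show ?case by (simp add: lin_lin pi del: cf_pull)
  qed
qed

definition Ob :: "('a, 'b vec) ser \<Rightarrow> ('a, 'b vec) ser" where
  "Ob F = pull (cod M) F + pull (hat F) N"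

text \<open>Bianchi identity for the defect: the codifferentials of \<open>M\<close> and
  \<open>N\<close> square to zero, so differentiating \<open>Ob F\<close> leaves only the terms that
  contain \<open>Ob F\<close> itself.\<close>

lemma Ob_cod:
  assumes F: "cf F [] = 0"
  shows "pull (cod M) (Ob F) = pull (hat F * ems (Ob F) * hat F) N"
proof -
  have MM': "pull (cod M) (cod M) = 0"
    by (simp add: pull_cod_cod[OF M0] MM)
  have "hat F * ems (pull (cod M) F) * hat F = hat F * ems (Ob F) * hat F + pull (hat F) (cod N)"
    by (simp add: pull_hat_cod[OF F] Ob_def ems_add distrib_left distrib_right ac_simps)
  then have "pull (cod M) (hat F) = hat F * ems (Ob F) * hat F + pull (hat F) (cod N)"
    using pull_cod_hat[OF M0 F] by simp
  then have "pull (cod M) (pull (hat F) N) = pull (hat F * ems (Ob F) * hat F) N + pull (hat F) (pull (cod N) N)"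
    by (simp add: pull_pull pull_add_left)
  moreover have "pull (cod M) (pull (cod M) F) = 0"
    by (simp only: pull_pull MM' pull_0_left)
  ultimately show ?thesis
    by (simp add: Ob_def[of F] pull_add NN)
qed

text \<open>Pulled back along the genuine morphism \<open>G\<close>, the defect of \<open>F\<close>
  becomes the defect of the composite of \<open>G\<close> and \<open>F\<close> as a map from
  \<open>N\<close> to itself.\<close>

lemma hat_Ob:
  assumes F: "cf F [] = 0"
  shows "pull (hat G) (Ob F) = pull (cod N) (pull (hat G) F) + pull (hat (pull (hat G) F)) N"
  by (simp add: Ob_def pull_add pull_pull hom_cod_hat[OF G N0] pull_hat_hat[OF F G0])

text \<open>The last clause, that the composite with \<open>G\<close> is the identity so far, is a
  normalisation: it forces the next obstruction to vanish on the image of \<open>i\<close>, so that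
  \<open>hty\<close> can bound it.\<close>

definition good_upto :: "nat \<Rightarrow> ('a, 'b vec) ser \<Rightarrow> bool" where
  "good_upto n F \<longleftrightarrow> cf F [] = 0 \<and> (\<forall>xs. hg wb (lw wa xs) (cf F xs)) \<and>
     (\<forall>a. cf F [a] = p a) \<and>
     (\<forall>xs. length xs \<le> n \<longrightarrow> cf (Ob F) xs = 0) \<and>
     (\<forall>bs. length bs \<le> n \<longrightarrow> cf (pull (hat G) F) bs = cf letter bs)"

lemma good_1: "\<exists>F. good_upto 1 F"
proof -
  define F where "F = Ser (\<lambda>xs. if length xs = 1 then p (hd xs) else 0)"
  have F: "cf F xs = (if length xs = 1 then p (hd xs) else 0)" for xs
    by (simp add: F_def)
  have h1: "cf (hat X) [x] = emb (cf X [x])" if "cf X [] = 0" for X :: "('c, 'd vec) ser" and x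
    using that by (subst hat_eq[OF that]) (simp add: cf_mult cf_hat_Nil)
  have c1: "cf (cod M) [x] = emb (d x)" for x
    unfolding cod_def by (subst sandwich) (auto simp: M0 bas_Nil)
  have c0: "cf (cod M) [] = 0" by (simp add: cod_def M0)
  have F0: "cf F [] = 0" by (simp add: F)
  have "cf (Ob F) xs = 0" if "length xs \<le> 1" for xs
    using that by (cases xs) (auto simp: Ob_def h1 c1 c0 F lin_emb pd N1 F0 cf_hat_Nil N0 simp flip: bas_Nil)
  moreover have "cf (pull (hat G) F) bs = cf letter bs" if "length bs \<le> 1" for bs
    using that by (cases bs) (auto simp: h1 F lin_emb pi G0 cf_hat_Nil cf_letter simp flip: bas_Nil)
  moreover have "hg wb (lw wa xs) (cf F xs)" for xs
    using wp by (cases xs) (auto simp: F)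
  ultimately have "good_upto 1 F" by (simp add: good_upto_def F)
  then show ?thesis ..
qed

lemma good_step:
  assumes good: "good_upto n F" and n: "1 \<le> n"
  shows "\<exists>F'. good_upto (Suc n) F' \<and> (\<forall>xs. length xs \<le> n \<longrightarrow> cf F' xs = cf F xs)"
proof -
  have F0: "cf F [] = 0" and Fw: "\<And>xs. hg wb (lw wa xs) (cf F xs)"
    and F1: "\<And>a. cf F [a] = p a"
    and O0: "\<And>xs. length xs \<le> n \<Longrightarrow> cf (Ob F) xs = 0"
    and X1: "\<And>bs. length bs \<le> n \<Longrightarrow> cf (pull (hat G) F) bs = cf letter bs"
    using good by (auto simp: good_upto_def)
  let ?m = "Suc n" and ?O = "Ob F" and ?X = "pull (hat G) F"
  \<comment> \<open>The obstruction is a cocycle. In the first new arity the right side of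
    \<open>Ob_cod\<close> is the unary part of \<open>N\<close> applied to the defect, and this part
    is zero.\<close>
  have O_der: "lin (cf ?O) (der d xs) = 0" if "length xs = ?m" for xs
  proof -
    have "lin (cf ?O) (der d xs) = cf (pull (cod M) ?O) xs"
      using that O0 by (simp add: cod_lead[OF M0])
    also have "\<dots> = lin (cf N) (emb (cf ?O xs))"
      unfolding Ob_cod[OF F0] cf_pull using that O0
      by (subst sandwich) (auto simp: cf_hat_Nil F0)
    finally show ?thesis by (simp add: lin_emb N1)
  qed
  \<comment> \<open>On the image of \<open>i\<close> the obstruction is the defect of the composite
    with \<open>G\<close>. That composite differs from the identity only from the new arity on, and
    in this arity the difference is seen only by the unary part of \<open>N\<close>, which is
    zero.\<close>
  have O_tens: "lin (cf ?O) (tens i bs) = 0" if "length bs = ?m" for bs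
  proof -
    have X0: "cf ?X [] = 0" using X1[of "[]"] by (simp add: cf_letter del: cf_pull)
    have l0: "cf letter [] = 0" by (simp add: cf_letter)
    have "lin (cf ?O) (tens i bs) = cf (pull (hat G) ?O) bs"
      using that O0 by (simp add: hat_lead[OF G0])
    also have "\<dots> = lin (cf ?X) (cf (cod N) bs) + lin (cf N) (cf (hat ?X) bs)"
      unfolding hat_Ob[OF F0] by (simp del: cf_pull) (simp only: cf_pull)
    finally have 1: "lin (cf ?O) (tens i bs) =
      lin (cf ?X) (cf (cod N) bs) + lin (cf N) (cf (hat ?X) bs)" .
    have "lin (cf (?X + letter)) (cf (cod N) bs) = lin (cf (?X + letter)) (der (\<lambda>b. cf N [b]) bs)"
      using that X1 by (intro cod_lead[OF N0]) (simp del: cf_pull)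
    also have "der (\<lambda>b. cf N [b]) bs = 0"
      by (induction bs) (simp_all add: N1)
    finally have 2: "lin (cf ?X) (cf (cod N) bs) = lin (cf letter) (cf (cod N) bs)"
      by (simp add: lin_fun_add add_eq_0_char2 del: cf_pull)
    have 3: "lin (cf letter) (cf (cod N) bs) = cf N bs"
      using arg_cong[OF pull_cod_letter[OF N0], of "\<lambda>f. cf f bs"] by simp
    have "cf (hat ?X) bs = cf (hat letter) bs + emb (cf letter bs + cf ?X bs)"
      using that X1 by (intro hat_perturb[OF l0 X0]) (simp del: cf_pull)
    then have 4: "lin (cf N) (cf (hat ?X) bs) = cf N bs"
      by (simp add: hat_letter lin_emb N1 del: cf_pull)
    show ?thesis by (simp add: 1 2 3 4 del: cf_pull)
  qed
  \<comment> \<open>\<open>hty\<close> bounds the obstruction; \<open>C\<close> adjusts the result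
    so that the composite with \<open>G\<close> stays the identity. It does not disturb the bounding
    because \<open>p\<close> annihilates boundaries.\<close>
  define C where "C bs = cf ?X bs + lin (cf ?O) (lin (hty h e) (tens i bs))" for bs
  define Q where "Q = Ser (\<lambda>xs. if length xs = ?m then lin (cf ?O) (hty h e xs) + lin C (tens p xs) else 0)"
  have Q: "cf Q xs = (if length xs = ?m then lin (cf ?O) (hty h e xs) + lin C (tens p xs) else 0)" for xs
    by (simp add: Q_def)
  let ?F = "F + Q"
  have F'0: "cf ?F [] = 0" by (simp add: F0 Q)
  have Q_der: "lin (cf Q) (der d xs) = cf ?O xs" if "length xs = ?m" for xs
  proof -
    have "lin (cf Q) (der d xs) = lin (\<lambda>ys. lin (cf ?O) (hty h e ys) + lin C (tens p ys)) (der d xs)"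
      using that by (intro lin_cong) (auto simp: Q dest: length_der)
    also have "\<dots> = lin (cf ?O) (lin (hty h e) (der d xs)) + lin C (lin (tens p) (der d xs))"
      by (simp add: lin_fun_add lin_lin)
    also have "lin (hty h e) (der d xs) = bas xs + lin (tens i) (tens p xs) + lin (der d) (hty h e xs)"
      using add_move_char2[OF hty_eq[of xs, symmetric]] by (metis add.commute hty_eq add_self_right)
    also have "lin (cf ?O) (bas xs + lin (tens i) (tens p xs) + lin (der d) (hty h e xs)) =
        cf ?O xs + lin (\<lambda>bs. lin (cf ?O) (tens i bs)) (tens p xs) +
        lin (\<lambda>ys. lin (cf ?O) (der d ys)) (hty h e xs)"
      by (simp add: lin_lin)
    also have "lin (\<lambda>bs. lin (cf ?O) (tens i bs)) (tens p xs) = 0"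
      using that by (intro lin_eq_0 O_tens) (auto dest: length_tens)
    also have "lin (\<lambda>ys. lin (cf ?O) (der d ys)) (hty h e xs) = 0"
      using that by (intro lin_eq_0 O_der) (auto dest: length_hty)
    finally show ?thesis by (simp add: tens_der)
  qed
  have Q_tens: "lin (cf Q) (tens i bs) = cf ?X bs" if "length bs = ?m" for bs
  proof -
    have "lin (cf Q) (tens i bs) = lin (\<lambda>ys. lin (cf ?O) (hty h e ys) + lin C (tens p ys)) (tens i bs)"
      using that by (intro lin_cong) (auto simp: Q dest: length_tens)
    also have "\<dots> = lin (cf ?O) (lin (hty h e) (tens i bs)) + lin C (lin (tens p) (tens i bs))"
      by (simp add: lin_fun_add lin_lin)
    finally show ?thesis
      by (simp add: tens_tens C_def ac_simps del: cf_pull)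
  qed
  have Q_low: "cf Q ys = 0" if "length ys \<le> n" for ys
    using that by (simp add: Q)
  have "cf (Ob ?F) xs = 0" if "length xs \<le> ?m" for xs
  proof -
    have "cf (hat ?F) xs = cf (hat F) xs + emb (cf Q xs)"
      using that Q_low hat_perturb[OF F0 F'0, of xs] by simp
    then have "cf (Ob ?F) xs = cf ?O xs + lin (cf Q) (cf (cod M) xs)"
      by (simp add: Ob_def lin_fun_add lin_emb N1 ac_simps)
    also have "lin (cf Q) (cf (cod M) xs) = lin (cf Q) (der d xs)"
      using that Q_low by (intro cod_lead[OF M0]) simp
    also have "cf ?O xs + lin (cf Q) (der d xs) = 0"
    proof (cases "length xs = ?m")
      case False
      then show ?thesis
        using that O0 Q_low by (auto intro!: lin_eq_0 dest: length_der)
    qed (simp add: Q_der)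
    finally show ?thesis .
  qed
  moreover have "cf (pull (hat G) ?F) bs = cf letter bs" if "length bs \<le> ?m" for bs
  proof -
    have "cf (pull (hat G) ?F) bs = cf ?X bs + lin (cf Q) (cf (hat G) bs)"
      by (simp add: lin_fun_add)
    also have "lin (cf Q) (cf (hat G) bs) = lin (cf Q) (tens i bs)"
      using that Q_low by (intro hat_lead[OF G0]) simp
    also have "cf ?X bs + lin (cf Q) (tens i bs) = cf letter bs"
    proof (cases "length bs = ?m")
      case True
      \<comment> \<open>As \<open>1 \<le> n\<close>, the new arity is at least two, where
        \<open>letter\<close> vanishes.\<close>
      then show ?thesis using n by (simp add: Q_tens cf_letter del: cf_pull)
    next
      case False
      then have "lin (cf Q) (tens i bs) = 0"
        using that Q_low by (auto intro!: lin_eq_0 dest: length_tens)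
      then show ?thesis using that False X1 by (simp del: cf_pull)
    qed
    finally show ?thesis .
  qed
  \<comment> \<open>Weights are kept: the defect raises the weight by \<open>s\<close> and the
    homotopy lowers it by \<open>s\<close>.\<close>
  moreover have "hg wb (lw wa xs) (cf ?F xs)" for xs
  proof -
    have we: "hg wa (wa a) (e a)" for a
      by (rule hg_lin[OF wp]) (use wG[of "[_]"] in \<open>simp, metis\<close>)
    have wO: "hg wb (lw wa xs + s) (cf ?O xs)" for xs
    proof -
      have "hg wb (lw wa xs + s) (lin (cf F) (cf (cod M) xs))"
        by (rule hg_lin[OF hg_cod[OF wM]]) (metis Fw)
      moreover have "hg wb (lw wa xs + s) (lin (cf N) (cf (hat F) xs))"
        by (rule hg_lin[OF hg_hat[OF F0 Fw]]) (metis wN)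
      ultimately show ?thesis by (simp add: Ob_def hg_add)
    qed
    have wX: "hg wb (lw wb bs) (cf ?X bs)" for bs
      unfolding cf_pull by (rule hg_lin[OF hg_hat[OF G0 wG]]) (metis Fw)
    have wH: "hg (lw wa) (lw wa xs - s) (hty h e xs)" for xs
      using hg_hty[of wa "- s" h e] wh we by simp
    have wOH: "hg wb (lw wa xs) (lin (cf ?O) (hty h e xs))" for xs
      by (rule hg_lin[OF wH]) (use wO in \<open>metis diff_add_cancel\<close>)
    have "hg wb (lw wb bs) (C bs)" for bs
      unfolding C_def lin_lin
      by (intro hg_add wX, rule hg_lin[OF hg_tens[of wa wb i]])
         (use wG[of "[_]"] wOH in \<open>auto, metis\<close>)
    then have "hg wb (lw wa xs) (lin C (tens p xs))"
      by (intro hg_lin[OF hg_tens[OF wp]]) metis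
    then show ?thesis by (auto simp: Q intro!: hg_add Fw wOH)
  qed
  ultimately have "good_upto (Suc n) ?F"
    using n by (auto simp: good_upto_def F0 F1 Q)
  then show ?thesis using Q_low by auto
qed

text \<open>Each step leaves the earlier arities unchanged, so the approximations stabilise on every
  word. An equation at a word involves \<open>F\<close> only on words that are no longer, hence the
  diagonal limit satisfies all of them.\<close>

theorem inverse_hom:
  "\<exists>F. hom M N F \<and> (\<forall>a. cf F [a] = p a) \<and> (\<forall>xs. hg wb (lw wa xs) (cf F xs))"
proof -
  have "\<exists>f. \<forall>n. good_upto (Suc n) (f n) \<and>
      (\<forall>xs. length xs \<le> Suc n \<longrightarrow> cf (f (Suc n)) xs = cf (f n) xs)"
    by (rule dependent_nat_choice) (use good_1 good_step in auto)
  then obtain f where f: "\<And>n. good_upto (Suc n) (f n)"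
    and step: "\<And>n xs. length xs \<le> Suc n \<Longrightarrow> cf (f (Suc n)) xs = cf (f n) xs"
    by blast
  have agree: "cf (f n) xs = cf (f m) xs" if "m \<le> n" "length xs \<le> Suc m" for m n xs
    using that by (induction n rule: dec_induct) (auto simp: step)
  define F where "F = Ser (\<lambda>xs. cf (f (length xs)) xs)"
  have F: "cf F xs = cf (f n) xs" if "length xs \<le> Suc n" for xs n
    using that agree[of "length xs" n xs] agree[of n "length xs" xs] by (cases "length xs \<le> n") (auto simp: F_def)
  have F0: "cf F [] = 0" and f0: "\<And>n. cf (f n) [] = 0"
    using f F[of "[]" 0] by (auto simp: good_upto_def)
  have "cf (Ob F) xs = 0" for xs
  proof -
    let ?g = "f (length xs)"
    have "cf (hat F) xs = cf (hat ?g) xs"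
      by (rule hat_cong) (auto simp: F0 f0 F)
    moreover have "lin (cf (F + ?g)) (cf (cod M) xs) = lin (cf (F + ?g)) (der d xs)"
      by (rule cod_lead[OF M0]) (simp add: F[of _ "length xs"])
    moreover have "lin (cf (F + ?g)) (der d xs) = 0"
      by (rule lin_eq_0) (auto dest!: length_der simp: F[of _ "length xs"])
    ultimately have "cf (Ob F) xs = cf (Ob ?g) xs"
      by (simp add: Ob_def lin_fun_add add_eq_0_char2)
    then show ?thesis using f[of "length xs"] by (simp add: good_upto_def)
  qed
  then have "Ob F = 0" by (intro ser_eqI) simp
  then have "hom M N F" by (simp add: hom_def F0 Ob_def add_eq_0_char2)
  moreover have "cf F [a] = p a" for a
    using F[of "[a]" 0] f[of 0] by (simp add: good_upto_def)
  moreover have "hg wb (lw wa xs) (cf F xs)" for xs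
    using F[of xs "length xs"] f[of "length xs"] by (simp add: good_upto_def)
  ultimately show ?thesis by blast
qed

end

section \<open>Translation between set-valued structure maps and series\<close>

definition vs :: "('a list \<Rightarrow> 'b set) \<Rightarrow> ('a, 'b vec) ser" where
  "vs g = Ser (\<lambda>xs. Vec (g xs))"

definition sf :: "('a, 'b vec) ser \<Rightarrow> 'a list \<Rightarrow> 'b set" where
  "sf F = (\<lambda>xs. supp (cf F xs))"

lemma cf_vs [simp]: "cf (vs g) = (\<lambda>xs. Vec (g xs))"
  by (simp add: vs_def)

lemma Vec_supp [simp]: "Vec (supp v) = v"
  by (rule supp_inverse)

lemma Vec_empty [simp]: "Vec {} = 0"
  by (simp add: zero_vec_def)

lemma Vec_singleton [simp]: "Vec {a} = bas a"
  by (simp add: bas_def)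

lemma Vec_inject_finite: "finite A \<Longrightarrow> finite B \<Longrightarrow> Vec A = Vec B \<longleftrightarrow> A = B"
  by (metis supp_Vec)

lemma Vec_eq_0: "finite A \<Longrightarrow> Vec A = 0 \<longleftrightarrow> A = {}"
  by (metis Vec_empty Vec_inject_finite finite.emptyI)

lemma lin_Vec: "finite A \<Longrightarrow> lin f (Vec A) = sum f A"
  by (simp add: lin_def)

lemma Vec_vsum:
  assumes "finite A" "\<And>a. a \<in> A \<Longrightarrow> finite (f a)"
  shows "Vec (vsum f A) = lin (\<lambda>a. Vec (f a)) (Vec A)" "finite (vsum f A)"
  using Vec_odd[OF assms] assms(1) by (simp_all add: vsum_def lin_def)

text \<open>Choosing one basis element from each factor enumerates the monomials in the expansion of
  a tensor product of vectors.\<close>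

lemma sum_list_all2:
  fixes f :: "'a list \<Rightarrow> 'm::char2"
  assumes "\<forall>V \<in> set Vs. finite V"
  shows "finite {as. list_all2 (\<lambda>a V. a \<in> V) as Vs} \<and>
    (\<Sum>as | list_all2 (\<lambda>a V. a \<in> V) as Vs. f as) = lin f (prod_list (map (\<lambda>V. emb (Vec V)) Vs))"
  using assms
proof (induction Vs arbitrary: f)
  case (Cons V Vs)
  let ?A = "{as. list_all2 (\<lambda>a V. a \<in> V) as Vs}"
  have eq: "{as. list_all2 (\<lambda>a V. a \<in> V) as (V # Vs)} = (\<lambda>(a, as). a # as) ` (V \<times> ?A)"
    by (auto simp: list_all2_Cons2 image_iff)
  have "(\<Sum>as | list_all2 (\<lambda>a V. a \<in> V) as (V # Vs). f as) = (\<Sum>a\<in>V. \<Sum>as\<in>?A. f (a # as))"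
    unfolding eq by (subst sum.reindex) (auto simp: inj_on_def sum.cartesian_product intro!: sum.cong)
  moreover have "finite ?A" using Cons by auto
  moreover have "(\<Sum>as\<in>?A. f (a # as)) = lin (\<lambda>w. f (a # w)) (prod_list (map (\<lambda>V. emb (Vec V)) Vs))" for a
    using Cons by auto
  ultimately show ?case
    using Cons.prems by (auto simp: eq lin_front) (simp add: lin_def[of _ "Vec V"])
qed (simp flip: bas_Nil)

lemma Vec_mext:
  assumes "\<forall>V \<in> set Vs. finite V" "\<And>as. finite (g as)"
  shows "Vec (mext g Vs) = lin (\<lambda>as. Vec (g as)) (prod_list (map (\<lambda>V. emb (Vec V)) Vs))"
    and "finite (mext g Vs)"
proof -
  let ?A = "{as. list_all2 (\<lambda>a V. a \<in> V) as Vs}"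
  have "finite ?A" and s: "(\<Sum>as\<in>?A. Vec (g as)) = lin (\<lambda>as. Vec (g as)) (prod_list (map (\<lambda>V. emb (Vec V)) Vs))"
    using sum_list_all2[OF assms(1)] by auto
  from Vec_odd[OF this(1), of g] assms(2) s
  show "Vec (mext g Vs) = lin (\<lambda>as. Vec (g as)) (prod_list (map (\<lambda>V. emb (Vec V)) Vs))"
    and "finite (mext g Vs)"
    by (simp_all add: mext_def)
qed

lemma prod_list_singletons: "prod_list (map (\<lambda>V. emb (Vec V)) (map (\<lambda>a. {a}) us)) = bas us"
  by (induction us) (simp_all add: plus_list_def bas_Nil)

lemma finite_pairs: "finite {(i, j). 1 \<le> j \<and> i + j \<le> (n :: nat)}"
  by (rule finite_subset[of _ "{..n} \<times> {..n}"]) auto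

lemma Vec_hom_lhs:
  assumes fin: "\<And>xs. finite (muA xs)" "\<And>xs. finite (f xs)" and mu: "muA [] = {}"
  shows "Vec (hom_lhs muA f as) = cf (pull (cod (vs muA)) (vs f)) as"
    and "finite (hom_lhs muA f as)"
proof -
  let ?t = "\<lambda>i j. mext f (map (\<lambda>a. {a}) (take i as) @ [muA (take j (drop i as))] @ map (\<lambda>a. {a}) (drop (i + j) as))"
  let ?I = "{(i, j). 1 \<le> j \<and> i + j \<le> length as}"
  let ?b = "\<lambda>i j. bas (take i as) * (emb (Vec (muA (take j (drop i as)))) * bas (drop j (drop i as)))"
  have ft: "finite (?t i j)" for i j
    by (rule Vec_mext) (auto simp: fin)
  have eq: "Vec (?t i j) = lin (\<lambda>as. Vec (f as)) (?b i j)" for i j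
    by (subst Vec_mext) (auto simp: fin prod_list_singletons add.commute simp del: map_map)
  have "Vec (hom_lhs muA f as) = lin (\<lambda>(i, j). Vec (?t i j)) (Vec ?I)" and 2: "finite (hom_lhs muA f as)"
    unfolding hom_lhs_def by (subst Vec_vsum; use ft finite_pairs in \<open>auto intro!: lin_cong\<close>)
      (rule Vec_vsum; use ft finite_pairs in auto)
  then have "Vec (hom_lhs muA f as) = (\<Sum>(i, j)\<in>?I. Vec (?t i j))"
    using lin_Vec[OF finite_pairs[of "length as"]] by simp
  also have "\<dots> = (\<Sum>(i, j)\<in>?I. lin (\<lambda>as. Vec (f as)) (?b i j))"
    by (simp only: eq)
  \<comment> \<open>The empty blocks included here, absent from \<open>hom_lhs\<close>, contribute
    zero because \<open>muA []\<close> is empty.\<close>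
  also have "\<dots> = (\<Sum>(i, j)\<in>(SIGMA i:{..length as}. {..length as - i}). lin (\<lambda>as. Vec (f as)) (?b i j))"
    by (rule sum.mono_neutral_left) (auto simp: mu Suc_le_eq intro!: gr0I)
  also have "\<dots> = cf (pull (cod (vs muA)) (vs f)) as"
    by (simp add: cod_def mult.assoc cf_mult sum_distrib_left lin_sum sum.Sigma split_def)
  finally show "Vec (hom_lhs muA f as) = cf (pull (cod (vs muA)) (vs f)) as" .
  show "finite (hom_lhs muA f as)" by (fact 2)
qed

lemma compositions_0: "compositions 0 = {[]}"
proof -
  have "cs \<in> compositions 0 \<longleftrightarrow> cs = []" for cs
    by (cases cs) (auto simp: compositions_def)
  then show ?thesis by blast
qed

lemma compositions_Suc:
  "compositions (Suc n) = (\<lambda>(i, cs). Suc i # cs) ` (SIGMA i:{..n}. compositions (n - i))"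
proof (intro equalityI subsetI)
  fix cs assume "cs \<in> compositions (Suc n)"
  then obtain c cs' where "cs = c # cs'" "0 < c" "c + sum_list cs' = Suc n" "\<forall>c\<in>set cs'. 0 < c"
    by (cases cs) (auto simp: compositions_def)
  then show "cs \<in> (\<lambda>(i, cs). Suc i # cs) ` (SIGMA i:{..n}. compositions (n - i))"
    by (intro image_eqI[of _ _ "(c - 1, cs')"]) (auto simp: compositions_def)
qed (auto simp: compositions_def)

lemma finite_compositions: "finite (compositions n)"
proof (induction n rule: less_induct)
  case (less n)
  then show ?case
    by (cases n) (auto simp: compositions_0 compositions_Suc)
qed

text \<open>Both sides are expanded along the first block. Parts of a composition are positive,
  which matches \<open>cf F [] = 0\<close>.\<close>

lemma hat_compositions:
  assumes F: "cf F [] = 0"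
  shows "cf (hat F) as = (\<Sum>cs\<in>compositions (length as). prod_list (map (\<lambda>xs. emb (cf F xs)) (blocks cs as)))"
proof (induction as rule: length_induct)
  case (1 as)
  show ?case
  proof (cases as)
    case (Cons x xs)
    let ?p = "\<lambda>cs as. prod_list (map (\<lambda>xs. emb (cf F xs)) (blocks cs as))"
    have "cf (hat F) as = (\<Sum>i\<le>length xs. emb (cf F (take (Suc i) as)) * cf (hat F) (drop (Suc i) as))"
      by (subst hat_eq[OF F]) (simp add: cf_mult Cons sum.atMost_Suc_shift F del: sum.atMost_Suc)
    also have "\<dots> = (\<Sum>i\<le>length xs. \<Sum>cs\<in>compositions (length xs - i). ?p (Suc i # cs) as)"
      using 1 by (intro sum.cong refl) (auto simp: Cons sum_distrib_left)
    also have "\<dots> = (\<Sum>cs\<in>compositions (length as). ?p cs as)"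
      by (simp add: Cons compositions_Suc sum.reindex inj_on_def sum.Sigma finite_compositions
          split_def del: blocks.simps)
    finally show ?thesis .
  qed (simp add: cf_hat_Nil F compositions_0)
qed

lemma Vec_hom_rhs:
  assumes fin: "\<And>xs. finite (muB xs)" "\<And>xs. finite (f xs)" and f: "f [] = {}"
  shows "Vec (hom_rhs muB f as) = cf (pull (hat (vs f)) (vs muB)) as"
    and "finite (hom_rhs muB f as)"
proof -
  let ?t = "\<lambda>cs. mext muB (map f (blocks cs as))"
  have ft: "finite (?t cs)" for cs
    by (rule Vec_mext) (auto simp: fin)
  have eq: "Vec (?t cs) = lin (\<lambda>as. Vec (muB as)) (prod_list (map (\<lambda>xs. emb (Vec (f xs))) (blocks cs as)))" for cs
    by (subst Vec_mext) (auto simp: fin o_def)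
  show "finite (hom_rhs muB f as)"
    unfolding hom_rhs_def by (rule Vec_vsum) (auto simp: ft finite_compositions)
  have "Vec (hom_rhs muB f as) = (\<Sum>cs\<in>compositions (length as). Vec (?t cs))"
    unfolding hom_rhs_def by (subst Vec_vsum) (auto simp: ft finite_compositions lin_def)
  then show "Vec (hom_rhs muB f as) = cf (pull (hat (vs f)) (vs muB)) as"
    using f by (simp add: eq hat_compositions lin_sum)
qed

lemma ainf_hom_iff:
  assumes "\<And>xs. finite (muA xs)" "muA [] = {}" "\<And>xs. finite (muB xs)" "muB [] = {}"
    and "\<And>xs. finite (f xs)" "f [] = {}"
  shows "ainf_hom muA muB f \<longleftrightarrow> hom (vs muA) (vs muB) (vs f)"
proof -
  have "hom_lhs muA f as = hom_rhs muB f as \<longleftrightarrow>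
     cf (pull (cod (vs muA)) (vs f)) as = cf (pull (hat (vs f)) (vs muB)) as" for as
    using Vec_hom_lhs[of muA f as] Vec_hom_rhs[of muB f as] assms
    by (metis Vec_inject_finite)
  moreover have "cf (pull (cod (vs muA)) (vs f)) [] = cf (pull (hat (vs f)) (vs muB)) []"
    by (simp add: cod_def assms cf_hat_Nil flip: bas_Nil)
  ultimately have "(\<forall>as. as \<noteq> [] \<longrightarrow> hom_lhs muA f as = hom_rhs muB f as) \<longleftrightarrow>
     pull (cod (vs muA)) (vs f) = pull (hat (vs f)) (vs muB)"
    by (metis ser_eqI)
  then show ?thesis
    using assms by (simp add: ainf_hom_def hom_def)
qed

lemma vs_sf [simp]: "vs (sf F) = F"
  by (rule ser_eqI) (simp add: sf_def)

lemma finite_sf [simp]: "finite (sf F xs)"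
  by (simp add: sf_def)

lemma Vec_vadd: "finite V \<Longrightarrow> finite W \<Longrightarrow> Vec (vadd V W) = Vec V + Vec W"
  by (simp add: vadd_def plus_vec_def)

lemma cycles_iff:
  assumes "\<And>xs. finite (mu xs)"
  shows "Z \<in> cycles mu \<longleftrightarrow> finite Z \<and> lin (\<lambda>a. cf (vs mu) [a]) (Vec Z) = 0"
proof (cases "finite Z")
  case True
  then have "Vec (dlin mu Z) = lin (\<lambda>a. cf (vs mu) [a]) (Vec Z)" "finite (dlin mu Z)"
    using Vec_vsum[of Z "\<lambda>a. mu [a]"] assms by (simp_all add: dlin_def)
  then show ?thesis using True Vec_eq_0[of "dlin mu Z"] by (simp add: cycles_def)
qed (simp add: cycles_def)

lemma boundaries_iff:
  assumes "\<And>xs. finite (mu xs)"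
  shows "Z \<in> boundaries mu \<longleftrightarrow> finite Z \<and> (\<exists>v. Vec Z = lin (\<lambda>a. cf (vs mu) [a]) v)"
proof
  assume "Z \<in> boundaries mu"
  then obtain W where "finite W" "Z = vsum (\<lambda>a. mu [a]) W"
    by (auto simp: boundaries_def dlin_def)
  then have "Vec Z = lin (\<lambda>a. cf (vs mu) [a]) (Vec W)" "finite Z"
    using Vec_vsum[of W "\<lambda>a. mu [a]"] assms by simp_all
  then show "finite Z \<and> (\<exists>v. Vec Z = lin (\<lambda>a. cf (vs mu) [a]) v)" by blast
next
  assume "finite Z \<and> (\<exists>v. Vec Z = lin (\<lambda>a. cf (vs mu) [a]) v)"
  then obtain v where "finite Z" "Vec Z = Vec (dlin mu (supp v))" "finite (dlin mu (supp v))"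
    using Vec_vsum[of "supp v" "\<lambda>a. mu [a]" for v] assms by (auto simp: dlin_def)
  then have "Z = dlin mu (supp v)" by (metis Vec_inject_finite)
  then show "Z \<in> boundaries mu" by (auto simp: boundaries_def)
qed

context contraction
begin

lemma hty': "lin h (lin d v) + lin d (lin h v) = v + lin i (lin p v)"
proof -
  have "lin (\<lambda>a. lin h (d a) + lin d (h a)) v = lin (\<lambda>a. bas a + e a) v"
    by (simp only: htpy)
  then show ?thesis by (simp add: lin_fun_add lin_lin)
qed

text \<open>Boundaries of the minimal \<open>N\<close> are zero. A cycle killed by \<open>p\<close>
  is the boundary of its homotopy, and every vector on the side of \<open>N\<close> is hit through
  \<open>i\<close>.\<close>

lemma quasi_iso_p:
  assumes muA: "M = vs muA" "\<And>xs. finite (muA xs)" and muB: "N = vs muB" "\<And>xs. finite (muB xs)"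
    and F: "\<And>a. cf F [a] = p a"
  shows "quasi_iso muA muB (sf F)"
proof -
  have V: "Vec (vsum (\<lambda>a. sf F [a]) Z) = lin p (Vec Z)" "finite (vsum (\<lambda>a. sf F [a]) Z)" if "finite Z" for Z
    using Vec_vsum[of Z "\<lambda>a. sf F [a]"] that F by (auto simp: sf_def)
  have "Z \<in> boundaries muA"
    if "Z \<in> cycles muA" "vsum (\<lambda>a. sf F [a]) Z \<in> boundaries muB" for Z
  proof -
    have "finite Z" "lin d (Vec Z) = 0" using that(1) muA cycles_iff[of muA] by auto
    moreover have "lin p (Vec Z) = 0"
      using that(2) V[OF \<open>finite Z\<close>] N1 muB by (auto simp: boundaries_iff)
    ultimately have "Vec Z = lin d (lin h (Vec Z))" using hty'[of "Vec Z"] by simp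
    then show ?thesis using \<open>finite Z\<close> muA by (auto simp: boundaries_iff)
  qed
  moreover have "\<exists>Z\<in>cycles muA. vadd (vsum (\<lambda>a. sf F [a]) Z) W \<in> boundaries muB"
    if "W \<in> cycles muB" for W
  proof -
    have W: "finite W" using that by (simp add: cycles_def)
    let ?Z = "supp (lin i (Vec W))"
    have "lin d (lin i (Vec W)) = 0" by (simp add: lin_lin di)
    then have "?Z \<in> cycles muA" using muA by (simp add: cycles_iff)
    moreover have "Vec (vadd (vsum (\<lambda>a. sf F [a]) ?Z) W) = 0" "finite (vadd (vsum (\<lambda>a. sf F [a]) ?Z) W)"
      using V[of ?Z] W by (simp_all add: Vec_vadd lin_lin pi) (simp add: vadd_def)
    then have "vadd (vsum (\<lambda>a. sf F [a]) ?Z) W \<in> boundaries muB"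
      using muB by (auto simp: boundaries_iff intro!: exI[of _ 0])
    ultimately show ?thesis by blast
  qed
  ultimately show ?thesis by (auto simp: quasi_iso_def)
qed

text \<open>Injectivity in homology: \<open>p\<close> is a left inverse of \<open>i\<close> and
  annihilates boundaries. Surjectivity: a cycle differs from its image under \<open>i\<close> after
  \<open>p\<close> by the boundary of its homotopy.\<close>

lemma quasi_iso_i:
  assumes muA: "M = vs muA" "\<And>xs. finite (muA xs)" and muB: "N = vs muB" "\<And>xs. finite (muB xs)"
  shows "quasi_iso muB muA (sf G)"
proof -
  have V: "Vec (vsum (\<lambda>a. sf G [a]) Z) = lin i (Vec Z)" "finite (vsum (\<lambda>a. sf G [a]) Z)" if "finite Z" for Z
    using Vec_vsum[of Z "\<lambda>a. sf G [a]"] that by (auto simp: sf_def)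
  have "Z \<in> boundaries muB"
    if Zc: "Z \<in> cycles muB" "vsum (\<lambda>a. sf G [a]) Z \<in> boundaries muA" for Z
  proof -
    have Z: "finite Z" using Zc by (simp add: cycles_def)
    then obtain v where "lin i (Vec Z) = lin d v"
      using Zc(2) V[OF Z] muA by (auto simp: boundaries_iff)
    then have "lin p (lin i (Vec Z)) = lin p (lin d v)" by simp
    then have "Vec Z = 0" by (simp add: lin_lin pi pd)
    then show ?thesis using Z muB by (auto simp: boundaries_iff intro!: exI[of _ 0])
  qed
  moreover have "\<exists>Z\<in>cycles muB. vadd (vsum (\<lambda>a. sf G [a]) Z) W \<in> boundaries muA"
    if "W \<in> cycles muA" for W
  proof -
    have W: "finite W" "lin d (Vec W) = 0" using that muA cycles_iff[of muA] by auto
    let ?Z = "supp (lin p (Vec W))"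
    have "?Z \<in> cycles muB" using muB N1 by (simp add: cycles_iff)
    moreover have "Vec (vadd (vsum (\<lambda>a. sf G [a]) ?Z) W) = lin d (lin h (Vec W))"
        "finite (vadd (vsum (\<lambda>a. sf G [a]) ?Z) W)"
      using V[of ?Z] W hty'[of "Vec W"] by (simp_all add: Vec_vadd ac_simps) (simp add: vadd_def)
    then have "vadd (vsum (\<lambda>a. sf G [a]) ?Z) W \<in> boundaries muA"
      using muA by (auto simp: boundaries_iff)
    ultimately show ?thesis by blast
  qed
  ultimately show ?thesis by (auto simp: quasi_iso_def)
qed

end

subsection \<open>Square matrices\<close>

text \<open>Used with two sizes: four by four over polynomials for the endomorphism algebra, and two
  by two over that algebra for series indexed by letters.\<close>

typedef ('n, 'r) sqmat = "UNIV :: ('n \<Rightarrow> 'n \<Rightarrow> 'r) set"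
  morphisms ent Mat by auto

lemma ent_Mat [simp]: "ent (Mat f) = f"
  by (simp add: Mat_inverse)

lemma sqmat_eqI: "(\<And>i j. ent M i j = ent N i j) \<Longrightarrow> M = N"
  by (metis ent_inject ext)

instantiation sqmat :: (type, char2) char2
begin

definition "0 = Mat (\<lambda>_ _. 0)"
definition "M + N = Mat (\<lambda>i j. ent M i j + ent N i j)"
definition "- M = (M :: ('a, 'b) sqmat)"
definition "M - N = (M :: ('a, 'b) sqmat) + N"

lemma ent_0 [simp]: "ent 0 = (\<lambda>i j. 0)"
  and ent_add [simp]: "ent (M + N) = (\<lambda>i j. ent M i j + ent N i j)"
  by (simp_all add: zero_sqmat_def plus_sqmat_def)

instance
  by standard (auto intro!: sqmat_eqI simp: uminus_sqmat_def minus_sqmat_def ac_simps)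

end

lemma ent_sum: "ent (\<Sum>x\<in>A. f x) i j = (\<Sum>x\<in>A. ent (f x) i j)"
  by (induction A rule: infinite_finite_induct) auto

instantiation sqmat :: (finite, f2ring) f2ring
begin

definition "1 = Mat (\<lambda>i j. if i = j then 1 else 0)"
definition "M * N = Mat (\<lambda>i k. \<Sum>j\<in>UNIV. ent M i j * ent N j k)"

lemma ent_1: "ent 1 i j = (if i = j then 1 else 0)"
  and ent_mult: "ent (M * N) i k = (\<Sum>j\<in>UNIV. ent M i j * ent N j k)"
  by (simp_all add: one_sqmat_def times_sqmat_def)

instance
proof
  fix a b c :: "('a, 'b) sqmat"
  show "(a + b) * c = a * c + b * c" "a * (b + c) = a * b + a * c"
    by (auto intro!: sqmat_eqI simp: ent_mult algebra_simps sum.distrib)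
  show "1 * a = a" "a * 1 = a"
    by (auto intro!: sqmat_eqI simp: ent_mult ent_1 if_distrib[of "\<lambda>x. x * _"] if_distrib[of "\<lambda>x. _ * x"] cong: if_cong)
  show "a * b * c = a * (b * c)"
  proof (rule sqmat_eqI)
    fix i l
    have "ent (a * b * c) i l = (\<Sum>k\<in>UNIV. \<Sum>j\<in>UNIV. ent a i j * ent b j k * ent c k l)"
      by (simp add: ent_mult sum_distrib_right)
    also have "\<dots> = (\<Sum>j\<in>UNIV. \<Sum>k\<in>UNIV. ent a i j * ent b j k * ent c k l)"
      by (rule sum.swap)
    also have "\<dots> = ent (a * (b * c)) i l"
      by (simp add: ent_mult sum_distrib_left mult.assoc)
    finally show "ent (a * b * c) i l = ent (a * (b * c)) i l" .
  qed
qed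

end

definition mu :: "'n \<Rightarrow> 'n \<Rightarrow> 'r::char2 \<Rightarrow> ('n, 'r) sqmat" where
  "mu i j r = Mat (\<lambda>i' j'. if i' = i \<and> j' = j then r else 0)"

lemma ent_mu: "ent (mu i j r) i' j' = (if i' = i \<and> j' = j then r else 0)"
  by (simp add: mu_def)

lemma mu_mult: "mu i j r * mu k l s = (if j = k then mu i l (r * s) else 0)"
  by (auto intro!: sqmat_eqI simp: ent_mult ent_mu if_distrib[of "\<lambda>x. x * _"] if_distrib[of "\<lambda>x. _ * x"]
      if_bool_eq_conj cong: if_cong)

lemma mu_add: "mu i j (r + s) = mu i j r + mu i j s"
  and mu_0 [simp]: "mu i j 0 = 0"
  by (auto intro!: sqmat_eqI simp: ent_mu)

subsection \<open>Disk words\<close>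

datatype lt = LD | LS

fun ol :: "lt \<Rightarrow> lt" where
  "ol LD = LS"
| "ol LS = LD"

lemma ol_ol [simp]: "ol (ol z) = z"
  and ol_neq [simp]: "ol z \<noteq> z" "z \<noteq> ol z"
  by (cases z; simp)+

lemma neq_iff_ol: "x \<noteq> y \<longleftrightarrow> x = ol y"
  by (cases x; cases y) auto

lemma UNIV_lt: "UNIV = {LD, LS}"
  by (auto intro: lt.exhaust)

instance lt :: finite
  by standard (simp add: UNIV_lt)

datatype tr = Lf | Nd tr tr tr

text \<open>The three subtrees fill the gaps of the shortest disk word z, ol z, z, ol z. A gap after
  a letter holds a word that starts with this letter and ends with the other one, so the bordering
  letters only lengthen runs, as in the replacement rules.\<close>

fun tw :: "lt \<Rightarrow> tr \<Rightarrow> lt list" where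
  "tw z Lf = []"
| "tw z (Nd s t u) = z # tw z s @ ol z # tw (ol z) t @ z # tw z u @ [ol z]"

text \<open>Parsing with one letter of lookahead: in a gap after \<open>z\<close>, the letter
  \<open>z\<close> opens a node and \<open>ol z\<close> closes the gap.\<close>

lemma tw_unique: "tw z s @ ol z # xs = tw z t @ ol z # ys \<Longrightarrow> s = t \<and> xs = ys"
proof (induction s arbitrary: z t xs ys)
  case Lf
  then show ?case by (cases t) auto
next
  case (Nd s1 s2 s3)
  show ?case
  proof (cases t)
    case Lf
    then show ?thesis using Nd.prems by simp
  next
    case (Nd t1 t2 t3)
    note eq = Nd.prems[unfolded Nd, simplified]
    from Nd.IH(1)[OF eq] have 1: "s1 = t1" and
      eq2: "tw (ol z) s2 @ z # tw z s3 @ ol z # ol z # xs = tw (ol z) t2 @ z # tw z t3 @ ol z # ol z # ys"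
      by auto
    from Nd.IH(2)[of "ol z", simplified, OF eq2] have 2: "s2 = t2" and
      eq3: "tw z s3 @ ol z # ol z # xs = tw z t3 @ ol z # ol z # ys"
      by auto
    from Nd.IH(3)[OF eq3] 1 2 Nd show ?thesis by auto
  qed
qed

lemma hd_tw: "t \<noteq> Lf \<Longrightarrow> tw z t \<noteq> [] \<and> hd (tw z t) = z \<and> last (tw z t) = ol z"
  by (cases t) auto

definition isT :: "lt \<Rightarrow> lt list \<Rightarrow> bool" where
  "isT z w \<longleftrightarrow> (\<exists>t. t \<noteq> Lf \<and> w = tw z t)"

lemma isT_hd: "isT z w \<Longrightarrow> w \<noteq> [] \<and> hd w = z \<and> last w = ol z"
  using hd_tw by (auto simp: isT_def)

subsection \<open>Indicator series\<close>

definition ind :: "'a list set \<Rightarrow> ('a, 'r::f2ring) ser" where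
  "ind S = Ser (\<lambda>w. if w \<in> S then 1 else 0)"

definition const :: "'r::f2ring \<Rightarrow> ('a, 'r) ser" where
  "const r = Ser (\<lambda>w. if w = [] then r else 0)"

lemma cf_ind: "cf (ind S) w = (if w \<in> S then 1 else 0)"
  and cf_const: "cf (const r) w = (if w = [] then r else 0)"
  by (simp_all add: ind_def const_def)

lemma cf_const_mult [simp]: "cf (const r * f) w = r * cf f w"
proof -
  have "cf (const r * f) w = (\<Sum>i\<le>length w. if i = 0 then r * cf f w else 0)"
    unfolding cf_mult by (intro sum.cong) (auto simp: cf_const)
  then show ?thesis by simp
qed

lemma cf_mult_const [simp]: "cf (f * const r) w = cf f w * r"
proof -
  have "cf (f * const r) w = (\<Sum>i\<le>length w. if i = length w then cf f w * r else 0)"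
    unfolding cf_mult by (intro sum.cong) (auto simp: cf_const)
  then show ?thesis by simp
qed

lemma const_mult: "const r * const s = const (r * s)"
  and const_add: "const (r + s) = const r + const s"
  and const_0 [simp]: "const 0 = 0"
  and const_1 [simp]: "const 1 = 1"
  by (auto intro!: ser_eqI simp: cf_const cf_1)

lemma const_ind: "const r * ind S = ind S * const r"
  by (rule ser_eqI) (simp add: cf_ind)

text \<open>A product of indicator series counts factorisations modulo two. If each word has at most
  one factorisation, this count is membership.\<close>

lemma ind_mult:
  assumes "\<And>u v u' v'. u \<in> S \<Longrightarrow> v \<in> S' \<Longrightarrow> u' \<in> S \<Longrightarrow> v' \<in> S' \<Longrightarrow> u @ v = u' @ v' \<Longrightarrow> u = u'"
  shows "ind S * ind S' = ind ((\<lambda>(u, v). u @ v) ` (S \<times> S'))"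
proof (rule ser_eqI)
  fix w
  have *: "cf (ind S * ind S') w = (\<Sum>i\<le>length w. if take i w \<in> S \<and> drop i w \<in> S' then 1 else 0)"
    unfolding cf_mult by (intro sum.cong) (auto simp: cf_ind)
  show "cf (ind S * ind S') w = cf (ind ((\<lambda>(u, v). u @ v) ` (S \<times> S'))) w"
  proof (cases "w \<in> (\<lambda>(u, v). u @ v) ` (S \<times> S')")
    case True
    then obtain u v where uv: "u \<in> S" "v \<in> S'" "w = u @ v" by auto
    have "(take i w \<in> S \<and> drop i w \<in> S') \<longleftrightarrow> i = length u" if "i \<le> length w" for i
    proof
      assume "take i w \<in> S \<and> drop i w \<in> S'"
      moreover have "take i w @ drop i w = u @ v"
        by (simp only: append_take_drop_id uv(3))
      ultimately have "take i w = u" using assms uv(1,2) by blast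
      then show "i = length u" using that by (metis length_take min.absorb2)
    qed (use uv in auto)
    then have "cf (ind S * ind S') w = (\<Sum>i\<le>length w. if i = length u then 1 else 0)"
      unfolding * by (intro sum.cong) auto
    then show ?thesis using True uv by (simp add: cf_ind)
  next
    case False
    then have "\<not> (take i w \<in> S \<and> drop i w \<in> S')" for i
      by (metis (mono_tags, lifting) append_take_drop_id case_prod_conv image_eqI mem_Sigma_iff)
    then have "cf (ind S * ind S') w = 0"
      unfolding * by (intro sum.neutral) auto
    then show ?thesis using False by (simp add: cf_ind)
  qed
qed

text \<open>\<open>X\<close> is a single letter, \<open>P\<close> the possible fillings of a gap
  (the empty one included), \<open>T\<close> the disk words beginning with \<open>z\<close>.\<close>

definition X :: "lt \<Rightarrow> (lt, 'r::f2ring) ser" where "X z = ind {[z]}"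
definition P :: "lt \<Rightarrow> (lt, 'r::f2ring) ser" where "P z = ind (range (tw z))"
definition T :: "lt \<Rightarrow> (lt, 'r::f2ring) ser" where "T z = ind {w. isT z w}"

lemma cf_T: "cf (T z) w = (if isT z w then 1 else 0)"
  by (simp add: T_def cf_ind)

lemma P_eq: "P z = 1 + T z"
proof (rule ser_eqI)
  fix w :: "lt list"
  have "w \<in> range (tw z) \<longleftrightarrow> w = [] \<or> isT z w"
  proof
    assume "w \<in> range (tw z)"
    then obtain t where "w = tw z t" by blast
    then show "w = [] \<or> isT z w" by (cases "t = Lf") (auto simp: isT_def)
  next
    assume "w = [] \<or> isT z w"
    then show "w \<in> range (tw z)"
      using rangeI[of "tw z" Lf] by (auto simp: isT_def)
  qed
  then show "cf (P z) w = cf (1 + T z) w"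
    using isT_hd[of z w] by (auto simp: P_def T_def cf_ind cf_1)
qed

lemma X_mult: "X z * ind S = ind ((\<lambda>w. z # w) ` S)"
proof -
  have "X z * ind S = ind ((\<lambda>(u, v). u @ v) ` ({[z]} \<times> S))"
    unfolding X_def by (rule ind_mult) simp
  also have "(\<lambda>(u, v). u @ v) ` ({[z]} \<times> S) = (\<lambda>w. z # w) ` S"
    by (auto simp: image_iff)
  finally show ?thesis .
qed

lemma P_mult:
  assumes "\<And>w. w \<in> S \<Longrightarrow> w \<noteq> [] \<and> hd w = ol z"
  shows "P z * ind S = ind ((\<lambda>(t, w). tw z t @ w) ` (UNIV \<times> S))"
proof -
  have "u = u'" if uv: "u \<in> range (tw z)" "v \<in> S" "u' \<in> range (tw z)" "v' \<in> S" "u @ v = u' @ v'"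
    for u v u' v'
  proof -
    obtain w w' where "v = ol z # w" "v' = ol z # w'"
      using assms[OF uv(2)] assms[OF uv(4)] by (cases v; cases v') auto
    moreover obtain s t where "u = tw z s" "u' = tw z t" using uv by blast
    ultimately show ?thesis using uv(5) tw_unique[of z s w t w'] by simp
  qed
  then have "P z * ind S = ind ((\<lambda>(u, v). u @ v) ` (range (tw z) \<times> S))"
    unfolding P_def by (rule ind_mult)
  also have "(\<lambda>(u, v). u @ v) ` (range (tw z) \<times> S) = (\<lambda>(t, w). tw z t @ w) ` (UNIV \<times> S)"
    by force
  finally show ?thesis .
qed

text \<open>The grammar of \<open>tw\<close> as an equation of series. Each product is unambiguous
  because the letter after a gap differs from the letter before it.\<close>

lemma T_eq: "T z = X z * (P z * (X (ol z) * (P (ol z) * (X z * (P z * X (ol z))))))"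
proof -
  define S1 where "S1 = (\<lambda>(t, w). tw z t @ w) ` (UNIV \<times> {[ol z]})"
  define S2 where "S2 = (\<lambda>w. z # w) ` S1"
  define S3 where "S3 = (\<lambda>(t, w). tw (ol z) t @ w) ` (UNIV \<times> S2)"
  define S4 where "S4 = (\<lambda>w. ol z # w) ` S3"
  define S5 where "S5 = (\<lambda>(t, w). tw z t @ w) ` (UNIV \<times> S4)"
  have 1: "P z * X (ol z) = ind S1"
    unfolding S1_def X_def by (rule P_mult) auto
  have 2: "X z * ind S1 = ind S2"
    unfolding S2_def by (rule X_mult)
  have 3: "P (ol z) * ind S2 = ind S3"
    unfolding S3_def by (rule P_mult) (auto simp: S2_def)
  have 4: "X (ol z) * ind S3 = ind S4"
    unfolding S4_def by (rule X_mult)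
  have 5: "P z * ind S4 = ind S5"
    unfolding S5_def by (rule P_mult) (auto simp: S4_def)
  have 6: "X z * ind S5 = ind ((\<lambda>w. z # w) ` S5)"
    by (rule X_mult)
  have "(\<lambda>w. z # w) ` S5 = {w. isT z w}"
  proof (intro equalityI subsetI)
    fix w assume "w \<in> {w. isT z w}"
    then obtain t where "t \<noteq> Lf" "w = tw z t" by (auto simp: isT_def)
    then obtain s1 s2 s3 where w: "w = tw z (Nd s1 s2 s3)" by (cases t) auto
    have "tw z s3 @ [ol z] \<in> S1" unfolding S1_def by force
    then have "z # tw z s3 @ [ol z] \<in> S2" by (simp add: S2_def)
    then have "tw (ol z) s2 @ z # tw z s3 @ [ol z] \<in> S3" unfolding S3_def by force
    then have "ol z # tw (ol z) s2 @ z # tw z s3 @ [ol z] \<in> S4" by (simp add: S4_def)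
    then have "tw z s1 @ ol z # tw (ol z) s2 @ z # tw z s3 @ [ol z] \<in> S5" unfolding S5_def by force
    then show "w \<in> (\<lambda>w. z # w) ` S5" by (simp add: w)
  next
    fix w assume "w \<in> (\<lambda>w. z # w) ` S5"
    then obtain s1 s2 s3 where "w = tw z (Nd s1 s2 s3)"
      by (auto simp: S5_def S4_def S3_def S2_def S1_def)
    then show "w \<in> {w. isT z w}"
      by (auto simp: isT_def)
  qed
  then show ?thesis by (simp only: T_def 1 2 3 4 5 6)
qed

lemma k_X: "const r * X z = X z * const r"
  and k_P: "const r * P z = P z * const r"
  and k_X': "const r * (X z * f) = X z * (const r * f)"
  and k_P': "const r * (P z * f) = P z * (const r * f)"
  by (simp_all add: X_def P_def const_ind flip: mult.assoc)

lemma k_T: "const r * T z = T z * const r"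
  by (simp add: T_def const_ind)

section \<open>The matrix series of building blocks and its inverse\<close>

text \<open>For the blocks of \<open>K\<close> the row is the first letter and the column the last
  one, so consecutive blocks in a power of \<open>K\<close> meet inside a run of equal
  letters.\<close>

abbreviation k :: "lt \<Rightarrow> lt \<Rightarrow> 'r::f2ring \<Rightarrow> (lt, (lt, 'r) sqmat) ser" where
  "k i j r \<equiv> const (mu i j r)"

lemma kk: "k i j r * k i' j' s = (if j = i' then k i j' (r * s) else 0)"
  and kk': "k i j r * (k i' j' s * f) = (if j = i' then k i j' (r * s) * f else 0)"
  by (simp_all add: const_mult mu_mult flip: mult.assoc)

text \<open>The relations that the construction takes from the matrix factorizations.
  \<open>bs\<close> makes the triple product of (S, D, S) vanish, \<open>cb\<close> and
  \<open>ac\<close> the products belonging to (D, S, D, S, D); \<open>cs\<close> and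
  \<open>sc\<close> produce the identity from four letters.\<close>

locale koszul =
  fixes d :: "'r::f2ring \<Rightarrow> 'r" and y sg a b c :: 'r
  assumes d_add: "d (r + s) = d r + d s" and d_mult: "d (r * s) = d r * s + r * d s"
    and dy: "d y = 0" and dsg: "d sg = 0" and da: "d a = y * sg" and db: "d b = sg * y"
    and dc: "d c = y * b + a * y" and cs: "c * sg = 1 + a * a" and sc: "sg * c = 1 + b * b"
    and bs: "b * sg = sg * a" and cb: "c * b = 0" and ac: "a * c = 0"
begin

lemma d0: "d 0 = 0" and d1: "d 1 = 0"
  using d_add[of 0 0] d_mult[of 1 1] by simp_all

lemma d_sum: "d (\<Sum>i\<in>I. f i) = (\<Sum>i\<in>I. d (f i))"
  by (induction I rule: infinite_finite_induct) (auto simp: d0 d_add)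

definition dm :: "('n, 'r) sqmat \<Rightarrow> ('n, 'r) sqmat" where
  "dm A = Mat (\<lambda>i j. d (ent A i j))"

lemma dm_add: "dm (A + B) = dm A + dm B" and dm_0: "dm 0 = 0"
  by (auto intro!: sqmat_eqI simp: dm_def d_add d0)

lemma dm_mult: "dm (A * B) = dm A * B + A * dm (B :: ('n::finite, 'r) sqmat)"
  by (auto intro!: sqmat_eqI simp: dm_def ent_mult d_sum d_mult sum.distrib)

lemma dm_1: "dm (1 :: ('n::finite, 'r) sqmat) = 0"
  by (auto intro!: sqmat_eqI simp: dm_def ent_1 d0 d1)

lemma dm_mu: "dm (mu i j r) = mu i j (d r)"
  by (auto intro!: sqmat_eqI simp: dm_def ent_mu d0)

lemma dm_sum: "dm (\<Sum>i\<in>I. f i) = (\<Sum>i\<in>I. dm (f i))"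
  by (induction I rule: infinite_finite_induct) (auto simp: dm_0 dm_add)

definition ds :: "('a, ('n, 'r) sqmat) ser \<Rightarrow> ('a, ('n, 'r) sqmat) ser" where
  "ds = smap dm"

lemma ds_add: "ds (f + g) = ds f + ds g"
  by (auto intro!: ser_eqI simp: ds_def dm_add)

lemma ds_mult: "ds (f * g) = ds f * g + f * ds (g :: ('a, ('n::finite, 'r) sqmat) ser)"
  by (rule ser_eqI) (simp add: ds_def cf_mult dm_sum dm_mult sum.distrib)

lemma ds_const: "ds (const r) = const (dm r)"
  by (rule ser_eqI) (simp add: ds_def cf_const dm_0)

lemma ds_ind: "ds (ind S) = 0"
  by (rule ser_eqI) (simp add: ds_def cf_ind dm_0 dm_1)

lemma ds_X: "ds (X z) = 0" and ds_P: "ds (P z) = 0"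
  by (simp_all add: X_def P_def ds_ind)

text \<open>The skeletons D, DSD, DS, SD, S carry the coefficients \<open>y\<close>,
  \<open>c\<close>, \<open>a\<close>, \<open>b\<close>, \<open>sg\<close>; a gap filled by
  \<open>P\<close> stands at every letter change.\<close>

definition K :: "(lt, (lt, 'r) sqmat) ser" where
  "K = X LD * k LD LD y + X LD * (P LD * (X LS * (P LS * (X LD * k LD LD c)))) +
       X LD * (P LD * (X LS * k LD LS a)) + X LS * (P LS * (X LD * k LS LD b)) + X LS * k LS LS sg"

text \<open>A disk word bridging a letter change, where \<open>J\<close> is the bare change. Their
  sum fills the gap between two blocks whose adjacent letters differ.\<close>

definition TJ :: "(lt, (lt, 'r) sqmat) ser" where
  "TJ = T LD * k LD LS 1 + T LS * k LS LD 1"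

definition J :: "(lt, (lt, 'r) sqmat) ser" where
  "J = k LD LS 1 + k LS LD 1"

lemma L_eq: "J + TJ = P LD * k LD LS 1 + P LS * k LS LD 1"
  by (simp add: J_def TJ_def P_eq distrib_right ac_simps)

text \<open>Joining two blocks across a filled letter change gives a longer skeleton. For DS, SD and
  DSD the coefficients are the derivatives of \<open>a\<close>, \<open>b\<close> and
  \<open>c\<close>. For DSDS and SDSD, \<open>cs\<close> and \<open>sc\<close> leave 1, and these
  skeletons sum to \<open>TJ\<close> by \<open>T_eq\<close>. SDS and DSDSD cancel by
  \<open>bs\<close>, \<open>cb\<close> and \<open>ac\<close>.\<close>

lemma ds_K: "ds K = TJ + K * (J + TJ) * K"
proof -
  have l: "ds K = X LD * (P LD * (X LS * (P LS * (X LD * (k LD LD (y * b) + k LD LD (a * y)))))) +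
       X LD * (P LD * (X LS * k LD LS (y * sg))) + X LS * (P LS * (X LD * k LS LD (sg * y)))"
    by (simp add: K_def ds_add ds_mult ds_X ds_P ds_const dm_mu dy dsg da db dc mu_add const_add)
  have t: "TJ = X LD * (P LD * (X LS * (P LS * (X LD * (P LD * (X LS * k LD LS 1)))))) +
       X LS * (P LS * (X LD * (P LD * (X LS * (P LS * (X LD * k LS LD 1))))))"
    by (simp add: TJ_def T_eq mult.assoc)
  show ?thesis
    unfolding l unfolding L_eq K_def unfolding t
    by (simp add: distrib_left distrib_right mult.assoc k_X k_P k_X' k_P' kk kk' cs sc bs cb ac
        mu_add const_add add.assoc add.commute add.left_commute)
qed

lemma K0: "cf K [] = 0"
  by (simp add: K_def X_def cf_ind)

definition G :: "(lt, (lt, 'r) sqmat) ser" where "G = ginv K"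

lemma G_eq: "G = 1 + K * G"
  unfolding G_def by (rule ginv_eq[OF K0])

lemma KG: "K * G = G + 1" and GK: "G * K = G + 1"
proof -
  show "K * G = G + 1"
    using add_move_char2[of G 1 "K * G"] G_eq by (metis add_self_left add.commute)
  have "G * (1 + K) = 1" unfolding G_def by (rule ginv_right[OF K0])
  then have "G + G * K = 1" by (simp add: distrib_left)
  then show "G * K = G + 1" by (metis add_self_left)
qed

text \<open>The derivative of the inverse is \<open>G * ds K * G\<close>, and \<open>G * K\<close>
  and \<open>K * G\<close> both equal \<open>G + 1\<close>. The term with \<open>J\<close> cuts a
  word at a letter change, the terms with \<open>TJ\<close> delete a disk word at the beginning or
  at the end.\<close>

lemma ds_G: "ds G + (G + 1) * J * (G + 1) + TJ * G + (G + 1) * TJ = 0"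
proof -
  have "ds (1 :: (lt, (lt, 'r) sqmat) ser) = 0"
    using ds_const[of "1 :: (lt, 'r) sqmat"] by (simp add: dm_1)
  then have "ds G = ds K * G + K * ds G"
    by (subst G_eq) (simp add: ds_add ds_mult)
  then have "ds G + K * ds G = ds K * G" by (rule add_move_char2)
  then have "(1 + K) * ds G = ds K * G" by (simp add: distrib_right)
  then have "G * (1 + K) * ds G = G * ds K * G" by (simp add: mult.assoc)
  moreover have "G * (1 + K) = 1" unfolding G_def by (rule ginv_right[OF K0])
  ultimately have "ds G = G * ds K * G" by simp
  also have "\<dots> = G * TJ * G + (G * K) * (J + TJ) * (K * G)"
    by (simp add: ds_K distrib_left distrib_right mult.assoc)
  finally show ?thesis
    unfolding KG GK by (simp add: distrib_left distrib_right mult.assoc add.assoc add.commute add.left_commute)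
qed

end

subsection \<open>Splitting a word inside a run\<close>

text \<open>Series in two words: the outer one is the part left of a marked cut, the inner one the
  part right of it. \<open>lam\<close> places a series on the left part, \<open>rho\<close> on the
  right part.\<close>

definition lam :: "('a, 'r::f2ring) ser \<Rightarrow> ('a, ('a, 'r) ser) ser" where
  "lam f = smap const f"

abbreviation rho :: "('a, 'r::f2ring) ser \<Rightarrow> ('a, ('a, 'r) ser) ser" where
  "rho f \<equiv> const f"

definition cut :: "'a \<Rightarrow> 'a \<Rightarrow> ('a, 'r::f2ring) ser \<Rightarrow> ('a, ('a, 'r) ser) ser" where
  "cut x y f = Ser (\<lambda>u. Ser (\<lambda>v. if u \<noteq> [] \<and> last u = x \<and> v \<noteq> [] \<and> hd v = y then cf f (u @ v) else 0))"

definition en :: "'a \<Rightarrow> ('a, 'r::f2ring) ser \<Rightarrow> ('a, 'r) ser" where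
  "en x f = Ser (\<lambda>u. if u \<noteq> [] \<and> last u = x then cf f u else 0)"

definition st :: "'a \<Rightarrow> ('a, 'r::f2ring) ser \<Rightarrow> ('a, 'r) ser" where
  "st x f = Ser (\<lambda>u. if u \<noteq> [] \<and> hd u = x then cf f u else 0)"

lemma const_sum: "const (\<Sum>i\<in>I. f i) = (\<Sum>i\<in>I. const (f i))"
  by (induction I rule: infinite_finite_induct) (auto simp: const_add)

lemma lam_add: "lam (f + g) = lam f + lam g"
  by (rule ser_eqI) (simp add: lam_def const_add)

lemma lam_mult: "lam (f * g) = lam f * lam g"
  by (rule ser_eqI) (simp add: lam_def cf_mult const_sum const_mult)

lemma lam_const: "lam (const r) = const (const r)"
  by (rule ser_eqI) (simp add: lam_def cf_const)

lemma lam_1 [simp]: "lam 1 = 1"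
  using lam_const[of 1] by simp

lemma lam_0 [simp]: "lam 0 = 0"
  by (rule ser_eqI) (simp add: lam_def)

lemma cf_lam_rho: "cf (cf (lam f * rho g) u) v = cf f u * cf g v"
  by (simp add: lam_def)

lemma lam_T_rho: "lam (T z) * rho g = rho g * lam (T z)"
  by (rule ser_eqI) (simp add: lam_def cf_T)

lemma rho_T_lam: "rho (T z) * lam f = lam f * rho (T z)"
  by (rule ser_eqI) (simp add: lam_def k_T)

lemma cut_cf: "cf (cf (cut x y f) u) v = (if u \<noteq> [] \<and> last u = x \<and> v \<noteq> [] \<and> hd v = y then cf f (u @ v) else 0)"
  by (simp add: cut_def)

lemma cf2_sum: "cf (\<Sum>i\<in>I. f i) v = (\<Sum>i\<in>I. cf (f i) v)"
  by (rule cf_sum)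

lemma cf_lam_mult: "cf (cf (lam f * H) u) v = (\<Sum>i\<le>length u. cf f (take i u) * cf (cf H (drop i u)) v)"
  by (simp add: cf_mult[of "lam f"] cf2_sum) (simp add: lam_def)

lemma cf_mult_rho: "cf (cf (H * rho g) u) v = (\<Sum>j\<le>length v. cf (cf H u) (take j v) * cf g (drop j v))"
  unfolding cf_mult_const by (rule cf_mult)

text \<open>The marked cut falls inside the piece read by \<open>g\<close>, inside the piece read by
  \<open>f\<close>, or exactly between them.\<close>

lemma cut_mult: "cut x y (f * g) = lam f * cut x y g + cut x y f * rho g + lam (en x f) * rho (st y g)"
proof (intro ser_eqI)
  fix u v
  show "cf (cf (cut x y (f * g)) u) v =
     cf (cf (lam f * cut x y g + cut x y f * rho g + lam (en x f) * rho (st y g)) u) v"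
  proof (cases "u \<noteq> [] \<and> last u = x \<and> v \<noteq> [] \<and> hd v = y")
    case True
    obtain m where m: "length u = Suc m" using True by (cases u) auto
    obtain n where n: "length v = Suc n" using True by (cases v) auto
    have 1: "cf (cf (lam f * cut x y g) u) v = (\<Sum>i<length u. cf f (take i u) * cf g (drop i u @ v))"
      unfolding cf_lam_mult using True
      by (simp add: cut_cf m flip: lessThan_Suc_atMost)
    have 2: "cf (cf (cut x y f * rho g) u) v = (\<Sum>j\<le>n. cf f (u @ take (Suc j) v) * cf g (drop (Suc j) v))"
    proof -
      have "cf (cf (cut x y f * rho g) u) v = (\<Sum>j\<le>n. cf (cf (cut x y f) u) (take (Suc j) v) * cf g (drop (Suc j) v))"
        unfolding cf_mult_rho n by (subst sum.atMost_Suc_shift) (simp add: cut_cf)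
      also have "\<dots> = (\<Sum>j\<le>n. cf f (u @ take (Suc j) v) * cf g (drop (Suc j) v))"
        using True by (intro sum.cong refl) (auto simp: cut_cf)
      finally show ?thesis .
    qed
    have "cf (f * g) (u @ v) = (\<Sum>i<Suc (length u + length v). cf f (take i (u @ v)) * cf g (drop i (u @ v)))"
      by (simp add: cf_mult lessThan_Suc_atMost del: take_append drop_append sum.lessThan_Suc)
    also have "{..<Suc (length u + length v)} = {..<length u} \<union> {length u} \<union> (\<lambda>j. length u + Suc j) ` {..n}"
    proof (intro equalityI subsetI)
      fix x assume x: "x \<in> {..<Suc (length u + length v)}"
      show "x \<in> {..<length u} \<union> {length u} \<union> (\<lambda>j. length u + Suc j) ` {..n}"
      proof (cases "x \<le> length u")
        case False
        then have "x = length u + Suc (x - Suc (length u))" "x - Suc (length u) \<in> {..n}"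
          using x n by auto
        then show ?thesis by blast
      qed auto
    qed (auto simp: n)
    also have "(\<Sum>i\<in>\<dots>. cf f (take i (u @ v)) * cf g (drop i (u @ v))) =
       (\<Sum>i<length u. cf f (take i u) * cf g (drop i u @ v)) + cf f u * cf g v +
       (\<Sum>j\<le>n. cf f (u @ take (Suc j) v) * cf g (drop (Suc j) v))"
      by (subst sum.union_disjoint; (subst sum.union_disjoint)?)
         (auto simp: sum.reindex inj_on_def intro!: sum.cong)
    finally have "cf (f * g) (u @ v) =
       cf (cf (lam f * cut x y g) u) v + cf f u * cf g v + cf (cf (cut x y f * rho g) u) v"
      unfolding 1 2 .
    then show ?thesis using True
      by (simp add: cut_cf cf_lam_rho en_def st_def ac_simps del: cf_mult_const)
  next
    case False
    have "cf (cf (lam f * cut x y g) u) v = 0"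
      unfolding cf_lam_mult using False by (auto simp: cut_cf intro!: sum.neutral)
    moreover have "cf (cf (cut x y f * rho g) u) v = 0"
      unfolding cf_mult_rho using False by (auto simp: cut_cf intro!: sum.neutral)
    moreover have "cf (cf (lam (en x f) * rho (st y g)) u) v = 0"
      unfolding cf_lam_rho using False by (auto simp: en_def st_def)
    moreover have "cf (cf (cut x y (f * g)) u) v = 0"
      by (simp only: cut_cf False if_False)
    ultimately show ?thesis by (simp del: cf_mult_const)
  qed
qed

lemma cut_add: "cut x y (f + g) = cut x y f + cut x y g"
  by (auto intro!: ser_eqI simp: cut_cf)

lemma en_add: "en x (f + g) = en x f + en x g"
  and st_add: "st x (f + g) = st x f + st x g"
  by (auto intro!: ser_eqI simp: en_def st_def)

lemma en_en: "en x (en z f) = (if x = z then en z f else 0)"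
  and st_st: "st x (st z f) = (if x = z then st z f else 0)"
  by (auto intro!: ser_eqI simp: en_def st_def)

lemma en_Nil: "cf (en x f) [] = 0" and st_Nil: "cf (st x f) [] = 0"
  by (simp_all add: en_def st_def)

lemma en_mult:
  assumes "cf g [] = 0"
  shows "en x (f * g) = f * en x g"
proof (rule ser_eqI)
  fix u
  have "cf f (take i u) * cf (en x g) (drop i u) =
      (if u \<noteq> [] \<and> last u = x then cf f (take i u) * cf g (drop i u) else 0)" if "i \<le> length u" for i
    using that assms by (cases "i = length u") (auto simp: en_def)
  then show "cf (en x (f * g)) u = cf (f * en x g) u"
    by (simp add: cf_mult cong: sum.cong_simp) (simp add: en_def cf_mult)
qed

lemma st_mult:
  assumes "cf f [] = 0"
  shows "st x (f * g) = st x f * g"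
proof (rule ser_eqI)
  fix u
  have "cf (st x f) (take i u) * cf g (drop i u) =
      (if u \<noteq> [] \<and> hd u = x then cf f (take i u) * cf g (drop i u) else 0)" if "i \<le> length u" for i
    using that assms by (cases "i = 0") (auto simp: st_def)
  then show "cf (st x (f * g)) u = cf (st x f * g) u"
    by (simp add: cf_mult cong: sum.cong_simp) (simp add: st_def cf_mult)
qed

lemma en_const [simp]: "en x (const r) = 0" and st_const [simp]: "st x (const r) = 0"
  by (auto intro!: ser_eqI simp: en_def st_def cf_const)

lemma en_1 [simp]: "en x 1 = 0" and st_1 [simp]: "st x 1 = 0"
  using en_const[of x 1] st_const[of x 1] by simp_all

lemma en_X: "en x (X z) = (if x = z then X z else 0)"
  and st_X: "st x (X z) = (if x = z then X z else 0)"
  by (auto intro!: ser_eqI simp: en_def st_def X_def cf_ind)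

lemma en_T: "en x (T z) = (if x = ol z then T z else 0)"
  and st_T: "st x (T z) = (if x = z then T z else 0)"
  using isT_hd by (auto intro!: ser_eqI simp: en_def st_def cf_T)

lemma X_Nil [simp]: "cf (X z) [] = 0" and T_Nil [simp]: "cf (T z) [] = 0"
  using isT_hd by (auto simp: X_def cf_ind cf_T)

text \<open>The value at a word cut inside a run of \<open>x\<close>, corrected by the terms in
  which a disk word touching the cut is deleted from the left or from the right part. These are the
  terms that disk products contribute next to such a cut.\<close>

definition nab :: "lt \<Rightarrow> (lt, 'r::f2ring) ser \<Rightarrow> (lt, (lt, 'r) ser) ser" where
  "nab x f = cut x x f + cut (ol x) x f * lam (T (ol x)) + rho (T x) * cut x (ol x) f"

text \<open>The failure of \<open>nab\<close> to be a derivation: the contributions in which the cut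
  is the junction of the two factors.\<close>

definition jn :: "lt \<Rightarrow> (lt, 'r::f2ring) ser \<Rightarrow> (lt, 'r) ser \<Rightarrow> (lt, (lt, 'r) ser) ser" where
  "jn x f g = lam (en x f) * rho (st x g) + lam (en (ol x) f) * (lam (T (ol x)) * rho (st x g)) +
     lam (en x f) * (rho (T x) * rho (st (ol x) g))"

lemma nab_add: "nab x (f + g) = nab x f + nab x g"
  by (simp add: nab_def cut_add distrib_left distrib_right ac_simps)

lemma rho_lam_T': "rho g * (lam (T z) * h) = lam (T z) * (rho g * h)"
  by (simp add: lam_T_rho flip: mult.assoc)

lemma rho_T_lam': "rho (T z) * (lam f * h) = lam f * (rho (T z) * h)"
  by (simp add: rho_T_lam flip: mult.assoc)

lemma nab_mult: "nab x (f * g) = lam f * nab x g + nab x f * rho g + jn x f g"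
  by (simp add: nab_def jn_def cut_mult distrib_left distrib_right mult.assoc rho_T_lam'
      lam_T_rho add.assoc add.commute add.left_commute)

lemma cut_eq_0: "(\<And>u v. u \<noteq> [] \<Longrightarrow> v \<noteq> [] \<Longrightarrow> cf f (u @ v) = 0) \<Longrightarrow> cut x y f = 0"
  by (auto intro!: ser_eqI simp: cut_cf)

lemma nab_eq_0: "(\<And>u v. u \<noteq> [] \<Longrightarrow> v \<noteq> [] \<Longrightarrow> cf f (u @ v) = 0) \<Longrightarrow> nab x f = 0"
  by (simp add: nab_def cut_eq_0)

lemma nab_X: "nab x (X z) = 0"
  by (rule nab_eq_0) (auto simp: X_def cf_ind append_eq_Cons_conv)

lemma nab_const: "nab x (const r) = 0"
  by (rule nab_eq_0) (auto simp: cf_const)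

text \<open>The junction terms at the two ends of a gap cancel: cutting beside the filling and
  deleting the filling as a disk word yield the same terms.\<close>

lemma nab_slot:
  assumes f: "en z f = f" and g: "st (ol z) g = g"
  shows "nab x (f * (P z * g)) = lam f * (lam (P z) * nab x g) + lam f * (nab x (P z) * rho g) + nab x f * rho (P z * g)"
proof -
  have f': "en (ol z) f = 0" "cf f [] = 0" 
    using en_en[of "ol z" z f] en_Nil[of z f] by (simp_all add: f)
  have g': "st z g = 0" "cf g [] = 0"
    using st_st[of z "ol z" g] st_Nil[of "ol z" g] by (simp_all add: g)
  have s: "st x (P z * g) = (if x = z then T z * g else g)" for x
    by (cases "x = z") (auto simp: P_eq distrib_right st_add st_mult st_T g g' neq_iff_ol)
  have e: "en x (P z) = (if x = z then 0 else T z)" for x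
    by (auto simp: P_eq en_add en_T neq_iff_ol)
  have "lam f * jn x (P z) g + jn x f (P z * g) = 0"
  proof (cases "x = z")
    case True
    then show ?thesis by (simp add: jn_def s e f f' g g' const_mult)
  next
    case False
    then have x: "x = ol z" by (simp add: neq_iff_ol)
    show ?thesis by (simp add: x jn_def s e f f' g g')
  qed
  then show ?thesis
    by (simp add: nab_mult distrib_left add.assoc)
qed

text \<open>Order of vanishing in the total length of both words, used to prove that a series with a
  recursive grammar is zero.\<close>

definition lowz :: "nat \<Rightarrow> ('a, ('a, 'r::f2ring) ser) ser \<Rightarrow> bool" where
  "lowz n H \<longleftrightarrow> (\<forall>u v. length u + length v \<le> n \<longrightarrow> cf (cf H u) v = 0)"

lemma lowz_add: "lowz n H \<Longrightarrow> lowz n H' \<Longrightarrow> lowz n (H + H')"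
  by (simp add: lowz_def)

lemma lowz_0 [simp]: "lowz n 0"
  by (simp add: lowz_def)

lemma lowz_lam: "lowz n H \<Longrightarrow> lowz n (lam f * H)"
  by (auto simp: lowz_def cf_lam_mult intro!: sum.neutral)

lemma lowz_rho: "lowz n H \<Longrightarrow> lowz n (H * rho f)"
  by (auto simp: lowz_def cf_mult_rho simp del: cf_mult_const intro!: sum.neutral)

lemma lowz_Suc:
  fixes f :: "('a, 'r::f2ring) ser"
  assumes "lowz n H" "cf f [] = 0"
  shows "lowz (Suc n) (lam f * H)"
  unfolding lowz_def cf_lam_mult
proof (intro allI impI sum.neutral ballI)
  fix u v :: "'a list" and i
  assume "length u + length v \<le> Suc n" "i \<in> {..length u}"
  then show "cf f (take i u) * cf (cf H (drop i u)) v = 0"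
    using assms by (cases "i = 0") (auto simp: lowz_def)
qed

lemma nab_T: 
  fixes z x
  defines "s3 \<equiv> X z * (P z * X (ol z))"
  defines "s2 \<equiv> X (ol z) * (P (ol z) * s3)"
  shows "nab x (T z :: (lt, 'r::f2ring) ser) = lam (X z) * (lam (P z) * nab x s2) + lam (X z) * (nab x (P z) * rho s2)"
    and "nab x s2 = lam (X (ol z)) * (lam (P (ol z)) * nab x s3) + lam (X (ol z)) * (nab x (P (ol z)) * rho (s3 :: (lt, 'r::f2ring) ser))"
    and "nab x (s3 :: (lt, 'r::f2ring) ser) = lam (X z) * (nab x (P z) * rho (X (ol z)))"
proof -
  have 2: "st (ol z) s2 = s2" and 3: "st z s3 = s3"
    by (simp_all add: s2_def s3_def st_mult st_X)
  have "nab x (X z * (P z * s2)) = lam (X z) * (lam (P z) * nab x s2) + lam (X z) * (nab x (P z) * rho s2)"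
    by (subst nab_slot) (simp_all add: en_X 2 nab_X)
  then show "nab x (T z :: (lt, 'r) ser) = lam (X z) * (lam (P z) * nab x s2) + lam (X z) * (nab x (P z) * rho s2)"
    by (simp add: T_eq s2_def s3_def)
  show "nab x s2 = lam (X (ol z)) * (lam (P (ol z)) * nab x s3) + lam (X (ol z)) * (nab x (P (ol z)) * rho s3)"
    unfolding s2_def by (subst nab_slot) (simp_all add: en_X 3 nab_X)
  show "nab x s3 = lam (X z) * (nab x (P z) * rho (X (ol z)))"
    unfolding s3_def by (subst nab_slot) (simp_all add: en_X st_X nab_X)
qed

text \<open>By the grammar, \<open>nab\<close> of a gap series is a combination of
  \<open>nab\<close> of gap series behind at least one further letter. The order of vanishing
  therefore exceeds every bound.\<close>

lemma nab_P: "nab x (P z :: (lt, 'r::f2ring) ser) = 0"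
proof -
  have P_T: "nab x (P z) = nab x (T z :: (lt, 'r) ser)" for z x
    using nab_const[of x 1] by (simp add: P_eq nab_add)
  have low: "lowz n (nab x (P z :: (lt, 'r) ser))" for n z x
  proof (induction n arbitrary: z x)
    case 0
    show ?case by (simp add: lowz_def nab_def cut_cf)
  next
    case (Suc n)
    have 1: "lowz (Suc n) (lam (X w) * (nab x (P z) * rho (f :: (lt, 'r) ser)))" for w z x f
      by (rule lowz_Suc[OF lowz_rho[OF Suc] X_Nil])
    have 3: "lowz (Suc n) (nab x (X z * (P z * X (ol z)) :: (lt, 'r) ser))"
      by (subst nab_T(3)) (rule 1)
    have 2: "lowz (Suc n) (nab x (X (ol z) * (P (ol z) * (X z * (P z * X (ol z)))) :: (lt, 'r) ser))"
      by (subst nab_T(2)) (rule lowz_add[OF lowz_lam[OF lowz_lam[OF 3]] 1])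
    show ?case
      unfolding P_T by (subst nab_T(1)) (rule lowz_add[OF lowz_lam[OF lowz_lam[OF 2]] 1])
  qed
  show ?thesis
  proof (intro ser_eqI)
    fix u v
    show "cf (cf (nab x (P z :: (lt, 'r) ser)) u) v = cf (cf 0 u) v"
      using low[of "length u + length v"] by (simp add: lowz_def zero_ser_def)
  qed
qed

lemma nab_slot_0:
  "en z f = f \<Longrightarrow> st (ol z) g = g \<Longrightarrow> nab x f = 0 \<Longrightarrow> nab x g = 0 \<Longrightarrow> nab x (f * (P z * g)) = 0"
  by (simp add: nab_slot nab_P)

lemma nab_mult_const: "nab x f = 0 \<Longrightarrow> nab x (f * const r) = 0"
  by (simp add: nab_mult nab_const jn_def)

context koszul
begin

lemma nab_K: "nab x K = 0"
proof -
  have s1: "nab x (X z * (P z * g)) = 0" if "st (ol z) g = g" "nab x g = 0"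
    for z and g :: "(lt, (lt, 'r) sqmat) ser"
    using that by (intro nab_slot_0 nab_X) (simp_all add: en_X)
  have st: "st z (X z * f) = X z * f" for z and f :: "(lt, (lt, 'r) sqmat) ser"
    by (simp add: st_mult st_X)
  have s2: "nab x (X z * (P z * (X (ol z) * const r))) = 0" for z and r :: "(lt, 'r) sqmat"
    by (rule s1[OF st nab_mult_const[OF nab_X]])
  have s3: "nab x (X z * (P z * (X (ol z) * (P (ol z) * (X z * const r))))) = 0" for z and r :: "(lt, 'r) sqmat"
    using s1[OF st s2[of "ol z"]] by simp
  show ?thesis
    unfolding K_def nab_add 
    using s2[of LD "mu LD LS a"] s2[of LS "mu LS LD b"] s3[of LD "mu LD LD c"]
    by (simp add: nab_mult_const[OF nab_X])
qed

abbreviation "ee x \<equiv> mu x x 1"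

lemma en_K: "en x K = K * const (ee x)"
proof -
  have e: "en x (f * k i j r) = (if x = z then f * k i j r else 0)" if "en z f = f" for z f i j r
  proof -
    have f: "cf f [] = 0" using that en_Nil[of z f] by simp
    have "en x (f * k i j r) = en x f * k i j r"
      by (rule ser_eqI) (simp add: en_def)
    moreover have "en x f = (if x = z then f else 0)"
      using en_en[of x z f] by (simp add: that)
    ultimately show ?thesis by simp
  qed
  have X: "en z (X z) = X z" "en z (f * X z) = f * X z" for z and f :: "(lt, (lt, 'r) sqmat) ser"
    by (simp_all add: en_mult en_X)
  have K: "K = X LD * k LD LD y + (X LD * (P LD * (X LS * P LS)) * X LD) * k LD LD c +
       (X LD * P LD * X LS) * k LD LS a + (X LS * P LS * X LD) * k LS LD b + X LS * k LS LS sg"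
    by (simp add: K_def mult.assoc)
  show ?thesis
    unfolding K en_add e[OF X(1)] e[OF X(2)]
    by (cases x) (simp_all add: distrib_right mult.assoc kk)
qed

lemma st_K: "st x K = const (ee x) * K"
proof -
  have X: "st x (X z * f) = (if x = z then X z * f else 0)" for z and f :: "(lt, (lt, 'r) sqmat) ser"
    by (simp add: st_mult st_X)
  show ?thesis
    unfolding K_def st_add X
    by (cases x) (simp_all add: distrib_left k_X k_X' k_P k_P' kk kk')
qed

lemma en_G: "en x G = (G + 1) * const (ee x)"
proof -
  have "en x G = en x (1 + G * K)" by (simp add: GK add.commute)
  also have "\<dots> = en x 1 + en x (G * K)" by (rule en_add)
  also have "\<dots> = (G * K) * const (ee x)"
    by (simp only: en_1 add_0_left en_mult[OF K0] en_K mult.assoc)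
  finally show ?thesis by (simp only: GK)
qed

lemma st_G: "st x G = const (ee x) * (G + 1)"
proof -
  have "st x G = st x 1 + st x (K * G)" by (subst G_eq) (simp only: st_add)
  also have "\<dots> = const (ee x) * (K * G)"
    by (simp only: st_1 add_0_left st_mult[OF K0] st_K mult.assoc)
  finally show ?thesis by (simp only: KG)
qed

text \<open>\<open>nab\<close> vanishes on \<open>K\<close>, so in \<open>G = 1 + K * G\<close> only
  cuts between two blocks contribute. The resulting linear equation is solved by multiplying with
  \<open>lam G\<close>.\<close>

lemma nab_G: "nab x G = lam (G + 1) * (const (const (ee x)) * rho (G + 1))"
proof -
  have kT: "const r * (T z * f) = T z * (const r * f)" for r z and f :: "(lt, (lt, 'r) sqmat) ser"
    by (simp add: k_T flip: mult.assoc)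
  have "rho (const (ee (ol x))) * rho (const (ee x) * h) = 0" for h :: "(lt, (lt, 'r) sqmat) ser"
    by (simp only: const_mult[of "const _"] kk') simp
  then have 1: "lam (K * const (ee (ol x))) * (lam (T (ol x)) * rho (const (ee x) * h)) = 0" for h
    by (simp only: lam_mult lam_const mult.assoc rho_lam_T' mult_zero_right)
  have "rho (const (ee x)) * (rho (T x) * rho (const (ee (ol x)) * h)) = 0" for h :: "(lt, (lt, 'r) sqmat) ser"
    by (simp only: const_mult[of "const _"] const_mult[of "T _"] kT kk') simp
  then have 2: "lam (K * const (ee x)) * (rho (T x) * rho (const (ee (ol x)) * h)) = 0" for h
    by (simp only: lam_mult lam_const mult.assoc mult_zero_right)
  have "rho (const (ee x)) * rho (const (ee x) * (G + 1)) = rho (const (ee x)) * rho (G + 1)"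
    by (simp only: const_mult[of "const _"] kk' refl if_True mult_1_left)
  then have "jn x K G = lam K * (const (const (ee x)) * rho (G + 1))"
    unfolding jn_def en_K st_G 1 2 by (simp only: lam_mult lam_const mult.assoc add_0_right)
  then have "nab x G = lam K * (const (const (ee x)) * rho (G + 1)) + lam K * nab x G"
    using nab_const[of x 1] by (subst G_eq) (simp add: nab_add nab_mult nab_K add.commute)
  then have "nab x G + lam K * nab x G = lam K * (const (const (ee x)) * rho (G + 1))"
    by (rule add_move_char2)
  then have "(1 + lam K) * nab x G = lam K * (const (const (ee x)) * rho (G + 1))"
    by (simp add: distrib_right)
  then have "lam G * ((1 + lam K) * nab x G) = lam G * (lam K * (const (const (ee x)) * rho (G + 1)))"
    by simp
  moreover have "lam G * (1 + lam K) = 1"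
    using lam_mult[of G K, symmetric] by (simp add: distrib_left GK lam_add)
  ultimately show ?thesis
    using lam_mult[of G K, symmetric] by (simp add: GK flip: mult.assoc)
qed

end

section \<open>Scalar values of the series on words\<close>

text \<open>The coefficient of \<open>G\<close> at a nonempty word is supported in the single entry
  given by its first and last letter (\<open>G_hd\<close>, \<open>G_last\<close>). Summing all
  entries extracts it without naming the position.\<close>

definition tot :: "('n::finite, 'r::f2ring) sqmat \<Rightarrow> 'r" where
  "tot M = (\<Sum>i\<in>UNIV. \<Sum>j\<in>UNIV. ent M i j)"

lemma tot_add: "tot (M + N) = tot M + tot N" and tot_0 [simp]: "tot 0 = 0"
  by (simp_all add: tot_def sum.distrib)

lemma tot_sum: "tot (\<Sum>i\<in>I. f i) = (\<Sum>i\<in>I. tot (f i))"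
  by (induction I rule: infinite_finite_induct) (auto simp: tot_add)

lemma tot_mu: "tot (M * mu x y 1 * N) = (\<Sum>i\<in>UNIV. ent M i x) * (\<Sum>j\<in>UNIV. ent N y j)"
proof -
  have "ent (M * mu x y 1) i k = (\<Sum>j\<in>UNIV. if j = x then (if k = y then ent M i x else 0) else 0)" for i k
    unfolding ent_mult by (rule sum.cong) (auto simp: ent_mu)
  then have "ent (M * mu x y 1) i k = (if k = y then ent M i x else 0)" for i k
    by simp
  then have "ent (M * mu x y 1 * N) i j = (\<Sum>k\<in>UNIV. if k = y then ent M i x * ent N y j else 0)" for i j
    unfolding ent_mult[of "M * _"] by (intro sum.cong) auto
  then have "ent (M * mu x y 1 * N) i j = ent M i x * ent N y j" for i j
    by simp
  then show ?thesis by (simp add: tot_def sum_product)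
qed

lemma tot_right: "M = M * mu x x 1 \<Longrightarrow> tot M = (\<Sum>i\<in>UNIV. ent M i x)"
proof -
  assume M: "M = M * mu x x 1"
  have "tot M = tot (M * mu x x 1 * 1)" using M by simp
  also have "\<dots> = (\<Sum>i\<in>UNIV. ent M i x)"
    unfolding tot_mu by (simp add: ent_1)
  finally show ?thesis .
qed

lemma tot_left: "N = mu x x 1 * N \<Longrightarrow> tot N = (\<Sum>j\<in>UNIV. ent N x j)"
proof -
  assume N: "N = mu x x 1 * N"
  have "tot N = tot (1 * mu x x 1 * N)" using N by simp
  also have "\<dots> = (\<Sum>j\<in>UNIV. ent N x j)"
    unfolding tot_mu by (simp add: ent_1)
  finally show ?thesis .
qed

lemma tot_mu':
  assumes "M = M * mu x' x' 1" "N = mu y' y' 1 * N"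
  shows "tot (M * mu x y 1 * N) = (if x = x' \<and> y = y' then tot M * tot N else 0)"
proof (cases "x = x' \<and> y = y'")
  case True
  then show ?thesis using tot_mu[of M x y N] tot_right[OF assms(1)] tot_left[OF assms(2)] by simp
next
  case False
  have "M * mu x y 1 * N = M * (mu x' x' 1 * mu x y 1 * mu y' y' 1) * N"
    by (subst assms(1), subst assms(2)) (simp add: mult.assoc)
  also have "\<dots> = 0" using False by (auto simp: mu_mult)
  finally show ?thesis using False by auto
qed

context koszul
begin

text \<open>The empty word is treated apart: its coefficient is the two by two identity matrix,
  whose entries add up to zero in characteristic two.\<close>

definition gv :: "lt list \<Rightarrow> 'r" where
  "gv w = (if w = [] then 1 else tot (cf G w))"

lemma G_Nil: "cf G [] = 1"
proof -
  have "cf G [] = cf (1 + K * G) []" by (subst G_eq) simp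
  then show ?thesis by (simp add: K0)
qed

lemma G_last: "u \<noteq> [] \<Longrightarrow> cf G u = cf G u * mu (last u) (last u) 1"
proof -
  assume "u \<noteq> []"
  then have "cf (en (last u) G) u = cf G u" by (simp add: en_def)
  then show ?thesis using \<open>u \<noteq> []\<close> unfolding en_G by (simp add: cf_1)
qed

lemma G_hd: "u \<noteq> [] \<Longrightarrow> cf G u = mu (hd u) (hd u) 1 * cf G u"
proof -
  assume "u \<noteq> []"
  then have "cf (st (hd u) G) u = cf G u" by (simp add: st_def)
  then show ?thesis using \<open>u \<noteq> []\<close> unfolding st_G by (simp add: cf_1)
qed

lemma tot_GmuG: "u \<noteq> [] \<Longrightarrow> v \<noteq> [] \<Longrightarrow>
    tot (cf G u * mu x z 1 * cf G v) = (if x = last u \<and> z = hd v then gv u * gv v else 0)"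
  using tot_mu'[OF G_last G_hd, of u v x z] by (simp add: gv_def)

lemma tot_muG: "tot (mu x z 1 * cf G v) = (if v = [] \<or> z = hd v then gv v else 0)"
proof (cases "v = []")
  case True
  then show ?thesis using tot_mu[of 1 x z 1] by (simp add: G_Nil gv_def ent_1)
next
  case False
  have "cf G v = mu (hd v) (hd v) 1 * cf G v" using False by (rule G_hd)
  then have "mu x z 1 * cf G v = (if z = hd v then mu x z 1 * cf G v else 0)"
    by (metis (no_types, opaque_lifting) kk mu_mult mult.assoc mult_zero_left)
  moreover have "tot (mu x (hd v) 1 * cf G v) = tot (cf G v)"
    using tot_mu[of 1 x "hd v" "cf G v"] tot_left[OF G_hd[OF False]] by (simp add: ent_1)
  ultimately show ?thesis using False by (auto simp: gv_def)
qed

lemma tot_Gmu: "u \<noteq> [] \<Longrightarrow> tot (cf G u * mu x z 1) = (if x = last u then gv u else 0)"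
proof -
  assume u: "u \<noteq> []"
  have "cf G u = cf G u * mu (last u) (last u) 1" using u by (rule G_last)
  then have "cf G u * mu x z 1 = (if x = last u then cf G u * mu x z 1 else 0)"
    by (metis (no_types, opaque_lifting) mu_mult mult.assoc mult_zero_right)
  moreover have "tot (cf G u * mu (last u) z 1) = tot (cf G u)"
    using tot_mu[of "cf G u" "last u" z 1] tot_right[OF G_last[OF u]] by (simp add: ent_1)
  ultimately show ?thesis using u by (auto simp: gv_def)
qed

lemma cf_mult_lam: "cf (cf (H * lam f) u) v = (\<Sum>i\<le>length u. cf (cf H (take i u)) v * cf f (drop i u))"
  by (simp add: cf_mult[of H] cf2_sum) (simp add: lam_def)

lemma cf_rho_mult: "cf (cf (rho f * H) u) v = (\<Sum>j\<le>length v. cf f (take j v) * cf (cf H u) (drop j v))"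
  unfolding cf_const_mult by (rule cf_mult)

text \<open>This is \<open>nab_G\<close> at the pair of words: a value is multiplicative across a
  cut inside a run, up to deleting a disk word beside the cut.\<close>

lemma gv_run:
  assumes "u \<noteq> []" "v \<noteq> []" "last u = x" "hd v = x"
  shows "gv (u @ v) = gv u * gv v +
     (\<Sum>i\<le>length u. if take i u \<noteq> [] \<and> last (take i u) = ol x \<and> isT (ol x) (drop i u) then gv (take i u @ v) else 0) +
     (\<Sum>j\<le>length v. if drop j v \<noteq> [] \<and> hd (drop j v) = ol x \<and> isT x (take j v) then gv (u @ drop j v) else 0)"
proof -
  have l: "cf (cf (nab x G) u) v = cf G (u @ v) +
     (\<Sum>i\<le>length u. if take i u \<noteq> [] \<and> last (take i u) = ol x \<and> isT (ol x) (drop i u) then cf G (take i u @ v) else 0) +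
     (\<Sum>j\<le>length v. if drop j v \<noteq> [] \<and> hd (drop j v) = ol x \<and> isT x (take j v) then cf G (u @ drop j v) else 0)"
  proof -
    have "cf (cf (cut x x G) u) v = cf G (u @ v)"
      using assms by (simp add: cut_cf)
    moreover have "cf (cf (cut (ol x) x G * lam (T (ol x))) u) v =
      (\<Sum>i\<le>length u. if take i u \<noteq> [] \<and> last (take i u) = ol x \<and> isT (ol x) (drop i u) then cf G (take i u @ v) else 0)"
      unfolding cf_mult_lam using assms by (intro sum.cong refl) (simp add: cut_cf cf_T)
    moreover have "cf (cf (rho (T x) * cut x (ol x) G) u) v =
      (\<Sum>j\<le>length v. if drop j v \<noteq> [] \<and> hd (drop j v) = ol x \<and> isT x (take j v) then cf G (u @ drop j v) else 0)"
      unfolding cf_rho_mult using assms by (intro sum.cong refl) (simp add: cut_cf cf_T)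
    ultimately show ?thesis unfolding nab_def cf_add by simp
  qed
  have "cf (cf (nab x G) u) v = cf (cf (lam (G + 1) * rho (const (ee x) * (G + 1))) u) v"
    unfolding nab_G by (simp only: const_mult[of "const _"])
  also have "\<dots> = cf G u * mu x x 1 * cf G v"
    unfolding cf_lam_rho using assms by (simp add: cf_1 mult.assoc)
  finally have "tot (cf (cf (nab x G) u) v) = gv u * gv v"
    using assms by (simp add: tot_GmuG)
  then have "gv u * gv v = gv (u @ v) +
     ((\<Sum>i\<le>length u. if take i u \<noteq> [] \<and> last (take i u) = ol x \<and> isT (ol x) (drop i u) then gv (take i u @ v) else 0) +
     (\<Sum>j\<le>length v. if drop j v \<noteq> [] \<and> hd (drop j v) = ol x \<and> isT x (take j v) then gv (u @ drop j v) else 0))"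
    unfolding l using assms
    by (simp add: tot_add tot_sum if_distrib[of tot] gv_def add.assoc cong: if_cong)
  from add_move_char2[OF this] show ?thesis by (simp add: add.assoc)
qed

lemma d_tot: "d (tot M) = tot (dm M)"
  by (simp add: tot_def dm_def d_sum)

lemma J_const: "J = const (mu LD LS 1 + mu LS LD 1)"
  by (simp add: J_def const_add)

lemma cf_TJ: "cf TJ u = (if isT LD u then mu LD LS 1 else 0) + (if isT LS u then mu LS LD 1 else 0)"
  by (simp add: TJ_def cf_T)

text \<open>This is \<open>ds_G\<close> at a single word. The three sums will be matched with cuts
  between entries of a sequence and with disk products at its beginning and at its end.\<close>

lemma gv_rel:
  assumes w: "w \<noteq> []"
  shows "d (gv w) +
     (\<Sum>i\<le>length w. if take i w \<noteq> [] \<and> drop i w \<noteq> [] \<and> last (take i w) \<noteq> hd (drop i w)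
        then gv (take i w) * gv (drop i w) else 0) +
     (\<Sum>i\<le>length w. if (\<exists>x. isT x (take i w)) \<and> (drop i w = [] \<or> hd (drop i w) = last (take i w)) then gv (drop i w) else 0) +
     (\<Sum>i\<le>length w. if take i w \<noteq> [] \<and> last (take i w) = hd (drop i w) \<and> (\<exists>x. isT x (drop i w)) then gv (take i w) else 0) = 0"
proof -
  have G1: "cf (G + 1) u = (if u = [] then 0 else cf G u)" for u
    by (simp add: cf_1 G_Nil)
  have "tot (cf (ds G + (G + 1) * J * (G + 1) + TJ * G + (G + 1) * TJ) w) = 0"
    by (simp add: ds_G)
  moreover have "tot (cf (ds G) w) = d (gv w)"
    using w by (simp add: ds_def gv_def d_tot)
  moreover have "tot (cf ((G + 1) * J * (G + 1)) w) =
      (\<Sum>i\<le>length w. if take i w \<noteq> [] \<and> drop i w \<noteq> [] \<and> last (take i w) \<noteq> hd (drop i w)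
        then gv (take i w) * gv (drop i w) else 0)"
    unfolding J_const cf_mult[of "_ * const _"] tot_sum cf_mult_const
  proof (intro sum.cong refl)
    fix i
    let ?u = "take i w" and ?v = "drop i w"
    show "tot (cf (G + 1) ?u * (mu LD LS 1 + mu LS LD 1) * cf (G + 1) ?v) =
      (if ?u \<noteq> [] \<and> ?v \<noteq> [] \<and> last ?u \<noteq> hd ?v then gv ?u * gv ?v else 0)"
    proof (cases "?u = [] \<or> ?v = []")
      case False
      then have "tot (cf (G + 1) ?u * (mu LD LS 1 + mu LS LD 1) * cf (G + 1) ?v) =
         (if LD = last ?u \<and> LS = hd ?v then gv ?u * gv ?v else 0) +
         (if LS = last ?u \<and> LD = hd ?v then gv ?u * gv ?v else 0)"
        by (simp only: G1 if_False distrib_left distrib_right tot_add) (use False in \<open>simp add: tot_GmuG del: take_eq_Nil drop_eq_Nil\<close>)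
      then show ?thesis using False by (cases "last ?u"; cases "hd ?v") (simp_all del: take_eq_Nil drop_eq_Nil)
    qed (auto simp: G_Nil cf_1)
  qed
  moreover have "tot (cf (TJ * G) w) = (\<Sum>i\<le>length w. if (\<exists>x. isT x (take i w)) \<and> (drop i w = [] \<or> hd (drop i w) = last (take i w)) then gv (drop i w) else 0)"
    unfolding cf_mult tot_sum
  proof (intro sum.cong refl)
    fix i
    let ?u = "take i w" and ?v = "drop i w"
    consider "isT LD ?u" "\<not> isT LS ?u" "last ?u = LS" | "isT LS ?u" "\<not> isT LD ?u" "last ?u = LD" | "\<nexists>x. isT x ?u"
      by (metis isT_hd lt.exhaust lt.distinct(1) ol.simps)
    then show "tot (cf TJ ?u * cf G ?v) = (if (\<exists>x. isT x ?u) \<and> (?v = [] \<or> hd ?v = last ?u) then gv ?v else 0)"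
      by cases (auto simp: cf_TJ tot_muG simp del: take_eq_Nil drop_eq_Nil)
  qed
  moreover have "tot (cf ((G + 1) * TJ) w) = (\<Sum>i\<le>length w. if take i w \<noteq> [] \<and> last (take i w) = hd (drop i w) \<and> (\<exists>x. isT x (drop i w)) then gv (take i w) else 0)"
    unfolding cf_mult tot_sum
  proof (intro sum.cong refl)
    fix i
    let ?u = "take i w" and ?v = "drop i w"
    consider "isT LD ?v" "\<not> isT LS ?v" "hd ?v = LD" | "isT LS ?v" "\<not> isT LD ?v" "hd ?v = LS" | "\<nexists>x. isT x ?v"
      by (metis isT_hd lt.exhaust lt.distinct(1) ol.simps)
    then show "tot (cf (G + 1) ?u * cf TJ ?v) = (if ?u \<noteq> [] \<and> last ?u = hd ?v \<and> (\<exists>x. isT x ?v) then gv ?u else 0)"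
      unfolding G1 by cases (auto simp: cf_TJ tot_Gmu simp del: take_eq_Nil drop_eq_Nil)
  qed
  ultimately show ?thesis
    unfolding cf_add tot_add by simp
qed

end

section \<open>Spelling sequences of basis elements as words\<close>

text \<open>Vertices are forgotten. For a reduced sequence the word together with the starting
  vertex recovers them, as only \<open>S\<close> changes the vertex.\<close>

fun uw :: "bbasis \<Rightarrow> lt list" where
  "uw (Idem v) = []"
| "uw (Dp v n) = replicate (Suc n) LD"
| "uw (Sw v n) = replicate (Suc n) LS"

abbreviation wd :: "bbasis list \<Rightarrow> lt list" where
  "wd s \<equiv> concat (map uw s)"

abbreviation kd :: "bbasis \<Rightarrow> lt" where
  "kd b \<equiv> hd (uw b)"

fun cmp :: "bbasis list \<Rightarrow> bool" where
  "cmp (a # b # s) \<longleftrightarrow> btgt a = bsrc b \<and> cmp (b # s)"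
| "cmp _ \<longleftrightarrow> True"

text \<open>Such a sequence is a word broken into its maximal runs; neighbouring entries have
  product zero in the quiver algebra.\<close>

fun good :: "bbasis list \<Rightarrow> bool" where
  "good [] \<longleftrightarrow> True"
| "good [a] \<longleftrightarrow> uw a \<noteq> []"
| "good (a # b # s) \<longleftrightarrow> uw a \<noteq> [] \<and> btgt a = bsrc b \<and> kd a \<noteq> kd b \<and> good (b # s)"

lemma good_append: "good (s @ t) \<longleftrightarrow> good s \<and> good t \<and>
    (s = [] \<or> t = [] \<or> btgt (last s) = bsrc (hd t) \<and> kd (last s) \<noteq> kd (hd t))"
proof (induction s rule: good.induct)
  case (2 a)
  then show ?case by (cases t) auto
qed auto

lemma cmp_append: "cmp (s @ t) \<longleftrightarrow> cmp s \<and> cmp t \<and> (s = [] \<or> t = [] \<or> btgt (last s) = bsrc (hd t))"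
proof (induction s rule: good.induct)
  case (2 a)
  then show ?case by (cases t) auto
qed auto

lemma good_Cons: "good (a # s) \<longleftrightarrow> uw a \<noteq> [] \<and> good s \<and> (s = [] \<or> btgt a = bsrc (hd s) \<and> kd a \<noteq> kd (hd s))"
  using good_append[of "[a]" s] by auto

lemma cmp_Cons: "cmp (a # s) \<longleftrightarrow> cmp s \<and> (s = [] \<or> btgt a = bsrc (hd s))"
  using cmp_append[of "[a]" s] by auto

lemma good_noidem: "good s \<Longrightarrow> b \<in> set s \<Longrightarrow> uw b \<noteq> []"
  by (induction s rule: good.induct) auto

lemma good_cmp: "good s \<Longrightarrow> cmp s"
  by (induction s rule: good.induct) auto

lemma uw_cases: "uw b = [] \<or> (\<exists>n. uw b = replicate (Suc n) (kd b))"
  by (cases b) auto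

lemma uw_replicate: "uw b \<noteq> [] \<Longrightarrow> \<exists>n z. uw b = replicate (Suc n) z"
  by (cases b) auto

lemma uw_eq: "bsrc a = bsrc b \<Longrightarrow> uw a = uw b \<Longrightarrow> a = b"
  by (cases a; cases b) (auto dest: arg_cong[where f = length])

lemma uw_last: "uw b \<noteq> [] \<Longrightarrow> last (uw b) = kd b"
  by (cases b) auto

lemma oth_oth [simp]: "oth (oth v) = v"
  by (cases v) auto

fun vt :: "vtx \<Rightarrow> lt list \<Rightarrow> vtx" where
  "vt v [] = v"
| "vt v (LD # w) = vt v w"
| "vt v (LS # w) = vt (oth v) w"

lemma vt_append: "vt v (u @ w) = vt (vt v u) w"
  by (induction v u rule: vt.induct) auto

lemma vt_LD: "vt v (replicate n LD) = v"
  by (induction n) auto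

lemma vt_LS: "vt v (replicate n LS) = (if even n then v else oth v)"
  by (induction n arbitrary: v) auto

lemma btgt_vt: "btgt b = vt (bsrc b) (uw b)"
  by (cases b) (auto simp: vt_LD vt_LS simp del: replicate_Suc)

lemma cmp_vt: "cmp s \<Longrightarrow> s \<noteq> [] \<Longrightarrow> btgt (last s) = vt (bsrc (hd s)) (wd s)"
  by (induction s rule: cmp.induct) (auto simp: vt_append btgt_vt)

text \<open>Nonzero products add the lengths of runs of the same letter. If a \<open>D\<close> entry
  meets an \<open>S\<close> entry, no basis element spells the mixed word.\<close>

lemma mulB_iff: "mulB a b = {c} \<longleftrightarrow> btgt a = bsrc b \<and> bsrc c = bsrc a \<and> uw c = uw a @ uw b"
proof -
  have r: "replicate n x = replicate m y \<longleftrightarrow> n = m \<and> (n = 0 \<or> x = y)" for n m and x y :: lt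
    by (auto simp: replicate_eq_replicate)
  have rr: "replicate n x @ replicate m x = replicate (n + m) x" for n m and x :: lt
    by (simp add: replicate_add)
  have mix: "replicate (Suc n) x \<noteq> replicate (Suc m) y @ replicate (Suc l) z" if "y \<noteq> z" for n m l and x y z :: lt
    using that by (metis append_is_Nil_conv hd_append2 hd_replicate last_appendR last_replicate nat.simps(3) replicate_empty)
  show ?thesis
  proof (cases a)
    case (Idem v)
    then show ?thesis using uw_eq[of b c] by (cases b) auto
  next
    case (Dp v n)
    show ?thesis
    proof (cases b)
      case (Dp w m)
      show ?thesis using \<open>a = Dp v n\<close> Dp
        by (cases c) (auto simp: rr r simp del: replicate_Suc)
    next
      case (Sw w m)
      show ?thesis using \<open>a = Dp v n\<close> Sw mix[of LD LS _ LD n m] mix[of LD LS _ LS n m]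
        by (cases c) (auto simp del: replicate_Suc)
    qed (use Dp in \<open>cases c; auto simp: r simp del: replicate_Suc\<close>)
  next
    case (Sw v n)
    show ?thesis
    proof (cases b)
      case (Sw w m)
      show ?thesis using \<open>a = Sw v n\<close> Sw
        by (cases c) (auto simp: rr r simp del: replicate_Suc)
    next
      case (Dp w m)
      show ?thesis using \<open>a = Sw v n\<close> Dp mix[of LS LD _ LD n m] mix[of LS LD _ LS n m]
        by (cases c) (auto simp del: replicate_Suc)
    qed (use Sw in \<open>cases c; auto simp: r simp del: replicate_Suc\<close>)
  qed
qed

lemma mulB_mem: "c \<in> mulB a b \<longleftrightarrow> mulB a b = {c}"
  by (induction a b rule: mulB.induct) (auto split: if_splits)

subsection \<open>Disk sequences are disk words\<close>

lemma pair_split: "xs @ c # ys = u @ A # Y # v \<Longrightarrow>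
   (\<exists>v'. xs @ [c] = u @ A # Y # v' \<and> v = v' @ ys) \<or> (\<exists>u'. c # ys = u' @ A # Y # v \<and> u = xs @ u')"
proof (induction xs arbitrary: u)
  case (Cons x xs)
  show ?case
  proof (cases u)
    case Nil
    then show ?thesis using Cons.prems by (cases xs) auto
  next
    case (Cons x' u')
    then show ?thesis using Cons.prems Cons.IH[of u'] by auto
  qed
qed auto

text \<open>A neighbouring unequal pair in a bordered gap lies inside the filling, where the
  hypothesis applies, or the gap is empty and its borders are the pair.\<close>

lemma slot_ins:
  assumes IH: "\<And>u v. tw z a = u @ A # ol A # v \<Longrightarrow> \<exists>a'. tw z a' = u @ A # A # ol A # A # ol A # ol A # v"
    and eq: "z # tw z a @ [ol z] = u @ A # ol A # v"
  shows "\<exists>a'. z # tw z a' @ [ol z] = u @ A # A # ol A # A # ol A # ol A # v"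
proof (cases "a = Lf")
  case True
  then have "u = [] \<and> v = [] \<and> A = z"
    using eq by (cases u; cases "tl u") auto
  then show ?thesis by (auto intro!: exI[of _ "Nd Lf Lf Lf"])
next
  case False
  note a = hd_tw[OF False, of z]
  obtain u' where u: "u = z # u'"
    using eq a by (cases u; cases "tw z a") auto
  then have eq': "tw z a @ [ol z] = u' @ A # ol A # v" using eq by simp
  show ?thesis
  proof (cases v rule: rev_cases)
    case Nil
    then have "tw z a = u' @ [A]" "ol z = ol A" using eq' by (auto simp: append_eq_append_conv2 Cons_eq_append_conv)
    then show ?thesis using a by (metis last_snoc ol_neq(1) ol_ol)
  next
    case (snoc v' x)
    then have "tw z a @ [ol z] = (u' @ A # ol A # v') @ [x]" using eq' by simp
    then have "tw z a = u' @ A # ol A # v'" "x = ol z" by auto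
    from IH[OF this(1)] obtain a' where "tw z a' = u' @ A # A # ol A # A # ol A # ol A # v'" by blast
    then show ?thesis using u snoc \<open>x = ol z\<close> by (intro exI[of _ a']) simp
  qed
qed

text \<open>Every neighbouring unequal pair of a tree word lies in one of the three bordered gaps of
  the root; inserting the shortest disk word there plants a new node.\<close>

lemma tw_ins: "tw z t = u @ A # ol A # v \<Longrightarrow> \<exists>t'. tw z t' = u @ A # A # ol A # A # ol A # ol A # v"
proof (induction t arbitrary: z u v)
  case (Nd a b c)
  have "(z # tw z a) @ ol z # (tw (ol z) b @ z # tw z c @ [ol z]) = u @ A # ol A # v"
    using Nd.prems by simp
  from pair_split[OF this] show ?case
  proof (elim disjE exE conjE)
    fix v' assume "(z # tw z a) @ [ol z] = u @ A # ol A # v'" and v: "v = v' @ tw (ol z) b @ z # tw z c @ [ol z]"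
    then have H: "z # tw z a @ [ol z] = u @ A # ol A # v'" by simp
    have "\<exists>a'. z # tw z a' @ [ol z] = u @ A # A # ol A # A # ol A # ol A # v'"
      by (rule slot_ins[OF _ H]) (erule Nd.IH(1))
    then obtain a' where "z # tw z a' @ [ol z] = u @ A # A # ol A # A # ol A # ol A # v'" ..
    then have "tw z (Nd a' b c) = u @ A # A # ol A # A # ol A # ol A # v"
      unfolding v by (simp flip: append_assoc append_Cons)
    then show ?thesis by blast
  next
    fix u' assume eq: "ol z # tw (ol z) b @ z # tw z c @ [ol z] = u' @ A # ol A # v" and u: "u = (z # tw z a) @ u'"
    have "(ol z # tw (ol z) b) @ z # (tw z c @ [ol z]) = u' @ A # ol A # v" using eq by simp
    from pair_split[OF this] show ?thesis
    proof (elim disjE exE conjE)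
      fix v' assume "(ol z # tw (ol z) b) @ [z] = u' @ A # ol A # v'" and v: "v = v' @ tw z c @ [ol z]"
      then have H: "ol z # tw (ol z) b @ [ol (ol z)] = u' @ A # ol A # v'" by simp
      have "\<exists>b'. ol z # tw (ol z) b' @ [ol (ol z)] = u' @ A # A # ol A # A # ol A # ol A # v'"
        by (rule slot_ins[OF _ H]) (erule Nd.IH(2))
      then obtain b' where "ol z # tw (ol z) b' @ [z] = u' @ A # A # ol A # A # ol A # ol A # v'" by auto
      then have "(ol z # tw (ol z) b' @ [z]) @ tw z c @ [ol z] = u' @ A # A # ol A # A # ol A # ol A # v"
        unfolding v by simp
      then have "tw z (Nd a b' c) = u @ A # A # ol A # A # ol A # ol A # v"
        unfolding u by simp
      then show ?thesis by blast
    next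
      fix u'' assume H: "z # tw z c @ [ol z] = u'' @ A # ol A # v" and u': "u' = (ol z # tw (ol z) b) @ u''"
      have "\<exists>c'. z # tw z c' @ [ol z] = u'' @ A # A # ol A # A # ol A # ol A # v"
        by (rule slot_ins[OF _ H]) (erule Nd.IH(3))
      then obtain c' where "z # tw z c' @ [ol z] = u'' @ A # A # ol A # A # ol A # ol A # v" ..
      then have "tw z (Nd a b c') = u @ A # A # ol A # A # ol A # ol A # v"
        unfolding u u' by simp
      then show ?thesis by blast
    qed
  qed
qed auto

lemma isT_ins: "isT z (u @ A # ol A # v) \<Longrightarrow> isT z (u @ A # A # ol A # A # ol A # ol A # v)"
  using tw_ins unfolding isT_def by (metis append_is_Nil_conv list.distinct(1) tw.simps(1))

lemma isT_base: "isT LD [LD, LS, LD, LS]" "isT LS [LS, LD, LS, LD]"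
  by (auto simp: isT_def intro!: exI[of _ "Nd Lf Lf Lf"])

lemma rotate_base:
  "rotate 2 [a, b, c, d] = [c, d, a, b]" "rotate 3 [a, b, c, d] = [d, a, b, c]"
  by (simp_all add: numeral_2_eq_2 numeral_3_eq_3)

text \<open>On words, all four replacement rules are one operation: A, ol A, A, ol A is inserted
  where a run of \<open>A\<close> meets a run of the other letter.\<close>

lemma disk_good: "disk s \<Longrightarrow> good s \<and> (\<exists>z. isT z (wd s)) \<and> 4 \<le> length s \<and> even (length s)"
proof (induction rule: disk.induct)
  case (base n)
  consider "n = 0" | "n = 1" | "n = 2" | "n = 3" using base by linarith
  then show ?case
    using isT_base by cases (auto simp: rotate_base)
next
  case (r1 p k l s)
  have "isT z ((wd p @ replicate k LD) @ LD # ol LD # (replicate l LS @ wd s)) \<longleftrightarrow> isT z (wd (p @ [Dp Bl k, Sw Bl l] @ s))" for z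
    by (simp add: replicate_app_Cons_same)
  then obtain z where "isT z ((wd p @ replicate k LD) @ LD # ol LD # (replicate l LS @ wd s))"
    using r1.IH by blast
  from isT_ins[OF this] have "isT z (wd (p @ [Dp Bl (Suc k), Sw Bl 0, Dp Wh 0, Sw Wh (Suc l)] @ s))"
    by (simp add: replicate_app_Cons_same)
  then show ?case using r1.IH by (auto simp: good_append good_Cons)
next
  case (r2 p k l s)
  have "isT z ((wd p @ replicate k LD) @ LD # ol LD # (replicate l LS @ wd s)) \<longleftrightarrow> isT z (wd (p @ [Dp Wh k, Sw Wh l] @ s))" for z
    by (simp add: replicate_app_Cons_same)
  then obtain z where "isT z ((wd p @ replicate k LD) @ LD # ol LD # (replicate l LS @ wd s))"
    using r2.IH by blast
  from isT_ins[OF this] have "isT z (wd (p @ [Dp Wh (Suc k), Sw Wh 0, Dp Bl 0, Sw Bl (Suc l)] @ s))"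
    by (simp add: replicate_app_Cons_same)
  then show ?case using r2.IH by (auto simp: good_append good_Cons)
next
  case (r3 v k p l s)
  have "isT z ((wd p @ replicate k LS) @ LS # ol LS # (replicate l LD @ wd s)) \<longleftrightarrow> isT z (wd (p @ [Sw v k, Dp Bl l] @ s))" for z
    by (simp add: replicate_app_Cons_same)
  then obtain z where "isT z ((wd p @ replicate k LS) @ LS # ol LS # (replicate l LD @ wd s))"
    using r3.IH by blast
  from isT_ins[OF this] have "isT z (wd (p @ [Sw v (Suc k), Dp Wh 0, Sw Wh 0, Dp Bl (Suc l)] @ s))"
    by (simp add: replicate_app_Cons_same)
  then show ?case using r3 by (cases v) (auto simp: good_append good_Cons split: if_splits)
next
  case (r4 v k p l s)
  have "isT z ((wd p @ replicate k LS) @ LS # ol LS # (replicate l LD @ wd s)) \<longleftrightarrow> isT z (wd (p @ [Sw v k, Dp Wh l] @ s))" for z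
    by (simp add: replicate_app_Cons_same)
  then obtain z where "isT z ((wd p @ replicate k LS) @ LS # ol LS # (replicate l LD @ wd s))"
    using r4.IH by blast
  from isT_ins[OF this] have "isT z (wd (p @ [Sw v (Suc k), Dp Bl 0, Sw Bl 0, Dp Wh (Suc l)] @ s))"
    by (simp add: replicate_app_Cons_same)
  then show ?case using r4 by (cases v) (auto simp: good_append good_Cons split: if_splits)
qed

text \<open>The first entry is the maximal initial run, recovered by \<open>takeWhile\<close>, and
  its vertex is prescribed; composability then fixes the starting vertex of the remaining
  entries.\<close>

lemma good_inj:
  "good s \<Longrightarrow> good t \<Longrightarrow> wd s = wd t \<Longrightarrow> (s \<noteq> [] \<Longrightarrow> t \<noteq> [] \<Longrightarrow> bsrc (hd s) = bsrc (hd t)) \<Longrightarrow> s = t"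
proof (induction s arbitrary: t)
  case Nil
  then show ?case by (cases t) (auto simp: good_Cons)
next
  case (Cons a s)
  then obtain b t' where t: "t = b # t'" by (cases t) (auto simp: good_Cons)
  obtain n where n: "uw a = replicate (Suc n) (kd a)" using Cons.prems uw_cases[of a] by (auto simp: good_Cons)
  obtain m where m: "uw b = replicate (Suc m) (kd b)" using Cons.prems t uw_cases[of b] by (auto simp: good_Cons)
  have eq: "uw a @ wd s = uw b @ wd t'" using Cons.prems t by simp
  have "uw a \<noteq> []" "uw b \<noteq> []" using Cons.prems t by (auto simp: good_Cons)
  then have k: "kd a = kd b" using eq by (metis hd_append2)
  have hs: "wd s = [] \<or> hd (wd s) \<noteq> kd a"
    using Cons.prems by (cases s) (auto simp: good_Cons)
  have ht: "wd t' = [] \<or> hd (wd t') \<noteq> kd a"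
    using Cons.prems t k by (cases t') (auto simp: good_Cons)
  have tk: "takeWhile (\<lambda>x. x = c) (replicate n c @ w) = replicate n c" if "w = [] \<or> hd w \<noteq> c" for n w and c :: lt
    using that by (induction n) (cases w; auto)+
  have "uw a = uw b"
    using arg_cong[OF eq, of "takeWhile (\<lambda>x. x = kd a)"] tk[OF hs, of "Suc n"] tk[OF ht, of "Suc m"] n m k
    by metis
  moreover have "bsrc a = bsrc b" using Cons.prems t by simp
  ultimately have ab: "a = b" by (rule uw_eq[rotated])
  have "s = t'"
    by (rule Cons.IH) (use Cons.prems t eq ab in \<open>auto simp: good_Cons\<close>)
  then show ?case using t ab by simp
qed

text \<open>Each entry spells a run, so a change of letter in the word sits between two consecutive
  entries.\<close>

lemma good_pair:
  "good s \<Longrightarrow> wd s = u @ A # ol A # v \<Longrightarrow>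
   \<exists>p a b q k l. s = p @ [a, b] @ q \<and> uw a = replicate (Suc k) A \<and> uw b = replicate (Suc l) (ol A) \<and>
     u = wd p @ replicate k A \<and> v = replicate l (ol A) @ wd q"
proof (induction s arbitrary: u)
  case (Cons a s)
  obtain n where n: "uw a = replicate (Suc n) (kd a)" using Cons.prems uw_cases[of a] by (auto simp: good_Cons)
  have eq: "replicate (Suc n) (kd a) @ wd s = u @ A # ol A # v" using Cons.prems n by simp
  consider "length u < n" | "length u = n" | "length u > n" by linarith
  then show ?case
  proof cases
    case 1
    have "(replicate (Suc n) (kd a) @ wd s) ! length u = A" "(replicate (Suc n) (kd a) @ wd s) ! Suc (length u) = ol A"
      unfolding eq by (simp_all add: nth_append)
    then have "kd a = A" "kd a = ol A" using 1 by (simp_all add: nth_append del: replicate_Suc)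
    then show ?thesis by simp
  next
    case 2
    have "replicate n (kd a) @ kd a # wd s = u @ A # ol A # v" using eq by (simp add: replicate_app_Cons_same)
    then have u: "u = replicate n (kd a)" "A = kd a" "wd s = ol A # v" using 2 by auto
    then obtain b q where s: "s = b # q" by (cases s) auto
    obtain m z where m: "uw b = replicate (Suc m) z" using Cons.prems s uw_replicate[of b] by (auto simp: good_Cons)
    then have "z = ol A" "v = replicate m z @ wd q" using u s by auto
    then show ?thesis using u s n m by (intro exI[of _ "[]"] exI[of _ a] exI[of _ b] exI[of _ q] exI[of _ n] exI[of _ m]) simp
  next
    case 3
    then obtain u' where u: "u = replicate (Suc n) (kd a) @ u'"
      using eq by (metis append_eq_append_conv_if length_replicate not_less_eq_eq not_le Suc_leI append_take_drop_id)
    then have "wd s = u' @ A # ol A # v" using eq by simp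
    moreover have "good s" using Cons.prems by (simp add: good_Cons)
    ultimately obtain p a' b q k l where "s = p @ [a', b] @ q" "uw a' = replicate (Suc k) A"
      "uw b = replicate (Suc l) (ol A)" "u' = wd p @ replicate k A" "v = replicate l (ol A) @ wd q"
      using Cons.IH by blast
    then show ?thesis using u n
      by (intro exI[of _ "a # p"] exI[of _ a'] exI[of _ b] exI[of _ q] exI[of _ k] exI[of _ l]) simp
  qed
qed simp

definition dword :: "vtx \<Rightarrow> lt list \<Rightarrow> bool" where
  "dword v w \<longleftrightarrow> (\<exists>s. disk s \<and> bsrc (hd s) = v \<and> wd s = w)"

lemma dword_ins:
  assumes "dword v0 (u @ A # ol A # v)"
  shows "dword v0 (u @ A # A # ol A # A # ol A # ol A # v)"
proof -
  obtain s where s: "disk s" "bsrc (hd s) = v0" "wd s = u @ A # ol A # v"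
    using assms by (auto simp: dword_def)
  have "good s" using disk_good[OF s(1)] by simp
  from good_pair[OF this s(3)] obtain p a b q k l where
    e: "s = p @ [a, b] @ q" "uw a = replicate (Suc k) A" "uw b = replicate (Suc l) (ol A)"
      "u = wd p @ replicate k A" "v = replicate l (ol A) @ wd q"
    by blast
  have ab: "btgt a = bsrc b" using \<open>good s\<close> e(1) by (simp add: good_append)
  show ?thesis
  proof (cases A)
    case LD
    obtain w where a: "a = Dp w k" using e(2) LD by (cases a) (auto dest: arg_cong[of _ _ length])
    have b: "b = Sw w l" using e(3) LD ab a by (cases b) (auto dest: arg_cong[of _ _ length])
    let ?t = "p @ [Dp w (Suc k), Sw w 0, Dp (oth w) 0, Sw (oth w) (Suc l)] @ q"
    have "disk ?t" using s(1) disk.r1[of p k l q] disk.r2[of p k l q] by (cases w) (auto simp: e(1) a b)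
    moreover have "bsrc (hd ?t) = v0" using s(2) e(1) a by (cases p) auto
    moreover have "wd ?t = u @ A # A # ol A # A # ol A # ol A # v"
      unfolding e(4,5) LD by (simp add: replicate_app_Cons_same)
    ultimately show ?thesis by (auto simp: dword_def)
  next
    case LS
    obtain w where a: "a = Sw w k" using e(2) LS by (cases a) (auto dest: arg_cong[of _ _ length])
    obtain x where b: "b = Dp x l" "btgt a = x" using e(3) LS ab by (cases b) (auto dest: arg_cong[of _ _ length])
    let ?t = "p @ [Sw w (Suc k), Dp (oth x) 0, Sw (oth x) 0, Dp x (Suc l)] @ q"
    have "disk ?t" using s(1) disk.r3[of w k p l q] disk.r4[of w k p l q] b(2) by (cases x) (auto simp: e(1) a b)
    moreover have "bsrc (hd ?t) = v0" using s(2) e(1) a by (cases p) auto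
    moreover have "wd ?t = u @ A # A # ol A # A # ol A # ol A # v"
      unfolding e(4,5) LS by (simp add: replicate_app_Cons_same)
    ultimately show ?thesis by (auto simp: dword_def)
  qed
qed

text \<open>The four rotations of the base sequence realise both starting letters at both
  vertices.\<close>

lemma dword_base: "dword v [z, ol z, z, ol z]"
proof -
  have "dword v [z, ol z, z, ol z]" if "n < 4" "bsrc (hd (rotate n [Sw Wh 0, Dp Bl 0, Sw Bl 0, Dp Wh 0])) = v"
     "wd (rotate n [Sw Wh 0, Dp Bl 0, Sw Bl 0, Dp Wh 0]) = [z, ol z, z, ol z]" for n
    using disk.base[OF that(1)] that by (auto simp: dword_def)
  from this[of 0] this[of 1] this[of 2] this[of 3] show ?thesis
    by (cases v; cases z) (simp_all add: rotate_base)
qed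

text \<open>A node is grown by one replacement, which opens three empty gaps; these are then filled
  from left to right.\<close>

lemma dword_fill: "dword v0 (u @ z # ol z # v) \<Longrightarrow> dword v0 (u @ z # tw z t @ ol z # v)"
proof (induction t arbitrary: u z v)
  case (Nd a b c)
  have "dword v0 ((u @ [z]) @ z # ol z # (z # ol z # ol z # v))"
    using dword_ins[OF Nd.prems] by simp
  from Nd.IH(1)[OF this] have "dword v0 ((u @ [z] @ z # tw z a) @ ol z # ol (ol z) # (ol z # ol z # v))"
    by simp
  from Nd.IH(2)[OF this] have "dword v0 ((u @ [z] @ z # tw z a @ ol z # tw (ol z) b) @ z # ol z # (ol z # v))"
    by simp
  from Nd.IH(3)[OF this] show ?case by simp
qed simp

lemma isT_dword: "isT z w \<Longrightarrow> dword v w"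
proof -
  assume "isT z w"
  then obtain t where "t \<noteq> Lf" "w = tw z t" by (auto simp: isT_def)
  then obtain a b c where w: "w = tw z (Nd a b c)" by (cases t) auto
  have "dword v ([] @ z # ol z # [z, ol z])" using dword_base[of v z] by simp
  from dword_fill[OF this, of a] have "dword v ((z # tw z a) @ ol z # ol (ol z) # [ol z])" by simp
  from dword_fill[OF this, of b] have "dword v ((z # tw z a @ ol z # tw (ol z) b) @ z # ol z # [])" by simp
  from dword_fill[OF this, of c] show ?thesis by (simp add: w)
qed

text \<open>Conversely, the replacement rules generate some disk sequence with the same word and
  starting vertex, and \<open>good_inj\<close> identifies it with \<open>s\<close>.\<close>

lemma disk_iff: "disk s \<longleftrightarrow> good s \<and> (\<exists>z. isT z (wd s))"
proof
  assume s: "good s \<and> (\<exists>z. isT z (wd s))"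
  then obtain z where z: "isT z (wd s)" by blast
  then have "s \<noteq> []" using isT_hd[of z "wd s"] by auto
  from isT_dword[OF z, of "bsrc (hd s)"] obtain t where t: "disk t" "bsrc (hd t) = bsrc (hd s)" "wd t = wd s"
    by (auto simp: dword_def)
  have "t = s" by (rule good_inj) (use t s disk_good[OF t(1)] in auto)
  then show "disk s" using t by simp
qed (use disk_good in blast)

section \<open>The higher products of the quiver algebra in terms of words\<close>

text \<open>A disk word is an initial part of the word of \<open>u\<close>, and \<open>b\<close> is
  what remains of the last entry. In \<open>sufb\<close> the disk word is a final part and
  \<open>b\<close> remains of the first entry.\<close>

definition preb :: "bbasis list \<Rightarrow> bbasis \<Rightarrow> bool" where
  "preb u b \<longleftrightarrow> (\<exists>a. disk (butlast u @ [a]) \<and> mulB a b = {last u})"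

definition sufb :: "bbasis list \<Rightarrow> bbasis \<Rightarrow> bool" where
  "sufb u b \<longleftrightarrow> (\<exists>a. disk (a # tl u) \<and> mulB b a = {hd u})"

lemma in_uw: "x \<in> set (uw c) \<Longrightarrow> x = kd c"
  by (cases c) (auto split: if_splits)

lemma kd_append:
  assumes "uw c = uw a @ uw b"
  shows "uw a \<noteq> [] \<Longrightarrow> kd a = kd c" "uw b \<noteq> [] \<Longrightarrow> kd b = kd c"
proof -
  show "uw a \<noteq> [] \<Longrightarrow> kd a = kd c" by (simp add: assms)
  show "uw b \<noteq> [] \<Longrightarrow> kd b = kd c" using in_uw[of "kd b" c] assms by simp
qed

lemma isT_vt: "isT z w \<Longrightarrow> vt v w = v"
proof -
  have "vt v (tw z t) = v" for t
  proof (induction t arbitrary: z v)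
    case (Nd a b c)
    then show ?case by (cases z) (simp_all add: vt_append)
  qed simp
  then show "isT z w \<Longrightarrow> vt v w = v" by (auto simp: isT_def)
qed

lemma disk_ends: "disk s \<Longrightarrow> btgt (last s) = bsrc (hd s)"
proof -
  assume s: "disk s"
  then obtain z where "isT z (wd s)" using disk_good by blast
  moreover have "cmp s" "s \<noteq> []" using disk_good[OF s] good_cmp by auto
  ultimately show ?thesis using cmp_vt[of s] isT_vt by simp
qed

lemma preb_D:
  assumes "preb u b"
  obtains t c a where "u = t @ [c]" "disk (t @ [a])" "btgt a = bsrc b" "bsrc c = bsrc a" "uw c = uw a @ uw b"
    "uw a \<noteq> []" "good u" "4 \<le> length u" "even (length u)" "bsrc b = bsrc (hd u)" "btgt b = btgt (last u)"
proof -
  obtain a where a: "disk (butlast u @ [a])" "mulB a b = {last u}"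
    using assms by (auto simp: preb_def)
  have "u \<noteq> []" using disk_good[OF a(1)] by auto
  then obtain t c where u: "u = t @ [c]" by (cases u rule: rev_cases) auto
  have d: "disk (t @ [a])" using a u by simp
  note g = disk_good[OF d]
  have m: "btgt a = bsrc b" "bsrc c = bsrc a" "uw c = uw a @ uw b"
    using a(2) by (auto simp: mulB_iff u)
  have na: "uw a \<noteq> []" using g by (auto simp: good_append)
  have k: "kd c = kd a" using m na by simp
  have gu: "good u" using g m na k unfolding u by (auto simp: good_append)
  have s: "bsrc b = bsrc (hd u)"
    using disk_ends[OF d] m(1,2) unfolding u by (cases t) simp_all
  have t: "btgt b = btgt (last u)"
    using m by (simp add: btgt_vt vt_append u)
  have l: "4 \<le> length u" "even (length u)"
    using g by (simp_all add: u)
  show ?thesis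
    by (rule that[OF u d m na gu l s t])
qed

lemma sufb_D:
  assumes "sufb u b"
  obtains t c a where "u = c # t" "disk (a # t)" "btgt b = bsrc a" "bsrc c = bsrc b" "uw c = uw b @ uw a"
    "uw a \<noteq> []" "good u" "4 \<le> length u" "even (length u)" "bsrc b = bsrc (hd u)" "btgt b = btgt (last u)"
proof -
  obtain a where a: "disk (a # tl u)" "mulB b a = {hd u}"
    using assms by (auto simp: sufb_def)
  have "u \<noteq> []" using disk_good[OF a(1)] by auto
  then obtain c t where u: "u = c # t" by (cases u) auto
  have d: "disk (a # t)" using a u by simp
  note g = disk_good[OF d]
  have m: "btgt b = bsrc a" "bsrc c = bsrc b" "uw c = uw b @ uw a"
    using a(2) by (auto simp: mulB_iff u)
  have na: "uw a \<noteq> []" using g by (auto simp: good_Cons)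
  have t: "btgt c = btgt a" using m by (simp add: btgt_vt vt_append)
  have k: "kd c = kd a" using kd_append(2)[OF m(3) na] by simp
  have gu: "good u" using g m na k t unfolding u by (auto simp: good_Cons)
  have "t \<noteq> []" using g by auto
  then have s: "btgt b = btgt (last u)"
    using disk_ends[OF d] m(1) by (simp add: u)
  have l: "4 \<le> length u" "even (length u)"
    using g by (simp_all add: u)
  have h: "bsrc b = bsrc (hd u)" using m by (simp add: u)
  show ?thesis
    by (rule that[OF u d m na gu l h s])
qed

text \<open>Disk sequences have even length at least four, so the arity conditions of
  \<open>muBinf\<close> hold automatically and the three sources of an output can be listed side by
  side.\<close>

lemma muBinf_iff:
  "b \<in> muBinf u \<longleftrightarrow> (\<exists>x y. u = [x, y] \<and> mulB x y = {b}) \<or> preb u b \<or> sufb u b"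
proof (cases "length u = 2")
  case True
  then obtain x y where u: "u = [x, y]" by (cases u; cases "tl u") auto
  have "\<not> preb u b" "\<not> sufb u b"
    using True by (auto elim!: preb_D sufb_D)
  then show ?thesis using mulB_mem by (auto simp: muBinf_def u)
next
  case False
  then show ?thesis
    by (auto simp: muBinf_def preb_def[symmetric] sufb_def[symmetric] elim: preb_D sufb_D)
qed

lemma muBinf_ends:
  assumes "b \<in> muBinf u"
  shows "u \<noteq> []" "cmp u" "bsrc b = bsrc (hd u)" "btgt b = btgt (last u)"
proof -
  have "u \<noteq> [] \<and> cmp u \<and> bsrc b = bsrc (hd u) \<and> btgt b = btgt (last u)"
    using assms unfolding muBinf_iff
  proof (elim disjE exE conjE)
    fix x y assume "u = [x, y]" "mulB x y = {b}"
    then show ?thesis by (auto simp: mulB_iff btgt_vt[of b] vt_append) (auto simp: btgt_vt)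
  qed (auto elim!: preb_D sufb_D dest: good_cmp)
  then show "u \<noteq> []" "cmp u" "bsrc b = bsrc (hd u)" "btgt b = btgt (last u)" by auto
qed

text \<open>An output never spells a longer word than the inputs, and only finitely many basis
  elements have bounded length.\<close>

lemma finite_muBinf: "finite (muBinf u)"
proof -
  have "muBinf u \<subseteq> {b. length (uw b) \<le> length (wd u)}"
  proof
    fix b assume "b \<in> muBinf u"
    then show "b \<in> {b. length (uw b) \<le> length (wd u)}"
      unfolding muBinf_iff by (auto simp: mulB_iff elim!: preb_D sufb_D)
  qed
  moreover have "{b. length (uw b) \<le> n} \<subseteq> Idem ` {Wh, Bl} \<union> (\<lambda>(v, k). Dp v k) ` ({Wh, Bl} \<times> {..n}) \<union>
      (\<lambda>(v, k). Sw v k) ` ({Wh, Bl} \<times> {..n})" for n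
  proof
    fix b assume b: "b \<in> {b. length (uw b) \<le> n}"
    have v: "v \<in> {Wh, Bl}" for v by (cases v) auto
    show "b \<in> Idem ` {Wh, Bl} \<union> (\<lambda>(v, k). Dp v k) ` ({Wh, Bl} \<times> {..n}) \<union>
      (\<lambda>(v, k). Sw v k) ` ({Wh, Bl} \<times> {..n})"
      using b v by (cases b) (auto simp: image_iff)
  qed
  then have "finite {b. length (uw b) \<le> n}" for n
    by (rule finite_subset) auto
  ultimately show ?thesis by (rule finite_subset)
qed

lemma letter_ex: "\<exists>a. bsrc a = v \<and> uw a = replicate (Suc n) z"
  by (cases z) (metis bsrc.simps uw.simps)+

text \<open>Entries are maximal runs, so a cut between two equal letters falls strictly inside one
  entry, which factors there.\<close>

lemma good_cut:
  "good s \<Longrightarrow> wd s = w1 @ w2 \<Longrightarrow> w1 \<noteq> [] \<Longrightarrow> w2 \<noteq> [] \<Longrightarrow> last w1 = hd w2 \<Longrightarrow>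
   \<exists>s1 c s2 a b. s = s1 @ c # s2 \<and> mulB a b = {c} \<and> uw a \<noteq> [] \<and> uw b \<noteq> [] \<and> w1 = wd s1 @ uw a \<and> w2 = uw b @ wd s2"
proof (induction s arbitrary: w1)
  case (Cons c s)
  obtain n z where n: "uw c = replicate (Suc n) z" using Cons.prems uw_replicate[of c] by (auto simp: good_Cons)
  have eq: "replicate (Suc n) z @ wd s = w1 @ w2" using Cons.prems n by simp
  consider "length w1 \<le> n" | "length w1 = Suc n" | "length w1 > Suc n" by linarith
  then show ?case
  proof cases
    case 1
    obtain k where k: "length w1 = Suc k" using Cons.prems by (cases w1) auto
    have kn: "Suc k \<le> Suc n" "Suc n - Suc k = Suc (n - Suc k)" using 1 k by linarith+
    have "w1 = take (length w1) (w1 @ w2)" by simp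
    also have "\<dots> = take (Suc k) (replicate (Suc n) z) @ take (Suc k - Suc n) (wd s)"
      by (simp only: k eq[symmetric] take_append length_replicate)
    also have "\<dots> = replicate (Suc k) z"
      by (simp only: take_replicate min.absorb1[OF kn(1)] diff_is_0_eq[THEN iffD2, OF kn(1)] take_0 append_Nil2)
    finally have w1: "w1 = replicate (Suc k) z" .
    have "w2 = drop (length w1) (w1 @ w2)" by simp
    also have "\<dots> = drop (Suc k) (replicate (Suc n) z) @ drop (Suc k - Suc n) (wd s)"
      by (simp only: k eq[symmetric] drop_append length_replicate)
    also have "\<dots> = replicate (Suc (n - Suc k)) z @ wd s"
      by (simp only: drop_replicate kn(2) diff_is_0_eq[THEN iffD2, OF kn(1)] drop_0)
    finally have w2: "w2 = replicate (Suc (n - Suc k)) z @ wd s" .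
    obtain a where a: "bsrc a = bsrc c" "uw a = replicate (Suc k) z" using letter_ex by blast
    obtain b where b: "bsrc b = btgt a" "uw b = replicate (Suc (n - Suc k)) z" using letter_ex by blast
    have "uw c = uw a @ uw b"
      unfolding n a b replicate_add[symmetric] using 1 k by simp
    then have "mulB a b = {c}" using a b by (simp add: mulB_iff)
    then show ?thesis
      by (intro exI[of _ "[]"] exI[of _ c] exI[of _ s] exI[of _ a] exI[of _ b]) (simp add: a(2) b(2) w1 w2)
  next
    case 2
    then have w: "replicate (Suc n) z = w1" "wd s = w2"
      using eq append_eq_append_conv[of "replicate (Suc n) z" w1 "wd s" w2] by (simp_all del: replicate_Suc)
    then obtain b q where bq: "s = b # q" using Cons.prems by (cases s) auto
    have "kd b \<noteq> kd c" "uw b \<noteq> []" using Cons.prems(1) bq by (auto simp: good_Cons)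
    moreover have "hd w2 = kd b" using w(2) bq \<open>uw b \<noteq> []\<close> by auto
    moreover have "last w1 = z" using w(1)[symmetric] by (simp del: replicate_Suc)
    moreover have "kd c = z" using n by simp
    ultimately show ?thesis using Cons.prems(5) by simp
  next
    case 3
    have "replicate (Suc n) z @ wd s = take (Suc n) w1 @ (drop (Suc n) w1 @ w2)"
      using eq by (simp only: append_assoc[symmetric] append_take_drop_id)
    moreover have "length (replicate (Suc n) z) = length (take (Suc n) w1)"
      using 3 by (simp del: replicate_Suc)
    ultimately have "replicate (Suc n) z = take (Suc n) w1"
      using append_eq_append_conv by blast
    then have w: "w1 = replicate (Suc n) z @ drop (Suc n) w1" "drop (Suc n) w1 \<noteq> []"
      using 3 by (simp_all del: replicate_Suc)
    define w' where "w' = drop (Suc n) w1"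
    note w = w[folded w'_def]
    have 1: "good s" using Cons.prems(1) by (simp add: good_Cons)
    have 2: "wd s = w' @ w2" using eq unfolding w(1) append_assoc same_append_eq .
    have 3: "last w' = hd w2" using Cons.prems(5) w(2) unfolding w(1) by simp
    from Cons.IH[OF 1 2 w(2) Cons.prems(4) 3]
    obtain s1 c' s2 a b where "s = s1 @ c' # s2" "mulB a b = {c'}" "uw a \<noteq> []" "uw b \<noteq> []"
      "w' = wd s1 @ uw a" "w2 = uw b @ wd s2" by blast
    then show ?thesis using w(1) n
      by (intro exI[of _ "c # s1"] exI[of _ c'] exI[of _ s2] exI[of _ a] exI[of _ b]) simp
  qed
qed simp

lemma length_wd_mono: "i \<le> j \<Longrightarrow> length (wd (take i s)) \<le> length (wd (take j s))"
proof -
  assume "i \<le> j"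
  then have "take j s = take i s @ take (j - i) (drop i s)"
    by (metis le_add_diff_inverse take_add)
  then show ?thesis by simp
qed

text \<open>A disk product at the beginning with a nontrivial remainder \<open>b\<close> corresponds
  to an initial disk word ending inside a run. The bijection \<open>g\<close> sends it to the length
  of the deleted disk word.\<close>

lemma prefix_sum:
  assumes s: "good s"
  shows "(\<Sum>(j, b) \<in> {(j, b). j \<le> length s \<and> preb (take j s) b \<and> uw b \<noteq> []}. f (wd (b # drop j s))) =
    (\<Sum>i\<le>length (wd s). if (\<exists>x. isT x (take i (wd s))) \<and> drop i (wd s) \<noteq> [] \<and>
       hd (drop i (wd s)) = last (take i (wd s)) then f (drop i (wd s)) else (0 :: 'm::comm_monoid_add))"
proof -
  let ?w = "wd s"
  let ?A = "{(j, b). j \<le> length s \<and> preb (take j s) b \<and> uw b \<noteq> []}"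
  let ?C = "\<lambda>i. (\<exists>x. isT x (take i ?w)) \<and> drop i ?w \<noteq> [] \<and> hd (drop i ?w) = last (take i ?w)"
  let ?I = "{i. i \<le> length ?w \<and> ?C i}"
  define g where "g = (\<lambda>(j, b). length (wd (take j s)) - length (uw b))"
  have A: "\<exists>t c a. take j s = t @ [c] \<and> disk (t @ [a]) \<and> uw c = uw a @ uw b \<and> uw a \<noteq> [] \<and> uw b \<noteq> [] \<and>
      bsrc b = bsrc (hd s) \<and> g (j, b) = length (wd (t @ [a])) \<and> take (g (j, b)) ?w = wd (t @ [a]) \<and>
      drop (g (j, b)) ?w = wd (b # drop j s) \<and> j = Suc (length t)"
    if "(j, b) \<in> ?A" for j b
  proof -
    have "preb (take j s) b" and j: "j \<le> length s" and b: "uw b \<noteq> []" using that by auto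
    then obtain t c a where 1: "take j s = t @ [c]" "disk (t @ [a])" "uw c = uw a @ uw b" "uw a \<noteq> []"
      "bsrc b = bsrc (hd (take j s))" by (elim preb_D) blast
    have "take j s @ drop j s = s" by (rule append_take_drop_id)
    then have "wd (take j s @ drop j s) = ?w" by (rule arg_cong)
    then have w: "?w = wd (t @ [a]) @ wd (b # drop j s)"
      unfolding 1(1) by (simp add: 1(3))
    have g: "g (j, b) = length (wd (t @ [a]))" by (simp add: g_def 1)
    have "length (take j s) = Suc (length t)" by (simp add: 1)
    then have jt: "j = Suc (length t)" using j by simp
    have hs: "bsrc b = bsrc (hd s)" using 1(5) jt by (cases s) auto
    have tk: "take (g (j, b)) ?w = wd (t @ [a])" "drop (g (j, b)) ?w = wd (b # drop j s)"
      unfolding g w by simp_all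
    show ?thesis using 1(1-4) b g tk hs jt by blast
  qed
  have "bij_betw g ?A ?I"
    unfolding bij_betw_def
  proof (intro conjI inj_onI equalityI subsetI)
    fix x y assume xy: "x \<in> ?A" "y \<in> ?A" "g x = g y"
    obtain j b j' b' where xy': "x = (j, b)" "y = (j', b')" by (cases x; cases y) auto
    obtain t c a where 1: "take j s = t @ [c]" "uw c = uw a @ uw b" "uw a \<noteq> []" "uw b \<noteq> []" "bsrc b = bsrc (hd s)"
      "g (j, b) = length (wd (t @ [a]))" "drop (g (j, b)) ?w = wd (b # drop j s)" "j = Suc (length t)"
      using A[of j b] xy xy' by blast
    obtain t' c' a' where 2: "take j' s = t' @ [c']" "uw c' = uw a' @ uw b'" "uw a' \<noteq> []" "uw b' \<noteq> []" "bsrc b' = bsrc (hd s)"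
      "g (j', b') = length (wd (t' @ [a']))" "drop (g (j', b')) ?w = wd (b' # drop j' s)" "j' = Suc (length t')"
      using A[of j' b'] xy xy' by blast
    have t: "t = take (length t) s" "t' = take (length t') s"
      using arg_cong[OF 1(1), of "take (length t)"] arg_cong[OF 2(1), of "take (length t')"] 1(8) 2(8) by auto
    have l: "length (wd (take j s)) = g (j, b) + length (uw b)" "length (wd (take j' s)) = g (j', b') + length (uw b')"
      using 1 2 by simp_all
    have pos: "0 < length (uw a)" "0 < length (uw a')" using 1(3) 2(3) by simp_all
    have e1: "g (j, b) = g (j', b')" using xy(3) by (simp only: xy')
    have e2: "g (j, b) = length (wd t) + length (uw a)" "g (j', b') = length (wd t') + length (uw a')"
      unfolding 1(6) 2(6) by simp_all
    note e = e1 e2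
    \<comment> \<open>If the two blocks ended at different entries, the shorter block would lie
      before the last entry of the longer one. The disk word of the longer block reaches into that
      entry by the nonempty \<open>a\<close>, so the two disk words could not have equal
      length.\<close>
    have jj: "j = j'"
    proof (rule ccontr)
      assume "j \<noteq> j'"
      then consider "j \<le> length t'" | "j' \<le> length t" using 1(8) 2(8) by linarith
      then show False
      proof cases
        case 1
        then have "length (wd (take j s)) \<le> length (wd t')" using length_wd_mono[of j "length t'" s] t by simp
        then show False using l pos e by linarith
      next
        case 2
        then have "length (wd (take j' s)) \<le> length (wd t)" using length_wd_mono[of j' "length t" s] t by simp
        then show False using l pos e by linarith
      qed
    qed
    have "wd (b # drop j s) = drop (g (j, b)) ?w" by (rule 1(7)[symmetric])
    also have "\<dots> = drop (g (j', b')) ?w" by (simp only: e(1))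
    also have "\<dots> = wd (b' # drop j' s)" by (rule 2(7))
    finally have "uw b = uw b'" by (simp add: jj)
    then have "b = b'" using 1(5) 2(5) uw_eq by simp
    then show "x = y" using jj xy' by simp
  next
    fix i assume "i \<in> g ` ?A"
    then obtain j b where jb: "(j, b) \<in> ?A" "i = g (j, b)" by auto
    from A[OF jb(1)] obtain t c a where 1: "disk (t @ [a])" "uw c = uw a @ uw b" "uw a \<noteq> []" "uw b \<noteq> []"
      "take (g (j, b)) ?w = wd (t @ [a])" "drop (g (j, b)) ?w = wd (b # drop j s)"
      by blast
    note tk = 1(5,6)[folded jb(2)]
    have T: "\<exists>x. isT x (take i ?w)" using disk_good[OF 1(1)] unfolding tk by blast
    have k: "kd b = kd a" using kd_append[OF 1(2)] 1(3,4) by simp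
    have dn: "drop i ?w \<noteq> []" unfolding tk using 1(4) by simp
    have "hd (drop i ?w) = kd b" unfolding tk using 1(4) by simp
    moreover have "last (take i ?w) = kd a" unfolding tk using 1(3) uw_last[of a] by simp
    ultimately have hl: "hd (drop i ?w) = last (take i ?w)" using k by (simp only:)
    have le: "i \<le> length ?w" using dn by simp
    show "i \<in> ?I" by (intro CollectI conjI le T dn hl)
  next
    fix i assume "i \<in> ?I"
    then have i: "i \<le> length ?w" and T: "\<exists>x. isT x (take i ?w)" and dn: "drop i ?w \<noteq> []"
      and hl: "hd (drop i ?w) = last (take i ?w)" by blast+
    from T obtain x where x: "isT x (take i ?w)" by blast
    have tn: "take i ?w \<noteq> []" using isT_hd[OF x] by blast
    from good_cut[OF s append_take_drop_id[symmetric] tn dn hl[symmetric]] obtain s1 c s2 a b where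
      1: "s = s1 @ c # s2" "mulB a b = {c}" "uw a \<noteq> []" "uw b \<noteq> []" "take i ?w = wd s1 @ uw a" "drop i ?w = uw b @ wd s2"
      by blast
    have m: "btgt a = bsrc b" "bsrc c = bsrc a" "uw c = uw a @ uw b" using 1(2) by (auto simp: mulB_iff)
    have "good (s1 @ [c])" using s 1(1) by (auto simp: good_append good_Cons)
    then have "good (s1 @ [a])" using m 1(3) by (auto simp: good_append)
    moreover have "isT x (wd (s1 @ [a]))" using x unfolding 1(5) by simp
    ultimately have "disk (s1 @ [a])" using disk_iff by blast
    then have "preb (take (Suc (length s1)) s) b" using 1(2) unfolding preb_def 1(1) by auto
    then have mem: "(Suc (length s1), b) \<in> ?A" using 1(1,4) by simp
    have gi: "g (Suc (length s1), b) = i"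
    proof -
      have "i = length (take i ?w)" using i by simp
      also have "\<dots> = length (wd s1 @ uw a)" unfolding 1(5) ..
      finally have "i = length (wd s1 @ uw a)" .
      then show ?thesis using m by (simp add: g_def 1(1))
    qed
    show "i \<in> g ` ?A" unfolding gi[symmetric] by (rule imageI[OF mem])
  qed
  then have "(\<Sum>i\<in>?I. f (drop i ?w)) = (\<Sum>x\<in>?A. f (drop (g x) ?w))"
    by (rule sum.reindex_bij_betw[symmetric])
  also have "\<dots> = (\<Sum>(j, b)\<in>?A. f (wd (b # drop j s)))"
  proof (rule sum.cong[OF refl])
    fix x assume x: "x \<in> ?A"
    obtain j b where jb: "x = (j, b)" by (cases x) auto
    have "drop (g (j, b)) ?w = wd (b # drop j s)" using A[of j b] x unfolding jb by blast
    then show "f (drop (g x) ?w) = (case x of (j, b) \<Rightarrow> f (wd (b # drop j s)))"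
      unfolding jb by simp
  qed
  also have "(\<Sum>i\<in>?I. f (drop i ?w)) = (\<Sum>i\<le>length ?w. if ?C i then f (drop i ?w) else 0)"
  proof -
    have I: "?I = {i \<in> {..length ?w}. ?C i}" by (simp only: atMost_iff)
    show ?thesis unfolding I by (rule sum.inter_filter) simp
  qed
  finally show ?thesis by (rule sym)
qed

text \<open>The mirror image of \<open>prefix_sum\<close>; here \<open>g\<close> is the length of
  the part that is kept.\<close>

lemma suffix_sum:
  assumes s: "good s"
  shows "(\<Sum>(i, b) \<in> {(i, b). i \<le> length s \<and> sufb (drop i s) b \<and> uw b \<noteq> []}. f (wd (take i s @ [b]))) =
    (\<Sum>l\<le>length (wd s). if take l (wd s) \<noteq> [] \<and> last (take l (wd s)) = hd (drop l (wd s)) \<and>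
       (\<exists>x. isT x (drop l (wd s))) then f (take l (wd s)) else (0 :: 'm::comm_monoid_add))"
proof -
  let ?w = "wd s"
  let ?A = "{(i, b). i \<le> length s \<and> sufb (drop i s) b \<and> uw b \<noteq> []}"
  let ?C = "\<lambda>l. take l ?w \<noteq> [] \<and> last (take l ?w) = hd (drop l ?w) \<and> (\<exists>x. isT x (drop l ?w))"
  let ?I = "{l. l \<le> length ?w \<and> ?C l}"
  define g where "g = (\<lambda>(i, b). length (wd (take i s @ [b])))"
  have A: "\<exists>t c a. drop i s = c # t \<and> disk (a # t) \<and> uw c = uw b @ uw a \<and> uw a \<noteq> [] \<and> uw b \<noteq> [] \<and>
      bsrc b = bsrc c \<and> g (i, b) = length (wd (take i s @ [b])) \<and> take (g (i, b)) ?w = wd (take i s @ [b]) \<and>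
      drop (g (i, b)) ?w = wd (a # t)"
    if "(i, b) \<in> ?A" for i b
  proof -
    have sb: "sufb (drop i s) b" and b: "uw b \<noteq> []" using that by auto
    obtain t c a where 1: "drop i s = c # t" "disk (a # t)" "uw c = uw b @ uw a" "uw a \<noteq> []" "bsrc c = bsrc b"
      by (rule sufb_D[OF sb]) blast
    have "take i s @ drop i s = s" by (rule append_take_drop_id)
    then have "wd (take i s @ drop i s) = ?w" by (rule arg_cong)
    then have w: "?w = wd (take i s @ [b]) @ wd (a # t)"
      unfolding 1(1) by (simp add: 1(3))
    have g: "g (i, b) = length (wd (take i s @ [b]))" by (simp add: g_def)
    have tk: "take (g (i, b)) ?w = wd (take i s @ [b])" "drop (g (i, b)) ?w = wd (a # t)"
      unfolding g w by simp_all
    show ?thesis using 1(1-4) 1(5)[symmetric] b g tk by blast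
  qed
  have "bij_betw g ?A ?I"
    unfolding bij_betw_def
  proof (intro conjI inj_onI equalityI subsetI)
    fix x y assume xy: "x \<in> ?A" "y \<in> ?A" "g x = g y"
    obtain i b i' b' where xy': "x = (i, b)" "y = (i', b')" by (cases x; cases y) auto
    obtain t c a where 1: "drop i s = c # t" "uw c = uw b @ uw a" "uw a \<noteq> []" "uw b \<noteq> []" "bsrc b = bsrc c"
      "g (i, b) = length (wd (take i s @ [b]))" "take (g (i, b)) ?w = wd (take i s @ [b])"
      using A[of i b] xy xy' by blast
    obtain t' c' a' where 2: "drop i' s = c' # t'" "uw c' = uw b' @ uw a'" "uw a' \<noteq> []" "uw b' \<noteq> []" "bsrc b' = bsrc c'"
      "g (i', b') = length (wd (take i' s @ [b']))" "take (g (i', b')) ?w = wd (take i' s @ [b'])"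
      using A[of i' b'] xy xy' by blast
    have il: "i < length s" "i' < length s"
      using arg_cong[OF 1(1), of length] arg_cong[OF 2(1), of length] by simp_all
    have cc: "take (Suc i) s = take i s @ [c]" "take (Suc i') s = take i' s @ [c']"
      using il 1(1) 2(1) by (simp_all add: take_Suc_conv_app_nth nth_via_drop)
    have l: "length (wd (take (Suc i) s)) = g (i, b) + length (uw a)" "length (wd (take (Suc i') s)) = g (i', b') + length (uw a')"
      using cc 1(2,6) 2(2,6) by simp_all
    have pos: "0 < length (uw a)" "0 < length (uw a')" using 1(3) 2(3) by simp_all
    have e1: "g (i, b) = g (i', b')" using xy(3) by (simp only: xy')
    have e2: "g (i, b) = length (wd (take i s)) + length (uw b)"
      "g (i', b') = length (wd (take i' s)) + length (uw b')"
      unfolding 1(6) 2(6) by simp_all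
    note e = e1 e2
    have ii: "i = i'"
    proof (rule ccontr)
      assume "i \<noteq> i'"
      then consider "Suc i \<le> i'" | "Suc i' \<le> i" by linarith
      then show False
      proof cases
        case 1
        from length_wd_mono[OF this, of s] show False using l pos e by linarith
      next
        case 2
        from length_wd_mono[OF this, of s] show False using l pos e by linarith
      qed
    qed
    have "wd (take i s @ [b]) = take (g (i, b)) ?w" by (rule 1(7)[symmetric])
    also have "\<dots> = take (g (i', b')) ?w" by (simp only: e(1))
    also have "\<dots> = wd (take i' s @ [b'])" by (rule 2(7))
    finally have "uw b = uw b'" by (simp add: ii)
    moreover have "bsrc b = bsrc b'" using 1(1,5) 2(1,5) ii by simp
    ultimately have "b = b'" using uw_eq by simp
    then show "x = y" using ii xy' by simp
  next
    fix l assume "l \<in> g ` ?A"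
    then obtain i b where jb: "(i, b) \<in> ?A" "l = g (i, b)" by auto
    from A[OF jb(1)] obtain t c a where 1: "disk (a # t)" "uw c = uw b @ uw a" "uw a \<noteq> []" "uw b \<noteq> []"
      "take (g (i, b)) ?w = wd (take i s @ [b])" "drop (g (i, b)) ?w = wd (a # t)"
      by blast
    note tk = 1(5,6)[folded jb(2)]
    have T: "\<exists>x. isT x (drop l ?w)" using disk_good[OF 1(1)] unfolding tk by blast
    have k: "kd b = kd a" using kd_append[OF 1(2)] 1(3,4) by simp
    have tn: "take l ?w \<noteq> []" unfolding tk using 1(4) by simp
    have "hd (drop l ?w) = kd a" unfolding tk using 1(3) by simp
    moreover have "last (take l ?w) = kd b" unfolding tk using 1(4) uw_last[of b] by simp
    ultimately have hl: "last (take l ?w) = hd (drop l ?w)" using k by (simp only:)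
    have "drop l ?w \<noteq> []" unfolding tk using 1(3) by simp
    then have le: "l \<le> length ?w" by simp
    show "l \<in> ?I" by (intro CollectI conjI le T tn hl)
  next
    fix l assume "l \<in> ?I"
    then have l: "l \<le> length ?w" and T: "\<exists>x. isT x (drop l ?w)" and tn: "take l ?w \<noteq> []"
      and hl: "last (take l ?w) = hd (drop l ?w)" by blast+
    from T obtain x where x: "isT x (drop l ?w)" by blast
    have dn: "drop l ?w \<noteq> []" using isT_hd[OF x] by blast
    from good_cut[OF s append_take_drop_id[symmetric] tn dn hl] obtain s1 c s2 b a where
      1: "s = s1 @ c # s2" "mulB b a = {c}" "uw b \<noteq> []" "uw a \<noteq> []" "take l ?w = wd s1 @ uw b" "drop l ?w = uw a @ wd s2"
      by blast
    have m: "btgt b = bsrc a" "bsrc c = bsrc b" "uw c = uw b @ uw a" using 1(2) by (auto simp: mulB_iff)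
    have "good (c # s2)" using s 1(1) by (auto simp: good_append)
    moreover have "btgt c = btgt a" using m by (simp add: btgt_vt vt_append)
    moreover have "kd c = kd a" using kd_append(2)[OF m(3) 1(4)] by simp
    ultimately have "good (a # s2)" using 1(4) by (auto simp: good_Cons)
    moreover have "isT x (wd (a # s2))" using x unfolding 1(6) by simp
    ultimately have "disk (a # s2)" using disk_iff by blast
    then have "sufb (drop (length s1) s) b" using 1(2) unfolding sufb_def 1(1) by auto
    then have mem: "(length s1, b) \<in> ?A" using 1(1,3) by simp
    have gi: "g (length s1, b) = l"
    proof -
      have "l = length (take l ?w)" using l by simp
      also have "\<dots> = length (wd s1 @ uw b)" unfolding 1(5) ..
      finally have "l = length (wd s1 @ uw b)" .
      then show ?thesis by (simp add: g_def 1(1))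
    qed
    show "l \<in> g ` ?A" unfolding gi[symmetric] by (rule imageI[OF mem])
  qed
  then have "(\<Sum>l\<in>?I. f (take l ?w)) = (\<Sum>x\<in>?A. f (take (g x) ?w))"
    by (rule sum.reindex_bij_betw[symmetric])
  also have "\<dots> = (\<Sum>(i, b)\<in>?A. f (wd (take i s @ [b])))"
  proof (rule sum.cong[OF refl])
    fix x assume x: "x \<in> ?A"
    obtain i b where jb: "x = (i, b)" by (cases x) auto
    have "take (g (i, b)) ?w = wd (take i s @ [b])" using A[of i b] x unfolding jb by blast
    then show "f (take (g x) ?w) = (case x of (i, b) \<Rightarrow> f (wd (take i s @ [b])))"
      unfolding jb by simp
  qed
  also have "(\<Sum>l\<in>?I. f (take l ?w)) = (\<Sum>l\<le>length ?w. if ?C l then f (take l ?w) else 0)"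
  proof -
    have I: "?I = {l \<in> {..length ?w}. ?C l}" by (simp only: atMost_iff)
    show ?thesis unfolding I by (rule sum.inter_filter) simp
  qed
  finally show ?thesis by (rule sym)
qed

text \<open>The inner cuts of a reduced sequence are exactly the letter changes of its word.\<close>

lemma change_sum:
  assumes s: "good s"
  shows "(\<Sum>k \<in> {0<..<length s}. f (wd (take k s)) (wd (drop k s))) =
    (\<Sum>l\<le>length (wd s). if take l (wd s) \<noteq> [] \<and> drop l (wd s) \<noteq> [] \<and> last (take l (wd s)) \<noteq> hd (drop l (wd s))
       then f (take l (wd s)) (drop l (wd s)) else (0 :: 'm::comm_monoid_add))"
proof -
  let ?w = "wd s"
  let ?C = "\<lambda>l. take l ?w \<noteq> [] \<and> drop l ?w \<noteq> [] \<and> last (take l ?w) \<noteq> hd (drop l ?w)"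
  let ?I = "{l. l \<le> length ?w \<and> ?C l}"
  let ?K = "{0<..<length s}"
  define g where "g k = length (wd (take k s))" for k
  have w: "?w = wd (take k s) @ wd (drop k s)" for k
    by (metis append_take_drop_id concat_append map_append)
  have t: "take (g k) ?w = wd (take k s)" "drop (g k) ?w = wd (drop k s)" for k
    unfolding g_def by (subst w[of k], simp)+
  have ne: "wd u \<noteq> []" "hd (wd u) = kd (hd u)" "last (wd u) = kd (last u)" if gu: "good u" "u \<noteq> []" for u
  proof -
    obtain a u' where a: "u = a # u'" using gu by (cases u) auto
    then show "wd u \<noteq> []" "hd (wd u) = kd (hd u)" using good_noidem[OF gu(1), of a] by auto
    obtain b u'' where b: "u = u'' @ [b]" using gu by (cases u rule: rev_cases) auto
    then show "last (wd u) = kd (last u)" using good_noidem[OF gu(1), of b] uw_last[of b] by auto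
  qed
  have "bij_betw g ?K ?I"
    unfolding bij_betw_def
  proof (intro conjI inj_onI equalityI subsetI)
    have mono: "g k < g k'" if "k < k'" "k' \<le> length s" for k k'
    proof -
      have "take (Suc k) s = take k s @ [s ! k]" using that by (simp add: take_Suc_conv_app_nth)
      moreover have "uw (s ! k) \<noteq> []" using good_noidem[OF s] that by simp
      ultimately have "g k < g (Suc k)" by (simp add: g_def)
      also have "\<dots> \<le> g k'" unfolding g_def using that by (intro length_wd_mono) simp
      finally show ?thesis .
    qed
    fix x y assume "x \<in> ?K" "y \<in> ?K" "g x = g y"
    then show "x = y" using mono[of x y] mono[of y x] by (cases x y rule: linorder_cases) auto
  next
    fix l assume "l \<in> g ` ?K"
    then obtain k where k: "k \<in> ?K" "l = g k" by auto
    have gs: "good (take k s @ drop k s)" using s by simp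
    have kk: "take k s \<noteq> []" "drop k s \<noteq> []" using k by auto
    then have "?C l" using gs[unfolded good_append] ne[of "take k s"] ne[of "drop k s"]
      unfolding k(2) t by auto
    then show "l \<in> ?I" by simp
  next
    fix l assume l: "l \<in> ?I"
    obtain u x where u: "take l ?w = u @ [x]" using l by (cases "take l ?w" rule: rev_cases) auto
    obtain y v where v: "drop l ?w = y # v" using l by (cases "drop l ?w") auto
    have y: "y = ol x" using l u v neq_iff_ol[of y x] by auto
    have "?w = u @ x # ol x # v" using append_take_drop_id[of l ?w] u v y by simp
    from good_pair[OF s this] obtain p a b q k m where
      1: "s = p @ [a, b] @ q" "uw a = replicate (Suc k) x" "u = wd p @ replicate k x" by blast
    have "l = length (take l ?w)" using l by simp
    then have "l = length (u @ [x])" using u by simp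
    then have "l = g (Suc (length p))" using 1 by (simp add: g_def)
    moreover have "Suc (length p) \<in> ?K" using 1 by simp
    ultimately show "l \<in> g ` ?K" by blast
  qed
  then have "(\<Sum>l\<in>?I. f (take l ?w) (drop l ?w)) = (\<Sum>k\<in>?K. f (take (g k) ?w) (drop (g k) ?w))"
    by (rule sum.reindex_bij_betw[symmetric])
  also have "\<dots> = (\<Sum>k\<in>?K. f (wd (take k s)) (wd (drop k s)))"
    unfolding t ..
  also have "(\<Sum>l\<in>?I. f (take l ?w) (drop l ?w)) = (\<Sum>l\<le>length ?w. if ?C l then f (take l ?w) (drop l ?w) else 0)"
  proof -
    have I: "?I = {l \<in> {..length ?w}. ?C l}" by (simp only: atMost_iff)
    show ?thesis unfolding I by (rule sum.inter_filter) simp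
  qed
  finally show ?thesis by (rule sym)
qed

text \<open>The remainder continues the run in which the disk word ends, and a disk word begins and
  ends with different letters.\<close>

lemma preb_kd:
  assumes "preb u b"
  shows "uw b \<noteq> [] \<Longrightarrow> kd b = kd (last u)" and "kd (hd u) \<noteq> kd (last u)"
proof -
  from assms obtain t c a where 1: "u = t @ [c]" "disk (t @ [a])" "uw c = uw a @ uw b" "uw a \<noteq> []"
    by (rule preb_D) blast
  have k: "kd a = kd c" using kd_append(1)[OF 1(3,4)] .
  show "uw b \<noteq> [] \<Longrightarrow> kd b = kd (last u)" using kd_append(2)[OF 1(3)] 1(1) by simp
  obtain z where z: "isT z (wd (t @ [a]))" "good (t @ [a])" "4 \<le> length (t @ [a])" using disk_good[OF 1(2)] by blast
  from z(3) obtain x t' where t: "t = x # t'" by (cases t) auto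
  have "uw x \<noteq> []" using z(2) t by (simp add: good_Cons)
  then have "kd x = z" "kd a = ol z" using isT_hd[OF z(1)] 1(4) uw_last[of a] t by simp_all
  then show "kd (hd u) \<noteq> kd (last u)" using k 1(1) t by simp
qed

lemma sufb_kd:
  assumes "sufb u b"
  shows "uw b \<noteq> [] \<Longrightarrow> kd b = kd (hd u)" and "kd (hd u) \<noteq> kd (last u)"
proof -
  from assms obtain t c a where 1: "u = c # t" "disk (a # t)" "uw c = uw b @ uw a" "uw a \<noteq> []"
    by (rule sufb_D) blast
  have k: "kd a = kd c" using kd_append(2)[OF 1(3,4)] .
  show "uw b \<noteq> [] \<Longrightarrow> kd b = kd (hd u)" using kd_append(1)[OF 1(3)] 1(1) by simp
  obtain z where z: "isT z (wd (a # t))" "good (a # t)" "4 \<le> length (a # t)" using disk_good[OF 1(2)] by blast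
  from z(3) obtain x t' where t: "t = t' @ [x]" by (cases t rule: rev_cases) auto
  have "uw x \<noteq> []" using good_noidem[OF z(2), of x] t by simp
  then have "kd a = z" "kd x = ol z" using isT_hd[OF z(1)] 1(4) uw_last[of x] t by simp_all
  then show "kd (hd u) \<noteq> kd (last u)" using k 1(1) t by simp
qed

lemma preb_good: "preb u b \<Longrightarrow> good u \<and> 4 \<le> length u \<and> bsrc b = bsrc (hd u) \<and> btgt b = btgt (last u)"
  by (erule preb_D) blast

lemma sufb_good: "sufb u b \<Longrightarrow> good u \<and> 4 \<le> length u \<and> bsrc b = bsrc (hd u) \<and> btgt b = btgt (last u)"
  by (erule sufb_D) blast

lemma mulB_D:
  assumes "mulB x y = {b}"
  shows "btgt x = bsrc y" "bsrc b = bsrc x" "btgt b = btgt y" "uw b = uw x @ uw y"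
    "uw x \<noteq> [] \<Longrightarrow> kd x = kd b" "uw y \<noteq> [] \<Longrightarrow> kd y = kd b"
proof -
  show 1: "btgt x = bsrc y" "bsrc b = bsrc x" "uw b = uw x @ uw y"
    using assms unfolding mulB_iff by blast+
  show "btgt b = btgt y" by (simp only: btgt_vt[of b] 1(2,3) vt_append) (simp add: btgt_vt 1(1)[symmetric])
  show "uw x \<noteq> [] \<Longrightarrow> kd x = kd b" "uw y \<noteq> [] \<Longrightarrow> kd y = kd b"
    using kd_append[OF 1(3)] by blast+
qed

section \<open>Which products can meet the support of the homomorphism\<close>

text \<open>The sequences on which the homomorphism may be nonzero. A single idempotent is included,
  longer sequences containing one are not: this is strict unitality.\<close>

definition valid :: "bbasis list \<Rightarrow> bool" where
  "valid s \<longleftrightarrow> good s \<and> s \<noteq> [] \<or> (\<exists>v. s = [Idem v])"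

lemma valid_cmp: "valid s \<Longrightarrow> cmp s"
  using good_cmp by (auto simp: valid_def)

lemma not_valid_idem:
  assumes "x \<in> set s" "uw x = []" "2 \<le> length s"
  shows "\<not> valid s"
  using assms good_noidem[of s x] by (auto simp: valid_def)

lemma uw_Nil_iff: "uw b = [] \<longleftrightarrow> b = Idem (bsrc b)"
  by (cases b) auto

text \<open>The whole sequence has exactly one junction of equal letters. A binary product can merge
  the entries there, and the only cut into two reduced pieces is at this place.\<close>

definition split2 :: "bbasis list \<Rightarrow> bbasis list \<Rightarrow> bool" where
  "split2 s1 s2 \<longleftrightarrow> s1 \<noteq> [] \<and> s2 \<noteq> [] \<and> good s1 \<and> good s2 \<and> btgt (last s1) = bsrc (hd s2) \<and> kd (last s1) = kd (hd s2)"

definition ops :: "bbasis list \<Rightarrow> (nat \<times> nat \<times> bbasis) set" where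
  "ops s = (SIGMA i:{..length s}. SIGMA j:{..length s - i}. muBinf (take j (drop i s)))"

definition res :: "bbasis list \<Rightarrow> nat \<times> nat \<times> bbasis \<Rightarrow> bbasis list" where
  "res s = (\<lambda>(i, j, b). take i s @ b # drop j (drop i s))"

lemma finite_ops: "finite (ops s)"
  unfolding ops_def by (intro finite_SigmaI finite_muBinf finite_atMost)

lemma ops_D:
  assumes "(i, j, b) \<in> ops s"
  obtains p u q where "s = p @ u @ q" "b \<in> muBinf u" "length p = i" "length u = j" "res s (i, j, b) = p @ b # q"
proof -
  have 1: "i \<le> length s" "j \<le> length s - i" "b \<in> muBinf (take j (drop i s))"
    using assms unfolding ops_def by simp_all
  have "s = take i s @ take j (drop i s) @ drop j (drop i s)" by (simp only: append_take_drop_id)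
  moreover have "length (take i s) = i" "length (take j (drop i s)) = j" using 1 by simp_all
  ultimately show ?thesis using that[of "take i s" "take j (drop i s)" "drop j (drop i s)"] 1(3)
    by (simp add: res_def)
qed

lemma ops_I: "s = p @ u @ q \<Longrightarrow> b \<in> muBinf u \<Longrightarrow> (length p, length u, b) \<in> ops s"
  by (simp add: ops_def)

lemma res_append: "s = p @ u @ q \<Longrightarrow> res s (length p, length u, b) = p @ b # q"
  by (simp add: res_def)

lemma append_split:
  assumes "xs @ ys = zs @ ws"
  shows "(\<exists>r. xs = zs @ r \<and> r @ ys = ws) \<or> (\<exists>r. xs @ r = zs \<and> ys = r @ ws \<and> r \<noteq> [])"
proof -
  from assms obtain r where "xs = zs @ r \<and> r @ ys = ws \<or> xs @ r = zs \<and> ys = r @ ws"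
    unfolding append_eq_append_conv2 by blast
  then show ?thesis by (cases "r = []") auto
qed

text \<open>Undoing one product creates at most one junction of equal letters: between the two
  factors of a binary product, or at one end of the block consumed by a disk product.\<close>

lemma good_step:
  assumes "b \<in> muBinf u" "good (p @ b # q)" "\<forall>x\<in>set u. uw x \<noteq> []"
  shows "good (p @ u @ q) \<or> (\<exists>s1 s2. p @ u @ q = s1 @ s2 \<and> split2 s1 s2)"
proof -
  have g: "good p" "good (b # q)" "good q" "uw b \<noteq> []" "p = [] \<or> btgt (last p) = bsrc b \<and> kd (last p) \<noteq> kd b"
    "q = [] \<or> btgt b = bsrc (hd q) \<and> kd b \<noteq> kd (hd q)"
    using assms(2) by (auto simp: good_append good_Cons)
  have u: "u \<noteq> []" "bsrc b = bsrc (hd u)" "btgt b = btgt (last u)" using muBinf_ends[OF assms(1)] by simp_all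
  consider (m) x y where "u = [x, y]" "mulB x y = {b}" | (p) "preb u b" | (s) "sufb u b"
    using assms(1) unfolding muBinf_iff by blast
  then show ?thesis
  proof cases
    case m
    note M = mulB_D[OF m(2)]
    have ne: "uw x \<noteq> []" "uw y \<noteq> []" using assms(3) m(1) by simp_all
    have k: "kd x = kd b" "kd y = kd b" using M(5)[OF ne(1)] M(6)[OF ne(2)] .
    have "good (p @ [x])" using g(1,5) M(2) ne(1) by (simp add: good_append k(1))
    moreover have "good (y # q)" using g(3,6) M(3) ne(2) by (simp add: good_Cons k(2))
    ultimately have "split2 (p @ [x]) (y # q)" using M(1) by (simp add: split2_def k)
    moreover have "p @ u @ q = (p @ [x]) @ (y # q)" using m by simp
    ultimately show ?thesis by blast
  next
    case p
    have "good u" "kd b = kd (last u)" using preb_good[OF p] preb_kd(1)[OF p g(4)] by blast+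
    then have uq: "good (u @ q)" using g(3,6) u(3) by (simp add: good_append)
    have h: "hd (u @ q) = hd u" "u @ q \<noteq> []" using u by simp_all
    show ?thesis
    proof (cases "p = [] \<or> kd (last p) \<noteq> kd (hd u)")
      case True
      then have "good (p @ u @ q)" using uq g(1,5) h u(2) by (simp add: good_append[of p]) blast
      then show ?thesis ..
    next
      case False
      then have "split2 p (u @ q)" using uq g(1,5) h u(2) by (simp add: split2_def)
      then show ?thesis by blast
    qed
  next
    case s
    have "good u" "kd b = kd (hd u)" using sufb_good[OF s] sufb_kd(1)[OF s g(4)] by blast+
    then have uq: "good (p @ u)" using g(1,5) u(2) by (auto simp: good_append)
    have h: "last (p @ u) = last u" "p @ u \<noteq> []" using u by simp_all
    show ?thesis
    proof (cases "q = [] \<or> kd (last u) \<noteq> kd (hd q)")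
      case True
      then have "good ((p @ u) @ q)" using uq g(3,6) h u(3) unfolding good_append[of "p @ u"] by auto
      then show ?thesis by simp
    next
      case False
      then have "split2 (p @ u) q" using uq g(3,6) h u(3) unfolding split2_def by auto
      moreover have "p @ u @ q = (p @ u) @ q" by simp
      ultimately show ?thesis by blast
    qed
  qed
qed

lemma cmp_step:
  assumes "b \<in> muBinf u" "cmp (p @ b # q)"
  shows "cmp (p @ u @ q)"
  using assms(2) muBinf_ends[OF assms(1)] by (auto simp: cmp_append cmp_Cons)

text \<open>The block of a disk product begins and ends with different letters. A neighbour on the
  side where the disk word begins or ends completely would have to differ from both letters, so the
  block must reach the end of the sequence on that side.\<close>

lemma good_ops:
  assumes s: "good s" and o: "(i, j, b) \<in> ops s" and v: "valid (res s (i, j, b))"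
  shows "i = 0 \<and> preb (take j s) b \<and> uw b \<noteq> [] \<or> j = length s - i \<and> sufb (drop i s) b \<and> uw b \<noteq> [] \<or>
     i = 0 \<and> j = length s \<and> uw b = []"
proof -
  from o obtain p u q where 1: "s = p @ u @ q" "b \<in> muBinf u" "length p = i" "length u = j" "res s (i, j, b) = p @ b # q"
    by (rule ops_D)
  have v': "valid (p @ b # q)" using v 1(5) by simp
  show ?thesis
  proof (cases "uw b = []")
    case True
    then have "\<not> good (p @ b # q)" using good_noidem[of "p @ b # q" b] by auto
    then obtain v where "p @ b # q = [Idem v]" using v' unfolding valid_def by blast
    then have "p = []" "q = []" by (cases p; simp)+
    then show ?thesis using True 1 by simp
  next
    case False
    then have g: "good (p @ b # q)" using v' unfolding valid_def by (auto simp: append_eq_Cons_conv)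
    have gu: "good (p @ u @ q)" using s 1(1) by simp
    have une: "u \<noteq> []" using muBinf_ends[OF 1(2)] by simp
    consider (m) x y where "u = [x, y]" "mulB x y = {b}" | (p) "preb u b" | (s) "sufb u b"
      using 1(2) unfolding muBinf_iff by blast
    then show ?thesis
    proof cases
      case m
      have "good ([x, y] @ q)" using gu unfolding m(1) good_append[of p] by blast
      then have n: "kd x \<noteq> kd y" "uw x \<noteq> []" "good (y # q)" by simp_all
      have "uw y \<noteq> []" using good_noidem[OF n(3), of y] by simp
      then show ?thesis using mulB_D(5)[OF m(2) n(2)] mulB_D(6)[OF m(2)] n(1) by simp
    next
      case p
      have "p = []"
      proof (rule ccontr)
        assume "p \<noteq> []"
        then have "kd (last p) \<noteq> kd b" "kd (last p) \<noteq> kd (hd u)" using g gu une by (auto simp: good_append)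
        then show False using preb_kd[OF p] False by (metis neq_iff_ol)
      qed
      then show ?thesis using p 1 False by simp
    next
      case s
      have "q = []"
      proof (rule ccontr)
        assume "q \<noteq> []"
        then have "kd b \<noteq> kd (hd q)" "kd (last u) \<noteq> kd (hd q)" using g gu une by (auto simp: good_append good_Cons)
        then show False using sufb_kd[OF s] False by (metis neq_iff_ol)
      qed
      then show ?thesis using s 1 False by auto
    qed
  qed
qed

text \<open>A valid result must have lost the junction of equal letters. Either the two entries are
  multiplied, or a disk product with its disk word ending or beginning exactly at the junction
  changes the letter there.\<close>

lemma split_ops:
  assumes s: "split2 s1 s2" and o: "(i, j, b) \<in> ops (s1 @ s2)" and v: "valid (res (s1 @ s2) (i, j, b))"
  shows "i = length s1 \<and> preb (take j s2) b \<and> uw b \<noteq> [] \<or>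
     i \<le> length s1 \<and> j = length s1 - i \<and> sufb (drop i s1) b \<and> uw b \<noteq> [] \<or>
     i = length s1 - 1 \<and> j = 2 \<and> mulB (last s1) (hd s2) = {b}"
proof -
  have S: "s1 \<noteq> []" "s2 \<noteq> []" "good s1" "good s2" "kd (last s1) = kd (hd s2)" using s by (simp_all add: split2_def)
  from o obtain p u q where 1: "s1 @ s2 = p @ u @ q" "b \<in> muBinf u" "length p = i" "length u = j"
    "res (s1 @ s2) (i, j, b) = p @ b # q"
    by (rule ops_D)
  have v': "valid (p @ b # q)" using v 1(5) by simp
  have noidem: "uw x \<noteq> []" if "x \<in> set (s1 @ s2)" for x using that S(3,4) good_noidem by auto
  have ngood: "\<not> good (t1 @ t2)" if "t1 \<noteq> []" "t2 \<noteq> []" "last t1 = last s1" "hd t2 = hd s2" for t1 t2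
    using that S(5) by (simp add: good_append)
  have une: "u \<noteq> []" using muBinf_ends[OF 1(2)] by simp
  have b: "uw b \<noteq> []"
  proof
    assume b0: "uw b = []"
    then have "\<not> good (p @ b # q)" using good_noidem[of "p @ b # q" b] by auto
    then obtain v where "p @ b # q = [Idem v]" using v' unfolding valid_def by blast
    then have "p = []" "q = []" by (cases p; simp)+
    then have pq: "s1 @ s2 = u" using 1(1) by simp
    consider (m) x y where "u = [x, y]" "mulB x y = {b}" | "good u"
      using 1(2) preb_good sufb_good unfolding muBinf_iff by blast
    then show False
    proof cases
      case m
      then show False using mulB_D(4)[OF m(2)] b0 noidem[of x] pq by simp
    next
      case 2
      then show False using ngood[of s1 s2] pq S by simp
    qed
  qed
  then have g: "good (p @ b # q)" using v' unfolding valid_def by (auto simp: append_eq_Cons_conv)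
  consider (m) x y where "u = [x, y]" "mulB x y = {b}" | (d) "preb u b \<or> sufb u b"
    using 1(2) unfolding muBinf_iff by blast
  then show ?thesis
  proof cases
    case m
    have "x \<in> set (s1 @ s2)" "y \<in> set (s1 @ s2)" using 1(1) m(1) by simp_all
    then have k: "kd x = kd y" using mulB_D(5,6)[OF m(2)] noidem by simp
    have eq: "s1 @ s2 = (p @ [x]) @ (y # q)" using 1(1) m(1) by simp
    consider r where "s1 = (p @ [x]) @ r" "r @ s2 = y # q" | r where "s1 @ r = p @ [x]" "s2 = r @ y # q"
      using append_eq_append_conv2[THEN iffD1, OF eq] by blast
    then show ?thesis
    proof cases
      case one: 1
      show ?thesis
      proof (cases r)
        case Nil
        then show ?thesis using one m 1(3,4) by auto
      next
        case (Cons z r')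
        then have "good (p @ [x] @ [y] @ r')" using one S(3) by simp
        then show ?thesis using k by (simp add: good_append good_Cons)
      qed
    next
      case 2
      show ?thesis
      proof (cases r rule: rev_cases)
        case Nil
        then show ?thesis using 2 m 1(3,4) by auto
      next
        case (snoc r' z)
        then have "good (r' @ [x] @ [y] @ q)" using 2 S(4) by simp
        then show ?thesis using k by (simp add: good_append good_Cons)
      qed
    qed
  next
    case d
    have gu: "good u" using d preb_good sufb_good by blast
    have "s1 @ s2 = p @ (u @ q)" by (fact 1(1))
    note eq = append_split[OF this]
    consider r where "s1 = p @ r" "r @ s2 = u @ q" | r where "s1 @ r = p" "s2 = r @ u @ q" "r \<noteq> []"
      using eq by blast
    then show ?thesis
    proof cases
      case one: 1
      show ?thesis
      proof (cases "r = []")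
        case True
        then have e: "p = s1" "s2 = u @ q" using one by simp_all
        have "kd (last s1) \<noteq> kd b" using g S(1) e by (auto simp: good_append)
        moreover have "kd (hd u) = kd (last s1)" using S(5) e une by simp
        ultimately have "preb u b" using d sufb_kd(1) b by auto
        then show ?thesis using 1 e b by auto
      next
        case False
        have "r @ s2 = u @ q" by (fact one(2))
        note eq = append_split[OF this]
        consider r2 where "r = u @ r2" "r2 @ s2 = q" | r2 where "r @ r2 = u" "s2 = r2 @ q" "r2 \<noteq> []"
          using eq by blast
        then show ?thesis
        proof cases
          case onb: 1
          show ?thesis
          proof (cases "r2 = []")
            case True
            then have e: "r = u" "q = s2" using onb by simp_all
            have "kd b \<noteq> kd (hd s2)" using g S(2) e by (auto simp: good_append good_Cons)
            moreover have "last u = last s1" using one(1) e une by simp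
            ultimately have "sufb u b" using d preb_kd(1) b S(5) by auto
            then show ?thesis using 1 one e b by auto
          next
            case False
            then have "last r2 = last s1" using one(1) onb(1) by simp
            then have "\<not> good (r2 @ s2)" using ngood False S(2) by blast
            then show ?thesis using g onb(2) by (auto simp: good_append[of p] good_Cons)
          qed
        next
          case 2
          then have "last r = last s1" "hd r2 = hd s2" using one(1) False by simp_all
          then have "\<not> good (r @ r2)" using ngood False 2(3) by blast
          then show ?thesis using gu 2(1) by simp
        qed
      qed
    next
      case 2
      then have "hd r = hd s2" by simp
      then have "\<not> good (s1 @ r)" using ngood S(1) 2(3) by blast
      then show ?thesis using g 2(1) by (auto simp: good_append[of p])
    qed
  qed
qed

section \<open>The homomorphism relations with the central variable set to one\<close>

text \<open>Vertices enter through orthogonal idempotents. The elements belonging to S, DS, SD and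
  DSD contain one arrow and exchange the two vertices; \<open>y\<close> preserves them.\<close>

locale koszul_idem = koszul d y sg a b c
  for d :: "'r::f2ring \<Rightarrow> 'r" and y sg a b c +
  fixes e :: "vtx \<Rightarrow> 'r"
  assumes ee: "e v * e w = (if v = w then e v else 0)" and de: "d (e v) = 0"
    and ey: "e v * y = y * e v" and esg: "e v * sg = sg * e (oth v)" and ea: "e v * a = a * e (oth v)"
    and eb: "e v * b = b * e (oth v)" and ec: "e v * c = c * e (oth v)"
begin

text \<open>A factor of \<open>K\<close> may carry an arrow in its word without the matching
  coefficient, or the coefficient without the word. The flag records such a missing exchange; flags
  add modulo two and cancel in \<open>K\<close>.\<close>

definition eqv :: "bool \<Rightarrow> (lt, (lt, 'r) sqmat) ser \<Rightarrow> bool" where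
  "eqv k1 f \<longleftrightarrow> (\<forall>w i j v. e v * ent (cf f w) i j = ent (cf f w) i j * e (vt (if k1 then oth v else v) w))"

lemma vt_oth: "vt (oth v) w = oth (vt v w)"
  by (induction v w rule: vt.induct) auto

lemma eqv_add: "eqv k1 f \<Longrightarrow> eqv k1 g \<Longrightarrow> eqv k1 (f + g)"
  by (simp add: eqv_def distrib_left distrib_right)

lemma slide: "p * q = q * p' \<Longrightarrow> p' * r = r * s \<Longrightarrow> p * (q * r) = q * r * (s :: 'r)"
proof -
  assume 1: "p * q = q * p'" and 2: "p' * r = r * s"
  have "p * (q * r) = q * p' * r" by (simp only: 1 flip: mult.assoc)
  also have "\<dots> = q * (p' * r)" by (rule mult.assoc)
  also have "\<dots> = q * r * s" unfolding 2 by (rule mult.assoc[symmetric])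
  finally show ?thesis .
qed

lemma eqv_mult:
  assumes f: "eqv k1 f" and g: "eqv l g"
  shows "eqv (k1 \<noteq> l) (f * g)"
  unfolding eqv_def
proof (intro allI)
  fix w i j v
  have "e v * (ent (cf f (take n w)) i m * ent (cf g (drop n w)) m j) =
     ent (cf f (take n w)) i m * ent (cf g (drop n w)) m j * e (vt (if k1 \<noteq> l then oth v else v) w)" for n m
  proof (rule slide)
    let ?v = "vt (if k1 then oth v else v) (take n w)"
    show "e v * ent (cf f (take n w)) i m = ent (cf f (take n w)) i m * e ?v"
      using f unfolding eqv_def by blast
    have "vt (if l then oth ?v else ?v) (drop n w) = vt (if k1 \<noteq> l then oth v else v) (take n w @ drop n w)"
      unfolding vt_append by (cases k1; cases l) (simp_all only: vt_oth oth_oth if_True if_False simp_thms)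
    then have vw: "vt (if l then oth ?v else ?v) (drop n w) = vt (if k1 \<noteq> l then oth v else v) w"
      unfolding append_take_drop_id .
    show "e ?v * ent (cf g (drop n w)) m j = ent (cf g (drop n w)) m j * e (vt (if k1 \<noteq> l then oth v else v) w)"
      using g unfolding eqv_def vw[symmetric] by blast
  qed
  then show "e v * ent (cf (f * g) w) i j = ent (cf (f * g) w) i j * e (vt (if k1 \<noteq> l then oth v else v) w)"
    by (simp only: cf_mult ent_sum ent_mult sum_distrib_left sum_distrib_right)
qed

lemma eqv_X: "eqv False (X LD)" "eqv True (X LS)"
  by (auto simp: eqv_def X_def cf_ind ent_1)

lemma eqv_P: "eqv False (P z)"
proof -
  have "vt v (tw z t) = v" for t v
    using isT_vt[of z "tw z t" v] by (cases "t = Lf") (auto simp: isT_def)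
  then show ?thesis by (auto simp: eqv_def P_def cf_ind ent_1)
qed

lemma eqv_k: "(\<And>v. e v * r = r * e (if l then oth v else v)) \<Longrightarrow> eqv l (k i j r)"
  by (auto simp: eqv_def cf_const ent_mu)

lemma eqv_K: "eqv False K"
proof -
  have k1: "eqv False (k LD LD y)" "eqv True (k LS LS sg)" "eqv True (k LD LS a)" "eqv True (k LS LD b)" "eqv True (k LD LD c)"
    by (rule eqv_k; simp add: ey esg ea eb ec)+
  note E = eqv_mult[of False _ False, simplified] eqv_mult[of False _ True, simplified]
    eqv_mult[of True _ False, simplified] eqv_mult[of True _ True, simplified]
  show ?thesis
    unfolding K_def
    by (intro eqv_add E(1)[OF eqv_X(1) k1(1)]
      E(1)[OF eqv_X(1) E(1)[OF eqv_P E(4)[OF eqv_X(2) E(2)[OF eqv_P E(2)[OF eqv_X(1) k1(5)]]]]]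
      E(1)[OF eqv_X(1) E(1)[OF eqv_P E(4)[OF eqv_X(2) k1(3)]]]
      E(4)[OF eqv_X(2) E(2)[OF eqv_P E(2)[OF eqv_X(1) k1(4)]]]
      E(4)[OF eqv_X(2) k1(2)])
qed

lemma eqv_G: "e v * ent (cf G w) i j = ent (cf G w) i j * e (vt v w)"
proof (induction w arbitrary: v i rule: length_induct)
  case (1 w)
  show ?case
  proof (cases "w = []")
    case True
    then show ?thesis by (simp add: G_Nil ent_1)
  next
    case False
    then have G: "cf G w = (\<Sum>n\<le>length w. cf K (take n w) * cf G (drop n w))"
      by (subst G_eq) (simp add: cf_1 cf_mult)
    have "e v * (ent (cf K (take n w)) i m * ent (cf G (drop n w)) m j) =
       ent (cf K (take n w)) i m * ent (cf G (drop n w)) m j * e (vt v w)" if "n \<le> length w" for n m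
    proof (cases "n = 0")
      case True
      then show ?thesis by (simp add: K0)
    next
      case n: False
      have w: "vt v w = vt (vt v (take n w)) (drop n w)"
        by (metis append_take_drop_id vt_append)
      have K: "e v * ent (cf K (take n w)) i m = ent (cf K (take n w)) i m * e (vt v (take n w))"
        using eqv_K unfolding eqv_def by simp
      have "length (drop n w) < length w" using n that False by simp
      then have "e (vt v (take n w)) * ent (cf G (drop n w)) m j = ent (cf G (drop n w)) m j * e (vt v w)"
        using 1 unfolding w by blast
      then show ?thesis by (rule slide[OF K])
    qed
    then show ?thesis
      unfolding G ent_sum ent_mult sum_distrib_left sum_distrib_right by (intro sum.cong refl) simp
  qed
qed

lemma e_gv: "e v * gv w = gv w * e (vt v w)"
  by (simp add: gv_def tot_def sum_distrib_left sum_distrib_right eqv_G)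

text \<open>The homomorphism with the powers of \<open>U\<close> suppressed. The leading idempotent
  restores the starting vertex that the word forgets.\<close>

definition Gl :: "bbasis list \<Rightarrow> 'r" where
  "Gl s = (if valid s then e (bsrc (hd s)) * gv (wd s) else 0)"

lemma Gl_good: "good s \<Longrightarrow> s \<noteq> [] \<Longrightarrow> Gl s = e (bsrc (hd s)) * gv (wd s)"
  by (simp add: Gl_def valid_def)

lemma Gl_Idem: "Gl [Idem v] = e v"
  by (simp add: Gl_def valid_def gv_def)

lemma Gl_mult:
  assumes "valid s" "valid t"
  shows "Gl s * Gl t = (if btgt (last s) = bsrc (hd t) then e (bsrc (hd s)) * (gv (wd s) * gv (wd t)) else 0)"
proof -
  have "s \<noteq> []" using assms by (auto simp: valid_def)
  then have t: "btgt (last s) = vt (bsrc (hd s)) (wd s)" by (rule cmp_vt[OF valid_cmp[OF assms(1)]])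
  have c: "gv (wd s) * e (btgt (last s)) = e (bsrc (hd s)) * gv (wd s)"
    unfolding t by (rule e_gv[symmetric])
  have 1: "Gl s * Gl t = (e (bsrc (hd s)) * gv (wd s)) * (e (bsrc (hd t)) * gv (wd t))"
    using assms by (simp only: Gl_def if_True)
  have 2: "\<dots> = gv (wd s) * (e (btgt (last s)) * e (bsrc (hd t))) * gv (wd t)"
    unfolding c[symmetric] by (simp only: mult.assoc)
  show ?thesis
  proof (cases "btgt (last s) = bsrc (hd t)")
    case True
    then have "e (btgt (last s)) * e (bsrc (hd t)) = e (btgt (last s))" by (simp add: ee)
    then have "gv (wd s) * (e (btgt (last s)) * e (bsrc (hd t))) = e (bsrc (hd s)) * gv (wd s)"
      using c by (simp only:)
    then have "Gl s * Gl t = e (bsrc (hd s)) * gv (wd s) * gv (wd t)" unfolding 1 2 by (simp only:)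
    then show ?thesis unfolding if_P[OF True] mult.assoc .
  next
    case False
    then have "e (btgt (last s)) * e (bsrc (hd t)) = 0" by (simp add: ee)
    then have "Gl s * Gl t = 0" unfolding 1 2 by (simp only: mult_zero_right mult_zero_left)
    then show ?thesis unfolding if_not_P[OF False] .
  qed
qed

lemma Gl_Idem_mult: "bsrc (hd s) = v \<Longrightarrow> e v * Gl s = Gl s"
proof -
  assume v: "bsrc (hd s) = v"
  have "e v * (e v * gv (wd s)) = e v * gv (wd s)"
    unfolding mult.assoc[symmetric] ee by (simp only: simp_thms if_True)
  then show ?thesis by (simp add: Gl_def v)
qed

lemma Gl_mult_Idem: "s \<noteq> [] \<Longrightarrow> btgt (last s) = v \<Longrightarrow> Gl s * e v = Gl s"
proof -
  assume s: "s \<noteq> []" "btgt (last s) = v"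
  show ?thesis
  proof (cases "valid s")
    case True
    then have "v = vt (bsrc (hd s)) (wd s)" using cmp_vt[OF valid_cmp[OF True]] s by simp
    then have "e (bsrc (hd s)) * gv (wd s) = gv (wd s) * e v" by (simp add: e_gv)
    then show ?thesis using True by (simp add: Gl_def mult.assoc ee)
  qed (simp add: Gl_def)
qed

lemma ops_sum:
  assumes "S \<subseteq> ops s" "\<And>x. x \<in> ops s \<Longrightarrow> valid (res s x) \<Longrightarrow> x \<in> S"
  shows "(\<Sum>x\<in>ops s. Gl (res s x)) = (\<Sum>x\<in>S. Gl (res s x))"
proof (rule sum.mono_neutral_right[OF finite_ops assms(1)], intro ballI)
  fix x assume "x \<in> ops s - S"
  then have "\<not> valid (res s x)" using assms(2) by blast
  then show "Gl (res s x) = 0" by (simp add: Gl_def)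
qed

definition splits :: "bbasis list \<Rightarrow> 'r" where
  "splits s = (\<Sum>k \<in> {0<..<length s}. Gl (take k s) * Gl (drop k s))"

lemma splits_single:
  assumes "0 < k1" "k1 < length s" "\<And>i. 0 < i \<Longrightarrow> i < length s \<Longrightarrow> i \<noteq> k1 \<Longrightarrow> \<not> valid (take i s) \<or> \<not> valid (drop i s)"
  shows "splits s = Gl (take k1 s) * Gl (drop k1 s)"
proof -
  have "splits s = (\<Sum>i \<in> {k1}. Gl (take i s) * Gl (drop i s))"
    unfolding splits_def
  proof (rule sum.mono_neutral_right)
    show "\<forall>i\<in>{0<..<length s} - {k1}. Gl (take i s) * Gl (drop i s) = 0"
    proof
      fix i assume "i \<in> {0<..<length s} - {k1}"
      then have "\<not> valid (take i s) \<or> \<not> valid (drop i s)" using assms(3) by simp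
      then show "Gl (take i s) * Gl (drop i s) = 0" by (auto simp: Gl_def)
    qed
  qed (use assms in auto)
  then show ?thesis by simp
qed

lemma splits_zero:
  assumes "\<And>i. 0 < i \<Longrightarrow> i < length s \<Longrightarrow> \<not> valid (take i s) \<or> \<not> valid (drop i s)"
  shows "splits s = 0"
  unfolding splits_def
proof (rule sum.neutral, intro ballI)
  fix i assume "i \<in> {0<..<length s}"
  then have "\<not> valid (take i s) \<or> \<not> valid (drop i s)" using assms by simp
  then show "Gl (take i s) * Gl (drop i s) = 0" by (auto simp: Gl_def)
qed

text \<open>Products have composable inputs and preserve the end vertices, so no result becomes
  composable. At a cut where the vertices disagree, orthogonal idempotents meet.\<close>

lemma rel_not_cmp:
  assumes s: "\<not> cmp s"
  shows "(\<Sum>x\<in>ops s. Gl (res s x)) = d (Gl s) + splits s"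
proof -
  have "(\<Sum>x\<in>ops s. Gl (res s x)) = (\<Sum>x\<in>{}. Gl (res s x))"
  proof (rule ops_sum)
    fix x assume x: "x \<in> ops s" "valid (res s x)"
    obtain i j b where x': "x = (i, j, b)" by (cases x)
    obtain p u q where "s = p @ u @ q" "b \<in> muBinf u" "res s x = p @ b # q"
      using x(1) unfolding x' by (rule ops_D) blast
    then show "x \<in> {}" using cmp_step[of b u p q] valid_cmp[OF x(2)] s by simp
  qed simp
  moreover have "Gl s = 0" using s valid_cmp by (auto simp: Gl_def)
  moreover have "splits s = 0"
    unfolding splits_def
  proof (rule sum.neutral, intro ballI)
    fix k assume k: "k \<in> {0<..<length s}"
    show "Gl (take k s) * Gl (drop k s) = 0"
    proof (cases "valid (take k s) \<and> valid (drop k s)")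
      case True
      have "\<not> cmp (take k s @ drop k s)" using s by simp
      then have "btgt (last (take k s)) \<noteq> bsrc (hd (drop k s))"
        unfolding cmp_append using True valid_cmp by blast
      then show ?thesis using True by (simp add: Gl_mult)
    next
      case False
      then show ?thesis by (auto simp: Gl_def)
    qed
  qed
  ultimately show ?thesis by (simp add: d0)
qed

lemma idem_ops:
  assumes "s = p @ x # q" "uw x = []" "(i, j, b1) \<in> ops s" "valid (res s (i, j, b1))" "2 \<le> length s"
  shows "j = 2 \<and> (i = length p \<and> q \<noteq> [] \<and> mulB x (hd q) = {b1} \<or> Suc i = length p \<and> mulB (last p) x = {b1}) \<or> p = [] \<and> q = []"
proof -
  obtain p' u q' where 1: "s = p' @ u @ q'" "b1 \<in> muBinf u" "length p' = i" "length u = j" "res s (i, j, b1) = p' @ b1 # q'"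
    using assms(3) by (rule ops_D)
  have une: "u \<noteq> []" using muBinf_ends[OF 1(2)] by simp
  have nin: "x \<notin> set p'" "x \<notin> set q'"
  proof -
    have "x \<notin> set p' \<and> x \<notin> set q'"
    proof (rule ccontr)
      assume "\<not> ?thesis"
      then have "x \<in> set (p' @ b1 # q')" "2 \<le> length (p' @ b1 # q')" by (cases p'; cases q'; auto)+
      then show False using not_valid_idem[of x "p' @ b1 # q'"] assms(2,4) 1(5) by simp
    qed
    then show "x \<notin> set p'" "x \<notin> set q'" by simp_all
  qed
  have xu: "x \<in> set u"
  proof -
    have "x \<in> set (p' @ u @ q')" unfolding 1(1)[symmetric] assms(1) by simp
    then show ?thesis using nin by simp
  qed
  have "\<not> good u" using xu good_noidem[of u x] assms(2) by blast
  then obtain x' y' where u: "u = [x', y']" "mulB x' y' = {b1}"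
    using 1(2) preb_good sufb_good unfolding muBinf_iff by blast
  have eq: "p @ (x # q) = p' @ ([x', y'] @ q')" using assms(1) 1(1) u by simp
  from append_split[OF eq] show ?thesis
  proof (elim disjE exE conjE)
    fix r assume r: "p = p' @ r" "r @ x # q = [x', y'] @ q'"
    show ?thesis
    proof (cases r)
      case Nil
      then show ?thesis using r u 1(3,4) by simp
    next
      case (Cons z r')
      then have "r' @ x # q = y' # q'" "z = x'" using r(2) by simp_all
      show ?thesis
      proof (cases r')
        case Nil
        then have "x = y'" "p = p' @ [x']" using \<open>r' @ x # q = y' # q'\<close> \<open>z = x'\<close> Cons r(1) by simp_all
        then show ?thesis using u 1(3,4) by simp
      next
        case (Cons w r'')
        then have "x \<in> set q'" using \<open>r' @ x # q = y' # q'\<close> by (metis append_Cons in_set_conv_decomp list.inject)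
        then show ?thesis using nin by simp
      qed
    qed
  next
    fix r assume r: "p @ r = p'" "x # q = r @ [x', y'] @ q'" "r \<noteq> []"
    then have "x \<in> set p'" by (cases r) auto
    then show ?thesis using nin by simp
  qed
qed

text \<open>Only multiplication of the idempotent with a neighbour can give a valid result. For an
  inner idempotent the two products agree and cancel; at an end the single product equals the cut
  that splits the idempotent off.\<close>

lemma rel_idem:
  assumes s: "cmp s" "x \<in> set s" "uw x = []" "2 \<le> length s"
  shows "(\<Sum>x\<in>ops s. Gl (res s x)) = d (Gl s) + splits s"
proof -
  obtain p q where pq: "s = p @ x # q" using s(2) by (meson split_list)
  obtain v where x: "x = Idem v" using s(3) by (cases x) auto
  have G0: "Gl s = 0" using not_valid_idem[OF s(2-4)] by (simp add: Gl_def)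
  have one: "p \<noteq> [] \<or> q \<noteq> []" using s(4) pq by auto
  have l: "mulB x (hd q) = {hd q}" "hd q \<in> muBinf [x, hd q]" if "q \<noteq> []"
  proof -
    show "mulB x (hd q) = {hd q}" using s(1) that unfolding pq mulB_iff x by (auto simp: cmp_append cmp_Cons)
    then show "hd q \<in> muBinf [x, hd q]" unfolding muBinf_iff by blast
  qed
  have r: "mulB (last p) x = {last p}" "last p \<in> muBinf [last p, x]" if "p \<noteq> []"
  proof -
    show "mulB (last p) x = {last p}" using s(1) that unfolding pq mulB_iff x by (auto simp: cmp_append cmp_Cons)
    then show "last p \<in> muBinf [last p, x]" unfolding muBinf_iff by blast
  qed
  let ?l = "(length p, 2 :: nat, hd q)" and ?r = "(length p - 1, 2 :: nat, last p)"
  have lo: "?l \<in> ops s" "res s ?l = p @ q" if "q \<noteq> []"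
  proof -
    have e: "s = p @ [x, hd q] @ tl q" using pq that by simp
    show "?l \<in> ops s" using ops_I[OF e l(2)[OF that]] by (simp add: numeral_2_eq_2)
    show "res s ?l = p @ q" using res_append[OF e, of "hd q"] that by (simp add: numeral_2_eq_2)
  qed
  have ro: "?r \<in> ops s" "res s ?r = p @ q" if "p \<noteq> []"
  proof -
    have e: "s = butlast p @ [last p, x] @ q" using pq that by simp
    show "?r \<in> ops s" using ops_I[OF e r(2)[OF that]] by (simp add: numeral_2_eq_2)
    show "res s ?r = p @ q" using res_append[OF e, of "last p"] that by (simp add: numeral_2_eq_2)
  qed
  define S where "S = (if q \<noteq> [] then {?l} else {}) \<union> (if p \<noteq> [] then {?r} else {})"
  have "(\<Sum>x\<in>ops s. Gl (res s x)) = (\<Sum>x\<in>S. Gl (res s x))"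
  proof (rule ops_sum)
    show "S \<subseteq> ops s" using lo ro by (auto simp: S_def)
    fix z assume z: "z \<in> ops s" "valid (res s z)"
    obtain i j b where z': "z = (i, j, b)" by (cases z)
    from idem_ops[OF pq s(3) z[unfolded z'] s(4)] one
    have "j = 2 \<and> (i = length p \<and> q \<noteq> [] \<and> mulB x (hd q) = {b} \<or> Suc i = length p \<and> mulB (last p) x = {b})" by blast
    then show "z \<in> S"
    proof (elim conjE disjE)
      assume "j = 2" "i = length p" "q \<noteq> []" "mulB x (hd q) = {b}"
      then show ?thesis using l(1) by (simp add: S_def z')
    next
      assume "j = 2" "Suc i = length p" "mulB (last p) x = {b}"
      moreover then have "p \<noteq> []" by auto
      moreover then have "b = last p" using r(1) \<open>mulB (last p) x = {b}\<close> by simp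
      ultimately show ?thesis by (auto simp: S_def z')
    qed
  qed
  also have "\<dots> = (if p = [] then Gl q else if q = [] then Gl p else 0)"
  proof -
    have "?l \<noteq> ?r" if "p \<noteq> []" using that by (cases p) auto
    then show ?thesis using one lo(2) ro(2) by (auto simp: S_def)
  qed
  also have "\<dots> = splits s"
  proof -
    have inv: "\<not> valid (take i s)" if "length p < i" "2 \<le> i" "i < length s" for i
    proof (rule not_valid_idem[OF _ s(3)])
      show "x \<in> set (take i s)" using that by (simp add: pq take_Cons')
    qed (use that in simp)
    have inv': "\<not> valid (drop i s)" if "i \<le> length p" "i + 2 \<le> length s" for i
    proof (rule not_valid_idem[OF _ s(3)])
      show "x \<in> set (drop i s)" using that by (simp add: pq)
    qed (use that in simp)
    consider "p = []" | "p \<noteq> []" "q = []" | "p \<noteq> []" "q \<noteq> []" by blast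
    then show ?thesis
    proof cases
      case 1
      then have q: "q \<noteq> []" using one by simp
      have "splits s = Gl (take 1 s) * Gl (drop 1 s)"
        by (rule splits_single) (use inv s(4) 1 in auto)
      also have "\<dots> = e v * Gl q" using 1 pq x by (simp add: Gl_Idem)
      also have "\<dots> = Gl q"
        by (rule Gl_Idem_mult) (use s(1) pq 1 q x in \<open>auto simp: cmp_Cons\<close>)
      finally show ?thesis using 1 by simp
    next
      case 2
      have "splits s = Gl (take (length p) s) * Gl (drop (length p) s)"
        by (rule splits_single) (use inv' 2 pq in auto)
      also have "\<dots> = Gl p * e v" using 2 pq x by (simp add: Gl_Idem)
      also have "\<dots> = Gl p"
        by (rule Gl_mult_Idem) (use s(1) pq 2 x in \<open>auto simp: cmp_append\<close>)
      finally show ?thesis using 2 by simp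
    next
      case 3
      then have lp: "1 \<le> length p" "1 \<le> length q" by (simp_all add: Suc_le_eq)
      have "splits s = 0"
      proof (rule splits_zero)
        fix i assume i: "0 < i" "i < length s"
        show "\<not> valid (take i s) \<or> \<not> valid (drop i s)"
        proof (cases "i \<le> length p")
          case True
          then show ?thesis using inv'[of i] lp pq by simp
        next
          case False
          then show ?thesis using inv[of i] lp i by simp
        qed
      qed
      then show ?thesis using 3 by simp
    qed
  qed
  finally show ?thesis by (simp add: G0 d0)
qed

end

lemma char2_move:
  assumes "x1 + x2 + (x3 + x4) + x5 = (0 :: 'm::char2)"
  shows "x3 + x5 + x4 = x1 + x2"
proof -
  have "(x1 + x2) + (x3 + x5 + x4) = x1 + x2 + (x3 + x4) + x5" by (simp add: ac_simps)
  then have "(x1 + x2) + (x3 + x5 + x4) = 0" unfolding assms .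
  then show ?thesis unfolding add_eq_0_char2 by (rule sym)
qed

lemma char2_cancel2: "x1 + x2 + (x3 + x2 + x1) = (x3 :: 'm::char2)"
proof -
  have "x1 + x2 + (x3 + x2 + x1) = x3 + (x1 + x1) + (x2 + x2)" by (simp only: ac_simps)
  then show ?thesis by simp
qed

lemma muBinf_length: "b \<in> muBinf u \<Longrightarrow> 2 \<le> length u"
  unfolding muBinf_iff using preb_good[of u b] sufb_good[of u b] by auto

lemma preb_muBinf: "preb u b \<Longrightarrow> b \<in> muBinf u" and sufb_muBinf: "sufb u b \<Longrightarrow> b \<in> muBinf u"
  and mulB_muBinf: "mulB x x' = {b} \<Longrightarrow> b \<in> muBinf [x, x']"
  unfolding muBinf_iff by blast+

text \<open>A full disk sequence satisfies both disk clauses with an idempotent as remainder; since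
  \<open>muBinf\<close> is a set, this output is counted once.\<close>

lemma muBinf_idem:
  assumes "good s"
  shows "b \<in> muBinf s \<and> uw b = [] \<longleftrightarrow> s \<noteq> [] \<and> b = Idem (bsrc (hd s)) \<and> (\<exists>z. isT z (wd s))"
proof
  assume r: "s \<noteq> [] \<and> b = Idem (bsrc (hd s)) \<and> (\<exists>z. isT z (wd s))"
  then have d: "disk s" using assms by (simp add: disk_iff)
  have t: "btgt (last s) = bsrc (hd s)" using disk_ends[OF d] .
  have "disk (butlast s @ [last s])" using d r by simp
  moreover have "mulB (last s) b = {last s}" unfolding mulB_iff using r t by simp
  ultimately have "preb s b" unfolding preb_def by blast
  then show "b \<in> muBinf s \<and> uw b = []" using r preb_muBinf by simp
next
  assume l: "b \<in> muBinf s \<and> uw b = []"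
  then have b: "s \<noteq> []" "b = Idem (bsrc (hd s))"
    using muBinf_ends[of b s] uw_Nil_iff[of b] by auto
  have "disk s"
  proof -
    consider (m) x x' where "s = [x, x']" "mulB x x' = {b}" | (p) "preb s b" | (s) "sufb s b"
      using l unfolding muBinf_iff by blast
    then show ?thesis
    proof cases
      case m
      then have "uw x = []" using mulB_D(4)[OF m(2)] l by simp
      then show ?thesis using good_noidem[OF assms, of x] m(1) by simp
    next
      case p
      then obtain t c a where *: "s = t @ [c]" "disk (t @ [a])" "bsrc c = bsrc a" "uw c = uw a @ uw b"
        by (rule preb_D) blast
      then have "c = a" using l by (intro uw_eq) simp_all
      then show ?thesis using * by simp
    next
      case s
      then obtain t c a where *: "s = c # t" "disk (a # t)" "btgt b = bsrc a" "bsrc c = bsrc b" "uw c = uw b @ uw a"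
        by (rule sufb_D) blast
      have "btgt b = bsrc b" using b(2) by (cases b) simp_all
      then have "c = a" using l * by (intro uw_eq) simp_all
      then show ?thesis using * by simp
    qed
  qed
  then show "s \<noteq> [] \<and> b = Idem (bsrc (hd s)) \<and> (\<exists>z. isT z (wd s))"
    using b by (simp add: disk_iff)
qed

lemma good_pre:
  assumes "good s" "preb (take j s) b" "uw b \<noteq> []"
  shows "good (b # drop j s)" and "bsrc b = bsrc (hd s)" and "hd (wd (b # drop j s)) = kd b"
proof -
  note g = preb_good[OF assms(2)]
  have ne: "take j s \<noteq> []" using g by auto
  have k: "kd b = kd (last (take j s))" using preb_kd(1)[OF assms(2,3)] .
  have "good (take j s @ drop j s)" using assms(1) by simp
  then show "good (b # drop j s)" unfolding good_append good_Cons using g ne k assms(3) by auto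
  show "bsrc b = bsrc (hd s)" using g ne by (cases s; cases j) auto
  show "hd (wd (b # drop j s)) = kd b" using assms(3) by simp
qed

lemma good_suf:
  assumes "good s" "sufb (drop i s) b" "uw b \<noteq> []"
  shows "good (take i s @ [b])" and "bsrc (hd (take i s @ [b])) = bsrc (hd s)"
    and "last (wd (take i s @ [b])) = kd b" and "btgt b = btgt (last s)"
proof -
  note g = sufb_good[OF assms(2)]
  have ne: "drop i s \<noteq> []" using g by auto
  have k: "kd b = kd (hd (drop i s))" using sufb_kd(1)[OF assms(2,3)] .
  have "good (take i s @ drop i s)" using assms(1) by simp
  then show "good (take i s @ [b])" unfolding good_append using g ne k assms(3) by auto
  show "bsrc (hd (take i s @ [b])) = bsrc (hd s)" using g ne by (cases s; cases i) auto
  show "last (wd (take i s @ [b])) = kd b" using assms(3) uw_last by simp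
  show "btgt b = btgt (last s)" using g ne by simp
qed

context koszul_idem
begin

definition preS :: "bbasis list \<Rightarrow> (nat \<times> bbasis) set" where
  "preS s = {(j, b). j \<le> length s \<and> preb (take j s) b \<and> uw b \<noteq> []}"

definition sufS :: "bbasis list \<Rightarrow> (nat \<times> bbasis) set" where
  "sufS s = {(i, b). i \<le> length s \<and> sufb (drop i s) b \<and> uw b \<noteq> []}"

lemma finite_preS: "finite (preS s)"
proof (rule finite_subset)
  show "preS s \<subseteq> (SIGMA j:{..length s}. muBinf (take j s))"
    by (auto simp: preS_def preb_muBinf)
qed (intro finite_SigmaI finite_muBinf finite_atMost)

lemma finite_sufS: "finite (sufS s)"
proof (rule finite_subset)
  show "sufS s \<subseteq> (SIGMA i:{..length s}. muBinf (drop i s))"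
    by (auto simp: sufS_def sufb_muBinf)
qed (intro finite_SigmaI finite_muBinf finite_atMost)

text \<open>The word identity \<open>gv_rel\<close> translated entry by entry: \<open>S1\<close> and
  \<open>S2\<close> are the disk products with nontrivial remainder at the beginning and at the end,
  \<open>S3\<close> is the full disk word, and cuts between entries are letter changes.\<close>

lemma rel_good:
  assumes s: "good s" "s \<noteq> []"
  shows "(\<Sum>x\<in>ops s. Gl (res s x)) = d (Gl s) + splits s"
proof -
  let ?w = "wd s" and ?v = "bsrc (hd s)"
  have w: "?w \<noteq> []" using s good_noidem[OF s(1), of "hd s"] by (cases s) auto
  define S1 where "S1 = (\<lambda>(j, b). (0 :: nat, j, b)) ` preS s"
  define S2 where "S2 = (\<lambda>(i, b). (i, length s - i, b)) ` sufS s"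
  define S3 where "S3 = (if \<exists>z. isT z ?w then {(0 :: nat, length s, Idem ?v)} else {})"
  let ?g = "\<lambda>x. Gl (res s x)"
  have fin: "finite S1" "finite S2" "finite S3"
    by (auto simp: S1_def S2_def S3_def finite_preS finite_sufS)
  have "(\<Sum>x\<in>ops s. ?g x) = (\<Sum>x\<in>S1 \<union> S2 \<union> S3. ?g x)"
  proof (rule ops_sum)
    have "S1 \<subseteq> ops s" by (auto simp: S1_def preS_def ops_def preb_muBinf)
    moreover have "S2 \<subseteq> ops s" by (auto simp: S2_def sufS_def ops_def sufb_muBinf)
    moreover have "S3 \<subseteq> ops s"
      using muBinf_idem[OF s(1), of "Idem ?v"] s(2) by (auto simp: S3_def ops_def)
    ultimately show "S1 \<union> S2 \<union> S3 \<subseteq> ops s" by blast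
    fix x assume x: "x \<in> ops s" "valid (res s x)"
    obtain i j b where x': "x = (i, j, b)" by (cases x)
    have o: "i \<le> length s" "j \<le> length s - i" "b \<in> muBinf (take j (drop i s))"
      using x(1) unfolding x' ops_def by simp_all
    from good_ops[OF s(1) x[unfolded x']]
    show "x \<in> S1 \<union> S2 \<union> S3"
    proof (elim disjE conjE)
      assume *: "i = 0" "preb (take j s) b" "uw b \<noteq> []"
      then have "(j, b) \<in> preS s" using o by (simp add: preS_def)
      then have "x \<in> S1" unfolding S1_def x' * by force
      then show ?thesis by blast
    next
      assume *: "j = length s - i" "sufb (drop i s) b" "uw b \<noteq> []"
      then have "(i, b) \<in> sufS s" using o by (simp add: sufS_def)
      then have "x \<in> S2" unfolding S2_def x' * by force
      then show ?thesis by blast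
    next
      assume *: "i = 0" "j = length s" "uw b = []"
      then have "b = Idem ?v" "\<exists>z. isT z ?w" using o(3) muBinf_idem[OF s(1), of b] by simp_all
      then show ?thesis using * by (simp add: S3_def x')
    qed
  qed
  also have "\<dots> = sum ?g S1 + sum ?g S2 + sum ?g S3"
  proof -
    have "S1 \<inter> S2 = {}"
    proof (rule ccontr)
      assume "S1 \<inter> S2 \<noteq> {}"
      then obtain b where b: "preb s b" "sufb s b" "uw b \<noteq> []"
        by (force simp: S1_def S2_def preS_def sufS_def)
      show False using preb_kd[OF b(1)] sufb_kd[OF b(2)] b(3) by simp
    qed
    moreover have "(S1 \<union> S2) \<inter> S3 = {}"
      by (auto simp: S1_def S2_def S3_def preS_def sufS_def)
    ultimately show ?thesis using fin by (simp add: sum.union_disjoint)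
  qed
  also have "sum ?g S1 = (\<Sum>(j, b)\<in>preS s. e ?v * gv (wd (b # drop j s)))"
  proof -
    have "inj_on (\<lambda>(j, b). (0 :: nat, j, b)) (preS s)" by (auto simp: inj_on_def)
    then have "sum ?g S1 = (\<Sum>(j, b)\<in>preS s. ?g (0, j, b))"
      unfolding S1_def by (simp only: sum.reindex comp_def) (simp add: case_prod_beta)
    also have "\<dots> = (\<Sum>(j, b)\<in>preS s. e ?v * gv (wd (b # drop j s)))"
    proof (intro sum.cong refl, clarify)
      fix j b assume "(j, b) \<in> preS s"
      then have *: "preb (take j s) b" "uw b \<noteq> []" by (simp_all add: preS_def)
      show "?g (0, j, b) = e ?v * gv (wd (b # drop j s))"
        using good_pre[OF s(1) *] by (simp add: res_def Gl_good)
    qed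
    finally show ?thesis .
  qed
  also have "\<dots> = e ?v * (\<Sum>(j, b)\<in>preS s. gv (wd (b # drop j s)))"
    by (simp add: sum_distrib_left case_prod_beta)
  also have "(\<Sum>(j, b)\<in>preS s. gv (wd (b # drop j s))) = 
      (\<Sum>i\<le>length ?w. if (\<exists>x. isT x (take i ?w)) \<and> drop i ?w \<noteq> [] \<and>
       hd (drop i ?w) = last (take i ?w) then gv (drop i ?w) else 0)" (is "_ = ?P")
    unfolding preS_def by (rule prefix_sum[OF s(1)])
  also have "sum ?g S2 = (\<Sum>(i, b)\<in>sufS s. e ?v * gv (wd (take i s @ [b])))"
  proof -
    have "inj_on (\<lambda>(i, b). (i, length s - i, b)) (sufS s)" by (auto simp: inj_on_def)
    then have "sum ?g S2 = (\<Sum>(i, b)\<in>sufS s. ?g (i, length s - i, b))"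
      unfolding S2_def by (simp only: sum.reindex comp_def) (simp add: case_prod_beta)
    also have "\<dots> = (\<Sum>(i, b)\<in>sufS s. e ?v * gv (wd (take i s @ [b])))"
    proof (intro sum.cong refl, clarify)
      fix i b assume "(i, b) \<in> sufS s"
      then have *: "sufb (drop i s) b" "uw b \<noteq> []" by (simp_all add: sufS_def)
      show "?g (i, length s - i, b) = e ?v * gv (wd (take i s @ [b]))"
        using good_suf(1,2)[OF s(1) *] Gl_good[of "take i s @ [b]"] by (simp add: res_def del: hd_append)
    qed
    finally show ?thesis .
  qed
  also have "\<dots> = e ?v * (\<Sum>(i, b)\<in>sufS s. gv (wd (take i s @ [b])))"
    by (simp add: sum_distrib_left case_prod_beta)
  also have "(\<Sum>(i, b)\<in>sufS s. gv (wd (take i s @ [b]))) =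
      (\<Sum>l\<le>length ?w. if take l ?w \<noteq> [] \<and> last (take l ?w) = hd (drop l ?w) \<and>
       (\<exists>x. isT x (drop l ?w)) then gv (take l ?w) else 0)" (is "_ = ?B")
    unfolding sufS_def by (rule suffix_sum[OF s(1)])
  also have "sum ?g S3 = e ?v * (if \<exists>z. isT z ?w then 1 else 0)"
    by (simp add: S3_def res_def Gl_Idem)
  finally have L: "(\<Sum>x\<in>ops s. ?g x) = e ?v * (?P + ?B + (if \<exists>z. isT z ?w then 1 else 0))"
    by (simp only: distrib_left)
  have "splits s = (\<Sum>k \<in> {0<..<length s}. e ?v * (gv (wd (take k s)) * gv (wd (drop k s))))"
    unfolding splits_def
  proof (intro sum.cong refl)
    fix m assume m: "m \<in> {0<..<length s}"
    have g: "good (take m s @ drop m s)" using s by simp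
    have ne: "take m s \<noteq> []" "drop m s \<noteq> []" using m by auto
    have gg: "good (take m s)" "good (drop m s)" "btgt (last (take m s)) = bsrc (hd (drop m s))"
      using g ne unfolding good_append by blast+
    have h: "hd (take m s) = hd s" using m by (cases s; cases m) auto
    have "Gl (take m s) * Gl (drop m s) = e (bsrc (hd (take m s))) * (gv (wd (take m s)) * gv (wd (drop m s)))"
      using Gl_mult[of "take m s" "drop m s"] gg ne unfolding valid_def by presburger
    then show "Gl (take m s) * Gl (drop m s) = e ?v * (gv (wd (take m s)) * gv (wd (drop m s)))"
      unfolding h .
  qed
  also have "\<dots> = e ?v * (\<Sum>k \<in> {0<..<length s}. gv (wd (take k s)) * gv (wd (drop k s)))"
    by (simp only: sum_distrib_left)
  also have "(\<Sum>k \<in> {0<..<length s}. gv (wd (take k s)) * gv (wd (drop k s))) =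
     (\<Sum>i\<le>length ?w. if take i ?w \<noteq> [] \<and> drop i ?w \<noteq> [] \<and> last (take i ?w) \<noteq> hd (drop i ?w)
        then gv (take i ?w) * gv (drop i ?w) else 0)" (is "_ = ?C")
    by (rule change_sum[OF s(1), where f = "\<lambda>u u'. gv u * gv u'"])
  finally have R: "splits s = e ?v * ?C" .
  have D: "d (Gl s) = e ?v * d (gv ?w)"
    by (simp add: Gl_good[OF s] d_mult de)
  \<comment> \<open>In \<open>gv_rel\<close> a full disk word belongs to the sum over initial
    deletions, with value \<open>gv [] = 1\<close>. It is split off to match
    \<open>S3\<close>.\<close>
  have A: "(\<Sum>i\<le>length ?w. if (\<exists>x. isT x (take i ?w)) \<and> (drop i ?w = [] \<or> hd (drop i ?w) = last (take i ?w)) then gv (drop i ?w) else 0) =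
     ?P + (if \<exists>z. isT z ?w then 1 else 0)"
  proof -
    have "(\<Sum>i\<le>length ?w. if (\<exists>x. isT x (take i ?w)) \<and> (drop i ?w = [] \<or> hd (drop i ?w) = last (take i ?w)) then gv (drop i ?w) else 0) =
      (\<Sum>i\<le>length ?w. (if (\<exists>x. isT x (take i ?w)) \<and> drop i ?w \<noteq> [] \<and>
       hd (drop i ?w) = last (take i ?w) then gv (drop i ?w) else 0) +
         (if i = length ?w then if \<exists>z. isT z ?w then 1 else 0 else 0))"
    proof (intro sum.cong refl)
      fix i assume "i \<in> {..length ?w}"
      then consider "i = length ?w" | "i < length ?w" by fastforce
      then show "(if (\<exists>x. isT x (take i ?w)) \<and> (drop i ?w = [] \<or> hd (drop i ?w) = last (take i ?w)) then gv (drop i ?w) else 0) =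
         (if (\<exists>x. isT x (take i ?w)) \<and> drop i ?w \<noteq> [] \<and>
       hd (drop i ?w) = last (take i ?w) then gv (drop i ?w) else 0) +
         (if i = length ?w then if \<exists>z. isT z ?w then 1 else 0 else 0)"
      proof cases
        case 1
        then show ?thesis by (simp add: gv_def)
      next
        case 2
        then have "drop i ?w \<noteq> []" "i \<noteq> length ?w" by auto
        then show ?thesis by (simp only: simp_thms if_False add_0_right)
      qed
    qed
    then show ?thesis by (simp only: sum.distrib sum.delta[OF finite_atMost] atMost_iff order_refl if_True)
  qed
  from gv_rel[OF w] have "d (gv ?w) + ?C + (?P + (if \<exists>z. isT z ?w then 1 else 0)) + ?B = 0"
    unfolding A .
  then have "?P + ?B + (if \<exists>z. isT z ?w then 1 else 0) = d (gv ?w) + ?C"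
    by (rule char2_move)
  then show ?thesis unfolding L R D distrib_left[symmetric] by (rule arg_cong)
qed

lemma letter_join:
  assumes "uw x \<noteq> []" "uw x' \<noteq> []" "kd x = kd x'" "btgt x = bsrc x'"
  obtains b' where "mulB x x' = {b'}"
proof -
  obtain n where n: "uw x = replicate (Suc n) (kd x)" using uw_cases[of x] assms(1) by blast
  obtain m where m: "uw x' = replicate (Suc m) (kd x')" using uw_cases[of x'] assms(2) by blast
  obtain b' where b': "bsrc b' = bsrc x" "uw b' = replicate (Suc (n + Suc m)) (kd x)"
    using letter_ex by blast
  have "replicate (Suc (n + Suc m)) (kd x) = replicate (Suc n) (kd x) @ replicate (Suc m) (kd x)"
    by (simp only: replicate_add[symmetric] add_Suc)
  also have "\<dots> = uw x @ uw x'"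
    using n m[folded assms(3)] by argo
  finally have "uw b' = uw x @ uw x'" using b'(2) by (rule trans[rotated])
  then show ?thesis using that b'(1) assms(4) unfolding mulB_iff by blast
qed

text \<open>The word identity \<open>gv_run\<close> translated: the value on the sequence itself is
  zero, and the ways to remove the unique junction of equal letters add up to the product of the two
  values.\<close>

lemma rel_split:
  assumes s: "split2 s1 s2"
  shows "(\<Sum>x\<in>ops (s1 @ s2). Gl (res (s1 @ s2) x)) = d (Gl (s1 @ s2)) + splits (s1 @ s2)"
proof -
  have S: "s1 \<noteq> []" "s2 \<noteq> []" "good s1" "good s2" "btgt (last s1) = bsrc (hd s2)" "kd (last s1) = kd (hd s2)"
    using s by (simp_all add: split2_def)
  let ?s = "s1 @ s2" and ?u = "wd s1" and ?w = "wd s2" and ?v = "bsrc (hd s1)"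
  define z where "z = kd (last s1)"
  have nid: "uw (last s1) \<noteq> []" "uw (hd s2) \<noteq> []" using S good_noidem by auto
  have ne: "?u \<noteq> []" "?w \<noteq> []" using nid last_in_set[OF S(1)] hd_in_set[OF S(2)] by auto
  have lu: "last ?u = z"
  proof -
    obtain t x where t: "s1 = t @ [x]" using S(1) by (metis append_butlast_last_id)
    then have "uw x \<noteq> []" using nid(1) by simp
    then show ?thesis using uw_last[of x] t by (simp add: z_def)
  qed
  have hw: "hd ?w = z" unfolding z_def S(6) using S(2) nid(2) by (cases s2) simp_all
  obtain b' where b': "mulB (last s1) (hd s2) = {b'}"
    by (rule letter_join[OF nid S(6,5)])
  have ngood: "\<not> good (t1 @ t2)" if "t1 \<noteq> []" "t2 \<noteq> []" "last t1 = last s1" "hd t2 = hd s2" for t1 t2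
    using that S(6) by (simp add: good_append)
  have nvalid: "\<not> valid (t1 @ t2)" if "t1 \<noteq> []" "t2 \<noteq> []" "last t1 = last s1" "hd t2 = hd s2" for t1 t2
    using ngood[OF that] that unfolding valid_def by (auto simp: append_eq_Cons_conv)
  define S1 where "S1 = (\<lambda>(j, b). (length s1, j, b)) ` preS s2"
  define S2 where "S2 = (\<lambda>(i, b). (i, length s1 - i, b)) ` sufS s1"
  define S3 where "S3 = {(length s1 - 1, 2 :: nat, b')}"
  let ?g = "\<lambda>x. Gl (res ?s x)"
  have fin: "finite S1" "finite S2" "finite S3"
    by (auto simp: S1_def S2_def S3_def finite_preS finite_sufS)
  have e3: "?s = butlast s1 @ [last s1, hd s2] @ tl s2" using S(1,2) by simp
  have "(\<Sum>x\<in>ops ?s. ?g x) = (\<Sum>x\<in>S1 \<union> S2 \<union> S3. ?g x)"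
  proof (rule ops_sum)
    have "S1 \<subseteq> ops ?s" by (auto simp: S1_def preS_def ops_def preb_muBinf)
    moreover have "S2 \<subseteq> ops ?s" by (auto simp: S2_def sufS_def ops_def sufb_muBinf)
    moreover have "S3 \<subseteq> ops ?s"
      using ops_I[OF e3 mulB_muBinf[OF b']] S(1) by (simp add: S3_def numeral_2_eq_2)
    ultimately show "S1 \<union> S2 \<union> S3 \<subseteq> ops ?s" by blast
    fix x assume x: "x \<in> ops ?s" "valid (res ?s x)"
    obtain i j b where x': "x = (i, j, b)" by (cases x)
    have o: "i \<le> length ?s" "j \<le> length ?s - i" "b \<in> muBinf (take j (drop i ?s))"
      using x(1) unfolding x' ops_def by simp_all
    from split_ops[OF s x[unfolded x']]
    show "x \<in> S1 \<union> S2 \<union> S3"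
    proof (elim disjE conjE)
      assume *: "i = length s1" "preb (take j s2) b" "uw b \<noteq> []"
      then have "(j, b) \<in> preS s2" using o by (simp add: preS_def)
      then have "x \<in> S1" unfolding S1_def x' * by force
      then show ?thesis by blast
    next
      assume *: "i \<le> length s1" "j = length s1 - i" "sufb (drop i s1) b" "uw b \<noteq> []"
      then have "(i, b) \<in> sufS s1" using o by (simp add: sufS_def)
      then have "x \<in> S2" unfolding S2_def x' * by force
      then show ?thesis by blast
    next
      assume *: "i = length s1 - 1" "j = 2" "mulB (last s1) (hd s2) = {b}"
      then show ?thesis using b' by (simp add: S3_def x')
    qed
  qed
  also have "\<dots> = sum ?g S1 + sum ?g S2 + sum ?g S3"
  proof -
    have "S1 \<inter> S2 = {}"
    proof (rule ccontr)
      assume "S1 \<inter> S2 \<noteq> {}"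
      then obtain b where b: "preb [] b"
        by (force simp: S1_def S2_def preS_def sufS_def)
      show False using preb_good[OF b] by simp
    qed
    moreover have "(S1 \<union> S2) \<inter> S3 = {}"
    proof -
      have "length s1 - 1 \<noteq> length s1" "length s1 - (length s1 - 1) \<noteq> 2" using S(1) by (cases s1; simp)+
      then show ?thesis unfolding S1_def S2_def S3_def by force
    qed
    ultimately show ?thesis using fin by (simp add: sum.union_disjoint)
  qed
  also have "sum ?g S1 = (\<Sum>(j, b)\<in>preS s2. e ?v * (if hd (wd (b # drop j s2)) = ol z then gv (?u @ wd (b # drop j s2)) else 0))"
  proof -
    have "inj_on (\<lambda>(j, b). (length s1, j, b)) (preS s2)" by (auto simp: inj_on_def)
    then have "sum ?g S1 = (\<Sum>(j, b)\<in>preS s2. ?g (length s1, j, b))"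
      unfolding S1_def by (simp only: sum.reindex comp_def) (simp add: case_prod_beta)
    also have "\<dots> = (\<Sum>(j, b)\<in>preS s2. e ?v * (if hd (wd (b # drop j s2)) = ol z then gv (?u @ wd (b # drop j s2)) else 0))"
    proof (intro sum.cong refl, clarify)
      fix j b assume "(j, b) \<in> preS s2"
      then have *: "preb (take j s2) b" "uw b \<noteq> []" by (simp_all add: preS_def)
      note g = good_pre[OF S(4) *]
      have r: "res ?s (length s1, j, b) = s1 @ b # drop j s2" by (simp add: res_def)
      show "?g (length s1, j, b) = e ?v * (if hd (wd (b # drop j s2)) = ol z then gv (?u @ wd (b # drop j s2)) else 0)"
      proof (cases "kd b = ol z")
        case True
        then have "kd (last s1) \<noteq> kd b" by (simp add: z_def neq_iff_ol)
        then have "good (s1 @ b # drop j s2)" unfolding good_append using S g by simp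
        then show ?thesis using True S(1) g(3) unfolding r by (simp add: Gl_good)
      next
        case False
        then have "kd (last s1) = kd b" unfolding z_def by (metis neq_iff_ol)
        then have "\<not> good (s1 @ b # drop j s2)" unfolding good_append using S(1) by simp
        then have "\<not> valid (s1 @ b # drop j s2)" unfolding valid_def using S(1) by (auto simp: append_eq_Cons_conv)
        then show ?thesis using False g(3) unfolding r by (simp add: Gl_def)
      qed
    qed
    finally show ?thesis .
  qed
  also have "\<dots> = e ?v * (\<Sum>(j, b)\<in>preS s2. (if hd (wd (b # drop j s2)) = ol z then gv (?u @ wd (b # drop j s2)) else 0))"
    by (simp add: sum_distrib_left case_prod_beta)
  also have "(\<Sum>(j, b)\<in>preS s2. (if hd (wd (b # drop j s2)) = ol z then gv (?u @ wd (b # drop j s2)) else 0)) =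
      (\<Sum>i\<le>length ?w. if (\<exists>x. isT x (take i ?w)) \<and> drop i ?w \<noteq> [] \<and>
       hd (drop i ?w) = last (take i ?w) then (if hd (drop i ?w) = ol z then gv (?u @ drop i ?w) else 0) else 0)"
    unfolding preS_def by (rule prefix_sum[OF S(4), where f = "\<lambda>t. if hd t = ol z then gv (?u @ t) else 0"])
  also have "\<dots> = (\<Sum>j\<le>length ?w. if drop j ?w \<noteq> [] \<and> hd (drop j ?w) = ol z \<and> isT z (take j ?w) then gv (?u @ drop j ?w) else 0)" (is "_ = ?P")
  proof (intro sum.cong refl)
    fix i
    have "(\<exists>x. isT x (take i ?w)) \<and> hd (drop i ?w) = last (take i ?w) \<and> hd (drop i ?w) = ol z \<longleftrightarrow>
       hd (drop i ?w) = ol z \<and> isT z (take i ?w)"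
    proof
      assume *: "(\<exists>x. isT x (take i ?w)) \<and> hd (drop i ?w) = last (take i ?w) \<and> hd (drop i ?w) = ol z"
      then obtain x where x: "isT x (take i ?w)" by blast
      have "last (take i ?w) = ol x" using isT_hd[OF x] by blast
      then have "ol x = ol z" using * by metis
      then have "x = z" by (cases x; cases z) simp_all
      then show "hd (drop i ?w) = ol z \<and> isT z (take i ?w)" using x * by blast
    next
      assume *: "hd (drop i ?w) = ol z \<and> isT z (take i ?w)"
      then have "last (take i ?w) = ol z" using isT_hd by blast
      then show "(\<exists>x. isT x (take i ?w)) \<and> hd (drop i ?w) = last (take i ?w) \<and> hd (drop i ?w) = ol z"
        using * by metis
    qed
    then show "(if (\<exists>x. isT x (take i ?w)) \<and> drop i ?w \<noteq> [] \<and>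
       hd (drop i ?w) = last (take i ?w) then (if hd (drop i ?w) = ol z then gv (?u @ drop i ?w) else 0) else 0) =
       (if drop i ?w \<noteq> [] \<and> hd (drop i ?w) = ol z \<and> isT z (take i ?w) then gv (?u @ drop i ?w) else 0)"
      by argo
  qed
  also have "sum ?g S2 = (\<Sum>(i, b)\<in>sufS s1. e ?v * (if last (wd (take i s1 @ [b])) = ol z then gv (wd (take i s1 @ [b]) @ ?w) else 0))"
  proof -
    have "inj_on (\<lambda>(i, b). (i, length s1 - i, b)) (sufS s1)" by (auto simp: inj_on_def)
    then have "sum ?g S2 = (\<Sum>(i, b)\<in>sufS s1. ?g (i, length s1 - i, b))"
      unfolding S2_def by (simp only: sum.reindex comp_def) (simp add: case_prod_beta)
    also have "\<dots> = (\<Sum>(i, b)\<in>sufS s1. e ?v * (if last (wd (take i s1 @ [b])) = ol z then gv (wd (take i s1 @ [b]) @ ?w) else 0))"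
    proof (intro sum.cong refl, clarify)
      fix i b assume "(i, b) \<in> sufS s1"
      then have *: "i \<le> length s1" "sufb (drop i s1) b" "uw b \<noteq> []" by (simp_all add: sufS_def)
      note g = good_suf[OF S(3) *(2,3)]
      have r: "res ?s (i, length s1 - i, b) = (take i s1 @ [b]) @ s2" using *(1) by (simp add: res_def)
      show "?g (i, length s1 - i, b) = e ?v * (if last (wd (take i s1 @ [b])) = ol z then gv (wd (take i s1 @ [b]) @ ?w) else 0)"
      proof (cases "kd b = ol z")
        case True
        then have "kd b \<noteq> kd (hd s2)" using S(6) by (simp add: z_def neq_iff_ol)
        then have G: "good ((take i s1 @ [b]) @ s2)" unfolding good_append[of "_ @ _"] using S(4,5) g by simp
        have "bsrc (hd ((take i s1 @ [b]) @ s2)) = ?v" using g(2) hd_append2[of "take i s1 @ [b]" s2] by simp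
        then have "Gl ((take i s1 @ [b]) @ s2) = e ?v * gv (wd ((take i s1 @ [b]) @ s2))"
          using Gl_good[OF G] by simp
        then show ?thesis using True unfolding r g(3) by simp
      next
        case False
        then have "kd b = kd (hd s2)" unfolding S(6)[symmetric] z_def by (metis neq_iff_ol)
        then have "\<not> good ((take i s1 @ [b]) @ s2)" unfolding good_append[of "_ @ _"] using S(2) by simp
        then have "\<not> valid ((take i s1 @ [b]) @ s2)" unfolding valid_def using S(2) by (auto simp: append_eq_Cons_conv)
        then show ?thesis using False unfolding r g(3) by (simp only: Gl_def if_False mult_zero_right)
      qed
    qed
    finally show ?thesis .
  qed
  also have "\<dots> = e ?v * (\<Sum>(i, b)\<in>sufS s1. (if last (wd (take i s1 @ [b])) = ol z then gv (wd (take i s1 @ [b]) @ ?w) else 0))"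
    by (simp add: sum_distrib_left case_prod_beta)
  also have "(\<Sum>(i, b)\<in>sufS s1. (if last (wd (take i s1 @ [b])) = ol z then gv (wd (take i s1 @ [b]) @ ?w) else 0)) =
    (\<Sum>l\<le>length ?u. if take l ?u \<noteq> [] \<and> last (take l ?u) = hd (drop l ?u) \<and>
       (\<exists>x. isT x (drop l ?u)) then (if last (take l ?u) = ol z then gv (take l ?u @ ?w) else 0) else 0)"
    unfolding sufS_def by (rule suffix_sum[OF S(3), where f = "\<lambda>t. if last t = ol z then gv (t @ ?w) else 0"])
  also have "\<dots> = (\<Sum>i\<le>length ?u. if take i ?u \<noteq> [] \<and> last (take i ?u) = ol z \<and> isT (ol z) (drop i ?u) then gv (take i ?u @ ?w) else 0)" (is "_ = ?B")
  proof (intro sum.cong refl)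
    fix i
    have "last (take i ?u) = hd (drop i ?u) \<and> (\<exists>x. isT x (drop i ?u)) \<and> last (take i ?u) = ol z \<longleftrightarrow>
       last (take i ?u) = ol z \<and> isT (ol z) (drop i ?u)"
    proof
      assume *: "last (take i ?u) = hd (drop i ?u) \<and> (\<exists>x. isT x (drop i ?u)) \<and> last (take i ?u) = ol z"
      then obtain x where x: "isT x (drop i ?u)" by blast
      have "hd (drop i ?u) = x" using isT_hd[OF x] by blast
      then have "x = ol z" using * by metis
      then show "last (take i ?u) = ol z \<and> isT (ol z) (drop i ?u)" using x * by blast
    next
      assume *: "last (take i ?u) = ol z \<and> isT (ol z) (drop i ?u)"
      then have "hd (drop i ?u) = ol z" using isT_hd by blast
      then show "last (take i ?u) = hd (drop i ?u) \<and> (\<exists>x. isT x (drop i ?u)) \<and> last (take i ?u) = ol z"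
        using * by metis
    qed
    then show "(if take i ?u \<noteq> [] \<and> last (take i ?u) = hd (drop i ?u) \<and>
       (\<exists>x. isT x (drop i ?u)) then (if last (take i ?u) = ol z then gv (take i ?u @ ?w) else 0) else 0) =
       (if take i ?u \<noteq> [] \<and> last (take i ?u) = ol z \<and> isT (ol z) (drop i ?u) then gv (take i ?u @ ?w) else 0)"
      by argo
  qed
  also have "sum ?g S3 = e ?v * gv (?u @ ?w)"
  proof -
    have r: "res ?s (length s1 - 1, 2, b') = butlast s1 @ b' # tl s2"
      using res_append[OF e3, of b'] by (simp add: numeral_2_eq_2)
    note M = mulB_D[OF b']
    have k: "kd b' = kd (last s1)" "kd b' = kd (hd s2)" using M(5)[OF nid(1)] M(6)[OF nid(2)] by simp_all
    have nb: "uw b' \<noteq> []" using M(4) nid by simp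
    have g1: "good (butlast s1 @ [last s1])" "good (hd s2 # tl s2)" using S(1-4) by simp_all
    have g: "good (butlast s1 @ b' # tl s2)"
      using g1 M(2,3) k nb unfolding good_append[of "butlast s1"] good_Cons by auto
    have b: "bsrc (hd (butlast s1 @ b' # tl s2)) = ?v"
      using M(2) S(1) by (cases s1 rule: rev_cases; cases "butlast s1") (auto simp: hd_append)
    have "wd (butlast s1 @ b' # tl s2) = wd (butlast s1 @ [last s1]) @ wd (hd s2 # tl s2)"
      using M(4) by simp
    then have "wd (butlast s1 @ b' # tl s2) = ?u @ ?w" using S(1,2) by simp
    then have "?g (length s1 - 1, 2, b') = e ?v * gv (?u @ ?w)" unfolding r using Gl_good[OF g] b by simp
    then show ?thesis by (simp add: S3_def)
  qed
  finally have L: "(\<Sum>x\<in>ops ?s. ?g x) = e ?v * (?P + ?B + gv (?u @ ?w))"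
    by (simp only: distrib_left)
  have "splits ?s = Gl (take (length s1) ?s) * Gl (drop (length s1) ?s)"
  proof (rule splits_single)
    fix i assume i: "0 < i" "i < length ?s" "i \<noteq> length s1"
    show "\<not> valid (take i ?s) \<or> \<not> valid (drop i ?s)"
    proof (cases "i < length s1")
      case True
      then have "drop i ?s = drop i s1 @ s2" "drop i s1 \<noteq> []" "last (drop i s1) = last s1" by simp_all
      then show ?thesis using nvalid[of "drop i s1" s2] S(2) by simp
    next
      case False
      then have *: "take i ?s = s1 @ take (i - length s1) s2" "take (i - length s1) s2 \<noteq> []"
        using i S(2) by simp_all
      then have "hd (take (i - length s1) s2) = hd s2" using S(2) by (cases s2; cases "i - length s1") simp_all
      then show ?thesis using nvalid[of s1 "take (i - length s1) s2"] S(1) * by simp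
    qed
  qed (use S in auto)
  also have "\<dots> = Gl s1 * Gl s2" by simp
  also have "\<dots> = e ?v * (gv ?u * gv ?w)"
    using Gl_mult[of s1 s2] S unfolding valid_def by presburger
  finally have R: "splits ?s = e ?v * (gv ?u * gv ?w)" .
  have "\<not> valid ?s" using nvalid[of s1 s2] S by simp
  then have "Gl ?s = 0" unfolding Gl_def by (rule if_not_P)
  then have D: "d (Gl ?s) = 0" by (simp only: d0)
  have "gv (?u @ ?w) = gv ?u * gv ?w + ?B + ?P" by (rule gv_run[OF ne lu hw])
  then have K': "?P + ?B + gv (?u @ ?w) = gv ?u * gv ?w"
    using char2_cancel2[of ?P ?B] by (simp only:)
  show ?thesis unfolding L R D K' by simp
qed

text \<open>There are at least two junctions of equal letters. Neither one product nor one cut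
  removes them all, so every term is zero.\<close>

lemma rel_none:
  assumes s: "cmp s" "\<forall>x\<in>set s. uw x \<noteq> []" "\<not> good s" "\<And>s1 s2. s = s1 @ s2 \<Longrightarrow> \<not> split2 s1 s2"
  shows "(\<Sum>x\<in>ops s. Gl (res s x)) = d (Gl s) + splits s"
proof -
  have "(\<Sum>x\<in>ops s. Gl (res s x)) = (\<Sum>x\<in>{}. Gl (res s x))"
  proof (rule ops_sum)
    fix x assume x: "x \<in> ops s" "valid (res s x)"
    obtain i j b where x': "x = (i, j, b)" by (cases x)
    obtain p u q where 1: "s = p @ u @ q" "b \<in> muBinf u" "res s x = p @ b # q"
      using x(1) unfolding x' by (rule ops_D) blast
    have "\<not> good (p @ b # q)"
    proof
      assume "good (p @ b # q)"
      then have "good s \<or> (\<exists>s1 s2. s = s1 @ s2 \<and> split2 s1 s2)"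
        using good_step[OF 1(2)] s(2) unfolding 1(1) by simp
      then show False using s(3,4) by blast
    qed
    then obtain v where v: "p @ b # q = [Idem v]" using x(2) unfolding 1(3) valid_def by blast
    then have pq: "p = []" "q = []" "b = Idem v" by (cases p; simp)+
    then have u: "u = s" using 1(1) by simp
    consider (m) x1 x2 where "u = [x1, x2]" "mulB x1 x2 = {b}" | "good u"
      using 1(2) preb_good sufb_good unfolding muBinf_iff by blast
    then show "x \<in> {}"
    proof cases
      case m
      then show ?thesis using mulB_D(4)[OF m(2)] pq s(2) u by auto
    qed (use u s(3) in simp)
  qed simp
  moreover have nI: "good t" if "valid t" "\<forall>x\<in>set t. uw x \<noteq> []" for t
    using that unfolding valid_def by auto
  then have "\<not> valid s" using s(2,3) by blast
  then have "Gl s = 0" by (simp add: Gl_def)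
  moreover have "splits s = 0"
  proof (rule splits_zero)
    fix i assume i: "0 < i" "i < length s"
    let ?t = "take i s" and ?r = "drop i s"
    show "\<not> valid ?t \<or> \<not> valid ?r"
    proof (rule ccontr)
      assume "\<not> ?thesis"
      then have "good ?t" "good ?r"
        using nI[of ?t] nI[of ?r] s(2) by (auto dest: in_set_takeD in_set_dropD)
      moreover have "?t \<noteq> []" "?r \<noteq> []" using i by auto
      moreover have "btgt (last ?t) = bsrc (hd ?r)"
        using s(1) cmp_append[of ?t ?r] \<open>?t \<noteq> []\<close> \<open>?r \<noteq> []\<close> unfolding append_take_drop_id by blast
      moreover have "\<not> split2 ?t ?r" using s(4)[of ?t ?r] by simp
      ultimately have "good (?t @ ?r)" unfolding good_append split2_def by blast
      then show False using s(3) by simp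
    qed
  qed
  ultimately show ?thesis by (simp add: d0)
qed

theorem Gl_rel: "(\<Sum>x\<in>ops s. Gl (res s x)) = d (Gl s) + splits s"
proof (cases "length s \<le> 1")
  case True
  show ?thesis
  proof (cases "good s \<and> s \<noteq> []")
    case False
    have "ops s = {}"
    proof (rule ccontr)
      assume "ops s \<noteq> {}"
      then obtain i j b where "(i, j, b) \<in> ops s" by force
      then obtain p u q where "s = p @ u @ q" "b \<in> muBinf u" by (rule ops_D)
      then have "2 \<le> length s" using muBinf_length[of b u] by simp
      then show False using True by simp
    qed
    moreover have "{0<..<length s} = {}" using True by auto
    then have "splits s = 0" by (simp only: splits_def sum.empty)
    moreover have "d (Gl s) = 0"
    proof (cases s)
      case Nil
      then show ?thesis by (simp add: Gl_def valid_def d0)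
    next
      case (Cons x t)
      then have "s = [x]" using True by simp
      then show ?thesis using False uw_Nil_iff[of x] by (cases "uw x = []") (metis Gl_Idem de, simp)
    qed
    ultimately show ?thesis by simp
  qed (use rel_good in blast)
next
  case False
  then have l: "2 \<le> length s" "s \<noteq> []" by auto
  consider "\<not> cmp s" | x where "cmp s" "x \<in> set s" "uw x = []" | "good s" | s1 s2 where "s = s1 @ s2" "split2 s1 s2" |
    "cmp s" "\<forall>x\<in>set s. uw x \<noteq> []" "\<not> good s" "\<And>s1 s2. s = s1 @ s2 \<Longrightarrow> \<not> split2 s1 s2"
    by blast
  then show ?thesis
    by cases (use rel_not_cmp rel_idem rel_good rel_split rel_none l in \<open>simp_all, blast?\<close>)
qed

end

section \<open>Quantum degrees of words\<close>

fun wt :: "lt \<Rightarrow> int" where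
  "wt LD = - 2"
| "wt LS = - 1"

text \<open>The quantum degree expected of the value on a word. A letter change counts 3: it
  separates two inputs, each further input carries one more \<open>U\<close> of quantum degree -3,
  and \<open>U\<close> is suppressed here.\<close>

fun dl :: "lt list \<Rightarrow> int" where
  "dl [] = 0"
| "dl [x] = wt x"
| "dl (x # z # w) = wt x + (if x = z then 0 else 3) + dl (z # w)"

lemma wt_ol: "wt z + wt (ol z) = - 3"
  by (cases z) simp_all

lemma dl_Cons: "dl (x # w) = wt x + (if w = [] \<or> x = hd w then 0 else 3) + dl w"
  by (cases w) simp_all

lemma dl_append: "u \<noteq> [] \<Longrightarrow> v \<noteq> [] \<Longrightarrow> dl (u @ v) = dl u + dl v + (if last u = hd v then 0 else 3)"
  by (induction u rule: dl.induct) (simp_all add: dl_Cons)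

lemma dl_replicate: "dl (replicate n z) = wt z * int n"
proof (induction n)
  case (Suc n)
  then show ?case by (cases n) (simp_all add: dl_Cons algebra_simps)
qed simp

text \<open>Each node inserts two letters of either kind, of total weight -6, and two more letter
  changes, worth 6.\<close>

lemma dl_tw: "dl (z # tw z t @ ol z # w) = dl (z # ol z # w)"
proof (induction t arbitrary: z w)
  case (Nd s t u)
  let ?r2 = "tw z u @ ol z # ol z # w"
  let ?r1 = "tw (ol z) t @ z # ?r2"
  have 1: "dl (z # tw z s @ ol z # ?r1) = dl (z # ol z # ?r1)" by (rule Nd.IH(1))
  have "dl (ol z # tw (ol z) t @ ol (ol z) # ?r2) = dl (ol z # ol (ol z) # ?r2)" by (rule Nd.IH(2))
  then have 2: "dl (ol z # ?r1) = wt (ol z) + 3 + dl (z # ?r2)" by simp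
  have 3: "dl (z # ?r2) = dl (z # ol z # ol z # w)" by (rule Nd.IH(3))
  have 4: "dl (z # tw z (Nd s t u) @ ol z # w) = wt z + dl (z # tw z s @ ol z # ?r1)" by simp
  have 5: "dl (z # ol z # ?r1) = wt z + 3 + dl (ol z # ?r1)" by simp
  show ?case unfolding 4 1 5 2 3 using wt_ol[of z] by simp
qed simp

text \<open>Compare the disk word placed between \<open>z\<close> and \<open>ol z\<close> with the
  empty gap: the degrees agree, and the bordering letters only lengthen its first and last
  run.\<close>

lemma dl_isT: "isT z w \<Longrightarrow> dl w = 3"
proof -
  assume T: "isT z w"
  then obtain t where t: "w = tw z t" by (auto simp: isT_def)
  have "dl (z # w @ [ol z]) = dl [z, ol z]" using dl_tw[of z t "[]"] t by simp
  moreover have "dl (z # w @ [ol z]) = wt z + (dl w + wt (ol z))"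
    using isT_hd[OF T] by (simp add: dl_Cons[of z] dl_append)
  ultimately show ?thesis by simp
qed

lemma dl_uw: "dl (uw b) = fst (degB b)"
proof (cases b)
  case (Dp v n)
  have "dl (uw b) = wt LD * int (Suc n)" unfolding Dp uw.simps by (rule dl_replicate)
  then show ?thesis using Dp by simp
next
  case (Sw v n)
  have "dl (uw b) = wt LS * int (Suc n)" unfolding Sw uw.simps by (rule dl_replicate)
  then show ?thesis using Sw by simp
qed simp

abbreviation dq :: "bbasis list \<Rightarrow> int" where
  "dq s \<equiv> sum_list (map (\<lambda>b. fst (degB b)) s)"

lemma dl_good: "good s \<Longrightarrow> s \<noteq> [] \<Longrightarrow> dl (wd s) = dq s + 3 * (int (length s) - 1)"
proof (induction s rule: good.induct)
  case (3 a b s)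
  have g: "uw a \<noteq> []" "kd a \<noteq> kd b" "good (b # s)" using 3(2) by simp_all
  have "uw b \<noteq> []" using good_noidem[OF g(3), of b] by simp
  then have h: "wd (b # s) \<noteq> []" "hd (wd (b # s)) = kd b" by simp_all
  have "dl (uw a @ wd (b # s)) = dl (uw a) + dl (wd (b # s)) + 3"
    using dl_append[OF g(1) h(1)] uw_last[OF g(1)] h(2) g(2) by simp
  then show ?case using 3(1)[OF g(3)] by (simp add: dl_uw)
qed (simp_all add: dl_uw)

lemma dl_uw_append:
  assumes "u \<noteq> []" "uw b \<noteq> [] \<Longrightarrow> kd b = last u"
  shows "dl (u @ uw b) = dl u + fst (degB b)"
  using assms dl_append[of u "uw b"] dl_uw[of b] by (cases "uw b = []") simp_all

lemma dl_append_uw: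
  assumes "u \<noteq> []" "uw b \<noteq> [] \<Longrightarrow> kd b = hd u"
  shows "dl (uw b @ u) = dl u + fst (degB b)"
  using assms dl_append[of "uw b" u] dl_uw[of b] uw_last[of b] by (cases "uw b = []") simp_all

text \<open>Removing a disk word by a cut inside a run lowers \<open>dl\<close> by exactly 3, which
  \<open>dl_good\<close> converts into the degrees of the inputs.\<close>

lemma muBinf_deg:
  assumes "b \<in> muBinf u"
  shows "fst (degB b) = dq u + 3 * (int (length u) - 2)"
proof -
  consider (m) x x' where "u = [x, x']" "mulB x x' = {b}" | (p) "preb u b" | (s) "sufb u b"
    using assms unfolding muBinf_iff by blast
  then show ?thesis
  proof cases
    case m
    note M = mulB_D[OF m(2)]
    have "dl (uw b) = dl (uw x) + dl (uw x')"
    proof (cases "uw x = [] \<or> uw x' = []")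
      case False
      then have "last (uw x) = hd (uw x')" using uw_last[of x] M(5,6) by argo
      then show ?thesis unfolding M(4) using dl_append False by simp
    qed (use M(4) in auto)
    then show ?thesis using m(1) by (simp add: dl_uw)
  next
    case p
    then obtain t c a where *: "u = t @ [c]" "disk (t @ [a])" "uw c = uw a @ uw b" "uw a \<noteq> []" "good u"
      by (rule preb_D) blast
    obtain z where z: "isT z (wd (t @ [a]))" using disk_good[OF *(2)] by blast
    have "kd b = last (wd (t @ [a]))" if "uw b \<noteq> []"
      using kd_append[OF *(3)] that *(4) uw_last[of a] by simp
    then have "dl (wd (t @ [a]) @ uw b) = 3 + fst (degB b)"
      using dl_uw_append[of "wd (t @ [a])" b] dl_isT[OF z] isT_hd[OF z] by simp
    moreover have "wd u = wd (t @ [a]) @ uw b" using * by simp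
    moreover have "dl (wd u) = dq u + 3 * (int (length u) - 1)" using dl_good[OF *(5)] *(1) by simp
    ultimately show ?thesis by simp
  next
    case s
    then obtain t c a where *: "u = c # t" "disk (a # t)" "uw c = uw b @ uw a" "uw a \<noteq> []" "good u"
      by (rule sufb_D) blast
    obtain z where z: "isT z (wd (a # t))" using disk_good[OF *(2)] by blast
    have "kd b = hd (wd (a # t))" if "uw b \<noteq> []"
      using kd_append[OF *(3)] that *(4) by simp
    then have "dl (uw b @ wd (a # t)) = 3 + fst (degB b)"
      using dl_append_uw[of "wd (a # t)" b] dl_isT[OF z] isT_hd[OF z] by simp
    moreover have "wd u = uw b @ wd (a # t)" using * by simp
    moreover have "dl (wd u) = dq u + 3 * (int (length u) - 1)" using dl_good[OF *(5)] *(1) by simp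
    ultimately show ?thesis by simp
  qed
qed

lemma cf_X: "cf (X z) [] = 0" "cf (X z) (x # w) = (if x = z \<and> w = [] then 1 else 0)"
  by (simp_all add: X_def cf_ind)

lemma cf_X_Cons:
  fixes f :: "(lt, 'r::f2ring) ser"
  shows "cf (X z * f) (x # w) = (if x = z then cf f w else 0)"
proof -
  have e: "Ser (\<lambda>u. cf (X z) (x # u)) = (if x = z then 1 else 0 :: (lt, 'r) ser)"
    by (rule ser_eqI) (simp add: cf_X cf_1)
  show ?thesis unfolding cf_mult_Cons e by (simp add: cf_X(1))
qed

lemma cf_X_Nil: "cf (X z * f) [] = 0"
  by (simp add: X_def cf_ind)

lemma isT_run: "isT z w \<Longrightarrow> set w \<subseteq> {x} \<Longrightarrow> False"
proof -
  assume T: "isT z w" and s: "set w \<subseteq> {x}"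
  have h: "w \<noteq> []" "hd w = z" "last w = ol z" using isT_hd[OF T] by blast+
  have "hd w = x" "last w = x" using s hd_in_set[OF h(1)] last_in_set[OF h(1)] by blast+
  then show False using h by simp
qed

context koszul
begin

lemma gv_single: "gv [LD] = y" "gv [LS] = sg"
proof -
  have G1: "cf G [x] = cf K [x]" for x
    by (subst G_eq) (simp add: cf_mult K0 G_Nil)
  show "gv [LD] = y"
    unfolding gv_def G1 K_def by (simp add: cf_X_Cons cf_X_Nil cf_X cf_const tot_def ent_mu UNIV_lt)
  show "gv [LS] = sg"
    unfolding gv_def G1 K_def by (simp add: cf_X_Cons cf_X_Nil cf_X cf_const tot_def ent_mu UNIV_lt)
qed

text \<open>A run contains no disk word, so both correction sums of \<open>gv_run\<close>
  vanish.\<close>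

lemma gv_replicate: "gv (replicate (Suc n) x) = gv [x] ^ Suc n"
proof (induction n)
  case (Suc n)
  have "gv ([x] @ replicate (Suc n) x) = gv [x] * gv (replicate (Suc n) x) + 0 + 0"
  proof (subst gv_run[of "[x]" "replicate (Suc n) x" x], simp, simp, simp, simp,
      intro arg_cong2[where f = plus] refl sum.neutral ballI)
    fix i
    have "set (drop i [x]) \<subseteq> {x}" using set_drop_subset[of i "[x]"] by simp
    then have "\<not> isT (ol x) (drop i [x])" using isT_run by blast
    then show "(if take i [x] \<noteq> [] \<and> last (take i [x]) = ol x \<and> isT (ol x) (drop i [x]) then gv (take i [x] @ replicate (Suc n) x) else 0) = 0"
      by argo
  next
    fix j
    have "set (take j (replicate (Suc n) x)) \<subseteq> {x}" using set_take_subset[of j "replicate (Suc n) x"] by auto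
    then have "\<not> isT x (take j (replicate (Suc n) x))" using isT_run by blast
    then show "(if drop j (replicate (Suc n) x) \<noteq> [] \<and> hd (drop j (replicate (Suc n) x)) = ol x \<and> isT x (take j (replicate (Suc n) x)) then gv ([x] @ drop j (replicate (Suc n) x)) else 0) = 0"
      by argo
  qed
  then show ?case using Suc by simp
qed simp

end

lemma ent_col: "M = M * mu l l 1 \<Longrightarrow> m \<noteq> l \<Longrightarrow> ent M i m = 0"
proof -
  assume M: "M = M * mu l l 1" and m: "m \<noteq> l"
  have "ent M i m = ent (M * mu l l 1) i m" by (rule arg_cong[OF M, of "\<lambda>M. ent M i m"])
  also have "\<dots> = 0" using m by (simp add: ent_mult ent_mu)
  finally show ?thesis .
qed

lemma ent_row: "M = mu l l 1 * M \<Longrightarrow> m \<noteq> l \<Longrightarrow> ent M m i = 0"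
proof -
  assume M: "M = mu l l 1 * M" and m: "m \<noteq> l"
  have "ent M m i = ent (mu l l 1 * M) m i" by (rule arg_cong[OF M, of "\<lambda>M. ent M m i"])
  also have "\<dots> = 0" using m by (simp add: ent_mult ent_mu)
  finally show ?thesis .
qed

text \<open>\<open>hq t r\<close> stands for homogeneity of degree \<open>t\<close>. The degrees -2,
  -1, 0, 0, 1 prescribed for \<open>y\<close>, \<open>sg\<close>, \<open>a\<close>,
  \<open>b\<close>, \<open>c\<close> are the values of \<open>dl\<close> on D, S, DS, SD,
  DSD.\<close>

locale koszul_deg = koszul_idem d y sg a b c e
  for d :: "'r::f2ring \<Rightarrow> 'r" and y sg a b c e +
  fixes hq :: "int \<Rightarrow> 'r \<Rightarrow> bool"
  assumes hq0: "hq t 0" and hq_add: "hq t r \<Longrightarrow> hq t r' \<Longrightarrow> hq t (r + r')"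
    and hq_mult: "hq t r \<Longrightarrow> hq t' r' \<Longrightarrow> hq (t + t') (r * r')" and hq1: "hq 0 1"
    and hqy: "hq (- 2) y" and hqsg: "hq (- 1) sg" and hqa: "hq 0 a" and hqb: "hq 0 b"
    and hqc: "hq 1 c" and hqe: "hq 0 (e v)"
begin

lemma hq_sum: "(\<And>i. i \<in> I \<Longrightarrow> hq t (f i)) \<Longrightarrow> hq t (\<Sum>i\<in>I. f i)"
  by (induction I rule: infinite_finite_induct) (auto simp: hq0 hq_add)

text \<open>Degrees of a tail series read after the letter \<open>x\<close>. The preceding letter is
  remembered because \<open>dl\<close> counts a letter change where the tail begins.\<close>

definition rd :: "lt \<Rightarrow> (lt, (lt, 'r) sqmat) ser \<Rightarrow> int \<Rightarrow> bool" where
  "rd x f t \<longleftrightarrow> (\<forall>w i j. hq (dl (x # w) + t) (ent (cf f w) i j))"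

lemma rd_k: "hq (wt x + t) r \<Longrightarrow> rd x (k i j r) t"
  by (auto simp: rd_def cf_const ent_mu hq0)

lemma rd_X:
  assumes "rd z f (t + wt x + (if x = z then 0 else 3))"
  shows "rd x (X z * f) t"
  unfolding rd_def
proof (intro allI)
  fix w i j
  show "hq (dl (x # w) + t) (ent (cf (X z * f) w) i j)"
  proof (cases w)
    case (Cons z' w')
    show ?thesis
    proof (cases "z' = z")
      case True
      have "hq (dl (z # w') + (t + wt x + (if x = z then 0 else 3))) (ent (cf f w') i j)"
        using assms unfolding rd_def by blast
      moreover have "dl (z # w') + (t + wt x + (if x = z then 0 else 3)) = dl (x # w) + t"
        using Cons True by simp
      ultimately have "hq (dl (x # w) + t) (ent (cf f w') i j)" by (simp only:)
      then show ?thesis using Cons True by (simp add: cf_X_Cons)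
    qed (simp add: Cons cf_X_Cons hq0)
  qed (simp add: cf_X_Nil hq0)
qed

lemma rd_P:
  assumes r: "rd z (X (ol z) * f) t"
  shows "rd z (P z * (X (ol z) * f)) t"
  unfolding rd_def
proof (intro allI)
  fix w i j
  have "hq (dl (z # w) + t) (ent (cf (P z) (take n w) * cf (X (ol z) * f) (drop n w)) i j)" for n
  proof (cases "take n w \<in> range (tw z) \<and> drop n w \<noteq> [] \<and> hd (drop n w) = ol z")
    case True
    then obtain s where s: "take n w = tw z s" by blast
    obtain w' where w': "drop n w = ol z # w'" using True by (metis list.collapse)
    have "w = tw z s @ ol z # w'" using append_take_drop_id[of n w] unfolding s w' by (rule sym)
    then have "dl (z # w) = dl (z # drop n w)" unfolding w' by (simp only: dl_tw)
    moreover have "cf (P z) (take n w) = (1 :: (lt, 'r) sqmat)" unfolding P_def s by (simp add: cf_ind)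
    moreover have "hq (dl (z # drop n w) + t) (ent (cf (X (ol z) * f) (drop n w)) i j)"
      using r unfolding rd_def by blast
    ultimately show ?thesis by (simp only: mult_1_left)
  next
    case False
    have "cf (P z) (take n w) * cf (X (ol z) * f) (drop n w) = 0"
    proof (cases "take n w \<in> range (tw z)")
      case True
      have "cf (X (ol z) * f) (drop n w) = 0"
        using False True by (cases "drop n w") (simp_all add: cf_X_Nil cf_X_Cons)
      then show ?thesis by (simp only: mult_zero_right)
    next
      case False
      then have "cf (P z) (take n w) = (0 :: (lt, 'r) sqmat)" unfolding P_def cf_ind by (rule if_not_P)
      then show ?thesis by (simp only: mult_zero_left)
    qed
    then show ?thesis by (simp only: ent_0 hq0)
  qed
  then show "hq (dl (z # w) + t) (ent (cf (P z * (X (ol z) * f)) w) i j)"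
    unfolding cf_mult[of "P z"] ent_sum by (intro hq_sum)
qed

lemma rd_0: "rd z f 0 \<Longrightarrow> hq (dl (x # w)) (ent (cf (X z * f) (x # w)) i j)"
  unfolding rd_def cf_X_Cons by (cases "x = z") (auto simp: hq0)

lemma hq_K: "w \<noteq> [] \<Longrightarrow> hq (dl w) (ent (cf K w) i j)"
proof -
  assume "w \<noteq> []"
  then obtain x w' where w: "w = x # w'" by (cases w) auto
  have 1: "rd LD (k LD LD y) 0" by (rule rd_k) (simp add: hqy)
  have "rd LD (k LD LD c) 3" by (rule rd_k) (simp add: hqc)
  then have "rd LS (X LD * k LD LD c) 1" by (intro rd_X) simp
  then have "rd LS (P LS * (X LD * k LD LD c)) 1" using rd_P[of LS] by simp
  then have "rd LD (X LS * (P LS * (X LD * k LD LD c))) 0" by (intro rd_X) simp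
  then have 2: "rd LD (P LD * (X LS * (P LS * (X LD * k LD LD c)))) 0" using rd_P[of LD] by simp
  have "rd LS (k LD LS a) 1" by (rule rd_k) (simp add: hqa)
  then have "rd LD (X LS * k LD LS a) 0" by (intro rd_X) simp
  then have 3: "rd LD (P LD * (X LS * k LD LS a)) 0" using rd_P[of LD] by simp
  have "rd LD (k LS LD b) 2" by (rule rd_k) (simp add: hqb)
  then have "rd LS (X LD * k LS LD b) 0" by (intro rd_X) simp
  then have 4: "rd LS (P LS * (X LD * k LS LD b)) 0" using rd_P[of LS] by simp
  have 5: "rd LS (k LS LS sg) 0" by (rule rd_k) (simp add: hqsg)
  show ?thesis unfolding w K_def cf_add ent_add by (intro hq_add rd_0 1 2 3 4 5)
qed

lemma K_last: "w \<noteq> [] \<Longrightarrow> cf K w = cf K w * mu (last w) (last w) 1"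
proof -
  assume w: "w \<noteq> []"
  have "cf (en (last w) K) w = cf K w" using w by (simp add: en_def)
  then show ?thesis unfolding en_K by simp
qed

text \<open>Blocks with nonzero product meet inside a run, where \<open>dl\<close> is
  additive.\<close>

lemma hq_G: "hq (dl w) (ent (cf G w) i j)"
proof (induction w arbitrary: i j rule: length_induct)
  case (1 w)
  show ?case
  proof (cases "w = []")
    case True
    then show ?thesis by (simp add: G_Nil ent_1 hq0 hq1)
  next
    case False
    then have G: "cf G w = (\<Sum>n\<le>length w. cf K (take n w) * cf G (drop n w))"
      by (subst G_eq) (simp add: cf_1 cf_mult)
    have "hq (dl w) (ent (cf K (take n w)) i m * ent (cf G (drop n w)) m j)" if "n \<le> length w" for n m
    proof (cases "n = 0")
      case True
      then show ?thesis by (simp add: K0 hq0)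
    next
      case n: False
      have t: "take n w \<noteq> []" using n False by simp
      have K: "hq (dl (take n w)) (ent (cf K (take n w)) i m)" by (rule hq_K[OF t])
      show ?thesis
      proof (cases "drop n w = []")
        case True
        then have "take n w = w" by simp
        then have "hq (dl w + 0) (ent (cf K (take n w)) i m * ent (cf G (drop n w)) m j)"
          using K True by (intro hq_mult) (simp_all add: G_Nil ent_1 hq0 hq1)
        then show ?thesis by simp
      next
        case d: False
        show ?thesis
        proof (cases "m = last (take n w) \<and> m = hd (drop n w)")
          case True
          have "length (drop n w) < length w" using n that False by simp
          then have "hq (dl (drop n w)) (ent (cf G (drop n w)) m j)" using 1 by blast
          then have "hq (dl (take n w) + dl (drop n w)) (ent (cf K (take n w)) i m * ent (cf G (drop n w)) m j)"
            by (rule hq_mult[OF K])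
          moreover have lh: "last (take n w) = hd (drop n w)"
            by (rule trans[OF conjunct1[OF True, symmetric] conjunct2[OF True]])
          have "dl (take n w) + dl (drop n w) = dl w"
            using dl_append[OF t d] unfolding append_take_drop_id if_P[OF lh] by simp
          ultimately show ?thesis by argo
        next
          case False
          then have "ent (cf K (take n w)) i m = 0 \<or> ent (cf G (drop n w)) m j = 0"
            using ent_col[OF K_last[OF t]] ent_row[OF G_hd[OF d]] by blast
          then show ?thesis by (elim disjE) (simp_all only: mult_zero_left mult_zero_right hq0)
        qed
      qed
    qed
    then show ?thesis
      unfolding G ent_sum ent_mult by (intro hq_sum) simp
  qed
qed

lemma hq_gv: "hq (dl w) (gv w)"
  unfolding gv_def tot_def by (cases "w = []") (simp_all add: hq1 hq_sum hq_G)

lemma hq_Gl: "hq (dq s + 3 * (int (length s) - 1)) (Gl s)"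
proof -
  consider "good s" "s \<noteq> []" | v where "s = [Idem v]" | "\<not> valid s" unfolding valid_def by blast
  then show ?thesis
  proof cases
    case 1
    have "hq (0 + dl (wd s)) (e (bsrc (hd s)) * gv (wd s))" by (intro hq_mult hqe hq_gv)
    then show ?thesis using 1 by (simp add: Gl_good dl_good)
  next
    case 2
    then show ?thesis by (simp add: Gl_Idem hqe)
  next
    case 3
    then show ?thesis by (simp add: Gl_def hq0)
  qed
qed

end

section \<open>The matrix factorization algebra as four by four matrices\<close>

lemma UNIV_gen: "UNIV = {G0s, G0u, G1s, G1u}"
  by (auto intro: gen.exhaust)

instance gen :: finite
  by standard (simp add: UNIV_gen)

lemma mmul_plus: "mmul m m' = m + m'"
  by (cases m; cases m') simp

type_synonym amat = "(gen, mono vec) sqmat"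
type_synonym umat = "(gen, (mono \<times> int) vec) sqmat"

abbreviation E :: "gen \<Rightarrow> gen \<Rightarrow> nat \<Rightarrow> nat \<Rightarrow> nat \<Rightarrow> amat" where
  "E i j p q r \<equiv> mu i j (bas (p, q, r))"

lemma bas_mult3: "bas (p, q, r) * bas (p', q', r') = bas (p + p', q + q', r + (r' :: nat) :: nat)"
  for p q p' q' :: nat
  by (simp add: plus_prod_def)

lemma one_amat: "(1 :: amat) = E G0s G0s 0 0 0 + E G0u G0u 0 0 0 + E G1s G1s 0 0 0 + E G1u G1u 0 0 0"
proof (rule sqmat_eqI)
  fix i j
  have "(1 :: mono vec) = bas (0, 0, 0)" by (simp add: one_vec_def zero_prod_def)
  then show "ent (1 :: amat) i j = ent (E G0s G0s 0 0 0 + E G0u G0u 0 0 0 + E G1s G1s 0 0 0 + E G1u G1u 0 0 0) i j"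
    by (cases i; cases j) (simp_all add: ent_1 ent_mu)
qed

definition D0 :: amat where
  "D0 = E G0u G0s 1 0 0 + E G0s G0u 0 1 1 + E G1u G1s 0 1 0 + E G1s G1u 1 0 1"

definition dR :: "amat \<Rightarrow> amat" where
  "dR r = r * D0 + D0 * r"

text \<open>Cocycles for the loops: multiplication by y on the first factorization and by x on the
  second. Those for the arrows, \<open>sgR\<close>, square to z. The homotopies have unit entries:
  \<open>aR\<close> exchanges the unshifted generators, \<open>bR\<close> the shifted ones, and
  \<open>cR\<close> sends an unshifted generator to the shifted one of the other
  factorization.\<close>

definition yR :: amat where
  "yR = E G0s G0s 0 1 0 + E G0u G0u 0 1 0 + E G1s G1s 1 0 0 + E G1u G1u 1 0 0"
definition sgR :: amat where
  "sgR = E G0u G1s 0 0 0 + E G0s G1u 0 0 1 + E G1u G0s 0 0 0 + E G1s G0u 0 0 1"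
definition aR :: amat where "aR = E G0u G1u 0 0 0 + E G1u G0u 0 0 0"
definition bR :: amat where "bR = E G0s G1s 0 0 0 + E G1s G0s 0 0 0"
definition cR :: amat where "cR = E G0s G1u 0 0 0 + E G1s G0u 0 0 0"

fun eR :: "vtx \<Rightarrow> amat" where
  "eR Wh = E G0s G0s 0 0 0 + E G0u G0u 0 0 0"
| "eR Bl = E G1s G1s 0 0 0 + E G1u G1u 0 0 0"

lemmas R_defs = D0_def dR_def yR_def sgR_def aR_def bR_def cR_def

lemmas R_simps = distrib_left distrib_right mu_mult bas_mult3 add.assoc add.commute add.left_commute

lemma R_rels:
  "dR yR = 0" "dR sgR = 0" "dR aR = yR * sgR" "dR bR = sgR * yR" "dR cR = yR * bR + aR * yR"
  "cR * sgR = 1 + aR * aR" "sgR * cR = 1 + bR * bR" "bR * sgR = sgR * aR" "cR * bR = 0" "aR * cR = 0"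
proof -
  show "dR yR = 0" by (simp add: R_defs R_simps del: mult_bas_bas)
  show "dR sgR = 0" by (simp add: R_defs R_simps del: mult_bas_bas)
  show "dR aR = yR * sgR" by (simp add: R_defs R_simps del: mult_bas_bas)
  show "dR bR = sgR * yR" by (simp add: R_defs R_simps del: mult_bas_bas)
  show "dR cR = yR * bR + aR * yR" by (simp add: R_defs R_simps del: mult_bas_bas)
  show "cR * sgR = 1 + aR * aR" by (simp add: R_defs one_amat R_simps del: mult_bas_bas)
  show "sgR * cR = 1 + bR * bR" by (simp add: R_defs one_amat R_simps del: mult_bas_bas)
  show "bR * sgR = sgR * aR" by (simp add: R_defs R_simps del: mult_bas_bas)
  show "cR * bR = 0" by (simp add: R_defs R_simps del: mult_bas_bas)
  show "aR * cR = 0" by (simp add: R_defs R_simps del: mult_bas_bas)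
qed

lemma R_idem:
  "eR v * eR w = (if v = w then eR v else 0)" "dR (eR v) = 0" "eR v * yR = yR * eR v"
  "eR v * sgR = sgR * eR (oth v)" "eR v * aR = aR * eR (oth v)" "eR v * bR = bR * eR (oth v)"
  "eR v * cR = cR * eR (oth v)"
proof -
  show "eR v * eR w = (if v = w then eR v else 0)" by (cases v; cases w) (simp_all add: R_simps del: mult_bas_bas)
  show "dR (eR v) = 0" by (cases v) (simp_all add: R_defs R_simps del: mult_bas_bas)
  show "eR v * yR = yR * eR v" by (cases v) (simp_all add: R_defs R_simps del: mult_bas_bas)
  show "eR v * sgR = sgR * eR (oth v)" by (cases v) (simp_all add: R_defs R_simps del: mult_bas_bas)
  show "eR v * aR = aR * eR (oth v)" by (cases v) (simp_all add: R_defs R_simps del: mult_bas_bas)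
  show "eR v * bR = bR * eR (oth v)" by (cases v) (simp_all add: R_defs R_simps del: mult_bas_bas)
  show "eR v * cR = cR * eR (oth v)" by (cases v) (simp_all add: R_defs R_simps del: mult_bas_bas)
qed

lemma commutator_derivation:
  fixes D :: "'r::f2ring"
  shows "(r + s) * D + D * (r + s) = (r * D + D * r) + (s * D + D * s)"
    and "r * s * D + D * (r * s) = (r * D + D * r) * s + r * (s * D + D * s)"
proof -
  show "(r + s) * D + D * (r + s) = (r * D + D * r) + (s * D + D * s)"
    by (simp add: distrib_left distrib_right ac_simps)
  have "(r * D + D * r) * s + r * (s * D + D * s) = (r * D * s + D * r * s) + (r * s * D + r * D * s)"
    by (simp add: distrib_left distrib_right mult.assoc)
  also have "\<dots> = r * s * D + D * (r * s) + (r * D * s + r * D * s)"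
    unfolding mult.assoc by (simp only: ac_simps)
  finally show "r * s * D + D * (r * s) = (r * D + D * r) * s + r * (s * D + D * s)" by simp
qed

definition gq :: "gen \<Rightarrow> int" where "gq i = fst (gdeg i)"
definition mq :: "mono \<Rightarrow> int" where "mq m = fst (mdeg m)"

lemma gq_simps [simp]: "gq G0s = 1" "gq G0u = 0" "gq G1s = 1" "gq G1u = 0"
  by (simp_all add: gq_def)

lemma mq_simps [simp]: "mq (p, q, r) = - 2 * (int p + int q + int r)"
  by (simp add: mq_def)

lemma degA_q: "degA (i, j, m) = (gq i + mq m - gq j, 0)"
  by (cases i; cases j; cases m) (simp_all add: gq_def mq_def)

lemma hg_mult_bas:
  assumes "\<And>m m'. w (m + m') = w m + w m'" "hg w s u" "hg w t v"
  shows "hg w (s + t) (u * v)"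
  unfolding times_vec_def
  by (rule hg_lin[OF assms(2)], rule hg_lin[OF assms(3)]) (simp add: assms(1))

definition hqR :: "int \<Rightarrow> amat \<Rightarrow> bool" where
  "hqR t M \<longleftrightarrow> (\<forall>i j. hg mq (t - gq i + gq j) (ent M i j))"

lemma mq_add: "mq (m + m') = mq m + mq m'"
  by (cases m; cases m') (simp add: mq_def)

lemma hqR_0: "hqR t 0" and hqR_add: "hqR t r \<Longrightarrow> hqR t r' \<Longrightarrow> hqR t (r + r')"
  by (simp_all add: hqR_def hg_add)

lemma hqR_mult: "hqR t r \<Longrightarrow> hqR t' r' \<Longrightarrow> hqR (t + t') (r * r')"
  unfolding hqR_def
proof (intro allI)
  fix i j
  assume 1: "\<forall>i j. hg mq (t - gq i + gq j) (ent r i j)" and 2: "\<forall>i j. hg mq (t' - gq i + gq j) (ent r' i j)"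
  have "hg mq (t + t' - gq i + gq j) (ent r i n * ent r' n j)" for n
  proof -
    have "hg mq ((t - gq i + gq n) + (t' - gq n + gq j)) (ent r i n * ent r' n j)"
      by (rule hg_mult_bas[OF mq_add]) (use 1 2 in blast)+
    moreover have "(t - gq i + gq n) + (t' - gq n + gq j) = t + t' - gq i + gq j" by simp
    ultimately show ?thesis by (simp only:)
  qed
  then show "hg mq (t + t' - gq i + gq j) (ent (r * r') i j)"
    unfolding ent_mult by (intro hg_sum)
qed

lemma hqR_E: "gq i + mq (p, q, r) - gq j = t \<Longrightarrow> hqR t (E i j p q r)"
  by (auto simp: hqR_def ent_mu)

lemma hqR_gens: "hqR 0 1" "hqR (- 2) yR" "hqR (- 1) sgR" "hqR 0 aR" "hqR 0 bR" "hqR 1 cR" "hqR 0 (eR v)"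
proof -
  show "hqR 0 1" unfolding one_amat by (intro hqR_add hqR_E) simp_all
  show "hqR (- 2) yR" unfolding yR_def by (intro hqR_add hqR_E) simp_all
  show "hqR (- 1) sgR" unfolding sgR_def by (intro hqR_add hqR_E) simp_all
  show "hqR 0 aR" unfolding aR_def by (intro hqR_add hqR_E) simp_all
  show "hqR 0 bR" unfolding bR_def by (intro hqR_add hqR_E) simp_all
  show "hqR 1 cR" unfolding cR_def by (intro hqR_add hqR_E) simp_all
  show "hqR 0 (eR v)" by (cases v) (auto intro!: hqR_add hqR_E)
qed

lemma dR_add: "dR (r + s) = dR r + dR s" and dR_mult: "dR (r * s) = dR r * s + r * dR s"
  unfolding dR_def by (rule commutator_derivation)+

interpretation R: koszul_deg dR yR sgR aR bR cR eR hqR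
  by unfold_locales (rule dR_add dR_mult R_rels R_idem hqR_0 hqR_add hqR_mult hqR_gens | assumption)+

subsection \<open>Powers of the central variable\<close>

definition upv :: "int \<Rightarrow> mono vec \<Rightarrow> (mono \<times> int) vec" where
  "upv n = lin (\<lambda>m. bas (m, n))"

lemma upv_add [simp]: "upv n (v + w) = upv n v + upv n w" and upv_0 [simp]: "upv n 0 = 0"
  and upv_bas [simp]: "upv n (bas m) = bas (m, n)"
  by (simp_all add: upv_def)

lemma upv_sum: "upv n (\<Sum>i\<in>I. f i) = (\<Sum>i\<in>I. upv n (f i))"
  unfolding upv_def by (rule lin_sum)

lemma upv_mult: "upv n v * upv n' w = upv (n + n') (v * w)"
proof (induction v rule: vec_induct)
  case (add m v)
  have "bas (m, n) * upv n' w = upv (n + n') (bas m * w)"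
    by (induction w rule: vec_induct) (simp_all add: distrib_left)
  then show ?case using add by (simp add: distrib_right)
qed simp

definition up :: "int \<Rightarrow> amat \<Rightarrow> umat" where
  "up n M = Mat (\<lambda>i j. upv n (ent M i j))"

lemma up_add: "up n (r + r') = up n r + up n r'" and up_0: "up n 0 = 0"
  by (auto intro!: sqmat_eqI simp: up_def)

lemma up_sum: "up n (\<Sum>i\<in>I. f i) = (\<Sum>i\<in>I. up n (f i))"
  by (induction I rule: infinite_finite_induct) (auto simp: up_0 up_add)

lemma up_mult: "up n r * up n' r' = up (n + n') (r * r')"
  by (rule sqmat_eqI) (simp add: up_def ent_mult upv_mult upv_sum)

lemma up_mu: "up n (mu i j (bas m)) = mu i j (bas (m, n))"
  by (auto intro!: sqmat_eqI simp: up_def ent_mu)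

text \<open>The commutator with \<open>D0\<close> times the inverse of \<open>U\<close>; this
  encodes that the differential lowers the exponent of \<open>U\<close> by one.\<close>

definition dS :: "umat \<Rightarrow> umat" where
  "dS r = r * up (- 1) D0 + up (- 1) D0 * r"

lemma dS_add: "dS (r + r') = dS r + dS r'" and dS_mult: "dS (r * r') = dS r * r' + r * dS r'"
  unfolding dS_def by (rule commutator_derivation)+

lemma dS_0: "dS 0 = 0"
  by (simp add: dS_def)

lemma dS_up: "dS (up n r) = up (n - 1) (dR r)"
proof -
  have "n + - 1 = n - 1" "- 1 + n = n - 1" by simp_all
  then show ?thesis unfolding dS_def dR_def up_mult up_add by (simp only:)
qed

lemma vec_comm: "v * w = w * (v :: 'm::{monoid_add, ab_semigroup_add} vec)"
proof (induction v rule: vec_induct)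
  case (add m v)
  have "bas m * w = w * bas m"
    by (induction w rule: vec_induct) (simp_all add: distrib_left distrib_right add.commute)
  then show ?case using add by (simp add: distrib_left distrib_right)
qed simp

lemma D0_sq: "D0 * D0 = Mat (\<lambda>i j. if i = j then bas (1, 1, 1) else 0)"
proof (rule sqmat_eqI)
  have D: "D0 * D0 = E G0s G0s 1 1 1 + E G0u G0u 1 1 1 + E G1s G1s 1 1 1 + E G1u G1u 1 1 1"
    by (simp add: D0_def R_simps del: mult_bas_bas)
  fix i j
  show "ent (D0 * D0) i j = ent (Mat (\<lambda>i j. if i = j then bas (1, 1, 1) else 0)) i j"
    unfolding D by (cases i; cases j) (simp_all add: ent_mu)
qed

text \<open>The square of a commutator is the commutator with the square, and \<open>D0\<close>
  squares to the central element xyz.\<close>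

lemma dS_dS: "dS (dS r) = 0"
proof -
  let ?D = "up (- 1) D0"
  have "?D * ?D = up (- 2) (Mat (\<lambda>i j. if i = j then bas (1, 1, 1) else 0))"
    by (simp add: up_mult D0_sq)
  then have D: "?D * ?D = Mat (\<lambda>i j. if i = j then bas ((1, 1, 1), - 2) else 0)" (is "_ = ?Z")
    by (auto intro!: sqmat_eqI simp: up_def)
  have "ent (r * ?Z) i j = ent (?Z * r) i j" for i j
    by (simp add: ent_mult if_distrib[of "\<lambda>x. x * _"] if_distrib[of "\<lambda>x. _ * x"] vec_comm[of "ent r i j"] cong: if_cong)
  then have "r * ?Z = ?Z * r" by (rule sqmat_eqI)
  then have c: "r * (?D * ?D) = ?D * (?D * r)" unfolding D[symmetric] by (simp only: mult.assoc)
  have "dS (dS r) = r * (?D * ?D) + ?D * (r * ?D) + (?D * (r * ?D) + ?D * (?D * r))"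
    unfolding dS_def by (simp add: distrib_left distrib_right mult.assoc)
  then show ?thesis unfolding c by (simp add: ac_simps)
qed

fun Ph :: "aubasis \<Rightarrow> umat" where
  "Ph ((i, j, m), n) = mu i j (bas (m, n))"

definition un :: "umat \<Rightarrow> aubasis vec" where
  "un M = (\<Sum>i\<in>UNIV. \<Sum>j\<in>UNIV. lin (\<lambda>(m, n). bas ((i, j, m), n)) (ent M i j))"

lemma un_add: "un (M + N) = un M + un N"
  by (simp add: un_def sum.distrib)

lemma un_0: "un 0 = 0"
  by (simp add: un_def)

lemma un_mu: "un (mu i j (bas (m, n))) = bas ((i, j, m), n)"
proof -
  have "un (mu i j (bas (m, n))) = (\<Sum>i'\<in>UNIV. \<Sum>j'\<in>UNIV. if j' = j then if i' = i then bas ((i, j, m), n) else 0 else 0)"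
    unfolding un_def by (intro sum.cong refl) (auto simp: ent_mu)
  then show ?thesis by simp
qed

lemma un_Ph: "un (lin Ph v) = v"
proof -
  have "un (lin Ph v) = lin bas v"
  proof (rule lin_eqI)
    show "un (lin Ph (v + w)) = un (lin Ph v) + un (lin Ph w)" for v w by (simp add: un_add)
    show "un (lin Ph (bas x)) = bas x" for x by (cases x rule: Ph.cases) (simp add: un_mu)
  qed
  then show ?thesis by simp
qed

lemma Ph_un: "lin Ph (un M) = M"
proof -
  have e: "lin (\<lambda>x. lin Ph (case x of (m, n) \<Rightarrow> bas ((i, j, m), n))) v = mu i j v" for i j v
    by (rule lin_eqI[symmetric]) (auto simp: mu_add)
  have "lin Ph (un M) = (\<Sum>i\<in>UNIV. \<Sum>j\<in>UNIV. mu i j (ent M i j))"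
    unfolding un_def lin_sum lin_lin e ..
  also have "\<dots> = M"
  proof (rule sqmat_eqI)
    fix i j
    have "ent (\<Sum>i\<in>UNIV. \<Sum>j\<in>UNIV. mu i j (ent M i j)) i j =
       (\<Sum>i'\<in>UNIV. \<Sum>j'\<in>UNIV. if j' = j then if i' = i then ent M i j else 0 else 0)"
      unfolding ent_sum by (intro sum.cong refl) (auto simp: ent_mu)
    then show "ent (\<Sum>i\<in>UNIV. \<Sum>j\<in>UNIV. mu i j (ent M i j)) i j = ent M i j" by simp
  qed
  finally show ?thesis .
qed

lemma Ph_inj: "lin Ph v = lin Ph w \<Longrightarrow> v = w"
  by (metis un_Ph)

subsection \<open>The structure maps in coordinates\<close>

text \<open>In coordinates, \<open>D0\<close> sends the generator \<open>j\<close> to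
  \<open>mo j\<close> times \<open>pt j\<close>.\<close>

fun pt :: "gen \<Rightarrow> gen" where
  "pt G0s = G0u" | "pt G0u = G0s" | "pt G1s = G1u" | "pt G1u = G1s"

fun mo :: "gen \<Rightarrow> mono" where
  "mo G0s = (1, 0, 0)" | "mo G0u = (0, 1, 1)" | "mo G1s = (0, 1, 0)" | "mo G1u = (1, 0, 1)"

lemma finite_compA: "finite (compA x x')"
  by (cases x; cases x'; simp split: prod.split)

lemma finite_d0: "finite d0"
  by (simp add: d0_def)

lemma Vec_dA: "Vec (dA (i, j, m)) = bas (i, pt j, m + mo (pt j)) + bas (pt i, j, mo i + m)"
  and finite_dA: "finite (dA x)"
proof -
  show f: "finite (dA x)" for x
    unfolding dA_def vadd_def using Vec_vsum(2)[OF finite_d0 finite_compA] by simp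
  have v: "finite (vsum (\<lambda>x'. compA x x') d0)" "finite (vsum (\<lambda>x'. compA x' x) d0)" for x
    by (rule Vec_vsum(2)[OF finite_d0 finite_compA])+
  have "Vec (dA (i, j, m)) = lin (\<lambda>x'. Vec (compA (i, j, m) x')) (Vec d0) + lin (\<lambda>x'. Vec (compA x' (i, j, m))) (Vec d0)"
    unfolding dA_def Vec_vadd[OF v] Vec_vsum(1)[OF finite_d0 finite_compA] ..
  also have "\<dots> = (\<Sum>x'\<in>d0. Vec (compA (i, j, m) x')) + (\<Sum>x'\<in>d0. Vec (compA x' (i, j, m)))"
    by (simp only: lin_Vec[OF finite_d0])
  also have "\<dots> = bas (i, pt j, m + mo (pt j)) + bas (pt i, j, mo i + m)"
    unfolding d0_def by (cases i; cases j) (simp_all add: mmul_plus)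
  finally show "Vec (dA (i, j, m)) = bas (i, pt j, m + mo (pt j)) + bas (pt i, j, mo i + m)" .
qed

lemma Vec_image: "finite A \<Longrightarrow> inj f \<Longrightarrow> Vec (f ` A) = lin (\<lambda>x. bas (f x)) (Vec A)"
proof -
  assume 1: "finite A" "inj f"
  have "Vec (f ` A) = lin bas (Vec (f ` A))" by simp
  also have "\<dots> = sum bas (f ` A)" using 1(1) by (intro lin_Vec) simp
  also have "\<dots> = (\<Sum>x\<in>A. bas (f x))" using 1(2) by (subst sum.reindex) (auto intro: inj_on_subset)
  also have "\<dots> = lin (\<lambda>x. bas (f x)) (Vec A)" by (rule lin_Vec[OF 1(1), symmetric])
  finally show ?thesis .
qed

lemma finite_muAU: "finite (muAU xs)"
  by (cases xs rule: muAU.cases) (simp_all add: finite_dA finite_compA)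

abbreviation MA :: "(aubasis, aubasis vec) ser" where "MA \<equiv> vs muAU"

lemma MA1: "cf MA [((i, j, m), n)] = bas ((i, pt j, m + mo (pt j)), n - 1) + bas ((pt i, j, mo i + m), n - 1)"
proof -
  have "cf MA [((i, j, m), n)] = Vec ((\<lambda>b. (b, n - 1)) ` dA (i, j, m))" by simp
  also have "\<dots> = lin (\<lambda>b. bas (b, n - 1)) (Vec (dA (i, j, m)))"
    by (rule Vec_image[OF finite_dA]) (simp add: inj_def)
  finally show ?thesis unfolding Vec_dA by simp
qed

lemma MA2: "cf MA [((i, j, m), n), ((i', j', m'), n')] = (if j = i' then bas ((i, j', m + m'), n + n') else 0)"
  by (simp add: mmul_plus)

text \<open>The tautological twisting cochain, reading a one-letter word as its matrix. It moves
  statements about bar words into a ring of matrix series.\<close>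

definition Th :: "(aubasis, umat) ser" where
  "Th = Ser (\<lambda>xs. case xs of [x] \<Rightarrow> Ph x | _ \<Rightarrow> 0)"

lemma cf_Th: "cf Th [] = 0" "cf Th [x] = Ph x" "cf Th (x # x' # xs) = 0"
  by (simp_all add: Th_def)

lemma D0_pt: "D0 = mu (pt G0s) G0s (bas (mo G0s)) + mu (pt G0u) G0u (bas (mo G0u)) +
    mu (pt G1s) G1s (bas (mo G1s)) + mu (pt G1u) G1u (bas (mo G1u))"
  by (simp add: D0_def)

lemma Ph_MA1: "lin Ph (cf MA [x]) = dS (Ph x)"
proof (cases x rule: Ph.cases)
  case (1 i j m n)
  have "dS (Ph x) = mu i (pt j) (bas (m + mo (pt j), n - 1)) + mu (pt i) j (bas (mo i + m, n - 1))"
    unfolding 1 Ph.simps dS_def D0_pt up_add up_mu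
    by (cases i; cases j) (simp_all add: distrib_left distrib_right mu_mult del: mo.simps)
  then show ?thesis unfolding 1 MA1 by simp
qed

lemma Ph_MA2: "lin Ph (cf MA [x, x']) = Ph x * Ph x'"
  by (cases x rule: Ph.cases; cases x' rule: Ph.cases) (simp add: MA2 mu_mult del: cf_vs)

text \<open>The differential and the composition of the dg algebra collected in one series equation;
  there are no higher terms.\<close>

lemma Ph_MA: "smap (lin Ph) MA = smap dS Th + Th * Th"
proof (rule ser_eqI)
  fix xs
  have T0: "cf (Th * Th) xs = 0" if "length xs \<noteq> 2"
    unfolding cf_mult
  proof (rule sum.neutral, intro ballI)
    fix i assume i: "i \<in> {..length xs}"
    have z: "cf Th u = 0" if "length u \<noteq> 1" for u
      using that by (cases u rule: muAU.cases) (simp_all add: cf_Th)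
    have "length (take i xs) \<noteq> 1 \<or> length (drop i xs) \<noteq> 1" using that i by auto
    then show "cf Th (take i xs) * cf Th (drop i xs) = 0" using z by (elim disjE) (simp_all only: mult_zero_left mult_zero_right not_False_eq_True)
  qed
  consider "xs = []" | x where "xs = [x]" | x x' where "xs = [x, x']" | x x' x'' ys where "xs = x # x' # x'' # ys"
    by (metis neq_Nil_conv)
  then show "cf (smap (lin Ph) MA) xs = cf (smap dS Th + Th * Th) xs"
  proof cases
    case 1
    then show ?thesis by (simp add: cf_Th dS_0)
  next
    case (2 x)
    then show ?thesis using T0 Ph_MA1[of x] by (simp add: cf_Th del: cf_vs)
  next
    case (3 x x')
    have "cf (Th * Th) [x, x'] = Ph x * Ph x'" by (simp add: cf_mult cf_Th numeral_2_eq_2)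
    then show ?thesis using Ph_MA2[of x x'] 3 by (simp add: cf_Th dS_0 del: cf_vs)
  next
    case (4 x x' x'' ys)
    then show ?thesis using T0 by (simp add: cf_Th dS_0)
  qed
qed

lemma lin_bas_mult: "lin f (bas u * t) = lin (\<lambda>w. f (u @ w)) t" for f :: "'a list \<Rightarrow> 'm::char2"
  by (induction t rule: vec_induct) (simp_all add: distrib_left plus_list_def)

lemma pull_cod_sum:
  fixes f :: "('a, 'm::char2) ser"
  shows "cf (pull (cod M) f) xs = (\<Sum>i\<le>length xs. \<Sum>j\<le>length xs - i.
     lin (\<lambda>b. cf f (take i xs @ b # drop j (drop i xs))) (cf M (take j (drop i xs))))"
proof -
  have "cf (cod M) xs = (\<Sum>i\<le>length xs. \<Sum>j\<le>length xs - i.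
     bas (take i xs) * (emb (cf M (take j (drop i xs))) * bas (drop j (drop i xs))))"
    unfolding cod_def mult.assoc cf_mult[of sid] by (simp add: cf_mult sum_distrib_left)
  then show ?thesis by (simp add: lin_sum lin_bas_mult lin_front)
qed

lemma pull_cod_Th: "pull (cod M) Th = smap (lin Ph) M"
proof (rule ser_eqI)
  fix xs
  have T: "cf Th (u @ b # w) = (if u = [] \<and> w = [] then Ph b else 0)" for u b w
    by (cases u; cases w; (cases "tl u")?) (simp_all add: Th_def split: list.split)
  note T' = T[of "[]", simplified]
  have "cf (pull (cod M) Th) xs = (\<Sum>i\<le>length xs. if i = 0 then lin Ph (cf M xs) else 0)"
    unfolding pull_cod_sum
  proof (intro sum.cong refl)
    fix i assume i: "i \<in> {..length xs}"
    show "(\<Sum>j\<le>length xs - i. lin (\<lambda>b. cf Th (take i xs @ b # drop j (drop i xs))) (cf M (take j (drop i xs)))) =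
       (if i = 0 then lin Ph (cf M xs) else 0)"
    proof (cases "i = 0")
      case True
      have "(\<Sum>j\<le>length xs - i. lin (\<lambda>b. cf Th (take i xs @ b # drop j (drop i xs))) (cf M (take j (drop i xs)))) =
         (\<Sum>j\<le>length xs. if j = length xs then lin Ph (cf M xs) else 0)"
        using True by (intro sum.cong) (auto simp: T')
      then show ?thesis using True by simp
    next
      case False
      then have "take i xs \<noteq> []" using i by auto
      then show ?thesis using False by (simp add: T)
    qed
  qed
  then show "cf (pull (cod M) Th) xs = cf (smap (lin Ph) M) xs" by simp
qed

lemma pull_hat_const:
  assumes "cf F [] = 0"
  shows "pull (hat F) (const r) = (const r :: ('a, 'r::f2ring) ser)"
proof -
  have c: "const r = smap (\<lambda>x. r * x) (1 :: ('c, 'r) ser)"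
    by (rule ser_eqI) (simp add: cf_const cf_1)
  have "smap (\<lambda>x. r * x) (pull (hat F) (1 :: (_, 'r) ser)) = pull (hat F) (smap (\<lambda>x. r * x) 1)"
    by (rule smap_pull) (simp_all add: distrib_left)
  then show ?thesis unfolding c[symmetric] pull_hat_1[OF assms] by (rule sym)
qed

lemma pull_hat_Th:
  assumes F: "cf F [] = 0"
  shows "pull (hat F) Th = smap (lin Ph) F"
proof (rule ser_eqI)
  fix xs
  have T: "cf Th (b # w) = cf (const (Ph b)) w" for b w
    by (cases w) (simp_all add: cf_Th cf_const)
  have h: "lin (cf Th) (emb v * cf (hat F) ys) = (if ys = [] then lin Ph v else 0)" for v ys
  proof -
    have "lin (cf Th) (emb v * cf (hat F) ys) = lin (\<lambda>b. cf (pull (hat F) (const (Ph b))) ys) v"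
      unfolding lin_front T by simp
    then show ?thesis unfolding pull_hat_const[OF F] by (simp add: cf_const)
  qed
  have "cf (pull (hat F) Th) xs = lin (cf Th) (cf (1 + ems F * hat F) xs)"
    by (simp flip: hat_eq[OF F])
  also have "\<dots> = lin (cf Th) (cf 1 xs) + (\<Sum>i\<le>length xs. lin (cf Th) (emb (cf F (take i xs)) * cf (hat F) (drop i xs)))"
    by (simp add: cf_mult lin_sum)
  also have "lin (cf Th) (cf 1 xs) = 0"
    using bas_Nil[where 'a = aubasis] by (simp add: cf_1 cf_Th flip: bas_Nil)
  also have "(\<Sum>i\<le>length xs. lin (cf Th) (emb (cf F (take i xs)) * cf (hat F) (drop i xs))) =
      (\<Sum>i\<le>length xs. if i = length xs then lin Ph (cf F xs) else 0)"
    unfolding h by (intro sum.cong) auto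
  finally show "cf (pull (hat F) Th) xs = cf (smap (lin Ph) F) xs" by simp
qed

lemma smap_pull_Ph: "smap (lin Ph) (pull Z f) = pull Z (smap (lin Ph) f)"
  by (rule smap_pull) simp_all

lemma smap_pull_dS: "smap dS (pull Z f) = pull Z (smap dS f)"
  by (rule smap_pull) (simp_all add: dS_add dS_0)

lemma smap_dS_mult: "smap dS (f * g) = smap dS f * g + f * smap dS g"
proof -
  have "dS (\<Sum>i\<in>I. t i) = (\<Sum>i\<in>I. dS (t i))" for I :: "nat set" and t
    by (induction I rule: infinite_finite_induct) (auto simp: dS_0 dS_add)
  then show ?thesis by (intro ser_eqI) (simp add: cf_mult dS_mult sum.distrib)
qed

lemma Ph_ser_inj: "smap (lin Ph) f = smap (lin Ph) g \<Longrightarrow> f = g"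
proof (rule ser_eqI)
  fix xs assume *: "smap (lin Ph) f = smap (lin Ph) g"
  have "cf (smap (lin Ph) f) xs = cf (smap (lin Ph) g) xs" unfolding * ..
  then show "cf f xs = cf g xs" by (intro Ph_inj) simp
qed

lemma MA0: "cf MA [] = 0"
  by simp

text \<open>Maurer--Cartan form of the dg algebra axioms: the tautological series satisfies
  \<open>pull (cod MA) Th = dTh + Th * Th\<close>.\<close>
lemma MA_MA: "pull (cod MA) MA = 0"
proof (rule Ph_ser_inj)
  have dd: "smap dS (smap dS Th) = 0" by (rule ser_eqI) (simp add: dS_dS)
  have da: "smap dS (f + g) = smap dS f + smap dS g" for f g :: "(aubasis, umat) ser"
    by (rule ser_eqI) (simp add: dS_add)
  let ?t = "smap dS Th" and ?D = "pull (cod MA)"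
  have T: "?D Th = ?t + Th * Th" unfolding pull_cod_Th Ph_MA ..
  have "smap (lin Ph) (?D MA) = ?D ?t + ?D (Th * Th)"
    unfolding smap_pull_Ph Ph_MA pull_add ..
  also have "?D ?t = ?t * Th + Th * ?t"
    unfolding smap_pull_dS[symmetric] T da dd smap_dS_mult by simp
  also have "?D (Th * Th) = (?t + Th * Th) * Th + Th * (?t + Th * Th)"
    unfolding pull_cod_mult[OF MA0] T ..
  also have "?t * Th + Th * ?t + ((?t + Th * Th) * Th + Th * (?t + Th * Th)) = 0"
    by (simp add: distrib_left distrib_right mult.assoc ac_simps)
  finally show "smap (lin Ph) (?D MA) = smap (lin Ph) 0" by (simp add: smap_def zero_ser_def)
qed

text \<open>An A-infinity morphism into a dg algebra is a twisting cochain, because only the unary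
  and the binary operation occur on the target side.\<close>

lemma hom_MA_iff:
  assumes "cf g [] = 0"
  shows "hom N MA g \<longleftrightarrow> pull (cod N) (smap (lin Ph) g) = smap dS (smap (lin Ph) g) + smap (lin Ph) g * smap (lin Ph) g"
proof -
  have r: "smap (lin Ph) (pull (hat g) MA) = smap dS (smap (lin Ph) g) + smap (lin Ph) g * smap (lin Ph) g"
    unfolding smap_pull_Ph Ph_MA pull_add smap_pull_dS[symmetric] pull_hat_mult[OF assms] pull_hat_Th[OF assms] ..
  have l: "smap (lin Ph) (pull (cod N) g) = pull (cod N) (smap (lin Ph) g)" by (rule smap_pull_Ph)
  show ?thesis
    unfolding hom_def l[symmetric] r[symmetric]
  proof
    assume "cf g [] = 0 \<and> pull (cod N) g = pull (hat g) MA"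
    then show "smap (lin Ph) (pull (cod N) g) = smap (lin Ph) (pull (hat g) MA)" by (simp only:)
  next
    assume "smap (lin Ph) (pull (cod N) g) = smap (lin Ph) (pull (hat g) MA)"
    then have "pull (cod N) g = pull (hat g) MA" by (rule Ph_ser_inj)
    with assms show "cf g [] = 0 \<and> pull (cod N) g = pull (hat g) MA" by (rule conjI)
  qed
qed

abbreviation NB :: "(bubasis, bubasis vec) ser" where "NB \<equiv> vs muBU"

lemma finite_muBU: "finite (muBU xs)"
  by (simp add: muBU_def finite_muBinf)

lemma NB0: "cf NB [] = 0" and NB1: "cf NB [x] = 0"
  by (simp_all add: muBU_def muBinf_def)

text \<open>The exponent of \<open>U\<close> on k inputs: a k-ary component has homological degree 1
  - k, and only \<open>U\<close> carries homological degree.\<close>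

definition gx :: "bubasis list \<Rightarrow> int" where
  "gx xs = int (length xs) - 1 + sum_list (map snd xs)"

definition GS :: "(bubasis, umat) ser" where
  "GS = Ser (\<lambda>xs. up (gx xs) (R.Gl (map fst xs)))"

definition GV :: "(bubasis, aubasis vec) ser" where
  "GV = Ser (\<lambda>xs. un (cf GS xs))"

lemma Gl_Nil: "R.Gl [] = 0"
  by (simp add: R.Gl_def valid_def)

lemma GV0: "cf GV [] = 0"
  by (simp add: GV_def GS_def Gl_Nil up_0 un_0)

lemma Ph_GV: "smap (lin Ph) GV = GS"
  by (rule ser_eqI) (simp add: GV_def Ph_un)

lemma sum_ops: "(\<Sum>x\<in>ops s. f x) =
    (\<Sum>i\<le>length s. \<Sum>j\<le>length s - i. \<Sum>b\<in>muBinf (take j (drop i s)). f (i, j, b))"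
proof -
  have "(\<Sum>x\<in>ops s. f x) = (\<Sum>(i, x)\<in>ops s. f (i, x))" by (simp add: case_prod_beta)
  also have "\<dots> = (\<Sum>i\<le>length s. \<Sum>x\<in>(SIGMA j:{..length s - i}. muBinf (take j (drop i s))). f (i, x))"
    unfolding ops_def by (rule sum.Sigma[symmetric]) (auto intro!: finite_SigmaI finite_muBinf)
  also have "\<dots> = (\<Sum>i\<le>length s. \<Sum>j\<le>length s - i. \<Sum>b\<in>muBinf (take j (drop i s)). f (i, j, b))"
  proof (rule sum.cong[OF refl])
    fix i
    have "(\<Sum>x\<in>(SIGMA j:{..length s - i}. muBinf (take j (drop i s))). f (i, x)) =
       (\<Sum>(j, b)\<in>(SIGMA j:{..length s - i}. muBinf (take j (drop i s))). f (i, j, b))" by (simp add: case_prod_beta)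
    also have "\<dots> = (\<Sum>j\<le>length s - i. \<Sum>b\<in>muBinf (take j (drop i s)). f (i, j, b))"
      by (rule sum.Sigma[symmetric]) (auto intro!: finite_muBinf)
    finally show "(\<Sum>x\<in>(SIGMA j:{..length s - i}. muBinf (take j (drop i s))). f (i, x)) =
       (\<Sum>j\<le>length s - i. \<Sum>b\<in>muBinf (take j (drop i s)). f (i, j, b))" .
  qed
  finally show ?thesis .
qed

lemma gx_append: "gx (xs @ ys) = gx xs + gx ys + 1"
  by (simp add: gx_def)

text \<open>A j-ary product removes j - 1 inputs and contributes \<open>U\<close> to the power j -
  2, so the exponent drops by one, as it does under the differential.\<close>

lemma gx_op:
  assumes "length u = j"
  shows "gx (p @ (b, int j - 2 + sum_list (map snd u)) # q) = gx (p @ u @ q) - 1"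
  using assms by (simp add: gx_def)

lemma GS_op:
  assumes "i \<le> length xs" "j \<le> length xs - i"
  shows "lin (\<lambda>x. cf GS (take i xs @ x # drop j (drop i xs))) (cf NB (take j (drop i xs))) =
    (\<Sum>b\<in>muBinf (take j (drop i (map fst xs))). up (gx xs - 1) (R.Gl (res (map fst xs) (i, j, b))))"
proof -
  let ?u = "take j (drop i xs)" and ?q = "drop j (drop i xs)" and ?p = "take i xs"
  let ?e = "int j - 2 + sum_list (map snd ?u)"
  have l: "length ?u = j" using assms by simp
  have m: "map fst ?u = take j (drop i (map fst xs))" by (simp add: take_map drop_map)
  have x: "?p @ ?u @ ?q = xs" by (simp only: append_take_drop_id)
  have "lin (\<lambda>x. cf GS (?p @ x # ?q)) (cf NB ?u) = (\<Sum>x\<in>muBU ?u. cf GS (?p @ x # ?q))"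
    unfolding cf_vs by (rule lin_Vec[OF finite_muBU])
  also have "\<dots> = (\<Sum>b\<in>muBinf (map fst ?u). cf GS (?p @ (b, ?e) # ?q))"
    unfolding muBU_def l by (subst sum.reindex) (auto simp: inj_on_def)
  also have "\<dots> = (\<Sum>b\<in>muBinf (map fst ?u). up (gx xs - 1) (R.Gl (res (map fst xs) (i, j, b))))"
  proof (rule sum.cong[OF refl])
    fix b
    have r: "map fst (?p @ (b, ?e) # ?q) = res (map fst xs) (i, j, b)"
      by (simp add: res_def take_map drop_map)
    have "cf GS (?p @ (b, ?e) # ?q) = up (gx (?p @ (b, ?e) # ?q)) (R.Gl (map fst (?p @ (b, ?e) # ?q)))"
      by (simp only: GS_def cf_Ser)
    then show "cf GS (?p @ (b, ?e) # ?q) = up (gx xs - 1) (R.Gl (res (map fst xs) (i, j, b)))"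
      unfolding gx_op[OF l] r x .
  qed
  finally show ?thesis unfolding m .
qed

lemma splits_all: "(\<Sum>i\<le>length s. R.Gl (take i s) * R.Gl (drop i s)) = R.splits s"
  unfolding R.splits_def
proof (rule sum.mono_neutral_right)
  show "\<forall>i\<in>{..length s} - {0<..<length s}. R.Gl (take i s) * R.Gl (drop i s) = 0"
  proof
    fix i assume "i \<in> {..length s} - {0<..<length s}"
    then have "take i s = [] \<or> drop i s = []" by auto
    then show "R.Gl (take i s) * R.Gl (drop i s) = 0"
      by (elim disjE) (simp_all only: Gl_Nil mult_zero_left mult_zero_right)
  qed
qed auto

text \<open>In the twisting cochain form all terms at a given word carry the same power of
  \<open>U\<close>, so the equation is \<open>R.Gl_rel\<close>.\<close>

lemma hom_GV: "hom NB MA GV"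
  unfolding hom_MA_iff[OF GV0] Ph_GV
proof (rule ser_eqI)
  fix xs :: "bubasis list"
  let ?s = "map fst xs" and ?t = "gx xs - 1"
  have "cf (pull (cod NB) GS) xs = (\<Sum>i\<le>length xs. \<Sum>j\<le>length xs - i.
     lin (\<lambda>x. cf GS (take i xs @ x # drop j (drop i xs))) (cf NB (take j (drop i xs))))"
    by (rule pull_cod_sum)
  also have "\<dots> = (\<Sum>i\<le>length xs. \<Sum>j\<le>length xs - i. \<Sum>b\<in>muBinf (take j (drop i ?s)). up ?t (R.Gl (res ?s (i, j, b))))"
    by (intro sum.cong refl GS_op) simp_all
  also have "\<dots> = (\<Sum>x\<in>ops ?s. up ?t (R.Gl (res ?s x)))"
    unfolding sum_ops length_map ..
  also have "\<dots> = up ?t (dR (R.Gl ?s) + R.splits ?s)"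
    unfolding up_sum[symmetric] R.Gl_rel ..
  finally have L: "cf (pull (cod NB) GS) xs = up ?t (dR (R.Gl ?s) + R.splits ?s)" .
  have "cf (GS * GS) xs = (\<Sum>i\<le>length xs. up ?t (R.Gl (take i ?s) * R.Gl (drop i ?s)))"
    unfolding cf_mult
  proof (rule sum.cong[OF refl])
    fix i
    have "gx (take i xs @ drop i xs) = gx (take i xs) + gx (drop i xs) + 1" by (rule gx_append)
    then have "gx (take i xs) + gx (drop i xs) = ?t" by simp
    then show "cf GS (take i xs) * cf GS (drop i xs) = up ?t (R.Gl (take i ?s) * R.Gl (drop i ?s))"
      by (simp only: GS_def cf_Ser up_mult take_map drop_map)
  qed
  also have "\<dots> = up ?t (R.splits ?s)"
    unfolding up_sum[symmetric] using splits_all[of ?s] by (simp only: length_map)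
  finally have R: "cf (GS * GS) xs = up ?t (R.splits ?s)" .
  have "cf (smap dS GS) xs = up ?t (dR (R.Gl ?s))" by (simp add: GS_def dS_up)
  then show "cf (pull (cod NB) GS) xs = cf (smap dS GS + GS * GS) xs"
    unfolding L cf_add R up_add by (simp only:)
qed

subsection \<open>Gradings\<close>

text \<open>Suspended degrees: subtracting (0, 1) per letter gives all components of a morphism
  weight zero and all structure maps the weight (0, 1).\<close>

abbreviation wa :: "aubasis \<Rightarrow> int \<times> int" where "wa x \<equiv> degAU x - (0, 1)"
abbreviation wb :: "bubasis \<Rightarrow> int \<times> int" where "wb x \<equiv> degBU x - (0, 1)"

lemma wa_eq: "wa ((i, j, m), n) = (gq i + mq m - gq j - 3 * n, - n - 1)"
  unfolding degAU_def fst_conv snd_conv degA_q by simp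

lemma degB_snd: "snd (degB b) = 0"
  by (cases b) simp_all

lemma wb_eq: "wb (b, n) = (fst (degB b) - 3 * n, - n - 1)"
  by (simp add: degBU_def degB_snd)

lemma lw_wb: "lw wb xs = (dq (map fst xs) - 3 * sum_list (map snd xs), - sum_list (map snd xs) - int (length xs))"
proof (induction xs)
  case (Cons x xs)
  have "lw wb (x # xs) = wb (fst x, snd x) + lw wb xs" by simp
  then show ?case unfolding wb_eq Cons by simp
qed (simp add: zero_prod_def)

lemma mo_pt: "mq (mo (pt j)) - gq (pt j) = - gq j - 3" "gq (pt i) + mq (mo i) = gq i - 3"
  by (cases j; simp) (cases i; simp)

lemma wM: "hg wa (lw wa xs + (0, 1)) (cf MA xs)"
proof -
  consider "xs = []" | x where "xs = [x]" | x x' where "xs = [x, x']" | x x' x'' ys where "xs = x # x' # x'' # ys"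
    by (metis neq_Nil_conv)
  then show ?thesis
  proof cases
    case (2 x)
    obtain i j m n where x: "x = ((i, j, m), n)" by (metis surj_pair)
    have l: "lw wa [x] + (0, 1) = (gq i + mq m - gq j - 3 * n, - n)" unfolding x list.map sum_list.Cons wa_eq by simp
    show ?thesis unfolding 2 l unfolding x MA1
      by (intro hg_add; unfold hg_bas wa_eq) (use mo_pt(1)[of j] mo_pt(2)[of i] in \<open>simp_all add: mq_add\<close>)
  next
    case (3 x x')
    obtain i j m n where x: "x = ((i, j, m), n)" by (metis surj_pair)
    obtain i' j' m' n' where x': "x' = ((i', j', m'), n')" by (metis surj_pair)
    have l: "lw wa [x, x'] + (0, 1) = (gq i + mq m - gq j + (gq i' + mq m' - gq j') - 3 * (n + n'), - (n + n') - 1)"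
      unfolding x x' list.map sum_list.Cons wa_eq by simp
    show ?thesis unfolding 3 l unfolding x x' MA2
    proof (cases "j = i'")
      case True
      have "wa ((i, j', m + m'), n + n') = (gq i + mq m - gq j + (gq i' + mq m' - gq j') - 3 * (n + n'), - (n + n') - 1)"
        unfolding wa_eq mq_add using True by simp
      then show "hg wa (gq i + mq m - gq j + (gq i' + mq m' - gq j') - 3 * (n + n'), - (n + n') - 1)
          (if j = i' then bas ((i, j', m + m'), n + n') else 0)"
        unfolding if_P[OF True] hg_bas .
    next
      case False
      show "hg wa (gq i + mq m - gq j + (gq i' + mq m' - gq j') - 3 * (n + n'), - (n + n') - 1)
          (if j = i' then bas ((i, j', m + m'), n + n') else 0)"
        unfolding if_not_P[OF False] by (rule hg_0)
    qed
  qed simp_all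
qed

lemma wN: "hg wb (lw wb xs + (0, 1)) (cf NB xs)"
  unfolding hg_def
proof
  fix x assume "x \<in> supp (cf NB xs)"
  then have "x \<in> muBU xs" using finite_muBU by simp
  then obtain b where b: "b \<in> muBinf (map fst xs)" "x = (b, int (length xs) - 2 + sum_list (map snd xs))"
    unfolding muBU_def by blast
  show "wb x = lw wb xs + (0, 1)"
    unfolding b(2) wb_eq lw_wb using muBinf_deg[OF b(1)] by simp
qed

lemma hg_un_up: "hqR t M \<Longrightarrow> hg wa (t - 3 * n, - n - 1) (un (up n M))"
proof -
  assume M: "hqR t M"
  have "hg wa (t - 3 * n, - n - 1) (lin (\<lambda>m. bas ((i, j, m), n)) (ent M i j))" for i j
    by (rule hg_lin[where w = mq and e = "t - gq i + gq j"]) (use M in \<open>simp_all only: hqR_def hg_bas wa_eq, simp\<close>)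
  then show ?thesis
    unfolding un_def up_def ent_Mat upv_def lin_lin lin_bas case_prod_conv by (intro hg_sum)
qed

lemma wG: "hg wa (lw wb xs) (cf GV xs)"
proof -
  have "hg wa (dq (map fst xs) + 3 * (int (length (map fst xs)) - 1) - 3 * gx xs, - gx xs - 1) (cf GV xs)"
    unfolding GV_def GS_def cf_Ser by (rule hg_un_up[OF R.hq_Gl])
  moreover have "(dq (map fst xs) + 3 * (int (length (map fst xs)) - 1) - 3 * gx xs, - gx xs - 1) = lw wb xs"
    unfolding lw_wb by (simp add: gx_def)
  ultimately show ?thesis by (simp only:)
qed

subsection \<open>The contraction\<close>

fun gs :: "vtx \<Rightarrow> gen" where "gs Wh = G0s" | "gs Bl = G1s"
fun gu :: "vtx \<Rightarrow> gen" where "gu Wh = G0u" | "gu Bl = G1u"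
fun yv :: "vtx \<Rightarrow> nat \<Rightarrow> mono" where "yv Wh n = (0, n, 0)" | "yv Bl n = (n, 0, 0)"

text \<open>The linear part of \<open>G\<close> in closed form, from the powers of \<open>yR\<close>
  and \<open>sgR\<close>. Even powers of \<open>sgR\<close> are powers of z, which explains the
  division by two.\<close>

fun inc :: "bbasis \<Rightarrow> int \<Rightarrow> aubasis vec" where
  "inc (Idem v) n = bas ((gs v, gs v, (0, 0, 0)), n) + bas ((gu v, gu v, (0, 0, 0)), n)"
| "inc (Dp v r) n = bas ((gs v, gs v, yv v (Suc r)), n) + bas ((gu v, gu v, yv v (Suc r)), n)"
| "inc (Sw v r) n = (if even r
     then bas ((gu v, gs (oth v), (0, 0, r div 2)), n) + bas ((gs v, gu (oth v), (0, 0, Suc (r div 2))), n)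
     else bas ((gs v, gs v, (0, 0, Suc r div 2)), n) + bas ((gu v, gu v, (0, 0, Suc r div 2)), n))"

lemma eR_mu: "eR v = mu (gs v) (gs v) (bas (0, 0, 0)) + mu (gu v) (gu v) (bas (0, 0, 0))"
  by (cases v) simp_all

lemma eR_y: "eR v * yR ^ r = mu (gs v) (gs v) (bas (yv v r)) + mu (gu v) (gu v) (bas (yv v r))"
proof (induction r)
  case 0
  then show ?case by (cases v) simp_all
next
  case (Suc r)
  have "eR v * yR ^ Suc r = eR v * yR ^ r * yR" by (simp only: power_Suc2 mult.assoc)
  then show ?case unfolding Suc
    by (cases v) (simp_all add: yR_def distrib_left distrib_right mu_mult bas_mult3 del: mult_bas_bas)
qed

lemma mu_sg: "(mu (gs v) (gs v) (bas (0, 0, r)) + mu (gu v) (gu v) (bas (0, 0, r))) * sgR =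
    mu (gu v) (gs (oth v)) (bas (0, 0, r)) + mu (gs v) (gu (oth v)) (bas (0, 0, Suc r))"
  by (cases v) (simp_all add: sgR_def distrib_left distrib_right mu_mult bas_mult3 add.commute del: mult_bas_bas)

lemma mu_sg': "(mu (gu v) (gs (oth v)) (bas (0, 0, r)) + mu (gs v) (gu (oth v)) (bas (0, 0, Suc r))) * sgR =
    mu (gs v) (gs v) (bas (0, 0, Suc r)) + mu (gu v) (gu v) (bas (0, 0, Suc r))"
  by (cases v) (simp_all add: sgR_def distrib_left distrib_right mu_mult bas_mult3 add.commute del: mult_bas_bas)

lemma eR_sg: "eR v * sgR ^ (2 * r) = mu (gs v) (gs v) (bas (0, 0, r)) + mu (gu v) (gu v) (bas (0, 0, r))"
    "eR v * sgR ^ Suc (2 * r) = mu (gu v) (gs (oth v)) (bas (0, 0, r)) + mu (gs v) (gu (oth v)) (bas (0, 0, Suc r))"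
proof -
  have st: "eR v * sgR ^ Suc n = eR v * sgR ^ n * sgR" for n by (simp only: power_Suc2 mult.assoc)
  show 1: "eR v * sgR ^ (2 * r) = mu (gs v) (gs v) (bas (0, 0, r)) + mu (gu v) (gu v) (bas (0, 0, r))"
  proof (induction r)
    case 0
    then show ?case by (simp add: eR_mu)
  next
    case (Suc r)
    have "2 * Suc r = Suc (Suc (2 * r))" by simp
    then show ?case by (simp only: st Suc mu_sg mu_sg')
  qed
  show "eR v * sgR ^ Suc (2 * r) = mu (gu v) (gs (oth v)) (bas (0, 0, r)) + mu (gs v) (gu (oth v)) (bas (0, 0, Suc r))"
    unfolding st 1 mu_sg ..
qed

lemma GV1: "cf GV [(b, n)] = inc b n"
proof -
  have g: "cf GV [(b, n)] = un (up n (R.Gl [b]))"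
    by (simp add: GV_def GS_def gx_def)
  show ?thesis
  proof (cases b)
    case (Idem v)
    then show ?thesis unfolding g by (simp add: R.Gl_Idem eR_mu up_add up_mu un_add un_mu)
  next
    case (Dp v r)
    have "R.Gl [b] = eR v * R.gv (replicate (Suc r) LD)"
      using R.Gl_good[of "[b]"] by (simp add: Dp del: replicate_Suc)
    then have "R.Gl [b] = eR v * yR ^ Suc r" unfolding R.gv_replicate R.gv_single .
    then show ?thesis unfolding g by (simp only: eR_y up_add up_mu un_add un_mu Dp inc.simps)
  next
    case (Sw v r)
    have "R.Gl [b] = eR v * R.gv (replicate (Suc r) LS)"
      using R.Gl_good[of "[b]"] by (simp add: Sw del: replicate_Suc)
    then have G: "R.Gl [b] = eR v * sgR ^ Suc r" unfolding R.gv_replicate R.gv_single .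
    show ?thesis
    proof (cases "even r")
      case True
      then obtain q where q: "r = 2 * q" by (rule evenE)
      show ?thesis unfolding g G unfolding q eR_sg(2) Sw by (simp add: up_add up_mu un_add un_mu)
    next
      case False
      then obtain q where q: "Suc r = 2 * q" by (metis even_Suc evenE)
      show ?thesis unfolding g G unfolding Sw inc.simps if_not_P[OF False] q eR_sg(1) by (simp add: up_add up_mu un_add un_mu)
    qed
  qed
qed

text \<open>Each cocycle in \<open>inc\<close> has two entries, and the projection detects the one
  that starts at a shifted generator. The surviving monomials are the pure powers that represent the
  basis of the quiver algebra.\<close>

fun pA :: "abasis \<Rightarrow> bbasis option" where
  "pA (G0s, G0s, (p, q, r)) = (if p = 0 \<and> r = 0 then Some (if q = 0 then Idem Wh else Dp Wh (q - 1))
     else if p = 0 \<and> q = 0 then Some (Sw Wh (2 * r - 1)) else None)"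
| "pA (G1s, G1s, (p, q, r)) = (if q = 0 \<and> r = 0 then Some (if p = 0 then Idem Bl else Dp Bl (p - 1))
     else if p = 0 \<and> q = 0 then Some (Sw Bl (2 * r - 1)) else None)"
| "pA (G0u, G1s, (p, q, r)) = (if p = 0 \<and> q = 0 then Some (Sw Wh (2 * r)) else None)"
| "pA (G1u, G0s, (p, q, r)) = (if p = 0 \<and> q = 0 then Some (Sw Bl (2 * r)) else None)"
| "pA _ = None"

text \<open>Only maps out of shifted generators are moved. The monomial is divided by the entry of
  \<open>D0\<close> leaving the source if possible, otherwise by the entry of \<open>D0\<close>
  entering the target.\<close>

fun hA :: "abasis \<Rightarrow> abasis option" where
  "hA (G0s, G0s, (p, q, r)) = (if 0 < p then Some (G0s, G0u, (p - 1, q, r))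
     else if 0 < q \<and> 0 < r then Some (G0u, G0s, (p, q - 1, r - 1)) else None)"
| "hA (G0u, G0s, (p, q, r)) = (if 0 < p then Some (G0u, G0u, (p - 1, q, r)) else None)"
| "hA (G1s, G1s, (p, q, r)) = (if 0 < q then Some (G1s, G1u, (p, q - 1, r))
     else if 0 < p \<and> 0 < r then Some (G1u, G1s, (p - 1, q, r - 1)) else None)"
| "hA (G1u, G1s, (p, q, r)) = (if 0 < q then Some (G1u, G1u, (p, q - 1, r)) else None)"
| "hA (G0u, G1s, (p, q, r)) = (if 0 < q then Some (G0u, G1u, (p, q - 1, r))
     else if 0 < p then Some (G0s, G1s, (p - 1, q, r)) else None)"
| "hA (G0s, G1s, (p, q, r)) = (if 0 < q then Some (G0s, G1u, (p, q - 1, r)) else None)"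
| "hA (G1u, G0s, (p, q, r)) = (if 0 < p then Some (G1u, G0u, (p - 1, q, r))
     else if 0 < q then Some (G1s, G0s, (p, q - 1, r)) else None)"
| "hA (G1s, G0s, (p, q, r)) = (if 0 < p then Some (G1s, G0u, (p - 1, q, r)) else None)"
| "hA _ = None"

fun pU :: "aubasis \<Rightarrow> bubasis vec" where
  "pU (x, n) = (case pA x of None \<Rightarrow> 0 | Some b \<Rightarrow> bas (b, n))"

text \<open>The exponent rises by one because the differential, which the homotopy inverts, lowers
  it by one.\<close>

fun hU :: "aubasis \<Rightarrow> aubasis vec" where
  "hU (x, n) = (case hA x of None \<Rightarrow> 0 | Some x' \<Rightarrow> bas (x', n + 1))"

lemma p_inc: "lin pU (cf GV [b]) = bas b"
proof (cases b)
  case (Pair b' n)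
  show ?thesis
  proof (cases b')
    case (Idem v)
    then show ?thesis unfolding Pair GV1 by (cases v) simp_all
  next
    case (Dp v r)
    then show ?thesis unfolding Pair GV1 by (cases v) simp_all
  next
    case (Sw v r)
    show ?thesis
    proof (cases "even r")
      case True
      then obtain q where q: "r = 2 * q" by (rule evenE)
      show ?thesis unfolding Pair GV1 Sw q by (cases v) simp_all
    next
      case False
      then obtain q where q: "r = Suc (2 * q)" by (metis oddE Suc_eq_plus1)
      show ?thesis unfolding Pair GV1 Sw q by (cases v) simp_all
    qed
  qed
qed

lemma p_d: "lin pU (cf MA [x]) = 0"
proof -
  obtain i j p q r n where x: "x = ((i, j, (p, q, r)), n)" by (metis surj_pair)
  show ?thesis unfolding x MA1 by (cases i; cases j) (simp_all add: add.commute)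
qed

lemma GV_fun: "(\<lambda>b. cf GV [b]) = (\<lambda>(b, n). inc b n)"
  using GV1 by auto

lemma homotopy: "lin hU (cf MA [x]) + lin (\<lambda>x. cf MA [x]) (hU x) = bas x + lin (\<lambda>b. cf GV [b]) (pU x)"
proof -
  obtain i j p q r n where x: "x = ((i, j, (p, q, r)), n)" by (metis surj_pair)
  show ?thesis unfolding x MA1 GV_fun
    \<comment> \<open>The conditions in \<open>pA\<close> and \<open>hA\<close> test only whether
      exponents vanish, so splitting each exponent into zero and successor makes the check
      finite.\<close>
    by (cases i; cases j; cases p; cases q; cases r) (simp_all add: MA1 add.commute add.left_commute add.assoc del: cf_vs)
qed

lemma wp: "hg wb (wa x) (pU x)"
proof -
  obtain i j p q r n where x: "x = ((i, j, (p, q, r)), n)" by (metis surj_pair)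
  have "fst (degB b) = gq i + mq (p, q, r) - gq j" if "pA (i, j, (p, q, r)) = Some b" for b
    using that by (cases i; cases j) (auto split: if_splits)
  then show ?thesis unfolding x wa_eq pU.simps
    by (cases "pA (i, j, (p, q, r))") (simp_all only: option.case hg_0 hg_bas wb_eq)
qed

lemma wh: "hg wa (wa x - (0, 1)) (hU x)"
proof -
  obtain i j p q r n where x: "x = ((i, j, (p, q, r)), n)" by (metis surj_pair)
  have "gq i' + mq m - gq j' = gq i + mq (p, q, r) - gq j + 3" if "hA (i, j, (p, q, r)) = Some (i', j', m)" for i' j' m
    using that by (cases i; cases j) (auto split: if_splits)
  then have "wa (x', n + 1) = wa x - (0, 1)" if "hA (i, j, (p, q, r)) = Some x'" for x'
    using that unfolding x by (cases x') (simp only: wa_eq, simp)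
  then show ?thesis unfolding x hU.simps
    by (cases "hA (i, j, (p, q, r))") (simp_all only: option.case hg_0 hg_bas)
qed

section \<open>Assembly of the two homomorphisms\<close>

interpretation C: contraction MA NB GV pU hU wa wb "(0, 1)"
  by (rule contraction.intro) (fact MA0 NB0 hom_GV MA_MA NB1 p_inc p_d homotopy wM wN wG wp wh)+

lemma lw_gsum: "lw (\<lambda>x. deg x - (0, 1)) xs = (fst (gsum (map deg xs)), snd (gsum (map deg xs)) - int (length xs))"
proof (induction xs)
  case (Cons x xs)
  then show ?case by (cases "deg x") (simp add: gsum_def)
qed (simp add: gsum_def zero_prod_def)

lemma bigraded_sf:
  assumes "\<And>xs. hg (\<lambda>x. deg' x - (0, 1)) (lw (\<lambda>x. deg x - (0, 1)) xs) (cf F xs)"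
  shows "bigraded_hom deg deg' (sf F)"
  unfolding bigraded_hom_def
proof (intro allI impI ballI)
  fix xs c assume "c \<in> sf F xs"
  then have "deg' c - (0, 1) = lw (\<lambda>x. deg x - (0, 1)) xs"
    using assms unfolding hg_def sf_def by blast
  then show "deg' c = (fst (gsum (map deg xs)), snd (gsum (map deg xs)) + 1 - int (length xs))"
    unfolding lw_gsum by (cases "deg' c") simp
qed

text \<open>With all input exponents zero, the output exponent is k - 1 for k inputs, and k is at
  least one.\<close>

lemma positive_sf:
  assumes "bigraded_hom deg deg' f" "\<And>x. snd (deg x) = - snd x" "\<And>x. snd (deg' x) = - snd x"
  shows "positive_hom f"
  unfolding positive_hom_def
proof (intro allI impI ballI)
  fix xs c assume xs: "xs \<noteq> []" "\<forall>a\<in>set xs. snd a = 0" and c: "c \<in> f xs"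
  have "sum_list (map snd (map deg xs)) = 0"
    using xs(2) by (intro sum_list_0[THEN trans[rotated]]) (simp add: assms(2) sum_list_eq_0_iff cong: map_cong)
  moreover have "snd (deg' c) = snd (gsum (map deg xs)) + 1 - int (length xs)"
    using assms(1) xs(1) c unfolding bigraded_hom_def by simp
  moreover have "1 \<le> length xs" using xs(1) by (cases xs) auto
  ultimately show "0 \<le> snd c" by (simp add: gsum_def assms(3))
qed

lemma snd_degAU: "snd (degAU x) = - snd x"
  by (cases x rule: Ph.cases) (simp add: degAU_def degA_q del: degA.simps)

lemma snd_degBU: "snd (degBU x) = - snd x"
  by (simp add: degBU_def degB_snd)

theorem mainTheorem4:
  shows "\<exists>(F :: aubasis list \<Rightarrow> bubasis set) (G :: bubasis list \<Rightarrow> aubasis set).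
           ainf_hom muAU muBU F \<and> bigraded_hom degAU degBU F \<and> quasi_iso muAU muBU F \<and>
           positive_hom F \<and>
           ainf_hom muBU muAU G \<and> bigraded_hom degBU degAU G \<and> quasi_iso muBU muAU G \<and>
           positive_hom G"
proof -
  obtain F where F: "hom MA NB F" "\<And>x. cf F [x] = pU x" "\<And>xs. hg wb (lw wa xs) (cf F xs)"
    using C.inverse_hom by blast
  have e: "muAU [] = {}" "muBU [] = {}" by (simp_all add: muBU_def muBinf_def)
  have F0: "sf F [] = {}" using F(1) by (simp add: hom_def sf_def)
  have G0: "sf GV [] = {}" by (simp add: sf_def GV0)
  have bF: "bigraded_hom degAU degBU (sf F)" by (rule bigraded_sf) (rule F(3))
  have bG: "bigraded_hom degBU degAU (sf GV)" by (rule bigraded_sf) (rule wG)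
  have "ainf_hom muAU muBU (sf F)"
    unfolding ainf_hom_iff[of muAU muBU "sf F", OF finite_muAU e(1) finite_muBU e(2) finite_sf F0] vs_sf by (rule F(1))
  moreover have "quasi_iso muAU muBU (sf F)"
    by (rule C.quasi_iso_p[OF refl finite_muAU refl finite_muBU F(2)])
  moreover have "positive_hom (sf F)"
    by (rule positive_sf[OF bF snd_degAU snd_degBU])
  moreover have "ainf_hom muBU muAU (sf GV)"
    unfolding ainf_hom_iff[of muBU muAU "sf GV", OF finite_muBU e(2) finite_muAU e(1) finite_sf G0] vs_sf by (rule hom_GV)
  moreover have "quasi_iso muBU muAU (sf GV)"
    by (rule C.quasi_iso_i[OF refl finite_muAU refl finite_muBU])
  moreover have "positive_hom (sf GV)"
    by (rule positive_sf[OF bG snd_degBU snd_degAU])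
  ultimately show ?thesis using bF bG by blast
qed

end
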